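(* Let $\Omega\subset\mathbb{R}^N$ be a connected open set with Lipschitz boundary. For every measurable set $E\subset\mathbb{R}^N$ the following two statements hold. (i) ($\Gamma$-liminf inequality) For every sequence $(s_n)\subset(0,1)$ with $s_n\to1^-$ and every sequence $(E_n)$ of measurable subsets of $\mathbb{R}^N$ with $\chi_{E_n}\to\chi_E$ in $L^1_{\rm loc}(\mathbb{R}^N)$, $$\liminf_{n\to\infty}(1-s_n)P^{\gamma,L}_{s_n}(E_n;\Omega)\ \ge\ \frac{\sqrt2}{\pi}\,P^\gamma(E;\Omega).$$ (ii) ($\Gamma$-limsup inequality) For every sequence $(s_n)\subset(0,1)$ with $s_n\to1^-$ there exists a sequence $(E_n)$ of measurable subsets of $\mathbb{R}^N$ with $\chi_{E_n}\to\chi_E$ in $L^1_{\rm loc}(\mathbb{R}^N)$ such that $$\limsup_{n\to\infty}(1-s_n)P^{\gamma}_{s_n}(E_n;\Omega)\ \le\ \frac{\sqrt2}{\pi}\,P^\gamma(E;\Omega).$$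
   Context: $\gamma$ is the standard Gaussian measure on $\mathbb{R}^N$, with density $(2\pi)^{-N/2}e^{-|x|^2/2}$ with respect to Lebesgue measure. The Mehler kernel is $$M_t(x,y)=\frac{1}{(1-e^{-2t})^{N/2}}\exp\left(-\frac{e^{-2t}|x|^2-2e^{-t}x\cdot y+e^{-2t}|y|^2}{2(1-e^{-2t})}\right),\qquad t>0,$$ and for $s\in(0,1)$, $K_s(x,y)=\int_0^\infty \frac{M_t(x,y)}{t^{s/2+1}}\,dt$. For $s\in(0,1)$ and $E$ measurable, with $A^c=\mathbb{R}^N\setminus A$, the local part of the fractional Gaussian perimeter is $$P^{\gamma,L}_s(E;\Omega)=\int_{E\cap\Omega}d\gamma(x)\int_{E^c\cap\Omega}K_s(x,y)\,d\gamma(y),$$ the nonlocal part is $$P^{\gamma,NL}_s(E;\Omega)=\int_{E\cap\Omega}d\gamma(x)\int_{E^c\cap\Omega^c}K_s(x,y)\,d\gamma(y)+\int_{E\cap\Omega^c}d\gamma(x)\int_{E^c\cap\Omega}K_s(x,y)\,d\gamma(y),$$ and $P^\gamma_s(E;\Omega)=P^{\gamma,L}_s(E;\Omega)+P^{\gamma,NL}_s(E;\Omega)$ (values in $[0,\infty]$). The Gaussian perimeter of $E$ in $\Omega$ (value in $[0,\infty]$) is $$P^\gamma(E;\Omega)=\sqrt{2\pi}\,\sup\left\{\int_E(\operatorname{div}\varphi-\varphi\cdot x)\,d\gamma(x):\ \varphi\in C_c^\infty(\Omega;\mathbb{R}^N),\ \|\varphi\|_\infty\le1\right\}.$$ When finite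 it equals $(2\pi)^{-(N-1)/2}\int_{\mathcal{F}E\cap\Omega}e^{-|x|^2/2}\,d\mathcal{H}^{N-1}(x)$, where $\mathcal{F}E$ is the reduced boundary. *)

theory Defs
  imports "HOL-Analysis.Analysis"
begin

definition gauss_measure :: "'a::euclidean_space measure" where
  "gauss_measure = density lebesgue
     (\<lambda>x. ennreal ((2 * pi) powr (- (real DIM('a) / 2)) * exp (- (norm x)\<^sup>2 / 2)))"

definition mehler_kernel :: "real \<Rightarrow> 'a::euclidean_space \<Rightarrow> 'a \<Rightarrow> real" where
  "mehler_kernel t x y =
     1 / (1 - exp (- 2 * t)) powr (real DIM('a) / 2) *
     exp (- ((exp (- 2 * t) * (norm x)\<^sup>2 - 2 * exp (- t) * (x \<bullet> y) + exp (- 2 * t) * (norm y)\<^sup>2)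
              / (2 * (1 - exp (- 2 * t)))))"

text \<open>The kernel takes values in \<open>[0, \<infinity>]\<close>; it is infinite on the diagonal.\<close>

definition frac_kernel :: "real \<Rightarrow> 'a::euclidean_space \<Rightarrow> 'a \<Rightarrow> ennreal" where
  "frac_kernel s x y =
     (\<integral>\<^sup>+ t\<in>{0<..}. ennreal (mehler_kernel t x y / t powr (s / 2 + 1)) \<partial>lborel)"

definition frac_perimeter_local ::
    "real \<Rightarrow> 'a::euclidean_space set \<Rightarrow> 'a set \<Rightarrow> ennreal" where
  "frac_perimeter_local s E \<Omega> =
     (\<integral>\<^sup>+ x \<in> E \<inter> \<Omega>. (\<integral>\<^sup>+ y \<in> - E \<inter> \<Omega>. frac_kernel s x y \<partial>gauss_measure) \<partial>gauss_measure)"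

definition frac_perimeter_nonlocal ::
    "real \<Rightarrow> 'a::euclidean_space set \<Rightarrow> 'a set \<Rightarrow> ennreal" where
  "frac_perimeter_nonlocal s E \<Omega> =
     (\<integral>\<^sup>+ x \<in> E \<inter> \<Omega>. (\<integral>\<^sup>+ y \<in> - E \<inter> - \<Omega>. frac_kernel s x y \<partial>gauss_measure) \<partial>gauss_measure)
   + (\<integral>\<^sup>+ x \<in> E \<inter> - \<Omega>. (\<integral>\<^sup>+ y \<in> - E \<inter> \<Omega>. frac_kernel s x y \<partial>gauss_measure) \<partial>gauss_measure)"

definition frac_perimeter ::
    "real \<Rightarrow> 'a::euclidean_space set \<Rightarrow> 'a set \<Rightarrow> ennreal" where
  "frac_perimeter s E \<Omega> = frac_perimeter_local s E \<Omega> + frac_perimeter_nonlocal s E \<Omega>"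

text \<open>\<open>C_k k f\<close>: \<open>f\<close> is of class \<open>C\<^sup>k\<close> on the whole space.\<close>

primrec C_k :: "nat \<Rightarrow> ('a::euclidean_space \<Rightarrow> 'b::real_normed_vector) \<Rightarrow> bool" where
  "C_k 0 f \<longleftrightarrow> continuous_on UNIV f"
| "C_k (Suc k) f \<longleftrightarrow>
     (\<forall>x. f differentiable (at x)) \<and>
     (\<forall>b\<in>Basis. C_k k (\<lambda>x. frechet_derivative f (at x) b))"

text \<open>Fields in \<open>C\<^sub>c\<^sup>\<infinity>(\<Omega>)\<close> are represented by their extension by zero to the whole space.\<close>

definition test_fields :: "'a::euclidean_space set \<Rightarrow> ('a \<Rightarrow> 'a) set" where
  "test_fields \<Omega> = {\<phi>. (\<forall>k. C_k k \<phi>) \<and> compact (closure {x. \<phi> x \<noteq> 0}) \<and>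
                        closure {x. \<phi> x \<noteq> 0} \<subseteq> \<Omega> \<and> (\<forall>x. norm (\<phi> x) \<le> 1)}"

definition divergence :: "('a::euclidean_space \<Rightarrow> 'a) \<Rightarrow> 'a \<Rightarrow> real" where
  "divergence \<phi> x = (\<Sum>b\<in>Basis. frechet_derivative \<phi> (at x) b \<bullet> b)"

text \<open>The truncation of negative values by \<open>ennreal\<close> does not change the supremum,
  since the zero field is admissible.\<close>

definition gauss_perimeter :: "'a::euclidean_space set \<Rightarrow> 'a set \<Rightarrow> ennreal" where
  "gauss_perimeter E \<Omega> = ennreal (sqrt (2 * pi)) *
     (SUP \<phi> \<in> test_fields \<Omega>.
        ennreal (LINT x:E|gauss_measure. divergence \<phi> x - \<phi> x \<bullet> x))"

text \<open>Near each boundary point, \<open>\<Omega>\<close> is the open region strictly above the graph of a Lipschitz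
  function \<open>g\<close> over the hyperplane orthogonal to some unit vector \<open>\<nu>\<close>; the radius, the direction
  and the Lipschitz constant may depend on the point.\<close>

definition lipschitz_boundary :: "'a::euclidean_space set \<Rightarrow> bool" where
  "lipschitz_boundary \<Omega> \<longleftrightarrow>
     (\<forall>p\<in>frontier \<Omega>. \<exists>r>0. \<exists>\<nu>. \<exists>L. \<exists>g :: 'a \<Rightarrow> real.
        norm \<nu> = 1 \<and> L-lipschitz_on {z. z \<bullet> \<nu> = 0} g \<and>
        \<Omega> \<inter> ball p r = {x \<in> ball p r. g (x - (x \<bullet> \<nu>) *\<^sub>R \<nu>) < x \<bullet> \<nu>})"

definition L1_loc_tendsto ::
    "(nat \<Rightarrow> 'a::euclidean_space \<Rightarrow> real) \<Rightarrow> ('a \<Rightarrow> real) \<Rightarrow> bool" where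
  "L1_loc_tendsto f g \<longleftrightarrow>
     (\<forall>K. compact K \<longrightarrow>
        (\<lambda>n. \<integral>\<^sup>+ x \<in> K. ennreal \<bar>f n x - g x\<bar> \<partial>lebesgue) \<longlonglongrightarrow> 0)"

end

theory Submission
  imports Defs "HOL-Probability.Probability"
begin

text \<open>Let \<open>X\<close>, \<open>Z\<close> be independent standard Gaussian vectors. By Mehler's formula the integral of the
  kernel over \<open>A \<times> B\<close> is \<open>\<integral> t powr (- s / 2 - 1) P(X \<in> A, Y \<in> B) dt\<close> with \<open>Y = exp (- t) X + sqrt (1 - exp (- 2 t)) Z\<close>;
  putting \<open>exp (- t) = cos \<theta>\<close>, the point \<open>Y = X\<^sub>\<theta>\<close> moves along a rotation of the plane spanned by
  \<open>X\<close> and \<open>Z\<close>, which preserves the Gaussian law.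

  Liminf: \<open>J(\<theta>) = P(X \<in> F, X\<^sub>\<theta> \<notin> F)\<close> is subadditive in \<open>\<theta>\<close>, up to the small probability of leaving
  \<open>\<Omega>\<close>. Hence \<open>(1 - s) \<integral> \<theta> powr (- s - 1) J(\<theta>) d\<theta>\<close> is bounded below by an average of \<open>J(\<theta>) / \<theta>\<close> over one dyadic
  interval of fixed small scale, where one can pass to the limit in \<open>F\<close>. For a fixed set \<open>E\<close> and a test field
  \<open>\<phi>\<close>, test \<open>J\<close> with a smooth substitute for the sign of \<open>\<phi>(X) \<bullet> Z\<close> and move the rotation onto the
  test function: its derivative at \<open>\<theta> = 0\<close> has conditional mean
  proportional to \<open>div \<phi> - \<phi> \<bullet> x\<close>.

  Limsup: mollify the indicator of \<open>E\<close> with kernels that, near the Lipschitz boundary, are shifted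
  into \<open>\<Omega>\<close>. Moved onto a vector field on the closure of \<open>\<Omega>\<close> by duality, they produce test fields
  compactly supported in \<open>\<Omega>\<close>; so the Gaussian total variation of the smoothed function on the closure of
  \<open>\<Omega>\<close> is at most the perimeter of \<open>E\<close> in \<open>\<Omega>\<close> plus a small error. By the
  coarea formula some level set, chosen in dependence on \<open>s\<close>, has at most the average fractional
  perimeter.\<close>

text \<open>Origin of the constant: for small angles t = - ln (cos \<theta>) is \<theta>^2 / 2 to
  leading order, so the weight turns into 2 powr (s / 2 + 1) * \<theta> powr (- s - 1), with factor
  2 powr (3 / 2) at s = 1. A test field whose Gaussian integral over E is V forces the flips in both
  directions together to have probability about sqrt (2 / pi) * V * \<theta>, half of it per
  direction. The product is 2 / sqrt pi * V, and the supremum of V is the perimeter divided by sqrt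
  (2 * pi). In the limsup the same number comes from the mean 1 / sqrt (2 * pi) of the positive part
  of a standard normal variable. Two obstacles shape the argument. The convergence of the sets has
  no rate, so it can be used only at a fixed angle; subadditivity carries the bound to all smaller
  ones. And pairs with just one point in \<Omega> count in the limsup, so the gradient has to be
  controlled on the closure of \<Omega>: mass that a plain mollification would leave near the
  boundary must be kept away, hence the inward shifts. Only the supremum over test fields is used,
  never the structure of the reduced boundary.\<close>

section \<open>The Gaussian measure on Borel sets and its one-dimensional moments\<close>

definition gauss_density :: "'a::euclidean_space \<Rightarrow> real" where
  "gauss_density x = (2 * pi) powr (- (real DIM('a) / 2)) * exp (- (norm x)\<^sup>2 / 2)"

text \<open>Built over \<open>lborel\<close>, not \<open>lebesgue\<close>: product measures, Fubini
  and images under linear maps then stay with Borel sets. \<open>nn_integral_gauss_measure\<close>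
  and \<open>integral_gauss_measure\<close> connect it with \<open>gauss_measure\<close>.\<close>

definition std_gauss :: "'a::euclidean_space measure" where
  "std_gauss = density lborel (\<lambda>x. ennreal (gauss_density x))"

lemma gauss_density_pos: "gauss_density x > 0"
  by (simp add: gauss_density_def)

lemma gauss_density_nonneg [simp]: "gauss_density x \<ge> 0"
  using gauss_density_pos[of x] by simp

lemma continuous_on_gauss_density [continuous_intros]:
  "continuous_on S f \<Longrightarrow> continuous_on S (\<lambda>x. gauss_density (f x))"
  unfolding gauss_density_def by (intro continuous_intros) auto

lemma borel_measurable_gauss_density [measurable]: "gauss_density \<in> borel_measurable borel"
  by (intro borel_measurable_continuous_onI continuous_intros)

lemma space_std_gauss [simp]: "space std_gauss = UNIV"
  and sets_std_gauss [simp, measurable_cong]: "sets std_gauss = sets borel"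
  by (simp_all add: std_gauss_def)

lemma gauss_density_eq_prod:
  fixes x :: "'a::euclidean_space"
  shows "gauss_density x = (\<Prod>b\<in>Basis. std_normal_density (x \<bullet> b))"
proof -
  have "(2 * pi) powr (- (real DIM('a) / 2)) = (1 / sqrt (2 * pi)) ^ DIM('a)"
  proof -
    have "1 / sqrt (2*pi) = (2 * pi) powr (-1/2)"
      by (simp add: powr_minus_divide powr_half_sqrt)
    then have "(1 / sqrt (2 * pi)) ^ DIM('a) = ((2 * pi) powr (-1/2)) powr (real DIM('a))"
      by (simp add: powr_realpow)
    also have "\<dots> = (2 * pi) powr (- (real DIM('a) / 2))"
      by (simp add: powr_powr)
    finally show ?thesis by simp
  qed
  moreover have "exp (- (norm x)\<^sup>2 / 2) = (\<Prod>b\<in>Basis. exp (- (x \<bullet> b)\<^sup>2 / 2))"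
    unfolding power2_norm_eq_inner
    by (subst euclidean_inner) (simp add: exp_sum[symmetric] sum_negf sum_divide_distrib power2_eq_square)
  ultimately show ?thesis
    by (simp add: gauss_density_def std_normal_density_def prod.distrib prod_dividef power_divide)
qed

lemma prob_space_std_gauss: "prob_space (std_gauss :: 'a::euclidean_space measure)"
proof
  have "emeasure (std_gauss :: 'a measure) (space std_gauss) = (\<integral>\<^sup>+x. (\<Prod>b\<in>Basis. ennreal (std_normal_density (x \<bullet> b))) \<partial>(lborel :: 'a measure))"
    by (simp add: std_gauss_def emeasure_density gauss_density_eq_prod prod_ennreal)
  also have "\<dots> = (\<Prod>b\<in>(Basis::'a set). \<integral>\<^sup>+x. ennreal (std_normal_density x) \<partial>lborel)"
    by (intro nn_integral_lborel_prod) auto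
  also have "(\<integral>\<^sup>+x. ennreal (std_normal_density x) \<partial>lborel) = 1"
    by (subst nn_integral_eq_integral) (auto simp: integrable_normal_density)
  finally show "emeasure (std_gauss :: 'a measure) (space std_gauss) = 1" by simp
qed

interpretation std_gauss: prob_space "std_gauss :: 'a::euclidean_space measure"
  by (rule prob_space_std_gauss)

lemma measure_std_gauss_UNIV [simp]: "measure std_gauss UNIV = 1"
  using std_gauss.prob_space by simp

lemma emeasure_std_gauss_UNIV [simp]: "emeasure std_gauss UNIV = 1"
  using std_gauss.emeasure_space_1 by simp

interpretation std_gauss_pair: pair_prob_space "std_gauss :: 'a::euclidean_space measure" "std_gauss :: 'b::euclidean_space measure"
  by unfold_locales

lemma distr_std_gauss_inner_Basis:
  assumes "b \<in> Basis"
  shows "distr (std_gauss :: 'a::euclidean_space measure) borel (\<lambda>x. x \<bullet> b) = density lborel std_normal_density"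
proof (rule measure_eqI)
  fix A :: "real set" assume "A \<in> sets (distr (std_gauss :: 'a measure) borel (\<lambda>x. x \<bullet> b))"
  then have [measurable]: "A \<in> sets borel" by simp
  have N: "(\<integral>\<^sup>+x. ennreal (std_normal_density x) \<partial>lborel) = 1"
    by (subst nn_integral_eq_integral) (auto simp: integrable_normal_density)
  have "emeasure (distr (std_gauss :: 'a measure) borel (\<lambda>x. x \<bullet> b)) A =
     (\<integral>\<^sup>+x. indicator A (x \<bullet> b) \<partial>(std_gauss :: 'a measure))"
    by (subst nn_integral_indicator[symmetric], simp, subst nn_integral_distr) auto
  also have "\<dots> = (\<integral>\<^sup>+x. (\<Prod>i\<in>Basis. ennreal (std_normal_density (x \<bullet> i)) * (if i = b then indicator A (x \<bullet> i) else 1)) \<partial>(lborel :: 'a measure))"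
    unfolding std_gauss_def
    by (subst nn_integral_density)
       (auto simp: gauss_density_eq_prod prod_ennreal prod.distrib prod.delta assms intro!: nn_integral_cong)
  also have "\<dots> = (\<Prod>i\<in>(Basis::'a set). \<integral>\<^sup>+x. ennreal (std_normal_density x) * (if i = b then indicator A x else 1) \<partial>lborel)"
    by (intro nn_integral_lborel_prod) auto
  also have "\<dots> = (\<Prod>i\<in>(Basis::'a set). if i = b then \<integral>\<^sup>+x. ennreal (std_normal_density x) * indicator A x \<partial>lborel else 1)"
    by (intro prod.cong refl) (simp add: N)
  also have "\<dots> = \<integral>\<^sup>+x. ennreal (std_normal_density x) * indicator A x \<partial>lborel"
    using assms by (simp add: prod.delta)
  finally show "emeasure (distr (std_gauss :: 'a measure) borel (\<lambda>x. x \<bullet> b)) A = emeasure (density lborel std_normal_density) A"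
    by (simp add: emeasure_density)
qed simp

lemma indep_vars_std_gauss_coordinates:
  "std_gauss.indep_vars (\<lambda>_. borel) (\<lambda>b x. x \<bullet> b) (Basis :: 'a::euclidean_space set)"
proof (subst std_gauss.indep_vars_iff_distr_eq_PiM')
  show "(Basis :: 'a set) \<noteq> {}" by simp
  show "\<And>i. i \<in> Basis \<Longrightarrow> (\<lambda>x. x \<bullet> i) \<in> std_gauss \<rightarrow>\<^sub>M borel" by simp
  show "distr (std_gauss :: 'a measure) (Pi\<^sub>M Basis (\<lambda>_. borel)) (\<lambda>x. \<lambda>i\<in>Basis. x \<bullet> i) =
    Pi\<^sub>M Basis (\<lambda>i. distr (std_gauss :: 'a measure) borel (\<lambda>x. x \<bullet> i))"
  proof (rule product_sigma_finite.PiM_eqI)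
    show "product_sigma_finite (\<lambda>i. distr (std_gauss :: 'a measure) borel (\<lambda>x. x \<bullet> i))"
      by (intro product_sigma_finite.intro prob_space_imp_sigma_finite std_gauss.prob_space_distr) simp
    show "finite (Basis :: 'a set)" by simp
    show "sets (distr (std_gauss :: 'a measure) (Pi\<^sub>M Basis (\<lambda>_. borel)) (\<lambda>x. \<lambda>i\<in>Basis. x \<bullet> i)) =
      sets (Pi\<^sub>M Basis (\<lambda>i. distr (std_gauss :: 'a measure) borel (\<lambda>x. x \<bullet> i)))"
      by (simp, intro sets_PiM_cong) auto
    fix A assume A: "\<And>i. i \<in> (Basis :: 'a set) \<Longrightarrow> A i \<in> sets (distr (std_gauss :: 'a measure) borel (\<lambda>x. x \<bullet> i))"
    then have Am[measurable]: "\<And>i. i \<in> (Basis :: 'a set) \<Longrightarrow> A i \<in> sets borel" by simp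
    have [measurable]: "Pi\<^sub>E (Basis :: 'a set) A \<in> sets (Pi\<^sub>M Basis (\<lambda>_. borel))"
      by (intro sets_PiM_I_finite Am) auto
    have "emeasure (distr (std_gauss :: 'a measure) (Pi\<^sub>M Basis (\<lambda>_. borel)) (\<lambda>x. \<lambda>i\<in>Basis. x \<bullet> i)) (Pi\<^sub>E Basis A)
      = (\<integral>\<^sup>+x. indicator (Pi\<^sub>E Basis A) (\<lambda>i\<in>Basis. x \<bullet> i) \<partial>(std_gauss :: 'a measure))"
      by (subst nn_integral_indicator[symmetric], simp, subst nn_integral_distr) auto
    also have "\<dots> = (\<integral>\<^sup>+x. (\<Prod>i\<in>Basis. indicator (A i) (x \<bullet> i)) \<partial>(std_gauss :: 'a measure))"
    proof (rule nn_integral_cong)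
      fix x :: 'a
      show "indicator (Pi\<^sub>E Basis A) (\<lambda>i\<in>Basis. x \<bullet> i) = (\<Prod>i\<in>Basis. indicator (A i) (x \<bullet> i) :: ennreal)"
        by (cases "\<forall>i\<in>Basis. x \<bullet> i \<in> A i") (auto simp: indicator_def PiE_iff intro!: prod_zero)
    qed
    also have "\<dots> = (\<integral>\<^sup>+x. (\<Prod>i\<in>Basis. ennreal (std_normal_density (x \<bullet> i)) * indicator (A i) (x \<bullet> i)) \<partial>(lborel :: 'a measure))"
      unfolding std_gauss_def
      by (subst nn_integral_density)
         (auto simp: gauss_density_eq_prod prod_ennreal prod.distrib intro!: nn_integral_cong)
    also have "\<dots> = (\<Prod>i\<in>(Basis::'a set). \<integral>\<^sup>+x. ennreal (std_normal_density x) * indicator (A i) x \<partial>lborel)"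
      by (intro nn_integral_lborel_prod) auto
    also have "\<dots> = (\<Prod>i\<in>(Basis::'a set). emeasure (distr (std_gauss :: 'a measure) borel (\<lambda>x. x \<bullet> i)) (A i))"
      by (intro prod.cong refl) (simp add: distr_std_gauss_inner_Basis emeasure_density Am)
    finally show "emeasure (distr (std_gauss :: 'a measure) (Pi\<^sub>M Basis (\<lambda>_. borel)) (\<lambda>x. \<lambda>i\<in>Basis. x \<bullet> i)) (Pi\<^sub>E Basis A)
      = (\<Prod>i\<in>(Basis::'a set). emeasure (distr (std_gauss :: 'a measure) borel (\<lambda>x. x \<bullet> i)) (A i))" .
  qed
qed

text \<open>The coordinates are independent standard normal variables; a linear combination is
  normal and its variances add up to \<open>(norm v)\<^sup>2\<close>.\<close>

lemma distributed_std_gauss_inner: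
  fixes v :: "'a::euclidean_space"
  assumes "v \<noteq> 0"
  shows "distributed std_gauss lborel (\<lambda>x. v \<bullet> x) (normal_density 0 (norm v))"
proof -
  \<comment> \<open>Every summand needs a positive variance, so the coordinates where v vanishes are
    removed first; \<open>v \<noteq> 0\<close> keeps the index set non-empty.\<close>
  define I where "I = {b\<in>Basis. v \<bullet> b \<noteq> 0}"
  have fin: "finite I" by (simp add: I_def)
  have ne: "I \<noteq> {}"
    using assms by (auto simp: I_def euclidean_eq_iff[of v 0])
  have d1: "distributed (std_gauss :: 'a measure) lborel (\<lambda>x. x \<bullet> b) (normal_density 0 1)" if "b \<in> Basis" for b
    unfolding distributed_def using distr_std_gauss_inner_Basis[OF that] by (simp cong: distr_cong)
  have d2: "distributed std_gauss lborel (\<lambda>x. (v \<bullet> b) * (x \<bullet> b)) (normal_density 0 \<bar>v \<bullet> b\<bar>)" if "b \<in> I" for b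
    using std_gauss.normal_density_affine[OF d1, of b "v \<bullet> b" 0] that by (simp add: I_def)
  have "std_gauss.indep_vars (\<lambda>_. borel) (\<lambda>b x. x \<bullet> b) I"
    using indep_vars_std_gauss_coordinates by (rule std_gauss.indep_vars_subset) (auto simp: I_def)
  then have ind: "std_gauss.indep_vars (\<lambda>_. borel) (\<lambda>b x. (v \<bullet> b) * (x \<bullet> b)) I"
    by (rule std_gauss.indep_vars_compose2[where Y="\<lambda>b r. (v \<bullet> b) * r"]) simp
  have "distributed std_gauss lborel (\<lambda>x. \<Sum>b\<in>I. (v \<bullet> b) * (x \<bullet> b)) (normal_density (\<Sum>b\<in>I. 0) (sqrt (\<Sum>b\<in>I. \<bar>v \<bullet> b\<bar>\<^sup>2)))"
    by (rule std_gauss.sum_indep_normal[OF fin ne ind _ d2]) (auto simp: I_def)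
  moreover have "(\<Sum>b\<in>I. (v \<bullet> b) * (x \<bullet> b)) = v \<bullet> x" for x
    by (subst euclidean_inner) (auto simp: I_def intro!: sum.mono_neutral_left)
  moreover have "sqrt (\<Sum>b\<in>I. \<bar>v \<bullet> b\<bar>\<^sup>2) = norm v"
    unfolding norm_eq_sqrt_inner
    by (subst euclidean_inner) (auto simp: I_def power2_eq_square intro!: sum.mono_neutral_left)
  ultimately show ?thesis by simp
qed

lemma has_bochner_integral_std_gauss_abs_inner:
  fixes v :: "'a::euclidean_space"
  shows "has_bochner_integral std_gauss (\<lambda>x. \<bar>v \<bullet> x\<bar>) (sqrt (2 / pi) * norm v)"
proof (cases "v = 0")
  case False
  have D: "distributed std_gauss lborel (\<lambda>x. v \<bullet> x) (normal_density 0 (norm v))"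
    by (rule distributed_std_gauss_inner[OF False])
  have b: "has_bochner_integral lborel (\<lambda>x. normal_density 0 (norm v) x * \<bar>x\<bar>) (norm v * sqrt (2 / pi))"
    using normal_moment_abs_odd[of "norm v" 0 0] False by simp
  have "integrable std_gauss (\<lambda>x. \<bar>v \<bullet> x\<bar>)"
    using distributed_integrable[OF D, of abs] b by (auto simp: has_bochner_integral_iff)
  moreover have "(\<integral>x. \<bar>v \<bullet> x\<bar> \<partial>std_gauss) = norm v * sqrt (2 / pi)"
    using distributed_integral[OF D, of abs] b by (auto simp: has_bochner_integral_iff)
  ultimately show ?thesis by (simp add: has_bochner_integral_iff)
qed (simp add: has_bochner_integral_zero)

lemma has_bochner_integral_std_gauss_inner_square:
  fixes v :: "'a::euclidean_space"
  shows "has_bochner_integral std_gauss (\<lambda>x. (v \<bullet> x)\<^sup>2) ((norm v)\<^sup>2)"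
proof (cases "v = 0")
  case False
  have D: "distributed std_gauss lborel (\<lambda>x. v \<bullet> x) (normal_density 0 (norm v))"
    by (rule distributed_std_gauss_inner[OF False])
  have b: "has_bochner_integral lborel (\<lambda>x. normal_density 0 (norm v) x * x\<^sup>2) ((norm v)\<^sup>2)"
    using normal_moment_even[of "norm v" 0 1] False by (simp add: power2_eq_square mult.commute)
  have "integrable std_gauss (\<lambda>x. (v \<bullet> x)\<^sup>2)"
    using distributed_integrable[OF D, of "\<lambda>x. x\<^sup>2"] b by (auto simp: has_bochner_integral_iff)
  moreover have "(\<integral>x. (v \<bullet> x)\<^sup>2 \<partial>std_gauss) = (norm v)\<^sup>2"
    using distributed_integral[OF D, of "\<lambda>x. x\<^sup>2"] b by (auto simp: has_bochner_integral_iff)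
  ultimately show ?thesis by (simp add: has_bochner_integral_iff)
qed (simp add: has_bochner_integral_zero)

lemma integrable_std_gauss_norm_square: "integrable std_gauss (\<lambda>x::'a::euclidean_space. (norm x)\<^sup>2)"
proof -
  have "integrable std_gauss (\<lambda>x::'a. \<Sum>b\<in>Basis. (b \<bullet> x)\<^sup>2)"
    by (intro Bochner_Integration.integrable_sum integrable.intros[OF has_bochner_integral_std_gauss_inner_square])
  moreover have "(\<Sum>b\<in>Basis. (b \<bullet> x)\<^sup>2) = (norm x)\<^sup>2" for x :: 'a
    unfolding power2_norm_eq_inner
    by (subst (2) euclidean_inner) (simp add: inner_commute power2_eq_square)
  ultimately show ?thesis by simp
qed

lemma norm_le_1_plus_square: "norm x \<le> 1 + (norm x)\<^sup>2"
proof -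
  have "0 \<le> (norm x - 1 / 2)\<^sup>2" by simp
  then have "norm x \<le> 1 / 4 + (norm x)\<^sup>2" by (simp add: power2_eq_square algebra_simps)
  then show ?thesis by simp
qed

lemma integrable_std_gauss_norm: "integrable std_gauss (\<lambda>x::'a::euclidean_space. norm x)"
proof (rule Bochner_Integration.integrable_bound)
  show "integrable std_gauss (\<lambda>x::'a. 1 + (norm x)\<^sup>2)"
    by (intro Bochner_Integration.integrable_add std_gauss.integrable_const integrable_std_gauss_norm_square)
  show "AE x::'a in std_gauss. norm (norm x) \<le> norm (1 + (norm x)\<^sup>2)" using norm_le_1_plus_square by auto
qed simp

text \<open>A centred normal density with deviation r times the standard density is a multiple of
  the density with deviation r / q, where q^2 = 1 + r^2; the multiple is the value of the
  integral.\<close>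

lemma has_bochner_integral_std_gauss_exp_inner:
  fixes w :: "'a::euclidean_space"
  shows "has_bochner_integral std_gauss (\<lambda>x. std_normal_density (w \<bullet> x))
           (1 / (sqrt (2 * pi) * sqrt (1 + (norm w)\<^sup>2)))"
proof (cases "w = 0")
  case True
  have "has_bochner_integral std_gauss (\<lambda>x::'a. std_normal_density 0) (std_normal_density 0)"
    by (simp add: has_bochner_integral_iff)
  then show ?thesis using True by (simp add: std_normal_density_def)
next
  case False
  define r where "r = norm w"
  have r: "r > 0" using False by (simp add: r_def)
  define q where "q = sqrt (1 + r\<^sup>2)"
  have q: "q > 0" "q\<^sup>2 = 1 + r\<^sup>2" by (auto simp: q_def add_pos_nonneg)
  have D: "distributed std_gauss lborel (\<lambda>x. w \<bullet> x) (normal_density 0 r)"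
    unfolding r_def by (rule distributed_std_gauss_inner[OF False])
  have eq: "normal_density 0 r x * std_normal_density x = (1 / (sqrt (2 * pi) * q)) * normal_density 0 (r / q) x" for x
  proof -
    have "exp (- x\<^sup>2 / (2 * r\<^sup>2)) * exp (- x\<^sup>2 / 2) = exp (- x\<^sup>2 / (2 * (r/q)\<^sup>2))"
      unfolding exp_add[symmetric] power_divide q(2) using r by (intro arg_cong[where f=exp]) (auto simp: field_simps)
    moreover have "sqrt (2 * pi * r\<^sup>2) = sqrt (2 * pi) * r" "sqrt (2 * pi * (r / q)\<^sup>2) = sqrt (2 * pi) * (r / q)"
      using r q(1) by (auto simp: real_sqrt_mult real_sqrt_divide)
    ultimately show ?thesis
      using r q(1) by (simp add: normal_density_def)
  qed
  have "has_bochner_integral lborel (\<lambda>x. (1 / (sqrt (2 * pi) * q)) * normal_density 0 (r / q) x) ((1 / (sqrt (2 * pi) * q)) * 1)"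
    using r q by (intro has_bochner_integral_mult_right) (auto simp: has_bochner_integral_iff)
  then have b: "has_bochner_integral lborel (\<lambda>x. normal_density 0 r x * std_normal_density x) (1 / (sqrt (2 * pi) * q))"
    by (simp add: eq)
  have "integrable std_gauss (\<lambda>x. std_normal_density (w \<bullet> x))"
    using distributed_integrable[OF D, of std_normal_density] b r by (auto simp: has_bochner_integral_iff)
  moreover have "(\<integral>x. std_normal_density (w \<bullet> x) \<partial>std_gauss) = 1 / (sqrt (2 * pi) * q)"
    using distributed_integral[OF D, of std_normal_density] b r by (auto simp: has_bochner_integral_iff)
  ultimately show ?thesis by (simp add: has_bochner_integral_iff q_def r_def)
qed

section \<open>Rotation invariance of the Gaussian law of pairs\<close>

lemma nn_integral_lborel_shift:
  fixes f :: "'a::euclidean_space \<Rightarrow> ennreal"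
  assumes [measurable]: "f \<in> borel_measurable borel"
  shows "(\<integral>\<^sup>+x. f (x + t) \<partial>lborel) = (\<integral>\<^sup>+x. f x \<partial>lborel)"
proof -
  have "(\<integral>\<^sup>+x. f x \<partial>lborel) = (\<integral>\<^sup>+x. f x \<partial>(distr lborel borel ((+) t)))"
    by (simp add: lborel_distr_plus)
  also have "\<dots> = (\<integral>\<^sup>+x. f (x + t) \<partial>lborel)"
    by (subst nn_integral_distr) (auto simp: add.commute)
  finally show ?thesis by simp
qed

lemma nn_integral_lborel_shear1:
  fixes F :: "'a::euclidean_space \<times> 'a \<Rightarrow> ennreal"
  assumes [measurable]: "F \<in> borel_measurable (borel \<Otimes>\<^sub>M borel)"
  shows "(\<integral>\<^sup>+p. F (fst p + a *\<^sub>R snd p, snd p) \<partial>(lborel \<Otimes>\<^sub>M lborel)) = (\<integral>\<^sup>+p. F p \<partial>(lborel \<Otimes>\<^sub>M lborel))"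
proof -
  have "(\<integral>\<^sup>+p. F (fst p + a *\<^sub>R snd p, snd p) \<partial>(lborel \<Otimes>\<^sub>M lborel)) =
    (\<integral>\<^sup>+z. \<integral>\<^sup>+x. F (x + a *\<^sub>R z, z) \<partial>lborel \<partial>lborel)"
    by (subst lborel_pair.nn_integral_snd[symmetric]) auto
  also have "\<dots> = (\<integral>\<^sup>+z. \<integral>\<^sup>+x. F (x, z) \<partial>lborel \<partial>lborel)"
    by (intro nn_integral_cong nn_integral_lborel_shift) measurable
  also have "\<dots> = (\<integral>\<^sup>+p. F p \<partial>(lborel \<Otimes>\<^sub>M lborel))"
    by (subst lborel_pair.nn_integral_snd) auto
  finally show ?thesis .
qed

lemma nn_integral_lborel_shear2:
  fixes F :: "'a::euclidean_space \<times> 'a \<Rightarrow> ennreal"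
  assumes [measurable]: "F \<in> borel_measurable (borel \<Otimes>\<^sub>M borel)"
  shows "(\<integral>\<^sup>+p. F (fst p, snd p + a *\<^sub>R fst p) \<partial>(lborel \<Otimes>\<^sub>M lborel)) = (\<integral>\<^sup>+p. F p \<partial>(lborel \<Otimes>\<^sub>M lborel))"
proof -
  have "(\<integral>\<^sup>+p. F (fst p, snd p + a *\<^sub>R fst p) \<partial>(lborel \<Otimes>\<^sub>M lborel)) =
    (\<integral>\<^sup>+x. \<integral>\<^sup>+z. F (x, z + a *\<^sub>R x) \<partial>lborel \<partial>lborel)"
    by (subst lborel.nn_integral_fst[symmetric]) auto
  also have "\<dots> = (\<integral>\<^sup>+x. \<integral>\<^sup>+z. F (x, z) \<partial>lborel \<partial>lborel)"
    by (intro nn_integral_cong nn_integral_lborel_shift) measurable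
  also have "\<dots> = (\<integral>\<^sup>+p. F p \<partial>(lborel \<Otimes>\<^sub>M lborel))"
    by (subst lborel.nn_integral_fst) auto
  finally show ?thesis .
qed

text \<open>A plane rotation by an angle other than \<open>\<pi>\<close> is a product of three shears.\<close>

lemma nn_integral_lborel_rotation:
  fixes F :: "'a::euclidean_space \<times> 'a \<Rightarrow> ennreal"
  assumes F [measurable]: "F \<in> borel_measurable (borel \<Otimes>\<^sub>M borel)"
    and cs: "c\<^sup>2 + s\<^sup>2 = (1::real)" and c: "c \<noteq> -1"
  shows "(\<integral>\<^sup>+p. F (c *\<^sub>R fst p + s *\<^sub>R snd p, c *\<^sub>R snd p - s *\<^sub>R fst p) \<partial>(lborel \<Otimes>\<^sub>M lborel)) =
         (\<integral>\<^sup>+p. F p \<partial>(lborel \<Otimes>\<^sub>M lborel))"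
proof -
  \<comment> \<open>The tangent of half the angle. The three shears have coefficients a, - s and a;
    the excluded value c = -1 is the one where this tangent is infinite.\<close>
  define a where "a = s / (1 + c)"
  have c': "1 + c \<noteq> 0" using c by linarith
  have s2: "s * s = (1 - c) * (1 + c)" using cs by (simp add: power2_eq_square algebra_simps)
  have a1: "1 - a * s = c" unfolding a_def using c' s2 by (simp add: field_simps)
  have "a * (1 + c) = s" unfolding a_def using c' by simp
  then have a2: "a + a * c = s" by (simp add: algebra_simps)
  have e: "(c *\<^sub>R x + s *\<^sub>R z, c *\<^sub>R z - s *\<^sub>R x) =
     ((x + a *\<^sub>R z) + a *\<^sub>R (z + (-s) *\<^sub>R (x + a *\<^sub>R z)), z + (-s) *\<^sub>R (x + a *\<^sub>R z))" for x z :: 'a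
  proof -
    have 1: "z + (-s) *\<^sub>R (x + a *\<^sub>R z) = (1 - a * s) *\<^sub>R z - s *\<^sub>R x"
      by (simp add: algebra_simps)
    have "(x + a *\<^sub>R z) + a *\<^sub>R ((1 - a * s) *\<^sub>R z - s *\<^sub>R x) = (1 - a * s) *\<^sub>R x + (a + a * (1 - a * s)) *\<^sub>R z"
      using scaleR_left_distrib[of a a z] by (simp add: algebra_simps)
    then show ?thesis unfolding 1 by (simp add: a1 a2)
  qed
  define F1 where "F1 p = F (fst p + a *\<^sub>R snd p, snd p)" for p
  have [measurable]: "F1 \<in> borel_measurable (borel \<Otimes>\<^sub>M borel)" unfolding F1_def by measurable
  define F2 where "F2 p = F1 (fst p, snd p + (-s) *\<^sub>R fst p)" for p
  have [measurable]: "F2 \<in> borel_measurable (borel \<Otimes>\<^sub>M borel)" unfolding F2_def by measurable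
  have "(\<integral>\<^sup>+p. F (c *\<^sub>R fst p + s *\<^sub>R snd p, c *\<^sub>R snd p - s *\<^sub>R fst p) \<partial>(lborel \<Otimes>\<^sub>M lborel))
     = (\<integral>\<^sup>+p. F2 (fst p + a *\<^sub>R snd p, snd p) \<partial>(lborel \<Otimes>\<^sub>M lborel))"
    unfolding F2_def F1_def e by simp
  also have "\<dots> = (\<integral>\<^sup>+p. F2 p \<partial>(lborel \<Otimes>\<^sub>M lborel))"
    by (rule nn_integral_lborel_shear1) measurable
  also have "\<dots> = (\<integral>\<^sup>+p. F1 p \<partial>(lborel \<Otimes>\<^sub>M lborel))"
    unfolding F2_def by (rule nn_integral_lborel_shear2) measurable
  also have "\<dots> = (\<integral>\<^sup>+p. F p \<partial>(lborel \<Otimes>\<^sub>M lborel))"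
    unfolding F1_def by (rule nn_integral_lborel_shear1) measurable
  finally show ?thesis .
qed

abbreviation gauss2 :: "('a::euclidean_space \<times> 'a) measure" where
  "gauss2 \<equiv> std_gauss \<Otimes>\<^sub>M std_gauss"

lemma sets_gauss2 [simp, measurable_cong]: "sets gauss2 = sets (borel \<Otimes>\<^sub>M borel)"
  by (intro sets_pair_measure_cong) auto

lemma space_gauss2 [simp]: "space gauss2 = UNIV"
  by (simp add: space_pair_measure)

lemma gauss2_eq_density:
  "(gauss2 :: ('a::euclidean_space \<times> 'a) measure) =
     density (lborel \<Otimes>\<^sub>M lborel) (\<lambda>p. ennreal (gauss_density (fst p)) * ennreal (gauss_density (snd p)))"
  unfolding std_gauss_def
  by (subst pair_measure_density)
     (auto simp: case_prod_beta' std_gauss_def[symmetric] intro: prob_space_imp_sigma_finite prob_space_std_gauss lborel.sigma_finite_measure_axioms)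

lemma gauss_density_mult_rotate:
  fixes x z :: "'a::euclidean_space"
  assumes cs: "c\<^sup>2 + s\<^sup>2 = (1::real)"
  shows "gauss_density (c *\<^sub>R x + s *\<^sub>R z) * gauss_density (c *\<^sub>R z - s *\<^sub>R x) = gauss_density x * gauss_density z"
proof -
  have "(norm (c *\<^sub>R x + s *\<^sub>R z))\<^sup>2 + (norm (c *\<^sub>R z - s *\<^sub>R x))\<^sup>2 = (c\<^sup>2 + s\<^sup>2) * ((norm x)\<^sup>2 + (norm z)\<^sup>2)"
    unfolding power2_norm_eq_inner
    by (simp add: inner_simps algebra_simps power2_eq_square inner_commute)
  then have "exp (- (norm (c *\<^sub>R x + s *\<^sub>R z))\<^sup>2 / 2) * exp (- (norm (c *\<^sub>R z - s *\<^sub>R x))\<^sup>2 / 2) = exp (- (norm x)\<^sup>2 / 2) * exp (- (norm z)\<^sup>2 / 2)"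
    unfolding exp_add[symmetric] cs by (simp add: field_simps)
  then show ?thesis by (simp add: gauss_density_def)
qed

lemma nn_integral_gauss2_rotation:
  fixes F :: "'a::euclidean_space \<times> 'a \<Rightarrow> ennreal"
  assumes F [measurable]: "F \<in> borel_measurable (borel \<Otimes>\<^sub>M borel)"
    and cs: "c\<^sup>2 + s\<^sup>2 = (1::real)" and c: "c \<noteq> -1"
  shows "(\<integral>\<^sup>+p. F (c *\<^sub>R fst p + s *\<^sub>R snd p, c *\<^sub>R snd p - s *\<^sub>R fst p) \<partial>gauss2) = (\<integral>\<^sup>+p. F p \<partial>gauss2)"
proof -
  have "(\<integral>\<^sup>+p. F (c *\<^sub>R fst p + s *\<^sub>R snd p, c *\<^sub>R snd p - s *\<^sub>R fst p) \<partial>gauss2) =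
    (\<integral>\<^sup>+p. (ennreal (gauss_density (fst p)) * ennreal (gauss_density (snd p))) *
        F (c *\<^sub>R fst p + s *\<^sub>R snd p, c *\<^sub>R snd p - s *\<^sub>R fst p) \<partial>(lborel \<Otimes>\<^sub>M lborel))"
    unfolding gauss2_eq_density by (subst nn_integral_density) auto
  also have "\<dots> = (\<integral>\<^sup>+p. (\<lambda>q. (ennreal (gauss_density (fst q)) * ennreal (gauss_density (snd q))) * F q)
        (c *\<^sub>R fst p + s *\<^sub>R snd p, c *\<^sub>R snd p - s *\<^sub>R fst p) \<partial>(lborel \<Otimes>\<^sub>M lborel))"
    by (intro nn_integral_cong) (simp add: ennreal_mult[symmetric] gauss_density_mult_rotate[OF cs])
  also have "\<dots> = (\<integral>\<^sup>+q. (ennreal (gauss_density (fst q)) * ennreal (gauss_density (snd q))) * F q \<partial>(lborel \<Otimes>\<^sub>M lborel))"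
    by (rule nn_integral_lborel_rotation[OF _ cs c]) measurable
  also have "\<dots> = (\<integral>\<^sup>+p. F p \<partial>gauss2)"
    unfolding gauss2_eq_density by (subst nn_integral_density) auto
  finally show ?thesis .
qed

lemma nn_integral_gauss2_swap:
  fixes F :: "'a::euclidean_space \<times> 'a \<Rightarrow> ennreal"
  assumes F [measurable]: "F \<in> borel_measurable (borel \<Otimes>\<^sub>M borel)"
  shows "(\<integral>\<^sup>+p. F (snd p, fst p) \<partial>gauss2) = (\<integral>\<^sup>+p. F p \<partial>gauss2)"
proof -
  have "(\<integral>\<^sup>+p. F (snd p, fst p) \<partial>gauss2) = (\<integral>\<^sup>+x. \<integral>\<^sup>+z. F (z, x) \<partial>std_gauss \<partial>std_gauss)"
    by (subst std_gauss.nn_integral_fst[symmetric]) auto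
  also have "\<dots> = (\<integral>\<^sup>+p. F p \<partial>gauss2)"
    by (subst std_gauss_pair.nn_integral_snd) auto
  finally show ?thesis .
qed

text \<open>A rotation with s and - c in the roles of cosine and sine, followed by a swap. The
  excluded position becomes s = -1, harmless when s is a nonnegative square root.\<close>

lemma nn_integral_gauss2_reflection:
  fixes F :: "'a::euclidean_space \<times> 'a \<Rightarrow> ennreal"
  assumes F [measurable]: "F \<in> borel_measurable (borel \<Otimes>\<^sub>M borel)"
    and cs: "c\<^sup>2 + s\<^sup>2 = (1::real)" and s: "s \<noteq> -1"
  shows "(\<integral>\<^sup>+p. F (c *\<^sub>R fst p + s *\<^sub>R snd p, s *\<^sub>R fst p - c *\<^sub>R snd p) \<partial>gauss2) = (\<integral>\<^sup>+p. F p \<partial>gauss2)"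
proof -
  have "s\<^sup>2 + (-c)\<^sup>2 = 1" using cs by simp
  from nn_integral_gauss2_rotation[of "\<lambda>q. F (snd q, fst q)", OF _ this s]
  have "(\<integral>\<^sup>+p. F (c *\<^sub>R fst p + s *\<^sub>R snd p, s *\<^sub>R fst p - c *\<^sub>R snd p) \<partial>gauss2) = (\<integral>\<^sup>+q. F (snd q, fst q) \<partial>gauss2)"
    by (simp add: add.commute)
  also have "\<dots> = (\<integral>\<^sup>+p. F p \<partial>gauss2)"
    by (rule nn_integral_gauss2_swap[OF F])
  finally show ?thesis .
qed

lemma distr_gauss2_rotation:
  assumes cs: "c\<^sup>2 + s\<^sup>2 = (1::real)" and c: "c \<noteq> -1"
  shows "distr gauss2 (borel \<Otimes>\<^sub>M borel) (\<lambda>p::'a::euclidean_space \<times> 'a. (c *\<^sub>R fst p + s *\<^sub>R snd p, c *\<^sub>R snd p - s *\<^sub>R fst p)) = gauss2"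
proof (rule measure_eqI)
  fix A :: "('a \<times> 'a) set" assume "A \<in> sets (distr gauss2 (borel \<Otimes>\<^sub>M borel) (\<lambda>p::'a \<times> 'a. (c *\<^sub>R fst p + s *\<^sub>R snd p, c *\<^sub>R snd p - s *\<^sub>R fst p)))"
  then have [measurable]: "A \<in> sets (borel \<Otimes>\<^sub>M borel)" by simp
  show "emeasure (distr gauss2 (borel \<Otimes>\<^sub>M borel) (\<lambda>p::'a \<times> 'a. (c *\<^sub>R fst p + s *\<^sub>R snd p, c *\<^sub>R snd p - s *\<^sub>R fst p))) A = emeasure gauss2 A"
  proof -
    let ?R = "\<lambda>p::'a \<times> 'a. (c *\<^sub>R fst p + s *\<^sub>R snd p, c *\<^sub>R snd p - s *\<^sub>R fst p)"
    have "emeasure (distr gauss2 (borel \<Otimes>\<^sub>M borel) ?R) A = (\<integral>\<^sup>+p. indicator A p \<partial>(distr gauss2 (borel \<Otimes>\<^sub>M borel) ?R))"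
      by simp
    also have "\<dots> = (\<integral>\<^sup>+p. indicator A (?R p) \<partial>gauss2)"
      by (subst nn_integral_distr) auto
    also have "\<dots> = (\<integral>\<^sup>+p. indicator A p \<partial>gauss2)"
      by (rule nn_integral_gauss2_rotation[OF _ cs c]) measurable
    finally show ?thesis by simp
  qed
qed simp

text \<open>Probability that the two members of a pair of standard Gaussian vectors with correlation
  c fall into A and B. It is used with c = exp (- t) and with c = cos \<theta>.\<close>

definition gauss_joint :: "real \<Rightarrow> 'a::euclidean_space set \<Rightarrow> 'a set \<Rightarrow> ennreal" where
  "gauss_joint c A B = emeasure gauss2 {p. fst p \<in> A \<and> c *\<^sub>R fst p + sqrt (1 - c\<^sup>2) *\<^sub>R snd p \<in> B}"

lemma gauss_joint_measurable_set [measurable]: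
  fixes A B :: "'a::euclidean_space set"
  assumes [measurable]: "A \<in> sets borel" "B \<in> sets borel"
  shows "{p. fst p \<in> A \<and> c *\<^sub>R fst p + s *\<^sub>R snd p \<in> B} \<in> sets (borel \<Otimes>\<^sub>M borel)"
proof -
  have "{p \<in> space (borel \<Otimes>\<^sub>M borel). fst p \<in> A \<and> c *\<^sub>R fst p + s *\<^sub>R snd p \<in> B} \<in> sets (borel \<Otimes>\<^sub>M (borel :: 'a measure))"
    by measurable
  then show ?thesis by (simp add: space_pair_measure)
qed

text \<open>With Y = c X + s Z, the reflection taking (X, Z) to (Y, s X - c Z) is an involution that
  preserves the Gaussian law and exchanges X with Y.\<close>

lemma gauss_joint_commute:
  fixes A B :: "'a::euclidean_space set"
  assumes [measurable]: "A \<in> sets borel" "B \<in> sets borel" and c: "\<bar>c\<bar> \<le> 1"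
  shows "gauss_joint c A B = gauss_joint c B A"
proof -
  define s where "s = sqrt (1 - c\<^sup>2)"
  have cs: "c\<^sup>2 + s\<^sup>2 = 1" using c by (simp add: s_def abs_square_le_1)
  have "s \<ge> 0" using c by (simp add: s_def abs_square_le_1)
  then have s: "s \<noteq> -1" by linarith
  have "c *\<^sub>R (c *\<^sub>R x + s *\<^sub>R z) + s *\<^sub>R (s *\<^sub>R x - c *\<^sub>R z) = (c\<^sup>2 + s\<^sup>2) *\<^sub>R x" for x z :: 'a
    by (simp add: algebra_simps power2_eq_square)
  then have e: "c *\<^sub>R (c *\<^sub>R x + s *\<^sub>R z) + s *\<^sub>R (s *\<^sub>R x - c *\<^sub>R z) = x" for x z :: 'a
    by (simp add: cs)
  have "gauss_joint c B A = (\<integral>\<^sup>+p. indicator {p. fst p \<in> B \<and> c *\<^sub>R fst p + s *\<^sub>R snd p \<in> A} p \<partial>gauss2)"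
    unfolding gauss_joint_def s_def by (simp add: sets_gauss2)
  also have "\<dots> = (\<integral>\<^sup>+p. indicator {p. fst p \<in> B \<and> c *\<^sub>R fst p + s *\<^sub>R snd p \<in> A} (c *\<^sub>R fst p + s *\<^sub>R snd p, s *\<^sub>R fst p - c *\<^sub>R snd p) \<partial>gauss2)"
    by (rule nn_integral_gauss2_reflection[OF _ cs s, symmetric]) measurable
  also have "\<dots> = (\<integral>\<^sup>+p. indicator {p. fst p \<in> A \<and> c *\<^sub>R fst p + s *\<^sub>R snd p \<in> B} p \<partial>gauss2)"
    by (intro nn_integral_cong) (auto simp: indicator_def e)
  also have "\<dots> = gauss_joint c A B"
    unfolding gauss_joint_def s_def by (simp add: sets_gauss2)
  finally show ?thesis by simp
qed

lemma gauss_joint_eq_nn_integral: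
  fixes A B :: "'a::euclidean_space set"
  assumes [measurable]: "A \<in> sets borel" "B \<in> sets borel"
  shows "gauss_joint c A B =
    (\<integral>\<^sup>+x. indicator A x * (\<integral>\<^sup>+z. indicator B (c *\<^sub>R x + sqrt (1 - c\<^sup>2) *\<^sub>R z) \<partial>std_gauss) \<partial>std_gauss)"
proof -
  have "gauss_joint c A B = (\<integral>\<^sup>+p. indicator A (fst p) * indicator B (c *\<^sub>R fst p + sqrt (1 - c\<^sup>2) *\<^sub>R snd p) \<partial>gauss2)"
  proof -
    let ?S = "{p. fst p \<in> A \<and> c *\<^sub>R fst p + sqrt (1 - c\<^sup>2) *\<^sub>R snd p \<in> B}"
    have "gauss_joint c A B = (\<integral>\<^sup>+p. indicator ?S p \<partial>gauss2)"
      unfolding gauss_joint_def by (simp add: sets_gauss2)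
    also have "\<dots> = (\<integral>\<^sup>+p. indicator A (fst p) * indicator B (c *\<^sub>R fst p + sqrt (1 - c\<^sup>2) *\<^sub>R snd p) \<partial>gauss2)"
      by (intro nn_integral_cong) (auto simp: indicator_def)
    finally show ?thesis .
  qed
  also have "\<dots> = (\<integral>\<^sup>+x. \<integral>\<^sup>+z. indicator A x * indicator B (c *\<^sub>R x + sqrt (1 - c\<^sup>2) *\<^sub>R z) \<partial>std_gauss \<partial>std_gauss)"
    by (subst std_gauss.nn_integral_fst[symmetric]) auto
  also have "\<dots> = (\<integral>\<^sup>+x. indicator A x * (\<integral>\<^sup>+z. indicator B (c *\<^sub>R x + sqrt (1 - c\<^sup>2) *\<^sub>R z) \<partial>std_gauss) \<partial>std_gauss)"
    by (intro nn_integral_cong nn_integral_cmult) auto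
  finally show ?thesis .
qed

section \<open>The Mehler kernel as a transition density\<close>

text \<open>Mehler's formula pointwise. The factor \<open>s ^ DIM('a)\<close> is the Jacobian of z
  \<mapsto> c x + s z, and completing the square adds the exponent of the kernel and that of the
  density at y to the Gaussian exponent of z.\<close>

lemma mehler_kernel_mult_gauss_density:
  fixes x z :: "'a::euclidean_space"
  assumes t: "t > 0" and c_def: "c = exp (- t)" and s_def: "s = sqrt (1 - c\<^sup>2)"
  shows "s ^ DIM('a) * (mehler_kernel t x (c *\<^sub>R x + s *\<^sub>R z) * gauss_density (c *\<^sub>R x + s *\<^sub>R z)) = gauss_density z"
proof -
  define y where "y = c *\<^sub>R x + s *\<^sub>R z"
  have c: "0 < c" "c < 1" using t by (auto simp: c_def)
  have c2: "exp (- 2 * t) = c\<^sup>2" by (simp add: c_def exp_double[symmetric])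
  have c1: "c\<^sup>2 < 1" using c by (simp add: power_less_one_iff abs_square_less_1)
  have s: "s > 0" "s\<^sup>2 = 1 - c\<^sup>2" using c1 by (auto simp: s_def)
  have p: "(1 - c\<^sup>2) powr (real DIM('a) / 2) = s ^ DIM('a)"
  proof -
    have "s ^ DIM('a) = ((1 - c\<^sup>2) powr (1/2)) powr (real DIM('a))"
      using s c1 by (simp add: s_def powr_realpow powr_half_sqrt)
    then show ?thesis by (simp add: powr_powr)
  qed
  have "(norm y)\<^sup>2 = c\<^sup>2 * (norm x)\<^sup>2 + 2 * c * s * (x \<bullet> z) + s\<^sup>2 * (norm z)\<^sup>2"
    unfolding y_def power2_norm_eq_inner by (simp add: inner_simps algebra_simps power2_eq_square inner_commute)
  moreover have "x \<bullet> y = c * (norm x)\<^sup>2 + s * (x \<bullet> z)"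
    unfolding y_def power2_norm_eq_inner by (simp add: inner_simps)
  ultimately have "c\<^sup>2 * (norm x)\<^sup>2 - 2 * c * (x \<bullet> y) + c\<^sup>2 * (norm y)\<^sup>2 + s\<^sup>2 * (norm y)\<^sup>2 = s\<^sup>2 * (norm z)\<^sup>2"
  proof -
    have "(c\<^sup>2 + s\<^sup>2) * (norm y)\<^sup>2 = (norm y)\<^sup>2" using s by simp
    then have "c\<^sup>2 * (norm y)\<^sup>2 + s\<^sup>2 * (norm y)\<^sup>2 = (norm y)\<^sup>2" by (simp only: distrib_right)
    then show ?thesis
      using \<open>(norm y)\<^sup>2 = _\<close> \<open>x \<bullet> y = _\<close> by (simp add: algebra_simps power2_eq_square)
  qed
  then have "(c\<^sup>2 * (norm x)\<^sup>2 - 2 * c * (x \<bullet> y) + c\<^sup>2 * (norm y)\<^sup>2) / (2 * s\<^sup>2) + (norm y)\<^sup>2 / 2 = (norm z)\<^sup>2 / 2"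
    using s(1) by (simp add: field_simps)
  then have "exp (- ((c\<^sup>2 * (norm x)\<^sup>2 - 2 * c * (x \<bullet> y) + c\<^sup>2 * (norm y)\<^sup>2) / (2 * s\<^sup>2))) * exp (- (norm y)\<^sup>2 / 2) = exp (- (norm z)\<^sup>2 / 2)"
    unfolding exp_add[symmetric] by (intro arg_cong[where f=exp]) linarith
  then show ?thesis
    unfolding y_def[symmetric] mehler_kernel_def gauss_density_def c2 c_def[symmetric] p unfolding s(2)[symmetric]
    using s(1) by (simp add: mult_ac)
qed

text \<open>The kernel is the density, relative to the Gaussian measure, of the conditional law of Y
  given X = x.\<close>

lemma nn_integral_mehler_kernel:
  fixes x :: "'a::euclidean_space" and f :: "'a \<Rightarrow> ennreal"
  assumes t: "t > 0" and [measurable]: "f \<in> borel_measurable borel"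
  shows "(\<integral>\<^sup>+y. ennreal (mehler_kernel t x y) * f y \<partial>std_gauss) =
         (\<integral>\<^sup>+z. f (exp (- t) *\<^sub>R x + sqrt (1 - (exp (- t))\<^sup>2) *\<^sub>R z) \<partial>std_gauss)"
proof -
  define c where "c = exp (- t)"
  define s where "s = sqrt (1 - c\<^sup>2)"
  have c: "0 < c" "c < 1" using t by (auto simp: c_def)
  have s: "s > 0" unfolding s_def using c by (simp add: abs_square_less_1)
  have mpos: "mehler_kernel t x y \<ge> 0" for y by (simp add: mehler_kernel_def)
  have [measurable]: "(\<lambda>y. mehler_kernel t x y) \<in> borel_measurable borel"
    unfolding mehler_kernel_def by measurable
  define h where "h y = ennreal (gauss_density y) * (ennreal (mehler_kernel t x y) * f y)" for y
  have [measurable]: "h \<in> borel_measurable borel" unfolding h_def by measurable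
  have "(\<integral>\<^sup>+y. ennreal (mehler_kernel t x y) * f y \<partial>std_gauss) = (\<integral>\<^sup>+y. h y \<partial>lborel)"
    unfolding std_gauss_def h_def by (subst nn_integral_density) auto
  also have "\<dots> = (\<integral>\<^sup>+z. ennreal (s ^ DIM('a)) * h (c *\<^sub>R x + s *\<^sub>R z) \<partial>lborel)"
    using s by (subst lborel_affine[of s "c *\<^sub>R x"]) (auto simp: nn_integral_density nn_integral_distr)
  also have "\<dots> = (\<integral>\<^sup>+z. ennreal (gauss_density z) * f (c *\<^sub>R x + s *\<^sub>R z) \<partial>lborel)"
  proof (intro nn_integral_cong)
    fix z
    have "ennreal (gauss_density z) = ennreal (s ^ DIM('a)) * (ennreal (gauss_density (c *\<^sub>R x + s *\<^sub>R z)) * ennreal (mehler_kernel t x (c *\<^sub>R x + s *\<^sub>R z)))"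
      unfolding mehler_kernel_mult_gauss_density[OF t c_def s_def, of x z, symmetric]
      using s by (simp add: ennreal_mult[symmetric] mpos mult_ac)
    then show "ennreal (s ^ DIM('a)) * h (c *\<^sub>R x + s *\<^sub>R z) = ennreal (gauss_density z) * f (c *\<^sub>R x + s *\<^sub>R z)"
      unfolding h_def by (simp add: mult.assoc)
  qed
  also have "\<dots> = (\<integral>\<^sup>+z. f (c *\<^sub>R x + s *\<^sub>R z) \<partial>std_gauss)"
    unfolding std_gauss_def by (subst nn_integral_density) auto
  finally show ?thesis unfolding s_def c_def .
qed

lemma borel_measurable_frac_kernel [measurable]:
  "(\<lambda>p. frac_kernel s (fst p) (snd p)) \<in> borel_measurable (borel \<Otimes>\<^sub>M (borel :: 'a::euclidean_space measure))"
  unfolding frac_kernel_def mehler_kernel_def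
  by (rule lborel.borel_measurable_nn_integral) measurable

text \<open>Tonelli's theorem brings the time integral of the kernel to the outside; at fixed t the
  double integral over A and B is then a probability for the correlated pair.\<close>

lemma nn_integral_frac_kernel_std_gauss:
  fixes A B :: "'a::euclidean_space set"
  assumes [measurable]: "A \<in> sets borel" "B \<in> sets borel"
  shows "(\<integral>\<^sup>+x\<in>A. (\<integral>\<^sup>+y\<in>B. frac_kernel s x y \<partial>std_gauss) \<partial>std_gauss) =
         (\<integral>\<^sup>+t\<in>{0<..}. ennreal (1 / t powr (s / 2 + 1)) * gauss_joint (exp (- t)) A B \<partial>lborel)"
proof -
  define w where "w t = ennreal (1 / t powr (s / 2 + 1)) * indicator {0<..} t" for t :: real
  have w[measurable]: "w \<in> borel_measurable borel" unfolding w_def by measurable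
  have mpos: "mehler_kernel t x y \<ge> 0" for t and x y :: 'a by (simp add: mehler_kernel_def)
  have M[measurable]: "(\<lambda>(t, x, y). mehler_kernel t x y) \<in> borel_measurable (borel \<Otimes>\<^sub>M borel \<Otimes>\<^sub>M (borel :: 'a measure))"
    unfolding mehler_kernel_def by measurable
  have [measurable]: "(\<lambda>t. mehler_kernel t x y) \<in> borel_measurable borel" for x y :: 'a
    unfolding mehler_kernel_def by measurable
  have [measurable]: "(\<lambda>p. mehler_kernel (fst p) x (snd p)) \<in> borel_measurable (borel \<Otimes>\<^sub>M borel)" for x :: 'a
    unfolding mehler_kernel_def by measurable
  have k: "frac_kernel s x y = (\<integral>\<^sup>+t. w t * ennreal (mehler_kernel t x y) \<partial>lborel)" for x y :: 'a
    unfolding frac_kernel_def w_def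
    by (intro nn_integral_cong) (simp add: ennreal_mult[symmetric] mpos mult_ac indicator_def)
  have "(\<integral>\<^sup>+x\<in>A. (\<integral>\<^sup>+y\<in>B. frac_kernel s x y \<partial>std_gauss) \<partial>std_gauss)
     = (\<integral>\<^sup>+x. indicator A x * (\<integral>\<^sup>+y. (\<integral>\<^sup>+t. w t * (ennreal (mehler_kernel t x y) * indicator B y) \<partial>lborel) \<partial>std_gauss) \<partial>std_gauss)"
  proof (intro nn_integral_cong)
    fix x :: 'a
    have "(\<integral>\<^sup>+t. w t * (ennreal (mehler_kernel t x y) * indicator B y) \<partial>lborel) = frac_kernel s x y * indicator B y" for y
      unfolding k by (subst nn_integral_multc[symmetric]) (auto simp: mult.assoc)
    then show "(\<integral>\<^sup>+y\<in>B. frac_kernel s x y \<partial>std_gauss) * indicator A x =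
      indicator A x * (\<integral>\<^sup>+y. (\<integral>\<^sup>+t. w t * (ennreal (mehler_kernel t x y) * indicator B y) \<partial>lborel) \<partial>std_gauss)"
      by (simp add: mult.commute)
  qed
  also have "\<dots> = (\<integral>\<^sup>+x. (\<integral>\<^sup>+t. indicator A x * (w t * (\<integral>\<^sup>+z. indicator B (exp (- t) *\<^sub>R x + sqrt (1 - (exp (- t))\<^sup>2) *\<^sub>R z) \<partial>std_gauss)) \<partial>lborel) \<partial>std_gauss)"
  proof (intro nn_integral_cong)
    fix x :: 'a
    interpret pair_sigma_finite lborel "std_gauss :: 'a measure" ..
    have "(\<integral>\<^sup>+y. (\<integral>\<^sup>+t. w t * (ennreal (mehler_kernel t x y) * indicator B y) \<partial>lborel) \<partial>std_gauss) =
      (\<integral>\<^sup>+t. (\<integral>\<^sup>+y. w t * (ennreal (mehler_kernel t x y) * indicator B y) \<partial>std_gauss) \<partial>lborel)"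
      by (rule Fubini') measurable
    also have "\<dots> = (\<integral>\<^sup>+t. w t * (\<integral>\<^sup>+y. (ennreal (mehler_kernel t x y) * indicator B y) \<partial>std_gauss) \<partial>lborel)"
      by (intro nn_integral_cong nn_integral_cmult) measurable
    also have "\<dots> = (\<integral>\<^sup>+t. w t * (\<integral>\<^sup>+z. indicator B (exp (- t) *\<^sub>R x + sqrt (1 - (exp (- t))\<^sup>2) *\<^sub>R z) \<partial>std_gauss) \<partial>lborel)"
      by (intro nn_integral_cong) (auto simp: w_def indicator_def[of "{0<..}"] nn_integral_mehler_kernel)
    finally show "indicator A x * (\<integral>\<^sup>+y. (\<integral>\<^sup>+t. w t * (ennreal (mehler_kernel t x y) * indicator B y) \<partial>lborel) \<partial>std_gauss) =
      (\<integral>\<^sup>+t. indicator A x * (w t * (\<integral>\<^sup>+z. indicator B (exp (- t) *\<^sub>R x + sqrt (1 - (exp (- t))\<^sup>2) *\<^sub>R z) \<partial>std_gauss)) \<partial>lborel)"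
      by (subst nn_integral_cmult) auto
  qed
  also have "\<dots> = (\<integral>\<^sup>+t. (\<integral>\<^sup>+x. w t * (indicator A x * (\<integral>\<^sup>+z. indicator B (exp (- t) *\<^sub>R x + sqrt (1 - (exp (- t))\<^sup>2) *\<^sub>R z) \<partial>std_gauss)) \<partial>std_gauss) \<partial>lborel)"
  proof -
    interpret pair_sigma_finite lborel "std_gauss :: 'a measure" ..
    show ?thesis unfolding mult.left_commute[of "indicator A _" "w _"] by (rule Fubini') measurable
  qed
  also have "\<dots> = (\<integral>\<^sup>+t. w t * gauss_joint (exp (- t)) A B \<partial>lborel)"
    unfolding gauss_joint_eq_nn_integral[OF assms]
    by (intro nn_integral_cong nn_integral_cmult) measurable
  also have "\<dots> = (\<integral>\<^sup>+t\<in>{0<..}. ennreal (1 / t powr (s / 2 + 1)) * gauss_joint (exp (- t)) A B \<partial>lborel)"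
    by (intro nn_integral_cong) (simp add: w_def indicator_def)
  finally show ?thesis .
qed

section \<open>From Lebesgue measurable data to Borel versions\<close>

lemma gauss_measure_eq_density: "gauss_measure = density lebesgue (\<lambda>x. ennreal (gauss_density x))"
  by (simp add: gauss_measure_def gauss_density_def)

lemma borel_measurable_lebesgueI: "f \<in> borel_measurable borel \<Longrightarrow> f \<in> borel_measurable lebesgue"
  by (rule measurable_completion) simp

lemma nn_integral_gauss_measure:
  assumes [measurable]: "f \<in> borel_measurable borel"
  shows "nn_integral gauss_measure f = nn_integral std_gauss f"
proof -
  have "nn_integral gauss_measure f = (\<integral>\<^sup>+x. ennreal (gauss_density x) * f x \<partial>lebesgue)"
    unfolding gauss_measure_eq_density by (rule nn_integral_density) (auto intro!: borel_measurable_lebesgueI)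
  also have "\<dots> = (\<integral>\<^sup>+x. ennreal (gauss_density x) * f x \<partial>lborel)"
    by (rule nn_integral_completion)
  also have "\<dots> = nn_integral std_gauss f"
    unfolding std_gauss_def by (rule nn_integral_density[symmetric]) auto
  finally show ?thesis .
qed

lemma integral_gauss_measure:
  fixes f :: "'a::euclidean_space \<Rightarrow> real"
  assumes [measurable]: "f \<in> borel_measurable borel"
  shows "integral\<^sup>L gauss_measure f = integral\<^sup>L std_gauss f"
proof -
  have "integral\<^sup>L gauss_measure f = (\<integral>x. gauss_density x *\<^sub>R f x \<partial>lebesgue)"
    unfolding gauss_measure_eq_density by (rule integral_density) (auto intro!: borel_measurable_lebesgueI)
  also have "\<dots> = (\<integral>x. gauss_density x *\<^sub>R f x \<partial>lborel)"
    by (rule integral_completion) auto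
  also have "\<dots> = integral\<^sup>L std_gauss f"
    unfolding std_gauss_def by (rule integral_density[symmetric]) auto
  finally show ?thesis .
qed

lemma AE_gauss_measureI:
  assumes "AE x in lebesgue. P x"
  shows "AE x in gauss_measure. P x"
  unfolding gauss_measure_eq_density by (subst AE_density) (use assms in \<open>auto intro!: borel_measurable_lebesgueI\<close>)

lemma lebesgue_set_borel_version:
  fixes E :: "'a::euclidean_space set"
  assumes "E \<in> sets lebesgue"
  obtains E0 where "E0 \<in> sets borel" "AE x in lebesgue. x \<in> E \<longleftrightarrow> x \<in> E0"
proof -
  from assms obtain S N N' where *: "E = S \<union> N" "N \<subseteq> N'" "N' \<in> null_sets lborel" "S \<in> sets lborel"
    by (rule sets_completionE)
  have "AE x in lborel. x \<notin> N'" using *(3) by (rule AE_not_in)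
  then have "AE x in lebesgue. x \<notin> N'" by (rule AE_completion)
  then have "AE x in lebesgue. x \<in> E \<longleftrightarrow> x \<in> S"
    by eventually_elim (use * in auto)
  with *(4) show ?thesis by (intro that) auto
qed

text \<open>The inner set is replaced first: once it is the Borel set B0 and the inner measure is
  \<open>std_gauss\<close>, the inner integral is a Borel function of x, which the change of the
  outer measure requires.\<close>

lemma nn_integral_frac_kernel_gauss_measure:
  fixes A B A0 B0 :: "'a::euclidean_space set"
  assumes [measurable]: "A0 \<in> sets borel" "B0 \<in> sets borel"
    and A: "AE x in lebesgue. x \<in> A \<longleftrightarrow> x \<in> A0" and B: "AE x in lebesgue. x \<in> B \<longleftrightarrow> x \<in> B0"
  shows "(\<integral>\<^sup>+x\<in>A. (\<integral>\<^sup>+y\<in>B. frac_kernel s x y \<partial>gauss_measure) \<partial>gauss_measure) =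
         (\<integral>\<^sup>+t\<in>{0<..}. ennreal (1 / t powr (s / 2 + 1)) * gauss_joint (exp (- t)) A0 B0 \<partial>lborel)"
proof -
  have [measurable]: "(\<lambda>y. frac_kernel s x y) \<in> borel_measurable borel" for x :: 'a
  proof -
    have "(\<lambda>y. (x, y)) \<in> borel \<rightarrow>\<^sub>M borel \<Otimes>\<^sub>M borel" by measurable
    from measurable_compose[OF this borel_measurable_frac_kernel] show ?thesis by simp
  qed
  have "(\<integral>\<^sup>+y\<in>B. frac_kernel s x y \<partial>gauss_measure) = (\<integral>\<^sup>+y\<in>B0. frac_kernel s x y \<partial>std_gauss)" for x :: 'a
  proof -
    have "(\<integral>\<^sup>+y\<in>B. frac_kernel s x y \<partial>gauss_measure) = (\<integral>\<^sup>+y\<in>B0. frac_kernel s x y \<partial>gauss_measure)"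
      using AE_gauss_measureI[OF B] by (intro nn_integral_cong_AE) (auto simp: indicator_def)
    then show ?thesis by (subst (asm) (2) nn_integral_gauss_measure) auto
  qed
  then have "(\<integral>\<^sup>+x\<in>A. (\<integral>\<^sup>+y\<in>B. frac_kernel s x y \<partial>gauss_measure) \<partial>gauss_measure) =
      (\<integral>\<^sup>+x\<in>A. (\<integral>\<^sup>+y\<in>B0. frac_kernel s x y \<partial>std_gauss) \<partial>gauss_measure)" by simp
  also have "\<dots> = (\<integral>\<^sup>+x\<in>A0. (\<integral>\<^sup>+y\<in>B0. frac_kernel s x y \<partial>std_gauss) \<partial>gauss_measure)"
    using AE_gauss_measureI[OF A] by (intro nn_integral_cong_AE) (auto simp: indicator_def)
  also have "\<dots> = (\<integral>\<^sup>+x\<in>A0. (\<integral>\<^sup>+y\<in>B0. frac_kernel s x y \<partial>std_gauss) \<partial>std_gauss)"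
  proof (rule nn_integral_gauss_measure)
    have "(\<lambda>x. \<integral>\<^sup>+y. frac_kernel s (fst (x, y)) (snd (x, y)) * indicator B0 (snd (x, y)) \<partial>std_gauss) \<in> borel_measurable borel"
      by (rule std_gauss.borel_measurable_nn_integral_fst) measurable
    then show "(\<lambda>x. (\<integral>\<^sup>+y\<in>B0. frac_kernel s x y \<partial>std_gauss) * indicator A0 x) \<in> borel_measurable borel"
      by simp
  qed
  also have "\<dots> = (\<integral>\<^sup>+t\<in>{0<..}. ennreal (1 / t powr (s / 2 + 1)) * gauss_joint (exp (- t)) A0 B0 \<partial>lborel)"
    by (rule nn_integral_frac_kernel_std_gauss) fact+
  finally show ?thesis .
qed

lemma frac_perimeter_local_eq:
  fixes E E0 \<Omega> :: "'a::euclidean_space set"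
  assumes [measurable]: "E0 \<in> sets borel" "\<Omega> \<in> sets borel"
    and E: "AE x in lebesgue. x \<in> E \<longleftrightarrow> x \<in> E0"
  shows "frac_perimeter_local s E \<Omega> =
    (\<integral>\<^sup>+t\<in>{0<..}. ennreal (1 / t powr (s / 2 + 1)) * gauss_joint (exp (- t)) (E0 \<inter> \<Omega>) (- E0 \<inter> \<Omega>) \<partial>lborel)"
  unfolding frac_perimeter_local_def
  by (rule nn_integral_frac_kernel_gauss_measure) (use E in auto)

text \<open>The disjunction packs the local part and both nonlocal parts into one event; the only
  crossings left out start and end outside \<Omega>.\<close>

definition gauss_crossing :: "real \<Rightarrow> 'a::euclidean_space set \<Rightarrow> 'a set \<Rightarrow> ennreal" where
  "gauss_crossing c E \<Omega> = emeasure gauss2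
     {p. fst p \<in> E \<and> c *\<^sub>R fst p + sqrt (1 - c\<^sup>2) *\<^sub>R snd p \<notin> E \<and>
         (fst p \<in> \<Omega> \<or> c *\<^sub>R fst p + sqrt (1 - c\<^sup>2) *\<^sub>R snd p \<in> \<Omega>)}"

lemma borel_measurable_gauss_joint_exp [measurable]:
  fixes A B :: "'a::euclidean_space set"
  assumes [measurable]: "A \<in> sets borel" "B \<in> sets borel"
  shows "(\<lambda>t. gauss_joint (exp (- t)) A B) \<in> borel_measurable borel"
proof -
  have "(\<lambda>t. \<integral>\<^sup>+x. indicator A x * (\<integral>\<^sup>+z. indicator B (exp (- t) *\<^sub>R x + sqrt (1 - (exp (- t))\<^sup>2) *\<^sub>R z) \<partial>std_gauss) \<partial>std_gauss) \<in> borel_measurable borel"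
    by measurable
  then show ?thesis by (simp add: gauss_joint_eq_nn_integral)
qed

lemma frac_perimeter_eq:
  fixes E E0 \<Omega> :: "'a::euclidean_space set"
  assumes [measurable]: "E0 \<in> sets borel" "\<Omega> \<in> sets borel"
    and E: "AE x in lebesgue. x \<in> E \<longleftrightarrow> x \<in> E0"
  shows "frac_perimeter s E \<Omega> =
    (\<integral>\<^sup>+t\<in>{0<..}. ennreal (1 / t powr (s / 2 + 1)) * gauss_crossing (exp (- t)) E0 \<Omega> \<partial>lborel)"
proof -
  let ?w = "\<lambda>t::real. ennreal (1 / t powr (s / 2 + 1))"
  have 1: "(\<integral>\<^sup>+x\<in>E \<inter> \<Omega>. (\<integral>\<^sup>+y\<in>- E \<inter> - \<Omega>. frac_kernel s x y \<partial>gauss_measure) \<partial>gauss_measure)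
     = (\<integral>\<^sup>+t\<in>{0<..}. ?w t * gauss_joint (exp (- t)) (E0 \<inter> \<Omega>) (- E0 \<inter> - \<Omega>) \<partial>lborel)"
    by (rule nn_integral_frac_kernel_gauss_measure) (use E in auto)
  have 2: "(\<integral>\<^sup>+x\<in>E \<inter> - \<Omega>. (\<integral>\<^sup>+y\<in>- E \<inter> \<Omega>. frac_kernel s x y \<partial>gauss_measure) \<partial>gauss_measure)
     = (\<integral>\<^sup>+t\<in>{0<..}. ?w t * gauss_joint (exp (- t)) (E0 \<inter> - \<Omega>) (- E0 \<inter> \<Omega>) \<partial>lborel)"
    by (rule nn_integral_frac_kernel_gauss_measure) (use E in auto)
  have c: "gauss_crossing c E0 \<Omega> = gauss_joint c (E0 \<inter> \<Omega>) (- E0 \<inter> \<Omega>) +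
     (gauss_joint c (E0 \<inter> \<Omega>) (- E0 \<inter> - \<Omega>) + gauss_joint c (E0 \<inter> - \<Omega>) (- E0 \<inter> \<Omega>))" for c
  proof -
    let ?Y = "\<lambda>p. c *\<^sub>R fst p + sqrt (1 - c\<^sup>2) *\<^sub>R snd p"
    let ?S = "\<lambda>A B. {p. fst p \<in> A \<and> ?Y p \<in> B}"
    have m: "?S A B \<in> sets gauss2" if "A \<in> sets borel" "B \<in> sets borel" for A B :: "'a set"
      using gauss_joint_measurable_set[OF that] by (simp add: sets_gauss2)
    have m1: "?S (E0 \<inter> \<Omega>) (- E0 \<inter> \<Omega>) \<in> sets gauss2" by (intro m) auto
    have m2: "?S (E0 \<inter> \<Omega>) (- E0 \<inter> - \<Omega>) \<in> sets gauss2" by (intro m) auto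
    have m3: "?S (E0 \<inter> - \<Omega>) (- E0 \<inter> \<Omega>) \<in> sets gauss2" by (intro m) auto
    have "gauss_crossing c E0 \<Omega> = emeasure gauss2 (?S (E0 \<inter> \<Omega>) (- E0 \<inter> \<Omega>) \<union>
       (?S (E0 \<inter> \<Omega>) (- E0 \<inter> - \<Omega>) \<union> ?S (E0 \<inter> - \<Omega>) (- E0 \<inter> \<Omega>)))"
      unfolding gauss_crossing_def by (intro arg_cong[where f="emeasure gauss2"]) auto
    also have "\<dots> = emeasure gauss2 (?S (E0 \<inter> \<Omega>) (- E0 \<inter> \<Omega>)) +
       emeasure gauss2 (?S (E0 \<inter> \<Omega>) (- E0 \<inter> - \<Omega>) \<union> ?S (E0 \<inter> - \<Omega>) (- E0 \<inter> \<Omega>))"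
      by (intro plus_emeasure[symmetric] m1 sets.Un[OF m2 m3]) auto
    also have "emeasure gauss2 (?S (E0 \<inter> \<Omega>) (- E0 \<inter> - \<Omega>) \<union> ?S (E0 \<inter> - \<Omega>) (- E0 \<inter> \<Omega>)) =
       emeasure gauss2 (?S (E0 \<inter> \<Omega>) (- E0 \<inter> - \<Omega>)) + emeasure gauss2 (?S (E0 \<inter> - \<Omega>) (- E0 \<inter> \<Omega>))"
      by (intro plus_emeasure[symmetric] m2 m3) auto
    finally show ?thesis unfolding gauss_joint_def .
  qed
  show ?thesis
    unfolding frac_perimeter_def frac_perimeter_nonlocal_def 1 2 frac_perimeter_local_eq[OF assms] c
    by (subst nn_integral_add[symmetric], measurable)+
       (auto simp: algebra_simps indicator_def intro!: nn_integral_cong)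
qed

lemma C_k_1_continuous_divergence:
  fixes \<phi> :: "'a::euclidean_space \<Rightarrow> 'a"
  assumes "C_k (Suc 0) \<phi>"
  shows "continuous_on UNIV (divergence \<phi>)"
  using assms unfolding divergence_def by (auto intro!: continuous_intros)

lemma C_k_1_continuous:
  assumes "C_k (Suc 0) f"
  shows "continuous_on UNIV f"
  using assms by (auto intro!: differentiable_imp_continuous_on simp: differentiable_on_def differentiable_at_withinI)

text \<open>The perimeter without its factor sqrt (2 * pi), written with the Borel measure so that a
  Borel version of the set can be inserted.\<close>

definition field_sup :: "'a::euclidean_space set \<Rightarrow> 'a set \<Rightarrow> ennreal" where
  "field_sup E \<Omega> = (SUP \<phi> \<in> test_fields \<Omega>.
     ennreal (\<integral>x. indicator E x * (divergence \<phi> x - \<phi> x \<bullet> x) \<partial>std_gauss))"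

lemma gauss_perimeter_eq:
  fixes E E0 \<Omega> :: "'a::euclidean_space set"
  assumes [measurable]: "E0 \<in> sets borel" "E \<in> sets lebesgue"
    and E: "AE x in lebesgue. x \<in> E \<longleftrightarrow> x \<in> E0"
  shows "gauss_perimeter E \<Omega> = ennreal (sqrt (2 * pi)) * field_sup E0 \<Omega>"
proof -
  have "(LINT x:E|gauss_measure. divergence \<phi> x - \<phi> x \<bullet> x) =
     (\<integral>x. indicator E0 x * (divergence \<phi> x - \<phi> x \<bullet> x) \<partial>std_gauss)" if "\<phi> \<in> test_fields \<Omega>" for \<phi>
  proof -
    have C: "C_k (Suc 0) \<phi>" using that unfolding test_fields_def by blast
    have [measurable]: "divergence \<phi> \<in> borel_measurable borel" "\<phi> \<in> borel_measurable borel"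
      using C_k_1_continuous_divergence[OF C] C_k_1_continuous[OF C]
      by (auto intro: borel_measurable_continuous_onI)
    have s: "sets (gauss_measure :: 'a measure) = sets lebesgue" by (simp add: gauss_measure_eq_density)
    have [measurable]: "f \<in> borel_measurable gauss_measure" if "f \<in> borel_measurable borel" for f :: "'a \<Rightarrow> real"
      using that by (simp add: gauss_measure_eq_density borel_measurable_lebesgueI)
    have [measurable]: "E \<in> sets gauss_measure" by (simp add: s)
    have "(LINT x:E|gauss_measure. divergence \<phi> x - \<phi> x \<bullet> x) = (LINT x|gauss_measure. indicator E0 x * (divergence \<phi> x - \<phi> x \<bullet> x))"
      unfolding set_lebesgue_integral_def
      using AE_gauss_measureI[OF E] by (intro integral_cong_AE) (auto simp: indicator_def)
    also have "\<dots> = (\<integral>x. indicator E0 x * (divergence \<phi> x - \<phi> x \<bullet> x) \<partial>std_gauss)"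
      by (rule integral_gauss_measure) measurable
    finally show ?thesis .
  qed
  then show ?thesis unfolding gauss_perimeter_def field_sup_def by simp
qed

lemma nn_integral_abs_indicator_diff:
  fixes A B A0 B0 K :: "'a::euclidean_space set"
  assumes [measurable]: "A0 \<in> sets borel" "B0 \<in> sets borel" "K \<in> sets borel"
    and A: "AE x in lebesgue. x \<in> A \<longleftrightarrow> x \<in> A0" and B: "AE x in lebesgue. x \<in> B \<longleftrightarrow> x \<in> B0"
  shows "(\<integral>\<^sup>+x\<in>K. ennreal \<bar>indicator A x - indicator B x\<bar> \<partial>lebesgue) =
    emeasure lborel (((A0 - B0) \<union> (B0 - A0)) \<inter> K)"
proof -
  have "(\<integral>\<^sup>+x\<in>K. ennreal \<bar>indicator A x - indicator B x\<bar> \<partial>lebesgue) =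
    (\<integral>\<^sup>+x. indicator (((A0 - B0) \<union> (B0 - A0)) \<inter> K) x \<partial>lebesgue)"
    using A B by (intro nn_integral_cong_AE) (auto simp: indicator_def)
  also have "\<dots> = (\<integral>\<^sup>+x. indicator (((A0 - B0) \<union> (B0 - A0)) \<inter> K) x \<partial>lborel)"
    by (rule nn_integral_completion)
  finally show ?thesis by simp
qed

section \<open>Local convergence in L1 and convergence in Gaussian measure\<close>

lemma gauss_tail_small:
  fixes \<epsilon> :: real
  assumes "\<epsilon> > 0"
  obtains R where "R > 0" "measure (std_gauss :: 'a::euclidean_space measure) (- cball 0 R) < \<epsilon>"
proof -
  have "(\<lambda>n. measure (std_gauss :: 'a measure) (- cball 0 (real n))) \<longlonglongrightarrow> measure (std_gauss :: 'a measure) (\<Inter>n. - cball 0 (real n))"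
    by (intro std_gauss.finite_Lim_measure_decseq) (auto simp: decseq_def)
  moreover have "(\<Inter>n. - cball (0::'a) (real n)) = {}"
    by (auto simp: not_le) (meson not_less real_arch_simple)
  ultimately have "(\<lambda>n. measure (std_gauss :: 'a measure) (- cball 0 (real n))) \<longlonglongrightarrow> 0" by simp
  then have "eventually (\<lambda>n. measure (std_gauss :: 'a measure) (- cball 0 (real n)) < \<epsilon>) sequentially"
    using assms by (rule order_tendstoD)
  then have "eventually (\<lambda>n. measure (std_gauss :: 'a measure) (- cball 0 (real n)) < \<epsilon> \<and> n > 0) sequentially"
    using eventually_gt_at_top by (rule eventually_conj)
  then obtain n where "measure (std_gauss :: 'a measure) (- cball 0 (real n)) < \<epsilon>" "n > 0"
    by (auto simp: eventually_sequentially)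
  then show ?thesis by (intro that[of "real n"]) auto
qed

lemma gauss_density_ge:
  fixes x :: "'a::euclidean_space"
  assumes "norm x \<le> R"
  shows "gauss_density x \<ge> (2 * pi) powr (- (real DIM('a) / 2)) * exp (- R\<^sup>2 / 2)"
  using assms unfolding gauss_density_def by (intro mult_left_mono) (auto intro: power_mono)

lemma gauss_density_le:
  fixes x :: "'a::euclidean_space"
  shows "gauss_density x \<le> (2 * pi) powr (- (real DIM('a) / 2))"
  unfolding gauss_density_def by (simp add: mult_le_cancel_left1)

text \<open>Outside a large ball the Gaussian mass is small whatever the sets are; inside, the
  density is bounded above by a constant.\<close>

lemma L1_loc_tendsto_imp_gauss:
  fixes F F0 :: "nat \<Rightarrow> 'a::euclidean_space set" and E E0 :: "'a set"
  assumes F0: "\<And>n. F0 n \<in> sets borel" "\<And>n. AE x in lebesgue. x \<in> F n \<longleftrightarrow> x \<in> F0 n"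
    and E0: "E0 \<in> sets borel" "AE x in lebesgue. x \<in> E \<longleftrightarrow> x \<in> E0"
    and lim: "L1_loc_tendsto (\<lambda>n. indicator (F n)) (indicator E)"
  shows "(\<lambda>n. measure std_gauss ((F0 n - E0) \<union> (E0 - F0 n))) \<longlonglongrightarrow> 0"
proof (rule LIMSEQ_I)
  fix r :: real assume r: "r > 0"
  note [measurable] = F0(1) E0(1)
  obtain R where R: "R > 0" "measure (std_gauss :: 'a measure) (- cball 0 R) < r / 2"
    using gauss_tail_small[of "r/2"] r by auto
  define C where "C = (2 * pi) powr (- (real DIM('a) / 2))"
  have C: "C > 0" by (simp add: C_def)
  let ?D = "\<lambda>n. ((F0 n - E0) \<union> (E0 - F0 n))"
  have "(\<integral>\<^sup>+x\<in>cball 0 R. ennreal \<bar>indicator (F n) x - indicator E x\<bar> \<partial>lebesgue) = emeasure lborel (?D n \<inter> cball 0 R)" for n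
    by (rule nn_integral_abs_indicator_diff[OF F0(1) E0(1) _ F0(2) E0(2)]) auto
  moreover have "(\<lambda>n. \<integral>\<^sup>+x\<in>cball 0 R. ennreal \<bar>indicator (F n) x - indicator E x\<bar> \<partial>lebesgue) \<longlonglongrightarrow> 0"
    using lim compact_cball[of "0::'a" R] unfolding L1_loc_tendsto_def by blast
  ultimately have "(\<lambda>n. emeasure lborel (?D n \<inter> cball 0 R)) \<longlonglongrightarrow> 0"
    by (simp only:)
  then have "eventually (\<lambda>n. emeasure lborel (?D n \<inter> cball 0 R) < ennreal (r / (2 * C))) sequentially"
    by (rule order_tendstoD) (use r C in auto)
  then obtain N where N: "\<And>n. n \<ge> N \<Longrightarrow> emeasure lborel (?D n \<inter> cball 0 R) < ennreal (r / (2 * C))"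
    by (auto simp: eventually_sequentially)
  show "\<exists>no. \<forall>n\<ge>no. norm (measure std_gauss (?D n) - 0) < r"
  proof (intro exI allI impI)
    fix n assume n: "n \<ge> N"
    have "emeasure std_gauss (?D n \<inter> cball 0 R) = (\<integral>\<^sup>+x. ennreal (gauss_density x) * indicator (?D n \<inter> cball 0 R) x \<partial>lborel)"
      unfolding std_gauss_def by (rule emeasure_density) auto
    also have "\<dots> \<le> (\<integral>\<^sup>+x. ennreal C * indicator (?D n \<inter> cball 0 R) x \<partial>lborel)"
      unfolding C_def by (intro nn_integral_mono mult_right_mono ennreal_leI gauss_density_le) auto
    also have "\<dots> = ennreal C * emeasure lborel (?D n \<inter> cball 0 R)"
      by (rule nn_integral_cmult_indicator) auto
    also have "\<dots> < ennreal C * ennreal (r / (2 * C))"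
      by (rule ennreal_mult_strict_left_mono[OF N[OF n]]) (use C in auto)
    also have "\<dots> = ennreal (r / 2)" using C r by (simp add: ennreal_mult[symmetric])
    finally have "measure std_gauss (?D n \<inter> cball 0 R) < r / 2"
      using r by (simp add: std_gauss.emeasure_eq_measure ennreal_less_iff)
    moreover have "measure std_gauss (?D n) \<le> measure std_gauss (?D n \<inter> cball 0 R) + measure std_gauss (- cball (0::'a) R)"
    proof -
      have "measure std_gauss (?D n) \<le> measure std_gauss ((?D n \<inter> cball 0 R) \<union> (- cball (0::'a) R))"
        by (intro std_gauss.finite_measure_mono) auto
      also have "\<dots> \<le> measure std_gauss (?D n \<inter> cball 0 R) + measure std_gauss (- cball (0::'a) R)"
        by (intro measure_Un_le) auto
      finally show ?thesis .
    qed
    ultimately show "norm (measure std_gauss (?D n) - 0) < r" using R(2) by simp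
  qed
qed

text \<open>On a compact set the density is bounded below by m > 0, so Lebesgue measure there is at
  most 1 / m times the Gaussian one.\<close>

lemma gauss_imp_L1_loc_tendsto:
  fixes F :: "nat \<Rightarrow> 'a::euclidean_space set" and E E0 :: "'a set"
  assumes F: "\<And>n. F n \<in> sets borel"
    and E0: "E0 \<in> sets borel" "AE x in lebesgue. x \<in> E \<longleftrightarrow> x \<in> E0"
    and lim: "(\<lambda>n. measure std_gauss ((F n - E0) \<union> (E0 - F n))) \<longlonglongrightarrow> 0"
  shows "L1_loc_tendsto (\<lambda>n. indicator (F n)) (indicator E)"
  unfolding L1_loc_tendsto_def
proof (intro allI impI)
  fix K :: "'a set" assume K: "compact K"
  note [measurable] = F E0(1)
  have [measurable]: "K \<in> sets borel" using K by (simp add: compact_imp_closed)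
  obtain R where R: "K \<subseteq> cball 0 R"
    using compact_imp_bounded[OF K] unfolding bounded_iff by (auto simp: subset_iff)
  define m where "m = (2 * pi) powr (- (real DIM('a) / 2)) * exp (- R\<^sup>2 / 2)"
  have m: "m > 0" by (simp add: m_def)
  let ?D = "\<lambda>n. ((F n - E0) \<union> (E0 - F n))"
  have e: "(\<integral>\<^sup>+x\<in>K. ennreal \<bar>indicator (F n) x - indicator E x\<bar> \<partial>lebesgue) = emeasure lborel (?D n \<inter> K)" for n
    by (rule nn_integral_abs_indicator_diff[OF F E0(1) _ _ E0(2)]) auto
  have b: "emeasure lborel (?D n \<inter> K) \<le> ennreal (measure std_gauss (?D n) / m)" for n
  proof -
    have "ennreal m * emeasure lborel (?D n \<inter> K) = (\<integral>\<^sup>+x. ennreal m * indicator (?D n \<inter> K) x \<partial>lborel)"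
      by (rule nn_integral_cmult_indicator[symmetric]) auto
    also have "\<dots> \<le> (\<integral>\<^sup>+x. ennreal (gauss_density x) * indicator (?D n) x \<partial>lborel)"
    proof (intro nn_integral_mono)
      fix x :: 'a
      show "ennreal m * indicator (?D n \<inter> K) x \<le> ennreal (gauss_density x) * indicator (?D n) x"
      proof (cases "x \<in> ?D n \<inter> K")
        case True
        then have "norm x \<le> R" using R by auto
        then have "m \<le> gauss_density x" unfolding m_def by (rule gauss_density_ge)
        then show ?thesis using True by (simp add: ennreal_leI)
      qed simp
    qed
    also have "\<dots> = emeasure std_gauss (?D n)"
      unfolding std_gauss_def by (rule emeasure_density[symmetric]) auto
    finally have "ennreal m * emeasure lborel (?D n \<inter> K) \<le> ennreal (measure std_gauss (?D n))"
      by (simp add: std_gauss.emeasure_eq_measure)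
    then have "ennreal (1 / m) * (ennreal m * emeasure lborel (?D n \<inter> K)) \<le> ennreal (1 / m) * ennreal (measure std_gauss (?D n))"
      by (rule mult_left_mono) simp
    then show ?thesis using m by (simp add: mult.assoc[symmetric] ennreal_mult[symmetric])
  qed
  have "(\<lambda>n. ennreal (measure std_gauss (?D n) / m)) \<longlonglongrightarrow> ennreal (0 / m)"
    by (intro tendsto_intros lim) (use m in auto)
  then have "(\<lambda>n. ennreal (measure std_gauss (?D n) / m)) \<longlonglongrightarrow> 0" by simp
  then show "(\<lambda>n. \<integral>\<^sup>+x\<in>K. ennreal \<bar>indicator (F n) x - indicator E x\<bar> \<partial>lebesgue) \<longlonglongrightarrow> 0"
    unfolding e by (rule tendsto_sandwich[OF _ _ tendsto_const, rotated 2]) (use b in auto)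
qed

section \<open>Gaussian moments against a Gaussian weight\<close>

lemma gauss_density_real: "gauss_density (x::real) = std_normal_density x"
  by (simp add: gauss_density_eq_prod)

lemma std_gauss_pair_eq:
  "(std_gauss :: ('a::euclidean_space \<times> 'b::euclidean_space) measure) = std_gauss \<Otimes>\<^sub>M std_gauss"
proof -
  have "gauss_density p = gauss_density (fst p) * gauss_density (snd p)" for p :: "'a \<times> 'b"
  proof -
    have "(2 * pi) powr (- (real DIM('a \<times> 'b) / 2)) = (2 * pi) powr (- (real DIM('a) / 2)) * (2 * pi) powr (- (real DIM('b) / 2))"
      by (simp add: powr_add[symmetric] add_divide_distrib)
    moreover have "exp (- (norm p)\<^sup>2 / 2) = exp (- (norm (fst p))\<^sup>2 / 2) * exp (- (norm (snd p))\<^sup>2 / 2)"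
      unfolding exp_add[symmetric] by (cases p) (simp add: norm_Pair field_simps)
    ultimately show ?thesis by (simp add: gauss_density_def)
  qed
  then have "(std_gauss :: ('a \<times> 'b) measure) =
     density (lborel \<Otimes>\<^sub>M lborel) (\<lambda>p. ennreal (gauss_density (fst p)) * ennreal (gauss_density (snd p)))"
    by (simp add: std_gauss_def lborel_prod ennreal_mult)
  also have "\<dots> = (std_gauss :: 'a measure) \<Otimes>\<^sub>M (std_gauss :: 'b measure)"
    unfolding std_gauss_def
    by (subst pair_measure_density)
       (auto simp: case_prod_beta' std_gauss_def[symmetric] intro: prob_space_imp_sigma_finite prob_space_std_gauss lborel.sigma_finite_measure_axioms)
  finally show ?thesis .
qed

text \<open>An auxiliary real coordinate: w \<bullet> z + r is the inner product of (w, 1) with the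
  Gaussian vector (z, r), and (w, 1) has norm sqrt (1 + |w|^2).\<close>

lemma integral_std_gauss_abs_inner_add:
  fixes w :: "'a::euclidean_space"
  shows "integrable (std_gauss \<Otimes>\<^sub>M (std_gauss :: real measure)) (\<lambda>(z, r). \<bar>w \<bullet> z + r\<bar>)"
    and "(\<integral>z. (\<integral>r. \<bar>w \<bullet> z + r\<bar> \<partial>(std_gauss :: real measure)) \<partial>std_gauss) = sqrt (2 / pi) * sqrt (1 + (norm w)\<^sup>2)"
proof -
  have b: "has_bochner_integral (std_gauss \<Otimes>\<^sub>M (std_gauss :: real measure)) (\<lambda>p. \<bar>(w, 1) \<bullet> p\<bar>) (sqrt (2 / pi) * norm (w, 1::real))"
    using has_bochner_integral_std_gauss_abs_inner[of "(w, 1::real)"] unfolding std_gauss_pair_eq .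
  have e: "(\<lambda>p. \<bar>(w, 1::real) \<bullet> p\<bar>) = (\<lambda>(z, r). \<bar>w \<bullet> z + r\<bar>)" by (auto simp: inner_prod_def)
  show i: "integrable (std_gauss \<Otimes>\<^sub>M (std_gauss :: real measure)) (\<lambda>(z, r). \<bar>w \<bullet> z + r\<bar>)"
    using b unfolding e by (rule integrable.intros)
  have "(\<integral>z. (\<integral>r. \<bar>w \<bullet> z + r\<bar> \<partial>(std_gauss :: real measure)) \<partial>std_gauss) = sqrt (2 / pi) * norm (w, 1::real)"
    using std_gauss_pair.integral_fst[OF i] b unfolding e by (simp add: has_bochner_integral_iff)
  then show "(\<integral>z. (\<integral>r. \<bar>w \<bullet> z + r\<bar> \<partial>(std_gauss :: real measure)) \<partial>std_gauss) = sqrt (2 / pi) * sqrt (1 + (norm w)\<^sup>2)"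
    by (simp add: norm_Pair add.commute)
qed

text \<open>The absolute value mollified by the standard normal law. Its derivative is the smooth
  sign function of \<open>gauss_sign_exists\<close>.\<close>

definition abs_mean :: "real \<Rightarrow> real" where
  "abs_mean u = (\<integral>r. \<bar>u + r\<bar> \<partial>(std_gauss :: real measure))"

lemma integrable_abs_add: "integrable (std_gauss :: real measure) (\<lambda>r. \<bar>u + r\<bar>)"
proof (rule Bochner_Integration.integrable_bound)
  show "integrable (std_gauss :: real measure) (\<lambda>r. \<bar>u\<bar> + norm r)"
    by (intro Bochner_Integration.integrable_add std_gauss.integrable_const integrable_std_gauss_norm)
qed auto

lemma abs_second_difference:
  "\<bar>b + a\<bar> + \<bar>b - a\<bar> - 2 * \<bar>b\<bar> = 2 * max 0 (\<bar>a\<bar> - \<bar>b\<bar> :: real)"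
  by (auto simp: abs_if max_def)

text \<open>The second difference of the absolute value is a tent of half-width |a|; rescaling its
  variable by |a| takes out the factor a^2 exactly, so the quotient is an average of the density
  over a shrinking window.\<close>

lemma abs_mean_second_difference:
  "abs_mean (u + a) + abs_mean (u - a) - 2 * abs_mean u =
     a\<^sup>2 * (\<integral>v. std_normal_density (\<bar>a\<bar> * v - u) * (2 * max 0 (1 - \<bar>v\<bar>)) \<partial>lborel)"
proof (cases "a = 0")
  case False
  have "abs_mean (u + a) + abs_mean (u - a) - 2 * abs_mean u =
     (\<integral>r. \<bar>u + a + r\<bar> + \<bar>u - a + r\<bar> - 2 * \<bar>u + r\<bar> \<partial>(std_gauss :: real measure))"
    unfolding abs_mean_def by (simp add: integrable_abs_add)
  also have "\<dots> = (\<integral>r. 2 * max 0 (\<bar>a\<bar> - \<bar>u + r\<bar>) \<partial>(std_gauss :: real measure))"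
    using abs_second_difference[of "u + _" a] by (intro Bochner_Integration.integral_cong refl) (simp add: algebra_simps)
  also have "\<dots> = (\<integral>r. std_normal_density r * (2 * max 0 (\<bar>a\<bar> - \<bar>u + r\<bar>)) \<partial>lborel)"
    unfolding std_gauss_def gauss_density_real by (subst integral_density) auto
  also have "\<dots> = \<bar>a\<bar> * (\<integral>v. std_normal_density (- u + \<bar>a\<bar> * v) * (2 * max 0 (\<bar>a\<bar> - \<bar>u + (- u + \<bar>a\<bar> * v)\<bar>)) \<partial>lborel)"
    using lborel_integral_real_affine[of "\<bar>a\<bar>" "\<lambda>r. std_normal_density r * (2 * max 0 (\<bar>a\<bar> - \<bar>u + r\<bar>))" "- u"] False by simp
  also have "\<dots> = \<bar>a\<bar> * (\<integral>v. \<bar>a\<bar> * (std_normal_density (\<bar>a\<bar> * v - u) * (2 * max 0 (1 - \<bar>v\<bar>))) \<partial>lborel)"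
  proof -
    have "max 0 (\<bar>a\<bar> - \<bar>u + (- u + \<bar>a\<bar> * v)\<bar>) = \<bar>a\<bar> * max 0 (1 - \<bar>v\<bar>)" for v
      using False by (auto simp: max_def abs_mult algebra_simps) 
    then show ?thesis by (simp add: mult_ac)
  qed
  also have "\<dots> = a\<^sup>2 * (\<integral>v. std_normal_density (\<bar>a\<bar> * v - u) * (2 * max 0 (1 - \<bar>v\<bar>)) \<partial>lborel)"
    by (simp add: power2_eq_square)
  finally show ?thesis .
qed simp

lemma std_normal_density_le_half: "2 * std_normal_density x \<le> 1"
proof -
  have "sqrt (2 * pi) \<ge> sqrt 4" using pi_gt3 by (intro real_sqrt_le_mono) simp
  then have 1: "sqrt (2 * pi) \<ge> 2" by simp
  have "std_normal_density x \<le> 1 / sqrt (2 * pi) * 1"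
    unfolding std_normal_density_def by (intro mult_left_mono) auto
  also have "\<dots> \<le> 1 / 2" using 1 by (simp add: field_simps)
  finally show ?thesis by simp
qed

lemma integral_tent: "has_bochner_integral lborel (\<lambda>v. 2 * max 0 (1 - \<bar>v\<bar>)) (2::real)"
proof -
  have "has_bochner_integral lborel (\<lambda>v. (2 - 2 * v) * indicator {0..1} v) ((2 * 1 - 1\<^sup>2) - (2 * 0 - 0\<^sup>2 :: real))"
    by (rule has_bochner_integral_FTC_Icc_real[where F="\<lambda>v. 2 * v - v\<^sup>2"])
       (auto intro!: derivative_eq_intros continuous_intros)
  moreover have "has_bochner_integral lborel (\<lambda>v. (2 + 2 * v) * indicator {-1..0} v) ((2 * 0 + 0\<^sup>2) - (2 * (-1) + (-1)\<^sup>2 :: real))"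
    by (rule has_bochner_integral_FTC_Icc_real[where F="\<lambda>v. 2 * v + v\<^sup>2"])
       (auto intro!: derivative_eq_intros continuous_intros)
  ultimately have "has_bochner_integral lborel (\<lambda>v. (2 - 2 * v) * indicator {0..1} v + (2 + 2 * v) * indicator {-1..0} v) (1 + 1::real)"
    by (intro has_bochner_integral_add) simp_all
  moreover have "AE v in lborel. (2 - 2 * v) * indicator {0..1} v + (2 + 2 * v) * indicator {-1..0} v = 2 * max 0 (1 - \<bar>v :: real\<bar>)"
    using AE_lborel_singleton[of "0::real"] by eventually_elim (auto simp: indicator_def max_def abs_if)
  ultimately show ?thesis
    by (subst has_bochner_integral_cong_AE[symmetric]) auto
qed

text \<open>The tent has mass 2 and the density is at most 1/2. The resulting bound a^2 is the
  integrable majorant for the limit of second differences.\<close>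

lemma abs_mean_second_difference_bounds:
  "0 \<le> abs_mean (u + a) + abs_mean (u - a) - 2 * abs_mean u"
  "abs_mean (u + a) + abs_mean (u - a) - 2 * abs_mean u \<le> a\<^sup>2"
proof -
  let ?I = "\<integral>v. std_normal_density (\<bar>a\<bar> * v - u) * (2 * max 0 (1 - \<bar>v\<bar>)) \<partial>lborel"
  have i: "integrable lborel (\<lambda>v. 2 * max 0 (1 - \<bar>v\<bar>) :: real)" and i2: "(\<integral>v. 2 * max 0 (1 - \<bar>v\<bar>) \<partial>lborel) = (2::real)"
    using integral_tent by (auto simp: has_bochner_integral_iff)
  have "0 \<le> ?I" by (intro integral_nonneg_AE AE_I2) auto
  then show "0 \<le> abs_mean (u + a) + abs_mean (u - a) - 2 * abs_mean u"
    unfolding abs_mean_second_difference by simp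
  have b: "std_normal_density y \<le> 1 / 2" for y using std_normal_density_le_half[of y] by simp
  have "?I \<le> (\<integral>v. 1 / 2 * (2 * max 0 (1 - \<bar>v\<bar>)) \<partial>lborel)"
  proof (rule integral_mono)
    show "integrable lborel (\<lambda>v. std_normal_density (\<bar>a\<bar> * v - u) * (2 * max 0 (1 - \<bar>v\<bar>)))"
    proof (rule Bochner_Integration.integrable_bound[OF i])
      show "AE v in lborel. norm (std_normal_density (\<bar>a\<bar> * v - u) * (2 * max 0 (1 - \<bar>v\<bar>))) \<le> norm (2 * max 0 (1 - \<bar>v\<bar>))"
        using b order_trans[OF b, of 1] by (auto simp: abs_mult intro!: mult_left_le_one_le)
    qed measurable
    show "integrable lborel (\<lambda>v. 1 / 2 * (2 * max 0 (1 - \<bar>v\<bar>)) :: real)" by (intro integrable_mult_right i)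
    show "std_normal_density (\<bar>a\<bar> * v - u) * (2 * max 0 (1 - \<bar>v\<bar>)) \<le> 1 / 2 * (2 * max 0 (1 - \<bar>v\<bar>))" for v
      by (intro mult_right_mono b) auto
  qed
  also have "\<dots> = 1" using i2 by (subst integral_mult_right_zero) simp
  finally have "?I \<le> 1" .
  then show "abs_mean (u + a) + abs_mean (u - a) - 2 * abs_mean u \<le> a\<^sup>2"
    unfolding abs_mean_second_difference by (simp add: mult_left_le)
qed

lemma abs_mean_second_difference_tendsto:
  fixes h :: "nat \<Rightarrow> real"
  assumes h: "h \<longlonglongrightarrow> 0" "\<And>n. h n > 0"
  shows "(\<lambda>n. (abs_mean (u + h n * a) + abs_mean (u - h n * a) - 2 * abs_mean u) / (h n)\<^sup>2) \<longlonglongrightarrow> 2 * std_normal_density u * a\<^sup>2"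
proof -
  have i: "integrable lborel (\<lambda>v. 2 * max 0 (1 - \<bar>v\<bar>) :: real)" and i2: "(\<integral>v. 2 * max 0 (1 - \<bar>v\<bar>) \<partial>lborel) = (2::real)"
    using integral_tent by (auto simp: has_bochner_integral_iff)
  have b: "std_normal_density y \<le> 1" for y using std_normal_density_le_half[of y] by simp
  have "(\<lambda>n. \<integral>v. std_normal_density (\<bar>h n * a\<bar> * v - u) * (2 * max 0 (1 - \<bar>v\<bar>)) \<partial>lborel)
     \<longlonglongrightarrow> (\<integral>v. std_normal_density u * (2 * max 0 (1 - \<bar>v\<bar>)) \<partial>lborel)"
  proof (rule integral_dominated_convergence[OF _ _ i])
    show "AE v in lborel. (\<lambda>n. std_normal_density (\<bar>h n * a\<bar> * v - u) * (2 * max 0 (1 - \<bar>v\<bar>))) \<longlonglongrightarrow> std_normal_density u * (2 * max 0 (1 - \<bar>v\<bar>))"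
    proof (intro AE_I2 tendsto_mult tendsto_const)
      fix v :: real
      have "(\<lambda>n. \<bar>h n * a\<bar> * v - u) \<longlonglongrightarrow> \<bar>0 * a\<bar> * v - u" by (intro tendsto_intros h)
      moreover have "isCont std_normal_density (\<bar>0 * a\<bar> * v - u)" unfolding std_normal_density_def by (intro continuous_intros) auto
      ultimately have "(\<lambda>n. std_normal_density (\<bar>h n * a\<bar> * v - u)) \<longlonglongrightarrow> std_normal_density (\<bar>0 * a\<bar> * v - u)"
        by (rule isCont_tendsto_compose[rotated])
      then show "(\<lambda>n. std_normal_density (\<bar>h n * a\<bar> * v - u)) \<longlonglongrightarrow> std_normal_density u"
        by (simp add: std_normal_density_def)
    qed
    show "AE v in lborel. norm (std_normal_density (\<bar>h n * a\<bar> * v - u) * (2 * max 0 (1 - \<bar>v\<bar>))) \<le> 2 * max 0 (1 - \<bar>v\<bar>)" for n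
      using b by (auto simp: abs_mult intro!: mult_left_le_one_le)
  qed measurable
  then have "(\<lambda>n. a\<^sup>2 * (\<integral>v. std_normal_density (\<bar>h n * a\<bar> * v - u) * (2 * max 0 (1 - \<bar>v\<bar>)) \<partial>lborel))
     \<longlonglongrightarrow> a\<^sup>2 * (std_normal_density u * 2)"
  proof (intro tendsto_mult tendsto_const)
    have "(\<integral>v. std_normal_density u * (2 * max 0 (1 - \<bar>v\<bar>)) \<partial>lborel) = std_normal_density u * 2"
      by (subst integral_mult_right_zero) (simp only: i2)
    then show "(\<lambda>n. \<integral>v. std_normal_density (\<bar>h n * a\<bar> * v - u) * (2 * max 0 (1 - \<bar>v\<bar>)) \<partial>lborel) \<longlonglongrightarrow> std_normal_density u * 2"
      if "(\<lambda>n. \<integral>v. std_normal_density (\<bar>h n * a\<bar> * v - u) * (2 * max 0 (1 - \<bar>v\<bar>)) \<partial>lborel) \<longlonglongrightarrow> (\<integral>v. std_normal_density u * (2 * max 0 (1 - \<bar>v\<bar>)) \<partial>lborel)"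
      using that by (simp only:)
  qed
  moreover have "(abs_mean (u + h n * a) + abs_mean (u - h n * a) - 2 * abs_mean u) / (h n)\<^sup>2 = a\<^sup>2 * (\<integral>v. std_normal_density (\<bar>h n * a\<bar> * v - u) * (2 * max 0 (1 - \<bar>v\<bar>)) \<partial>lborel)" for n
    unfolding abs_mean_second_difference using h(2)[of n] by (simp add: power_mult_distrib)
  ultimately show ?thesis by (simp add: mult_ac)
qed

text \<open>Rationalizing takes the factor h^2 out of the numerator exactly; after that the limit is
  plain continuity.\<close>

lemma sqrt_second_difference_tendsto:
  fixes h :: "nat \<Rightarrow> real"
  assumes h: "h \<longlonglongrightarrow> 0" "\<And>n. h n > 0" and A: "A > 0"
    and pos: "\<And>n. A + 2 * B * h n + C * (h n)\<^sup>2 > 0" "\<And>n. A - 2 * B * h n + C * (h n)\<^sup>2 > 0"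
  shows "(\<lambda>n. (sqrt (A + 2 * B * h n + C * (h n)\<^sup>2) + sqrt (A - 2 * B * h n + C * (h n)\<^sup>2) - 2 * sqrt A) / (h n)\<^sup>2)
    \<longlonglongrightarrow> (C - B\<^sup>2 / A) / sqrt A"
proof -
  define X where "X n = sqrt (A + 2 * B * h n + C * (h n)\<^sup>2)" for n
  define Y where "Y n = sqrt (A - 2 * B * h n + C * (h n)\<^sup>2)" for n
  define a where "a = sqrt A"
  have a: "a > 0" "A = a\<^sup>2" using A by (auto simp: a_def)
  have X: "X n > 0" "(X n)\<^sup>2 = a\<^sup>2 + 2 * B * h n + C * (h n)\<^sup>2" and Y: "Y n > 0" "(Y n)\<^sup>2 = a\<^sup>2 - 2 * B * h n + C * (h n)\<^sup>2" for n
    using pos[of n] by (auto simp: X_def Y_def a(2))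
  \<comment> \<open>X - a and Y - a are rationalized separately. Their linear terms in h cancel up
    to the difference of 1 / (X + a) and 1 / (Y + a), and rationalizing Y - X supplies the second
    factor h there.\<close>
  have eq: "(X n + Y n - 2 * a) / (h n)\<^sup>2 = C / (X n + a) + C / (Y n + a) - 8 * B\<^sup>2 / ((X n + a) * (Y n + a) * (X n + Y n))" for n
  proof -
    have p: "X n + a > 0" "Y n + a > 0" "X n + Y n > 0" using X(1)[of n] Y(1)[of n] a(1) by auto
    have "X n - a = (2 * B * h n + C * (h n)\<^sup>2) / (X n + a)" "Y n - a = (C * (h n)\<^sup>2 - 2 * B * h n) / (Y n + a)"
      using p X(2)[of n] Y(2)[of n] by (auto simp: eq_divide_eq power2_eq_square algebra_simps)
    then have "X n + Y n - 2 * a = (2 * B * h n + C * (h n)\<^sup>2) / (X n + a) + (C * (h n)\<^sup>2 - 2 * B * h n) / (Y n + a)"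
      by linarith
    also have "\<dots> = (h n)\<^sup>2 * (C / (X n + a) + C / (Y n + a)) + 2 * B * h n * (1 / (X n + a) - 1 / (Y n + a))"
      by (simp add: add_divide_distrib diff_divide_distrib algebra_simps)
    also have "1 / (X n + a) - 1 / (Y n + a) = (Y n - X n) / ((X n + a) * (Y n + a))"
      using p by (simp add: field_simps)
    also have "Y n - X n = - (4 * B * h n) / (X n + Y n)"
    proof -
      have "(Y n - X n) * (X n + Y n) = - (4 * B * h n)"
        using X(2)[of n] Y(2)[of n] by (simp add: power2_eq_square algebra_simps)
      then show ?thesis using p by (subst nonzero_eq_divide_eq) auto
    qed
    finally have "X n + Y n - 2 * a = (h n)\<^sup>2 * (C / (X n + a) + C / (Y n + a) - 8 * B\<^sup>2 / ((X n + a) * (Y n + a) * (X n + Y n)))"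
      by (simp add: algebra_simps power2_eq_square)
    then show ?thesis using h(2)[of n] by simp
  qed
  have "X \<longlonglongrightarrow> sqrt (A + 2 * B * 0 + C * 0\<^sup>2)" "Y \<longlonglongrightarrow> sqrt (A - 2 * B * 0 + C * 0\<^sup>2)"
    unfolding X_def Y_def by (intro tendsto_intros h)+
  then have XY: "X \<longlonglongrightarrow> a" "Y \<longlonglongrightarrow> a" by (simp_all add: a_def)
  have "(\<lambda>n. C / (X n + a) + C / (Y n + a) - 8 * B\<^sup>2 / ((X n + a) * (Y n + a) * (X n + Y n)))
     \<longlonglongrightarrow> C / (a + a) + C / (a + a) - 8 * B\<^sup>2 / ((a + a) * (a + a) * (a + a))"
    using a(1) by (intro tendsto_intros XY) auto
  moreover have "C / (a + a) + C / (a + a) - 8 * B\<^sup>2 / ((a + a) * (a + a) * (a + a)) = (C - B\<^sup>2 / A) / sqrt A"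
    unfolding a_def[symmetric] using a(1) by (simp add: a(2) field_simps power2_eq_square)
  ultimately show ?thesis unfolding eq[symmetric] by (simp add: X_def Y_def a_def)
qed

text \<open>The weight \<open>2 * std_normal_density\<close> is the second derivative of \<open>abs_mean\<close>, and the mean of
  \<open>abs_mean ((w + h *\<^sub>R p) \<bullet> Z)\<close> is known exactly; take second differences in \<open>h\<close>.\<close>

lemma has_bochner_integral_gauss_weight_square:
  fixes w p :: "'a::euclidean_space"
  shows "has_bochner_integral std_gauss (\<lambda>z. 2 * std_normal_density (w \<bullet> z) * (p \<bullet> z)\<^sup>2)
    (sqrt (2 / pi) * (((norm p)\<^sup>2 - (w \<bullet> p)\<^sup>2 / (1 + (norm w)\<^sup>2)) / sqrt (1 + (norm w)\<^sup>2)))"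
proof -
  define h :: "nat \<Rightarrow> real" where "h n = inverse (real (Suc n))" for n
  have h0: "h \<longlonglongrightarrow> 0" unfolding h_def by (rule LIMSEQ_inverse_real_of_nat)
  have h: "h n > 0" for n by (simp add: h_def)
  define D where "D n z = (abs_mean (w \<bullet> z + h n * (p \<bullet> z)) + abs_mean (w \<bullet> z - h n * (p \<bullet> z)) - 2 * abs_mean (w \<bullet> z)) / (h n)\<^sup>2" for n z
  have [measurable]: "abs_mean \<in> borel_measurable borel"
    unfolding abs_mean_def by measurable
  have [measurable]: "D n \<in> borel_measurable std_gauss" for n unfolding D_def by measurable
  have ip: "integrable std_gauss (\<lambda>z. (p \<bullet> z)\<^sup>2)"
    using has_bochner_integral_std_gauss_inner_square by (rule integrable.intros)
  have ptw: "AE z in std_gauss. (\<lambda>n. D n z) \<longlonglongrightarrow> 2 * std_normal_density (w \<bullet> z) * (p \<bullet> z)\<^sup>2"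
    unfolding D_def by (intro AE_I2 abs_mean_second_difference_tendsto h0 h)
  have bound: "AE z in std_gauss. norm (D n z) \<le> (p \<bullet> z)\<^sup>2" for n
  proof (intro AE_I2)
    fix z
    show "norm (D n z) \<le> (p \<bullet> z)\<^sup>2"
      using abs_mean_second_difference_bounds[of "w \<bullet> z" "h n * (p \<bullet> z)"] h[of n]
      unfolding D_def by (simp add: power_mult_distrib field_simps)
  qed
  have lim: "(\<lambda>n. integral\<^sup>L std_gauss (D n)) \<longlonglongrightarrow> (\<integral>z. 2 * std_normal_density (w \<bullet> z) * (p \<bullet> z)\<^sup>2 \<partial>std_gauss)"
    by (rule integral_dominated_convergence[OF _ _ ip ptw bound]) measurable
  have int: "integrable std_gauss (\<lambda>z. 2 * std_normal_density (w \<bullet> z) * (p \<bullet> z)\<^sup>2)"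
    by (rule integrable_dominated_convergence[OF _ _ ip ptw bound]) measurable
  have am: "integrable std_gauss (\<lambda>z. abs_mean (v \<bullet> z))" "(\<integral>z. abs_mean (v \<bullet> z) \<partial>std_gauss) = sqrt (2 / pi) * sqrt (1 + (norm v)\<^sup>2)" for v :: 'a
    using std_gauss_pair.integrable_fst[OF integral_std_gauss_abs_inner_add(1)[of v]] integral_std_gauss_abs_inner_add(2)[of v]
    unfolding abs_mean_def by auto
  have D: "integral\<^sup>L std_gauss (D n) = sqrt (2 / pi) * ((sqrt ((1 + (norm w)\<^sup>2) + 2 * (w \<bullet> p) * h n + (norm p)\<^sup>2 * (h n)\<^sup>2) +
      sqrt ((1 + (norm w)\<^sup>2) - 2 * (w \<bullet> p) * h n + (norm p)\<^sup>2 * (h n)\<^sup>2) - 2 * sqrt (1 + (norm w)\<^sup>2)) / (h n)\<^sup>2)" for n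
  proof -
    have "D n = (\<lambda>z. (abs_mean ((w + h n *\<^sub>R p) \<bullet> z) + abs_mean ((w - h n *\<^sub>R p) \<bullet> z) - 2 * abs_mean (w \<bullet> z)) / (h n)\<^sup>2)"
      by (simp add: D_def inner_simps fun_eq_iff)
    then have "integral\<^sup>L std_gauss (D n) = (sqrt (2 / pi) * sqrt (1 + (norm (w + h n *\<^sub>R p))\<^sup>2) + sqrt (2 / pi) * sqrt (1 + (norm (w - h n *\<^sub>R p))\<^sup>2) - 2 * (sqrt (2 / pi) * sqrt (1 + (norm w)\<^sup>2))) / (h n)\<^sup>2"
      by (simp add: am)
    moreover have "(norm (w + h n *\<^sub>R p))\<^sup>2 = (norm w)\<^sup>2 + 2 * (w \<bullet> p) * h n + (norm p)\<^sup>2 * (h n)\<^sup>2"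
       "(norm (w - h n *\<^sub>R p))\<^sup>2 = (norm w)\<^sup>2 - 2 * (w \<bullet> p) * h n + (norm p)\<^sup>2 * (h n)\<^sup>2"
      unfolding power2_norm_eq_inner by (simp_all add: inner_simps algebra_simps power2_eq_square inner_commute)
    ultimately show ?thesis by (simp add: algebra_simps diff_divide_distrib add_divide_distrib)
  qed
  have "(\<lambda>n. integral\<^sup>L std_gauss (D n)) \<longlonglongrightarrow> sqrt (2 / pi) * (((norm p)\<^sup>2 - (w \<bullet> p)\<^sup>2 / (1 + (norm w)\<^sup>2)) / sqrt (1 + (norm w)\<^sup>2))"
    unfolding D
  proof (intro tendsto_mult tendsto_const sqrt_second_difference_tendsto h0 h)
    fix n
    have "1 + (norm (w + h n *\<^sub>R p))\<^sup>2 > 0" "1 + (norm (w - h n *\<^sub>R p))\<^sup>2 > 0" by (simp_all add: add_pos_nonneg)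
    then show "0 < (1 + (norm w)\<^sup>2) + 2 * (w \<bullet> p) * h n + (norm p)\<^sup>2 * (h n)\<^sup>2"
       "0 < (1 + (norm w)\<^sup>2) - 2 * (w \<bullet> p) * h n + (norm p)\<^sup>2 * (h n)\<^sup>2"
      unfolding power2_norm_eq_inner by (simp_all add: inner_simps algebra_simps power2_eq_square inner_commute)
  qed (simp add: add_pos_nonneg)
  with lim have "(\<integral>z. 2 * std_normal_density (w \<bullet> z) * (p \<bullet> z)\<^sup>2 \<partial>std_gauss) = sqrt (2 / pi) * (((norm p)\<^sup>2 - (w \<bullet> p)\<^sup>2 / (1 + (norm w)\<^sup>2)) / sqrt (1 + (norm w)\<^sup>2))"
    by (rule LIMSEQ_unique)
  with int show ?thesis by (simp add: has_bochner_integral_iff)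
qed

text \<open>Polarization of the quadratic case. The value reflects that the Gaussian law with the
  additional weight is again Gaussian, with covariance I - w w^T / (1 + |w|^2) and total mass
  proportional to 1 / sqrt (1 + |w|^2).\<close>

lemma has_bochner_integral_gauss_weight_mult:
  fixes w p q :: "'a::euclidean_space"
  shows "has_bochner_integral std_gauss (\<lambda>z. 2 * std_normal_density (w \<bullet> z) * ((p \<bullet> z) * (q \<bullet> z)))
    (sqrt (2 / pi) * ((p \<bullet> q - (w \<bullet> p) * (w \<bullet> q) / (1 + (norm w)\<^sup>2)) / sqrt (1 + (norm w)\<^sup>2)))"
proof -
  define A where "A = 1 + (norm w)\<^sup>2"
  have "has_bochner_integral std_gauss (\<lambda>z. 1 / 4 * (2 * std_normal_density (w \<bullet> z) * ((p + q) \<bullet> z)\<^sup>2 - 2 * std_normal_density (w \<bullet> z) * ((p - q) \<bullet> z)\<^sup>2))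
    (1 / 4 * (sqrt (2 / pi) * (((norm (p + q))\<^sup>2 - (w \<bullet> (p + q))\<^sup>2 / A) / sqrt A) - sqrt (2 / pi) * (((norm (p - q))\<^sup>2 - (w \<bullet> (p - q))\<^sup>2 / A) / sqrt A)))"
    unfolding A_def by (intro has_bochner_integral_mult_right has_bochner_integral_diff has_bochner_integral_gauss_weight_square)
  moreover have "1 / 4 * (2 * std_normal_density (w \<bullet> z) * ((p + q) \<bullet> z)\<^sup>2 - 2 * std_normal_density (w \<bullet> z) * ((p - q) \<bullet> z)\<^sup>2)
    = 2 * std_normal_density (w \<bullet> z) * ((p \<bullet> z) * (q \<bullet> z))" for z
    by (simp add: inner_simps power2_eq_square algebra_simps)
  moreover have "1 / 4 * (sqrt (2 / pi) * (((norm (p + q))\<^sup>2 - (w \<bullet> (p + q))\<^sup>2 / A) / sqrt A) - sqrt (2 / pi) * (((norm (p - q))\<^sup>2 - (w \<bullet> (p - q))\<^sup>2 / A) / sqrt A))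
    = sqrt (2 / pi) * ((p \<bullet> q - (w \<bullet> p) * (w \<bullet> q) / A) / sqrt A)"
  proof -
    have n: "(norm (p + q))\<^sup>2 - (norm (p - q))\<^sup>2 = 4 * (p \<bullet> q)"
      unfolding power2_norm_eq_inner by (simp add: inner_simps inner_commute)
    have w: "(w \<bullet> (p + q))\<^sup>2 - (w \<bullet> (p - q))\<^sup>2 = 4 * ((w \<bullet> p) * (w \<bullet> q))"
      by (simp add: inner_simps power2_eq_square algebra_simps)
    have "((norm (p + q))\<^sup>2 - (w \<bullet> (p + q))\<^sup>2 / A) - ((norm (p - q))\<^sup>2 - (w \<bullet> (p - q))\<^sup>2 / A)
       = ((norm (p + q))\<^sup>2 - (norm (p - q))\<^sup>2) - ((w \<bullet> (p + q))\<^sup>2 - (w \<bullet> (p - q))\<^sup>2) / A"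
      by (simp add: diff_divide_distrib)
    also have "\<dots> = 4 * (p \<bullet> q - (w \<bullet> p) * (w \<bullet> q) / A)" unfolding n w by simp
    finally have e: "((norm (p + q))\<^sup>2 - (w \<bullet> (p + q))\<^sup>2 / A) - ((norm (p - q))\<^sup>2 - (w \<bullet> (p - q))\<^sup>2 / A) = 4 * (p \<bullet> q - (w \<bullet> p) * (w \<bullet> q) / A)" .
    have "1 / 4 * (s * (P / r) - s * (Q / r)) = s * (Z / r)" if "P - Q = 4 * Z" for s P Q r Z :: real
    proof -
      have "1 / 4 * (s * (P / r) - s * (Q / r)) = s * ((P - Q) / r) / 4"
        by (simp add: diff_divide_distrib right_diff_distrib)
      then show ?thesis unfolding that by simp
    qed
    from this[OF e] show ?thesis .
  qed
  ultimately show ?thesis unfolding A_def by (simp only:)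
qed

section \<open>A smooth sign function\<close>

text \<open>The function is 2 \<Phi> - 1 for the standard normal distribution function \<Phi>. It is
  obtained as the antiderivative vanishing at 0; it is odd, and its derivative has total mass 2,
  whence the bound 1.\<close>

lemma gauss_sign_exists:
  obtains \<sigma> :: "real \<Rightarrow> real" where
    "\<And>u. (\<sigma> has_real_derivative 2 * std_normal_density u) (at u)" "\<sigma> 0 = 0" "\<And>u. \<bar>\<sigma> u\<bar> \<le> 1"
proof -
  have c: "isCont (\<lambda>u. 2 * std_normal_density u) x" for x
    unfolding std_normal_density_def by (intro continuous_intros) auto
  have "\<exists>F. \<forall>x. -\<infinity> < ereal x \<longrightarrow> ereal x < \<infinity> \<longrightarrow> (F has_vector_derivative 2 * std_normal_density x) (at x)"
    by (rule einterval_antiderivative) (auto intro: c)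
  then obtain F where F: "\<And>x. (F has_real_derivative 2 * std_normal_density x) (at x)"
    by (auto simp: has_real_derivative_iff_has_vector_derivative)
  define \<sigma> where "\<sigma> u = F u - F 0" for u
  have d: "(\<sigma> has_real_derivative 2 * std_normal_density u) (at u)" for u
    unfolding \<sigma>_def by (auto intro!: derivative_eq_intros F)
  have odd: "\<sigma> (- u) = - \<sigma> u" for u
  proof -
    have "((\<lambda>u. \<sigma> (- u) + \<sigma> u) has_real_derivative 0) (at u)" for u
    proof -
      have "((\<lambda>u. \<sigma> (- u)) has_real_derivative (2 * std_normal_density (- u)) * (- 1)) (at u)"
        by (rule DERIV_chain2[OF d]) (auto intro!: derivative_eq_intros)
      from DERIV_add[OF this d[of u]] show ?thesis by (simp add: std_normal_density_def)
    qed
    then have "\<forall>u. ((\<lambda>u. \<sigma> (- u) + \<sigma> u) has_real_derivative 0) (at u)" by blast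
    from DERIV_isconst_all[OF this, of u 0] show ?thesis by (simp add: \<sigma>_def)
  qed
  have b: "\<bar>\<sigma> u\<bar> \<le> 1" if "u \<ge> 0" for u
  proof -
    have "has_bochner_integral lborel (\<lambda>x. 2 * std_normal_density x * indicator {-u..u} x) (\<sigma> u - \<sigma> (- u))"
      using that by (intro has_bochner_integral_FTC_Icc_real d c) auto
    then have "\<sigma> u - \<sigma> (- u) = (\<integral>x. 2 * std_normal_density x * indicator {-u..u} x \<partial>lborel)"
      by (simp add: has_bochner_integral_iff)
    also have "\<dots> \<le> (\<integral>x. 2 * std_normal_density x \<partial>lborel)"
      using \<open>has_bochner_integral _ _ _\<close> by (intro integral_mono) (auto simp: has_bochner_integral_iff indicator_def)
    also have "\<dots> = 2" by simp
    finally have "\<sigma> u \<le> 1" by (simp add: odd)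
    moreover have "\<sigma> u \<ge> \<sigma> 0"
      by (rule DERIV_nonneg_imp_nondecreasing[OF that]) (use d in \<open>auto intro!: exI\<close>)
    ultimately show ?thesis by (simp add: \<sigma>_def)
  qed
  have "\<bar>\<sigma> u\<bar> \<le> 1" for u
    using b[of u] b[of "- u"] odd[of u] by (cases "u \<ge> 0") auto
  then show ?thesis using that[of \<sigma>] d by (simp add: \<sigma>_def)
qed

section \<open>Lower bound for the rate of change of an indicator along rotations\<close>

lemma integrable_gauss2_fst:
  fixes g :: "'a::euclidean_space \<Rightarrow> real"
  assumes g: "integrable std_gauss g"
  shows "integrable (gauss2 :: ('a \<times> 'a) measure) (\<lambda>p. g (fst p))"
proof (rule std_gauss_pair.Fubini_integrable)
  have [measurable]: "g \<in> borel_measurable borel" using borel_measurable_integrable[OF g] by simp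
  show "(\<lambda>p. g (fst p)) \<in> borel_measurable (gauss2 :: ('a \<times> 'a) measure)" by measurable
  show "integrable std_gauss (\<lambda>x. \<integral>y. norm (g (fst (x, y :: 'a))) \<partial>std_gauss)" using g by simp
  show "AE x in std_gauss. integrable std_gauss (\<lambda>y::'a. g (fst (x, y)))" by simp
qed

lemma integrable_gauss2_snd:
  fixes g :: "'a::euclidean_space \<Rightarrow> real"
  assumes g: "integrable std_gauss g"
  shows "integrable (gauss2 :: ('a \<times> 'a) measure) (\<lambda>p. g (snd p))"
proof (rule std_gauss_pair.Fubini_integrable)
  have [measurable]: "g \<in> borel_measurable borel" using borel_measurable_integrable[OF g] by simp
  show "(\<lambda>p. g (snd p)) \<in> borel_measurable (gauss2 :: ('a \<times> 'a) measure)" by measurable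
  show "integrable std_gauss (\<lambda>x::'a. \<integral>y. norm (g (snd (x, y))) \<partial>std_gauss)" by simp
  show "AE x::'a in std_gauss. integrable std_gauss (\<lambda>y. g (snd (x, y)))" using g by simp
qed

lemma integrable_gauss2_norms:
  "integrable (gauss2 :: ('a::euclidean_space \<times> 'a) measure) (\<lambda>p. B * (1 + (norm (fst p))\<^sup>2 + (norm (snd p))\<^sup>2))"
  by (intro integrable_mult_right Bochner_Integration.integrable_add integrable_gauss2_fst[OF integrable_std_gauss_norm_square]
      integrable_gauss2_snd[OF integrable_std_gauss_norm_square] std_gauss_pair.P.integrable_const)

lemma norm_rotate_square:
  fixes x z :: "'a::euclidean_space"
  shows "(norm (cos r *\<^sub>R x + sin r *\<^sub>R z))\<^sup>2 + (norm (cos r *\<^sub>R z - sin r *\<^sub>R x))\<^sup>2 = (norm x)\<^sup>2 + (norm z)\<^sup>2"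
proof -
  have "(norm (c *\<^sub>R x + s *\<^sub>R z))\<^sup>2 + (norm (c *\<^sub>R z - s *\<^sub>R x))\<^sup>2 = (c\<^sup>2 + s\<^sup>2) * ((norm x)\<^sup>2 + (norm z)\<^sup>2)" for c s :: real
    unfolding power2_norm_eq_inner
    by (simp add: inner_simps algebra_simps power2_eq_square inner_commute)
  from this[of "cos r" "sin r"] show ?thesis by simp
qed

text \<open>Along the rotation X' = Z and Z' = - X, so the derivative of \<sigma> (W X \<bullet> Z)
  is \<sigma>' times W'(X) Z \<bullet> Z - W X \<bullet> X, which is \<open>D\<close> at angle 0.
  The quotients look backwards, at angle - \<theta> n, because the rotation will be transferred from
  the set to this function by its inverse.\<close>

lemma field_flow_limit:
  fixes W :: "'a::euclidean_space \<Rightarrow> 'a" and E :: "'a set" and \<theta> :: "nat \<Rightarrow> real"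
  assumes W: "\<And>x. (W has_derivative W' x) (at x)" and B: "\<And>x v. norm (W' x v) \<le> B * norm v" "\<And>x. norm (W x) \<le> B"
    and \<sigma>: "\<And>u. (\<sigma> has_real_derivative 2 * std_normal_density u) (at u)"
    and \<theta>: "\<theta> \<longlonglongrightarrow> 0" "\<And>n. \<theta> n > 0" and E[measurable]: "E \<in> sets borel"
  defines "f \<equiv> \<lambda>r p. \<sigma> (W (cos r *\<^sub>R fst p + sin r *\<^sub>R snd p) \<bullet> (cos r *\<^sub>R snd p - sin r *\<^sub>R fst p))"
    and "D \<equiv> \<lambda>p. 2 * std_normal_density (W (fst p) \<bullet> snd p) * (W' (fst p) (snd p) \<bullet> snd p - W (fst p) \<bullet> fst p)"
  shows "integrable gauss2 (\<lambda>p. indicator E (fst p) * D p)"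
    and "(\<lambda>n. \<integral>p. indicator E (fst p) * ((f 0 p - f (- \<theta> n) p) / \<theta> n) \<partial>gauss2) \<longlonglongrightarrow> (\<integral>p. indicator E (fst p) * D p \<partial>gauss2)"
proof -
  have B0: "B \<ge> 0" using B(2)[of 0] by (rule order_trans[OF norm_ge_zero])
  have der: "((\<lambda>r. f r p) has_real_derivative
     2 * std_normal_density (W (cos r *\<^sub>R fst p + sin r *\<^sub>R snd p) \<bullet> (cos r *\<^sub>R snd p - sin r *\<^sub>R fst p)) *
     (W' (cos r *\<^sub>R fst p + sin r *\<^sub>R snd p) (cos r *\<^sub>R snd p - sin r *\<^sub>R fst p) \<bullet> (cos r *\<^sub>R snd p - sin r *\<^sub>R fst p)
      - W (cos r *\<^sub>R fst p + sin r *\<^sub>R snd p) \<bullet> (cos r *\<^sub>R fst p + sin r *\<^sub>R snd p))) (at r)" for r p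
  proof -
    define X where "X r = cos r *\<^sub>R fst p + sin r *\<^sub>R snd p" for r
    define Z where "Z r = cos r *\<^sub>R snd p - sin r *\<^sub>R fst p" for r
    have X: "(X has_derivative (\<lambda>h. h *\<^sub>R Z r)) (at r)"
      unfolding X_def Z_def by (auto intro!: derivative_eq_intros simp: algebra_simps)
    have Z: "(Z has_derivative (\<lambda>h. h *\<^sub>R (- X r))) (at r)"
      unfolding X_def Z_def by (auto intro!: derivative_eq_intros simp: algebra_simps)
    have lin: "linear (W' (X r))" using W by (rule has_derivative_linear)
    have WX: "((\<lambda>r. W (X r)) has_derivative (\<lambda>h. W' (X r) (h *\<^sub>R Z r))) (at r)"
      by (rule has_derivative_compose[OF X W])
    have "((\<lambda>r. W (X r) \<bullet> Z r) has_derivative (\<lambda>h. W (X r) \<bullet> (h *\<^sub>R (- X r)) + W' (X r) (h *\<^sub>R Z r) \<bullet> Z r)) (at r)"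
      by (rule has_derivative_inner[OF WX Z])
    then have "((\<lambda>r. W (X r) \<bullet> Z r) has_real_derivative (W' (X r) (Z r) \<bullet> Z r - W (X r) \<bullet> X r)) (at r)"
      unfolding has_field_derivative_def
      by (rule has_derivative_eq_rhs) (auto simp: linear_cmul[OF lin] algebra_simps)
    from DERIV_chain2[OF \<sigma> this] show ?thesis
      unfolding f_def X_def Z_def by simp
  qed
  have bnd: "\<bar>2 * std_normal_density u * (W' x z \<bullet> z - W x \<bullet> x)\<bar> \<le> B * (1 + (norm x)\<^sup>2 + (norm z)\<^sup>2)" for u x z
  proof -
    have "\<bar>W' x z \<bullet> z\<bar> \<le> norm (W' x z) * norm z" by (rule Cauchy_Schwarz_ineq2)
    also have "\<dots> \<le> (B * norm z) * norm z" by (intro mult_right_mono B) auto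
    finally have 1: "\<bar>W' x z \<bullet> z\<bar> \<le> B * (norm z)\<^sup>2" by (simp add: power2_eq_square mult.assoc)
    have "\<bar>W x \<bullet> x\<bar> \<le> norm (W x) * norm x" by (rule Cauchy_Schwarz_ineq2)
    also have "\<dots> \<le> B * (1 + (norm x)\<^sup>2)" by (intro mult_mono B norm_le_1_plus_square B0) auto
    finally have 2: "\<bar>W x \<bullet> x\<bar> \<le> B * (1 + (norm x)\<^sup>2)" .
    have "\<bar>2 * std_normal_density u * (W' x z \<bullet> z - W x \<bullet> x)\<bar> \<le> 1 * \<bar>W' x z \<bullet> z - W x \<bullet> x\<bar>"
      unfolding abs_mult[of "2 * std_normal_density u"] using std_normal_density_le_half[of u]
      by (intro mult_right_mono) auto
    also have "\<dots> \<le> \<bar>W' x z \<bullet> z\<bar> + \<bar>W x \<bullet> x\<bar>" by simp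
    also have "\<dots> \<le> B * (norm z)\<^sup>2 + B * (1 + (norm x)\<^sup>2)" using 1 2 by (rule add_mono)
    finally show ?thesis by (simp add: algebra_simps)
  qed
  \<comment> \<open>Rotations preserve |X|^2 + |Z|^2, so the bound on the derivative along the whole
    path is expressed by the initial pair: an integrable majorant for all difference
    quotients.\<close>
  have lip: "\<bar>f 0 p - f r p\<bar> \<le> B * (1 + (norm (fst p))\<^sup>2 + (norm (snd p))\<^sup>2) * \<bar>r\<bar>" for r p
  proof -
    have "norm (f 0 p - f r p) \<le> B * (1 + (norm (fst p))\<^sup>2 + (norm (snd p))\<^sup>2) * norm (0 - r)"
    proof (rule field_differentiable_bound[OF convex_UNIV])
      fix t :: real
      show "((\<lambda>r. f r p) has_field_derivative
         2 * std_normal_density (W (cos t *\<^sub>R fst p + sin t *\<^sub>R snd p) \<bullet> (cos t *\<^sub>R snd p - sin t *\<^sub>R fst p)) *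
         (W' (cos t *\<^sub>R fst p + sin t *\<^sub>R snd p) (cos t *\<^sub>R snd p - sin t *\<^sub>R fst p) \<bullet> (cos t *\<^sub>R snd p - sin t *\<^sub>R fst p)
          - W (cos t *\<^sub>R fst p + sin t *\<^sub>R snd p) \<bullet> (cos t *\<^sub>R fst p + sin t *\<^sub>R snd p))) (at t within UNIV)"
        using der[of p t] by simp
      show "norm (2 * std_normal_density (W (cos t *\<^sub>R fst p + sin t *\<^sub>R snd p) \<bullet> (cos t *\<^sub>R snd p - sin t *\<^sub>R fst p)) *
         (W' (cos t *\<^sub>R fst p + sin t *\<^sub>R snd p) (cos t *\<^sub>R snd p - sin t *\<^sub>R fst p) \<bullet> (cos t *\<^sub>R snd p - sin t *\<^sub>R fst p)
          - W (cos t *\<^sub>R fst p + sin t *\<^sub>R snd p) \<bullet> (cos t *\<^sub>R fst p + sin t *\<^sub>R snd p)))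
         \<le> B * (1 + (norm (fst p))\<^sup>2 + (norm (snd p))\<^sup>2)"
        unfolding real_norm_def by (rule order_trans[OF bnd]) (simp add: norm_rotate_square add.assoc)
    qed auto
    then show ?thesis by simp
  qed
  have cW: "continuous_on UNIV W"
    using W by (meson continuous_at_imp_continuous_on has_derivative_continuous)
  then have [measurable]: "W \<in> borel_measurable borel" by (rule borel_measurable_continuous_onI)
  have "continuous_on UNIV \<sigma>" using \<sigma> DERIV_isCont continuous_at_imp_continuous_on by blast
  then have [measurable]: "\<sigma> \<in> borel_measurable borel" by (rule borel_measurable_continuous_onI)
  have [measurable]: "f r \<in> borel_measurable gauss2" for r unfolding f_def by measurable
  define g where "g n p = indicator E (fst p) * ((f 0 p - f (- \<theta> n) p) / \<theta> n)" for n p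
  have gm[measurable]: "g n \<in> borel_measurable gauss2" for n unfolding g_def by measurable
  have ptw: "(\<lambda>n. g n p) \<longlonglongrightarrow> indicator E (fst p) * D p" for p
  proof -
    have d: "((\<lambda>r. f r p) has_real_derivative D p) (at 0)"
      using der[of p 0] by (simp add: D_def)
    have "((\<lambda>r. (f r p - f 0 p) / (r - 0)) \<longlongrightarrow> D p) (at 0)"
      using d unfolding has_field_derivative_iff .
    moreover have "filterlim (\<lambda>n. - \<theta> n) (at 0) sequentially"
      unfolding filterlim_at using tendsto_minus[OF \<theta>(1)] \<theta>(2) by (auto intro!: always_eventually simp: less_imp_neq[symmetric] dest: less_imp_neq)
    ultimately have "(\<lambda>n. (f (- \<theta> n) p - f 0 p) / (- \<theta> n - 0)) \<longlonglongrightarrow> D p" by (rule filterlim_compose)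
    moreover have "(f (- \<theta> n) p - f 0 p) / (- \<theta> n - 0) = (f 0 p - f (- \<theta> n) p) / \<theta> n" for n
      using \<theta>(2)[of n] by (simp add: field_simps)
    ultimately have "(\<lambda>n. (f 0 p - f (- \<theta> n) p) / \<theta> n) \<longlonglongrightarrow> D p" by simp
    then show ?thesis unfolding g_def by (intro tendsto_intros)
  qed
  have lm[measurable]: "(\<lambda>p. indicator E (fst p) * D p) \<in> borel_measurable gauss2"
    by (rule borel_measurable_LIMSEQ_real[OF ptw gm])
  have bound: "AE p in gauss2. norm (g n p) \<le> B * (1 + (norm (fst p))\<^sup>2 + (norm (snd p))\<^sup>2)" for n
  proof (intro AE_I2)
    fix p :: "'a \<times> 'a"
    have nn: "B * (1 + (norm (fst p))\<^sup>2 + (norm (snd p))\<^sup>2) \<ge> 0" using B0 by simp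
    have "\<bar>(f 0 p - f (- \<theta> n) p) / \<theta> n\<bar> \<le> B * (1 + (norm (fst p))\<^sup>2 + (norm (snd p))\<^sup>2)"
      using lip[of p "- \<theta> n"] \<theta>(2)[of n] by (simp add: divide_le_eq)
    then show "norm (g n p) \<le> B * (1 + (norm (fst p))\<^sup>2 + (norm (snd p))\<^sup>2)"
      using nn unfolding g_def by (cases "fst p \<in> E") auto
  qed
  have ptw': "AE p in gauss2. (\<lambda>n. g n p) \<longlonglongrightarrow> indicator E (fst p) * D p"
    by (intro AE_I2 ptw)
  show "integrable gauss2 (\<lambda>p. indicator E (fst p) * D p)"
    by (rule integrable_dominated_convergence[OF lm gm integrable_gauss2_norms ptw' bound])
  show "(\<lambda>n. \<integral>p. indicator E (fst p) * ((f 0 p - f (- \<theta> n) p) / \<theta> n) \<partial>gauss2) \<longlonglongrightarrow> (\<integral>p. indicator E (fst p) * D p \<partial>gauss2)"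
    unfolding g_def[symmetric]
    by (rule integral_dominated_convergence[OF lm gm integrable_gauss2_norms ptw' bound])
qed

text \<open>Computes the mean over Z, at fixed X = x, of the limit \<open>D\<close> from
  \<open>field_flow_limit\<close>: the quadratic form is expanded in the basis, and the rank-one
  correction of the covariance shows up next to the trace of A.\<close>

lemma gauss_weight_quadratic_mean:
  fixes w x :: "'a::euclidean_space"
  assumes A: "linear A"
  shows "has_bochner_integral std_gauss (\<lambda>z. 2 * std_normal_density (w \<bullet> z) * (A z \<bullet> z - w \<bullet> x))
    (sqrt (2 / pi) * (((\<Sum>b\<in>Basis. A b \<bullet> b - (w \<bullet> A b) * (w \<bullet> b) / (1 + (norm w)\<^sup>2)) - w \<bullet> x) / sqrt (1 + (norm w)\<^sup>2)))"
proof -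
  define S where "S = sqrt (1 + (norm w)\<^sup>2)"
  have Az: "A z \<bullet> z = (\<Sum>b\<in>Basis. (A b \<bullet> z) * (b \<bullet> z))" for z
  proof -
    have "A z = A (\<Sum>b\<in>Basis. (z \<bullet> b) *\<^sub>R b)" by (simp add: euclidean_representation)
    also have "\<dots> = (\<Sum>b\<in>Basis. (z \<bullet> b) *\<^sub>R A b)"
      by (simp add: linear_sum[OF A] linear_cmul[OF A])
    finally have "A z \<bullet> z = (\<Sum>b\<in>Basis. (z \<bullet> b) *\<^sub>R A b) \<bullet> z" by (rule arg_cong)
    also have "\<dots> = (\<Sum>b\<in>Basis. (A b \<bullet> z) * (b \<bullet> z))"
      by (simp add: inner_sum_left inner_commute[of z] mult.commute)
    finally show ?thesis .
  qed
  have 1: "has_bochner_integral std_gauss (\<lambda>z. \<Sum>b\<in>Basis. 2 * std_normal_density (w \<bullet> z) * ((A b \<bullet> z) * (b \<bullet> z)))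
    (\<Sum>b\<in>Basis. sqrt (2 / pi) * ((A b \<bullet> b - (w \<bullet> A b) * (w \<bullet> b) / (1 + (norm w)\<^sup>2)) / S))"
    unfolding S_def by (intro has_bochner_integral_sum has_bochner_integral_gauss_weight_mult)
  have 2: "has_bochner_integral std_gauss (\<lambda>z. (2 * (w \<bullet> x)) * std_normal_density (w \<bullet> z)) ((2 * (w \<bullet> x)) * (1 / (sqrt (2 * pi) * S)))"
    unfolding S_def by (intro has_bochner_integral_mult_right has_bochner_integral_std_gauss_exp_inner)
  have pi2: "2 / sqrt (2 * pi) = sqrt (2 / pi)"
    by (simp add: real_sqrt_mult real_sqrt_divide field_simps)
  have gen: "(\<Sum>b\<in>(Basis :: 'a set). c * (f b / S)) - c * (y / S) = c * (((\<Sum>b\<in>Basis. f b) - y) / S)" for c y and f :: "'a \<Rightarrow> real"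
    by (simp add: sum_distrib_left[symmetric] sum_divide_distrib[symmetric] diff_divide_distrib right_diff_distrib)
  have e: "(2 * (w \<bullet> x)) * (1 / (sqrt (2 * pi) * S)) = sqrt (2 / pi) * ((w \<bullet> x) / S)"
    unfolding pi2[symmetric] by simp
  have "(\<lambda>z. (\<Sum>b\<in>Basis. 2 * std_normal_density (w \<bullet> z) * ((A b \<bullet> z) * (b \<bullet> z))) - (2 * (w \<bullet> x)) * std_normal_density (w \<bullet> z))
    = (\<lambda>z. 2 * std_normal_density (w \<bullet> z) * (A z \<bullet> z - w \<bullet> x))"
  proof
    fix z
    have "(\<Sum>b\<in>Basis. 2 * std_normal_density (w \<bullet> z) * ((A b \<bullet> z) * (b \<bullet> z))) = 2 * std_normal_density (w \<bullet> z) * (A z \<bullet> z)"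
      unfolding Az by (simp only: sum_distrib_left)
    then show "(\<Sum>b\<in>Basis. 2 * std_normal_density (w \<bullet> z) * ((A b \<bullet> z) * (b \<bullet> z))) - (2 * (w \<bullet> x)) * std_normal_density (w \<bullet> z)
      = 2 * std_normal_density (w \<bullet> z) * (A z \<bullet> z - w \<bullet> x)"
      by (simp add: algebra_simps)
  qed
  moreover have "(\<Sum>b\<in>Basis. sqrt (2 / pi) * ((A b \<bullet> b - (w \<bullet> A b) * (w \<bullet> b) / (1 + (norm w)\<^sup>2)) / S)) - sqrt (2 / pi) * ((w \<bullet> x) / S)
     = sqrt (2 / pi) * (((\<Sum>b\<in>Basis. A b \<bullet> b - (w \<bullet> A b) * (w \<bullet> b) / (1 + (norm w)\<^sup>2)) - w \<bullet> x) / S)"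
    by (rule gen)
  ultimately show ?thesis
    using has_bochner_integral_diff[OF 1 2] unfolding e S_def[symmetric] by (simp only:)
qed

lemma continuous_compact_support_bounded:
  fixes f :: "'a::euclidean_space \<Rightarrow> 'b::real_normed_vector"
  assumes "continuous_on UNIV f" "compact K" "\<And>x. x \<notin> K \<Longrightarrow> f x = 0"
  obtains B where "B > 0" "\<And>x. norm (f x) \<le> B"
proof -
  have "compact (f ` K)" using assms by (intro compact_continuous_image) (auto intro: continuous_on_subset)
  then obtain B where B: "B > 0" "\<And>y. y \<in> f ` K \<Longrightarrow> norm y \<le> B"
    using compact_imp_bounded bounded_pos by metis
  have "norm (f x) \<le> B" for x using B assms(3)[of x] by (cases "x \<in> K") auto
  with B(1) show ?thesis by (rule that)
qed

lemma has_derivative_zero_outside: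
  fixes f :: "'a::euclidean_space \<Rightarrow> 'b::real_normed_vector"
  assumes "closed K" "\<And>x. x \<notin> K \<Longrightarrow> f x = 0" "x \<notin> K"
  shows "(f has_derivative (\<lambda>_. 0)) (at x)"
  by (rule has_derivative_transform_within_open[of "\<lambda>_. 0" _ _ UNIV "- K"]) (use assms in auto)

lemma C_k_1_has_derivative:
  assumes "C_k (Suc 0) f"
  shows "(f has_derivative frechet_derivative f (at x)) (at x)"
  using assms by (simp add: frechet_derivative_works)

lemma C_k_1_derivative_bounded:
  fixes f :: "'a::euclidean_space \<Rightarrow> 'b::real_normed_vector"
  assumes f: "C_k (Suc 0) f" and K: "compact K" "\<And>x. x \<notin> K \<Longrightarrow> f x = 0"
  obtains B where "B > 0" "\<And>x v. norm (frechet_derivative f (at x) v) \<le> B * norm v"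
proof -
  have z: "frechet_derivative f (at x) v = 0" if "x \<notin> K" for x v
    using frechet_derivative_at[OF has_derivative_zero_outside[of K f x]] compact_imp_closed[OF K(1)] K(2) that by (simp add: fun_eq_iff)
  have "\<exists>B. B > 0 \<and> (\<forall>x. norm (frechet_derivative f (at x) b) \<le> B)" if "b \<in> Basis" for b
  proof -
    have "continuous_on UNIV (\<lambda>x. frechet_derivative f (at x) b)" using f that by simp
    from continuous_compact_support_bounded[OF this K(1) z] obtain B where "B > 0" "\<And>x. norm (frechet_derivative f (at x) b) \<le> B"
      by blast
    then show ?thesis by blast
  qed
  then obtain Bb where Bb: "\<And>b. b \<in> Basis \<Longrightarrow> Bb b > 0" "\<And>b x. b \<in> Basis \<Longrightarrow> norm (frechet_derivative f (at x) b) \<le> Bb b"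
    by metis
  show ?thesis
  proof (rule that[of "(\<Sum>b\<in>(Basis::'a set). Bb b)"])
    show "(\<Sum>b\<in>(Basis::'a set). Bb b) > 0" by (intro sum_pos) (auto intro: Bb)
    fix x v :: 'a
    have lin: "linear (frechet_derivative f (at x))"
      using C_k_1_has_derivative[OF f] by (rule has_derivative_linear)
    have "frechet_derivative f (at x) v = frechet_derivative f (at x) (\<Sum>b\<in>Basis. (v \<bullet> b) *\<^sub>R b)"
      by (simp add: euclidean_representation)
    also have "\<dots> = (\<Sum>b\<in>Basis. (v \<bullet> b) *\<^sub>R frechet_derivative f (at x) b)"
      by (simp add: linear_sum[OF lin] linear_cmul[OF lin])
    also have "norm \<dots> \<le> (\<Sum>b\<in>Basis. norm v * Bb b)"
      by (intro sum_norm_le) (auto intro!: mult_mono Basis_le_norm Bb)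
    finally show "norm (frechet_derivative f (at x) v) \<le> (\<Sum>b\<in>Basis. Bb b) * norm v"
      by (simp only: sum_distrib_right mult.commute[of "norm v"])
  qed
qed

text \<open>With \<open>W = l \<phi> / sqrt (1 - l\<^sup>2 |\<phi>|\<^sup>2)\<close> the Gaussian mean of \<open>\<sigma> (W \<bullet> Z) Z\<close> is exactly
  \<open>sqrt (2 / pi) l \<phi>\<close>; at \<open>|\<phi>| = 1\<close> and \<open>l = 1\<close> the function \<open>\<sigma> (W \<bullet> Z)\<close> would be the sign of \<open>\<phi> \<bullet> Z\<close>.\<close>

lemma field_flow_mean:
  fixes \<phi> :: "'a::euclidean_space \<Rightarrow> 'a"
  assumes \<phi>: "C_k (Suc 0) \<phi>" and K: "compact K" "\<And>x. x \<notin> K \<Longrightarrow> \<phi> x = 0" and le1: "\<And>x. norm (\<phi> x) \<le> 1"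
    and l: "0 < l" "l < (1::real)"
  obtains W W' B where
    "\<And>x. (W has_derivative W' x) (at x)" "\<And>x v. norm (W' x v) \<le> B * norm v" "\<And>x. norm (W x) \<le> B"
    "\<And>x. x \<notin> K \<Longrightarrow> W x = 0"
    "\<And>x. (\<integral>z. 2 * std_normal_density (W x \<bullet> z) * (W' x z \<bullet> z - W x \<bullet> x) \<partial>std_gauss) =
        sqrt (2 / pi) * l * (divergence \<phi> x - \<phi> x \<bullet> x)"
proof -
  define \<phi>' where "\<phi>' x = frechet_derivative \<phi> (at x)" for x
  have \<phi>': "(\<phi> has_derivative \<phi>' x) (at x)" for x
    unfolding \<phi>'_def by (rule C_k_1_has_derivative[OF \<phi>])
  obtain B where B: "B > 0" "\<And>x v. norm (\<phi>' x v) \<le> B * norm v"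
    unfolding \<phi>'_def using C_k_1_derivative_bounded[OF \<phi> K] by metis
  \<comment> \<open>This normalization makes 1 + |W|^2 equal to 1 / q^2, so the square roots in the
    weighted moments become powers of q. Since l < 1, q is bounded below by m, and W and W' are
    bounded.\<close>
  define q where "q x = sqrt (1 - l\<^sup>2 * (\<phi> x \<bullet> \<phi> x))" for x
  define m where "m = sqrt (1 - l\<^sup>2)"
  have l2: "l\<^sup>2 < 1" using l by (simp add: power_less_one_iff abs_square_less_1)
  then have m: "m > 0" "m\<^sup>2 = 1 - l\<^sup>2" by (auto simp: m_def)
  have \<phi>2: "\<phi> x \<bullet> \<phi> x \<le> 1" for x
    using le1[of x] by (simp add: power2_norm_eq_inner[symmetric] abs_square_le_1)
  have rad: "1 - l\<^sup>2 \<le> 1 - l\<^sup>2 * (\<phi> x \<bullet> \<phi> x)" for x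
    using \<phi>2[of x] by (simp add: mult_left_le)
  then have qm: "q x \<ge> m" for x unfolding q_def m_def by (rule real_sqrt_le_mono)
  have q0: "q x > 0" for x using qm[of x] m by linarith
  have q2: "(q x)\<^sup>2 = 1 - l\<^sup>2 * (\<phi> x \<bullet> \<phi> x)" for x
    unfolding q_def using rad[of x] l2 by simp
  define W where "W x = (l / q x) *\<^sub>R \<phi> x" for x
  define W' where "W' x v = (l / q x) *\<^sub>R \<phi>' x v + (l * l\<^sup>2 * (\<phi> x \<bullet> \<phi>' x v) / (q x) ^ 3) *\<^sub>R \<phi> x" for x v
  have dq: "(q has_derivative (\<lambda>v. - (l\<^sup>2 * (\<phi> x \<bullet> \<phi>' x v)) / q x)) (at x)" for x
  proof -
    have "1 - l\<^sup>2 * (\<phi> x \<bullet> \<phi> x) > 0" using rad[of x] l2 by linarith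
    moreover have "((\<lambda>x. 1 - l\<^sup>2 * (\<phi> x \<bullet> \<phi> x)) has_derivative (\<lambda>v. - (2 * (l\<^sup>2 * (\<phi> x \<bullet> \<phi>' x v))))) (at x)"
      by (auto intro!: derivative_eq_intros \<phi>' simp: inner_commute)
    ultimately have "((\<lambda>x. sqrt (1 - l\<^sup>2 * (\<phi> x \<bullet> \<phi> x))) has_derivative (\<lambda>v. - (2 * (l\<^sup>2 * (\<phi> x \<bullet> \<phi>' x v))) * (inverse (sqrt (1 - l\<^sup>2 * (\<phi> x \<bullet> \<phi> x))) / 2))) (at x)"
      by (rule has_derivative_real_sqrt[THEN has_derivative_eq_rhs]) (auto simp: field_simps)
    then show ?thesis unfolding q_def by (rule has_derivative_eq_rhs) (auto simp: field_simps)
  qed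
  have dW: "(W has_derivative W' x) (at x)" for x
  proof -
    have "((\<lambda>x. l / q x) has_derivative (\<lambda>v. l * l\<^sup>2 * (\<phi> x \<bullet> \<phi>' x v) / (q x) ^ 3)) (at x)"
      using q0[of x] by (auto intro!: derivative_eq_intros dq simp: field_simps power3_eq_cube power2_eq_square)
    from has_derivative_scaleR[OF this \<phi>'] show ?thesis
      unfolding W_def W'_def by (rule has_derivative_eq_rhs) auto
  qed
  have bW: "norm (W x) \<le> l / m" for x
  proof -
    have "norm (W x) = l / q x * norm (\<phi> x)" using l q0[of x] by (simp add: W_def)
    also have "\<dots> \<le> l / m * 1" using l q0[of x] m qm[of x] le1[of x] by (intro mult_mono frac_le) auto
    finally show ?thesis by simp
  qed
  have bW': "norm (W' x v) \<le> (l / m * B + l * l\<^sup>2 * B / m ^ 3) * norm v" for x v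
  proof -
    have "norm (W' x v) \<le> l / q x * norm (\<phi>' x v) + l * l\<^sup>2 * \<bar>\<phi> x \<bullet> \<phi>' x v\<bar> / (q x) ^ 3 * norm (\<phi> x)"
      unfolding W'_def using l q0[of x] by (intro order_trans[OF norm_triangle_ineq]) (simp add: abs_mult)
    also have "\<dots> \<le> l / m * (B * norm v) + l * l\<^sup>2 * (B * norm v) / m ^ 3 * 1"
    proof (intro add_mono mult_mono frac_le power_mono qm B le1)
      have "\<bar>\<phi> x \<bullet> \<phi>' x v\<bar> \<le> norm (\<phi> x) * norm (\<phi>' x v)" by (rule Cauchy_Schwarz_ineq2)
      also have "\<dots> \<le> 1 * (B * norm v)" by (intro mult_mono le1 B) auto
      finally show "\<bar>\<phi> x \<bullet> \<phi>' x v\<bar> \<le> B * norm v" by simp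
    qed (use l m B(1) q0[of x] in auto)
    finally show ?thesis by (simp add: algebra_simps)
  qed
  have mean: "(\<integral>z. 2 * std_normal_density (W x \<bullet> z) * (W' x z \<bullet> z - W x \<bullet> x) \<partial>std_gauss) =
        sqrt (2 / pi) * l * (divergence \<phi> x - \<phi> x \<bullet> x)" for x
  proof -
    have "linear (W' x)" using dW by (rule has_derivative_linear)
    note hb = gauss_weight_quadratic_mean[OF this, of "W x" x]
    define Q where "Q = q x"
    define s where "s = \<phi> x \<bullet> \<phi> x"
    have Q: "Q > 0" "Q\<^sup>2 = 1 - l\<^sup>2 * s" using q0[of x] q2[of x] by (simp_all add: Q_def s_def)
    have "1 + (norm (W x))\<^sup>2 = 1 + l\<^sup>2 * s / Q\<^sup>2"
      unfolding power2_norm_eq_inner by (simp add: W_def Q_def s_def power2_eq_square)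
    also have "\<dots> = 1 / Q\<^sup>2" using Q(1) by (simp add: field_simps) (simp add: Q(2))
    finally have n: "1 + (norm (W x))\<^sup>2 = 1 / Q\<^sup>2" .
    have sq: "sqrt (1 + (norm (W x))\<^sup>2) = 1 / Q" unfolding n using Q(1) by (simp add: real_sqrt_divide)
    \<comment> \<open>The covariance correction cancels exactly the part of W' that comes from
      differentiating 1 / q; only l / Q times the derivative of \<phi> survives.\<close>
    have b: "W' x b \<bullet> b - (W x \<bullet> W' x b) * (W x \<bullet> b) / (1 + (norm (W x))\<^sup>2) = l / Q * (\<phi>' x b \<bullet> b)" for b
    proof -
      define a where "a = \<phi> x \<bullet> \<phi>' x b"
      define d where "d = \<phi> x \<bullet> b"
      have 1: "W' x b \<bullet> b = l / Q * (\<phi>' x b \<bullet> b) + l * l\<^sup>2 * a / Q ^ 3 * d"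
        by (simp add: W'_def inner_simps Q_def a_def d_def)
      have "W x \<bullet> W' x b = (l / Q) * (l / Q * a + l * l\<^sup>2 * a / Q ^ 3 * s)"
        by (simp add: W_def W'_def inner_simps Q_def a_def s_def add_divide_distrib algebra_simps)
      also have "\<dots> = l\<^sup>2 * a / Q ^ 4 * (Q\<^sup>2 + l\<^sup>2 * s)"
        using Q(1) by (simp add: field_simps power2_eq_square power3_eq_cube power4_eq_xxxx)
      also have "\<dots> = l\<^sup>2 * a / Q ^ 4" by (simp add: Q(2))
      finally have 2: "W x \<bullet> W' x b = l\<^sup>2 * a / Q ^ 4" .
      have 3: "W x \<bullet> b = l / Q * d" by (simp add: W_def Q_def d_def)
      show ?thesis unfolding 1 2 3 n using Q(1)
        by (simp add: field_simps power2_eq_square power3_eq_cube power4_eq_xxxx)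
    qed
    have "(\<integral>z. 2 * std_normal_density (W x \<bullet> z) * (W' x z \<bullet> z - W x \<bullet> x) \<partial>std_gauss) =
      sqrt (2 / pi) * (((\<Sum>b\<in>Basis. l / Q * (\<phi>' x b \<bullet> b)) - W x \<bullet> x) / (1 / Q))"
      using hb unfolding b sq by (simp add: has_bochner_integral_iff)
    also have "\<dots> = sqrt (2 / pi) * ((l / Q * divergence \<phi> x - l / Q * (\<phi> x \<bullet> x)) / (1 / Q))"
      by (simp add: divergence_def \<phi>'_def sum_distrib_left W_def Q_def)
    also have "sqrt (2 / pi) * ((l / Q * divergence \<phi> x - l / Q * (\<phi> x \<bullet> x)) / (1 / Q)) = sqrt (2 / pi) * l * (divergence \<phi> x - \<phi> x \<bullet> x)"
      using Q(1) by (simp add: left_diff_distrib right_diff_distrib)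
    finally show ?thesis .
  qed
  define C where "C = max (l / m) (l / m * B + l * l\<^sup>2 * B / m ^ 3)"
  show ?thesis
  proof (rule that[of W W' C])
    show "norm (W' x v) \<le> C * norm v" for x v
      by (rule order_trans[OF bW']) (auto simp: C_def intro!: mult_right_mono)
    show "norm (W x) \<le> C" for x by (rule order_trans[OF bW]) (simp add: C_def)
    show "W x = 0" if "x \<notin> K" for x using K(2)[OF that] by (simp add: W_def)
  qed (use dW mean in auto)
qed

lemma integral_gauss2_rotation:
  fixes F :: "'a::euclidean_space \<times> 'a \<Rightarrow> real"
  assumes F [measurable]: "F \<in> borel_measurable (borel \<Otimes>\<^sub>M borel)"
    and cs: "c\<^sup>2 + s\<^sup>2 = (1::real)" and c: "c \<noteq> -1"
  shows "(\<integral>p. F (c *\<^sub>R fst p + s *\<^sub>R snd p, c *\<^sub>R snd p - s *\<^sub>R fst p) \<partial>gauss2) = (\<integral>p. F p \<partial>gauss2)"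
proof -
  have "(\<integral>p. F p \<partial>gauss2) = (\<integral>p. F p \<partial>(distr gauss2 (borel \<Otimes>\<^sub>M borel) (\<lambda>p::'a \<times> 'a. (c *\<^sub>R fst p + s *\<^sub>R snd p, c *\<^sub>R snd p - s *\<^sub>R fst p))))"
    by (simp add: distr_gauss2_rotation[OF cs c])
  also have "\<dots> = (\<integral>p. F (c *\<^sub>R fst p + s *\<^sub>R snd p, c *\<^sub>R snd p - s *\<^sub>R fst p) \<partial>gauss2)"
    by (rule integral_distr) measurable
  finally show ?thesis by simp
qed

text \<open>Both directions are counted, into E and out of E; \<open>rotation_flip_le\<close> shows
  that they have the same share, up to far pairs.\<close>

definition rotation_flip :: "real \<Rightarrow> 'a::euclidean_space set \<Rightarrow> 'a set \<Rightarrow> ('a \<times> 'a) set" where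
  "rotation_flip \<theta> K E = {p. fst p \<in> K \<and> (fst p \<in> E) \<noteq> (cos \<theta> *\<^sub>R fst p + sin \<theta> *\<^sub>R snd p \<in> E)}"

lemma rotation_flip_sets [measurable]:
  fixes E K :: "'a::euclidean_space set"
  assumes [measurable]: "E \<in> sets borel" "K \<in> sets borel"
  shows "rotation_flip \<theta> K E \<in> sets (borel \<Otimes>\<^sub>M borel)"
proof -
  have "{p \<in> space (borel \<Otimes>\<^sub>M borel). fst p \<in> K \<and> (fst p \<in> E) \<noteq> (cos \<theta> *\<^sub>R fst p + sin \<theta> *\<^sub>R snd p \<in> E)} \<in> sets (borel \<Otimes>\<^sub>M (borel :: 'a measure))"
    by measurable
  then show ?thesis by (simp add: space_pair_measure rotation_flip_def)
qed

text \<open>By contradiction, since \<open>field_flow_limit\<close> speaks of sequences: failing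
  angles tending to 0 would give l * sqrt (2 / pi) * V \<le> sqrt (2 / pi) * V - \<eta> for every l
  < 1, which is false as l tends to 1.\<close>

lemma rotation_flip_lower_bound:
  fixes \<phi> :: "'a::euclidean_space \<Rightarrow> 'a" and E :: "'a set"
  assumes \<phi>: "C_k (Suc 0) \<phi>" and K: "compact K" "\<And>x. x \<notin> K \<Longrightarrow> \<phi> x = 0" and le1: "\<And>x. norm (\<phi> x) \<le> 1"
    and E[measurable]: "E \<in> sets borel" and \<eta>: "\<eta> > 0"
  shows "\<exists>\<delta>>0. \<forall>\<theta>. 0 < \<theta> \<longrightarrow> \<theta> < \<delta> \<longrightarrow>
     \<theta> * (sqrt (2 / pi) * (\<integral>x. indicator E x * (divergence \<phi> x - \<phi> x \<bullet> x) \<partial>std_gauss) - \<eta>)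
      \<le> measure gauss2 (rotation_flip \<theta> K E)"
proof (rule ccontr)
  define V where "V = (\<integral>x. indicator E x * (divergence \<phi> x - \<phi> x \<bullet> x) \<partial>std_gauss)"
  have [measurable]: "K \<in> sets borel" using K(1) by (simp add: compact_imp_closed)
  assume "\<not> ?thesis"
  then have *: "\<exists>\<theta>. 0 < \<theta> \<and> \<theta> < \<delta> \<and> measure gauss2 (rotation_flip \<theta> K E) < \<theta> * (sqrt (2 / pi) * V - \<eta>)" if "\<delta> > 0" for \<delta>
    using that unfolding V_def by (meson not_le)
  have "\<exists>\<theta>. 0 < \<theta> \<and> \<theta> < inverse (real (Suc n)) \<and> measure gauss2 (rotation_flip \<theta> K E) < \<theta> * (sqrt (2 / pi) * V - \<eta>)" for n
    by (rule *) simp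
  then obtain \<theta> where \<theta>: "\<And>n. 0 < \<theta> n" "\<And>n. \<theta> n < inverse (real (Suc n))"
    "\<And>n. measure gauss2 (rotation_flip (\<theta> n) K E) < \<theta> n * (sqrt (2 / pi) * V - \<eta>)"
    by metis
  have \<theta>0: "\<theta> \<longlonglongrightarrow> 0"
    by (rule tendsto_sandwich[OF _ _ tendsto_const LIMSEQ_inverse_real_of_nat]) (intro always_eventually allI less_imp_le \<theta>)+
  have \<theta>1: "\<theta> n < 1" for n
    by (rule less_le_trans[OF \<theta>(2)]) (simp add: inverse_eq_divide)
  have cos1: "cos (\<theta> n) \<noteq> -1" for n
    using cos_gt_zero_pi[of "\<theta> n"] \<theta>(1)[of n] \<theta>1[of n] pi_gt3 by auto
  have key: "sqrt (2 / pi) * l * V \<le> sqrt (2 / pi) * V - \<eta>" if l: "0 < l" "l < 1" for l :: real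
  proof -
    obtain W W' B where W: "\<And>x. (W has_derivative W' x) (at x)" "\<And>x v. norm (W' x v) \<le> B * norm v" "\<And>x. norm (W x) \<le> B"
      "\<And>x. x \<notin> K \<Longrightarrow> W x = 0"
      "\<And>x. (\<integral>z. 2 * std_normal_density (W x \<bullet> z) * (W' x z \<bullet> z - W x \<bullet> x) \<partial>std_gauss) =
          sqrt (2 / pi) * l * (divergence \<phi> x - \<phi> x \<bullet> x)"
      by (rule field_flow_mean[OF \<phi> K le1 l]) (assumption, rule that)
    obtain \<sigma> :: "real \<Rightarrow> real" where \<sigma>: "\<And>u. (\<sigma> has_real_derivative 2 * std_normal_density u) (at u)" "\<sigma> 0 = 0" "\<And>u. \<bar>\<sigma> u\<bar> \<le> 1"
      by (rule gauss_sign_exists) (rule that)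
    define f where "f r p = \<sigma> (W (cos r *\<^sub>R fst p + sin r *\<^sub>R snd p) \<bullet> (cos r *\<^sub>R snd p - sin r *\<^sub>R fst p))" for r and p :: "'a \<times> 'a"
    define D where "D p = 2 * std_normal_density (W (fst p) \<bullet> snd p) * (W' (fst p) (snd p) \<bullet> snd p - W (fst p) \<bullet> fst p)" for p
    note lim = field_flow_limit[OF W(1-3) \<sigma>(1) \<theta>0 \<theta>(1) E, folded f_def D_def]
    have "(\<integral>p. indicator E (fst p) * D p \<partial>gauss2) = (\<integral>x. \<integral>z. indicator E x * D (x, z) \<partial>std_gauss \<partial>std_gauss)"
      using std_gauss_pair.integral_fst'[OF lim(1)] by simp
    also have "\<dots> = (\<integral>x. indicator E x * (sqrt (2 / pi) * l * (divergence \<phi> x - \<phi> x \<bullet> x)) \<partial>std_gauss)"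
      by (simp add: D_def W(5))
    also have "\<dots> = sqrt (2 / pi) * l * V"
      unfolding V_def by (subst integral_mult_right_zero[symmetric]) (simp add: mult_ac)
    finally have DV: "(\<integral>p. indicator E (fst p) * D p \<partial>gauss2) = sqrt (2 / pi) * l * V" .
    have cW: "continuous_on UNIV W"
      using W(1) by (meson continuous_at_imp_continuous_on has_derivative_continuous)
    then have [measurable]: "W \<in> borel_measurable borel" by (rule borel_measurable_continuous_onI)
    have "continuous_on UNIV \<sigma>" using \<sigma>(1) DERIV_isCont continuous_at_imp_continuous_on by blast
    then have [measurable]: "\<sigma> \<in> borel_measurable borel" by (rule borel_measurable_continuous_onI)
    have [measurable]: "f r \<in> borel_measurable (borel \<Otimes>\<^sub>M borel)" for r unfolding f_def by measurable
    have f1: "\<bar>f r p\<bar> \<le> 1" for r p unfolding f_def by (rule \<sigma>(3))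
    have "(\<integral>p. indicator E (fst p) * ((f 0 p - f (- \<theta> n) p) / \<theta> n) \<partial>gauss2) \<le> sqrt (2 / pi) * V - \<eta>" for n
    proof -
      let ?c = "cos (\<theta> n)" and ?s = "sin (\<theta> n)"
      have i: "integrable gauss2 g" if "g \<in> borel_measurable (borel \<Otimes>\<^sub>M borel)" "\<And>p. \<bar>g p\<bar> \<le> 1" for g :: "'a \<times> 'a \<Rightarrow> real"
        by (rule std_gauss_pair.P.integrable_const_bound[of _ 1]) (use that in auto)
      have i1: "integrable gauss2 (\<lambda>p. indicator E (fst p) * f r p)" for r
        by (rule i) (use f1 in \<open>auto simp: indicator_def\<close>)
      have i2: "integrable gauss2 (\<lambda>p. indicator E (?c *\<^sub>R fst p + ?s *\<^sub>R snd p) * f 0 p)"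
        by (rule i) (use f1 in \<open>auto simp: indicator_def\<close>)
      \<comment> \<open>Invariance under rotation by - \<theta> n: the difference of the test
        function at two angles, at one indicator, becomes the difference of the indicator at X and
        at the rotated point, with the test function at angle 0.\<close>
      have "(\<integral>p. (\<lambda>q. indicator E (?c *\<^sub>R fst q + ?s *\<^sub>R snd q) * f 0 q) (?c *\<^sub>R fst p + (- ?s) *\<^sub>R snd p, ?c *\<^sub>R snd p - (- ?s) *\<^sub>R fst p) \<partial>gauss2)
         = (\<integral>p. indicator E (?c *\<^sub>R fst p + ?s *\<^sub>R snd p) * f 0 p \<partial>gauss2)"
        by (rule integral_gauss2_rotation) (use cos1 in auto)
      moreover have "?c *\<^sub>R (?c *\<^sub>R x + (- ?s) *\<^sub>R z) + ?s *\<^sub>R (?c *\<^sub>R z - (- ?s) *\<^sub>R x) = x" for x z :: 'a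
      proof -
        have "c *\<^sub>R (c *\<^sub>R x + (- s) *\<^sub>R z) + s *\<^sub>R (c *\<^sub>R z - (- s) *\<^sub>R x) = (c\<^sup>2 + s\<^sup>2) *\<^sub>R x" for c s :: real
          by (simp add: algebra_simps power2_eq_square)
        from this[of ?c ?s] show ?thesis by simp
      qed
      ultimately have rot: "(\<integral>p. indicator E (fst p) * f (- \<theta> n) p \<partial>gauss2) = (\<integral>p. indicator E (?c *\<^sub>R fst p + ?s *\<^sub>R snd p) * f 0 p \<partial>gauss2)"
        by (simp add: f_def)
      have "(\<integral>p. indicator E (fst p) * ((f 0 p - f (- \<theta> n) p) / \<theta> n) \<partial>gauss2)
        = ((\<integral>p. indicator E (fst p) * f 0 p \<partial>gauss2) - (\<integral>p. indicator E (fst p) * f (- \<theta> n) p \<partial>gauss2)) / \<theta> n"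
        by (subst Bochner_Integration.integral_diff[OF i1 i1, symmetric]) (simp add: right_diff_distrib)
      also have "\<dots> = (\<integral>p. (indicator E (fst p) - indicator E (?c *\<^sub>R fst p + ?s *\<^sub>R snd p)) * f 0 p \<partial>gauss2) / \<theta> n"
        unfolding rot by (subst Bochner_Integration.integral_diff[OF i1 i2, symmetric]) (simp add: left_diff_distrib)
      also have "\<dots> \<le> (\<integral>p. indicator (rotation_flip (\<theta> n) K E) p \<partial>gauss2) / \<theta> n"
      proof (intro divide_right_mono integral_mono)
        show "integrable gauss2 (\<lambda>p. (indicator E (fst p) - indicator E (?c *\<^sub>R fst p + ?s *\<^sub>R snd p)) * f 0 p)"
          unfolding left_diff_distrib by (intro Bochner_Integration.integrable_diff i1 i2)
        show "integrable gauss2 (indicat_real (rotation_flip (\<theta> n) K E))"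
          by (rule i) (auto simp: indicator_def)
        \<comment> \<open>The test function is bounded by 1 and vanishes for starting points outside
          K, and the two indicators differ only on a flip.\<close>
        show "(indicator E (fst p) - indicator E (?c *\<^sub>R fst p + ?s *\<^sub>R snd p)) * f 0 p \<le> indicat_real (rotation_flip (\<theta> n) K E) p" for p
        proof (cases "fst p \<in> K")
          case True
          then show ?thesis using f1[of 0 p] by (auto simp: indicator_def rotation_flip_def)
        next
          case False
          then have "f 0 p = 0" using W(4)[OF False] \<sigma>(2) by (simp add: f_def)
          then show ?thesis by simp
        qed
      qed (use \<theta>(1)[of n] in simp)
      also have "\<dots> = measure gauss2 (rotation_flip (\<theta> n) K E) / \<theta> n" by simp
      also have "\<dots> \<le> sqrt (2 / pi) * V - \<eta>"
        using \<theta>(1)[of n] \<theta>(3)[of n] by (simp add: divide_le_eq mult.commute less_imp_le)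
      finally show ?thesis .
    qed
    with lim(2) show ?thesis unfolding DV by (intro LIMSEQ_le_const2) auto
  qed
  \<comment> \<open>The value l = 1 itself is not allowed, since q could vanish where |\<phi>| = 1;
    the inequality is only carried over in the limit.\<close>
  have "((\<lambda>l. sqrt (2 / pi) * l * V) \<longlongrightarrow> sqrt (2 / pi) * 1 * V) (at_left 1)" by (intro tendsto_intros)
  moreover have "eventually (\<lambda>l. sqrt (2 / pi) * l * V \<le> sqrt (2 / pi) * V - \<eta>) (at_left (1::real))"
    by (rule eventually_mono[OF eventually_at_left_real[of 0 1]]) (auto intro: key)
  ultimately have "sqrt (2 / pi) * 1 * V \<le> sqrt (2 / pi) * V - \<eta>"
    by (rule tendsto_upperbound) simp
  with \<eta> show False by simp
qed

section \<open>The liminf inequality\<close>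

definition rot_fst :: "real \<Rightarrow> 'a::euclidean_space \<times> 'a \<Rightarrow> 'a" where
  "rot_fst \<theta> p = cos \<theta> *\<^sub>R fst p + sin \<theta> *\<^sub>R snd p"

text \<open>The real-valued \<open>gauss_joint\<close> at correlation cos \<theta>. Angles add up
  when rotations are composed, and the subdivision into equal steps relies on that.\<close>

definition rot_joint :: "real \<Rightarrow> 'a::euclidean_space set \<Rightarrow> 'a set \<Rightarrow> real" where
  "rot_joint \<theta> A B = measure gauss2 {p. fst p \<in> A \<and> rot_fst \<theta> p \<in> B}"

text \<open>Exceptional pairs. A rotation by an angle up to \<theta> moves X by at most \<theta>
  (|X| + |Z|); so outside this event with a = d / \<theta> the moving point stays within distance d
  of its start.\<close>

definition gauss_far :: "'a::euclidean_space itself \<Rightarrow> real \<Rightarrow> real" where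
  "gauss_far _ a = measure gauss2 {p :: 'a \<times> 'a. norm (fst p) + norm (snd p) \<ge> a}"

lemma rot_fst_measurable [measurable]: "rot_fst \<theta> \<in> borel \<Otimes>\<^sub>M borel \<rightarrow>\<^sub>M borel"
  unfolding rot_fst_def by measurable

lemma rot_fst_0 [simp]: "rot_fst 0 p = fst p"
  by (simp add: rot_fst_def)

lemma rot_joint_set [measurable]:
  fixes A B :: "'a::euclidean_space set"
  assumes [measurable]: "A \<in> sets borel" "B \<in> sets borel"
  shows "{p. rot_fst \<alpha> p \<in> A \<and> rot_fst \<theta> p \<in> B} \<in> sets (borel \<Otimes>\<^sub>M borel)"
proof -
  have "{p \<in> space (borel \<Otimes>\<^sub>M borel). rot_fst \<alpha> p \<in> A \<and> rot_fst \<theta> p \<in> B} \<in> sets (borel \<Otimes>\<^sub>M (borel :: 'a measure))"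
    by measurable
  then show ?thesis by (simp add: space_pair_measure)
qed

lemma rot_fst_set [measurable]:
  fixes B :: "'a::euclidean_space set"
  assumes "B \<in> sets borel"
  shows "{p. rot_fst \<theta> p \<in> B} \<in> sets (borel \<Otimes>\<^sub>M borel)"
  using rot_joint_set[OF _ assms, of UNIV 0 \<theta>] by simp

lemma gauss_far_set [measurable]:
  "{p :: 'a::euclidean_space \<times> 'a. norm (fst p) + norm (snd p) \<ge> a} \<in> sets (borel \<Otimes>\<^sub>M borel)"
proof -
  have "{p \<in> space (borel \<Otimes>\<^sub>M (borel :: 'a measure)). norm (fst p) + norm (snd p) \<ge> a} \<in> sets (borel \<Otimes>\<^sub>M (borel :: 'a measure))"
    by measurable
  then show ?thesis by (simp add: space_pair_measure)
qed

lemma gauss_joint_cos: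
  assumes "0 \<le> \<theta>" "\<theta> \<le> pi"
  shows "gauss_joint (cos \<theta>) A B = ennreal (rot_joint \<theta> A B)"
proof -
  have "sqrt (1 - (cos \<theta>)\<^sup>2) = sin \<theta>"
    using sin_ge_zero[OF assms] by (simp add: sin_squared_eq[symmetric])
  then show ?thesis
    unfolding gauss_joint_def rot_joint_def rot_fst_def
    by (simp add: std_gauss_pair.P.emeasure_eq_measure)
qed

lemma rot_joint_commute:
  assumes "A \<in> sets borel" "B \<in> sets borel" "0 \<le> \<theta>" "\<theta> \<le> pi"
  shows "rot_joint \<theta> A B = rot_joint \<theta> B A"
proof -
  have "ennreal (rot_joint \<theta> A B) = ennreal (rot_joint \<theta> B A)"
    using gauss_joint_commute[OF assms(1,2), of "cos \<theta>"] assms(3,4) by (simp add: gauss_joint_cos)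
  then show ?thesis by (simp add: rot_joint_def)
qed

text \<open>Stationarity: the points at angles \<alpha> and \<alpha> + \<theta> have the joint law
  of those at 0 and \<theta>. The bound \<alpha> < pi avoids the excluded case cos \<alpha> =
  -1.\<close>

lemma measure_rotate:
  fixes A B :: "'a::euclidean_space set"
  assumes [measurable]: "A \<in> sets borel" "B \<in> sets borel" and \<alpha>: "0 \<le> \<alpha>" "\<alpha> < pi"
  shows "measure gauss2 {p. rot_fst \<alpha> p \<in> A \<and> rot_fst (\<alpha> + \<theta>) p \<in> B} = rot_joint \<theta> A B"
proof -
  let ?R = "\<lambda>p::'a \<times> 'a. (cos \<alpha> *\<^sub>R fst p + sin \<alpha> *\<^sub>R snd p, cos \<alpha> *\<^sub>R snd p - sin \<alpha> *\<^sub>R fst p)"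
  have c: "cos \<alpha> \<noteq> -1"
    using cos_monotone_0_pi[of \<alpha> pi] \<alpha> by (cases "\<alpha> = 0") auto
  have r: "rot_fst \<theta> (?R p) = rot_fst (\<alpha> + \<theta>) p" for p
    by (simp add: rot_fst_def cos_add sin_add algebra_simps)
  have m: "{p. fst p \<in> A \<and> rot_fst \<theta> p \<in> B} \<in> sets (borel \<Otimes>\<^sub>M borel)"
    using rot_joint_set[OF assms(1,2), of 0 \<theta>] by simp
  have "rot_joint \<theta> A B = measure (distr gauss2 (borel \<Otimes>\<^sub>M borel) ?R) {p. fst p \<in> A \<and> rot_fst \<theta> p \<in> B}"
    unfolding rot_joint_def by (subst distr_gauss2_rotation) (use c in auto)
  also have "\<dots> = measure gauss2 (?R -` {p. fst p \<in> A \<and> rot_fst \<theta> p \<in> B} \<inter> space gauss2)"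
    by (rule measure_distr) (use m in measurable)
  also have "?R -` {p. fst p \<in> A \<and> rot_fst \<theta> p \<in> B} \<inter> space gauss2 = {p. rot_fst \<alpha> p \<in> A \<and> rot_fst (\<alpha> + \<theta>) p \<in> B}"
    using r by (auto simp: rot_fst_def[of \<alpha>])
  finally show ?thesis by simp
qed

lemma measure_gauss2_fst:
  fixes A :: "'a::euclidean_space set"
  assumes [measurable]: "A \<in> sets borel"
  shows "measure gauss2 {p. fst p \<in> A} = measure std_gauss A"
proof -
  have "{p. fst p \<in> A} = A \<times> (UNIV :: 'a set)" by auto
  then have "emeasure gauss2 {p. fst p \<in> A} = emeasure std_gauss A"
    using std_gauss.emeasure_pair_measure_Times[of A std_gauss "UNIV :: 'a set"] by simp
  then show ?thesis by (simp add: measure_def)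
qed

lemma measure_rot_fst:
  fixes A :: "'a::euclidean_space set"
  assumes [measurable]: "A \<in> sets borel" and \<alpha>: "0 \<le> \<alpha>" "\<alpha> < pi"
  shows "measure gauss2 {p. rot_fst \<alpha> p \<in> A} = measure std_gauss A"
  using measure_rotate[OF assms(1) _ \<alpha>, of UNIV 0] measure_gauss2_fst[OF assms(1)]
  by (simp add: rot_joint_def)

lemma norm_rot_fst_diff:
  assumes "\<theta> \<ge> 0"
  shows "norm (rot_fst \<theta> p - fst p) \<le> \<theta> * (norm (fst p) + norm (snd p))"
proof -
  have "1 - cos \<theta> = 2 * (sin (\<theta> / 2))\<^sup>2"
    using cos_double_sin[of "\<theta> / 2"] by simp
  also have "\<dots> \<le> 2 * \<bar>sin (\<theta> / 2)\<bar>"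
  proof -
    have "(sin (\<theta> / 2))\<^sup>2 = \<bar>sin (\<theta> / 2)\<bar> * \<bar>sin (\<theta> / 2)\<bar>" by (simp add: power2_eq_square)
    also have "\<dots> \<le> \<bar>sin (\<theta> / 2)\<bar> * 1" by (rule mult_left_mono) auto
    finally show ?thesis by simp
  qed
  also have "\<dots> \<le> \<theta>" using abs_sin_x_le_abs_x[of "\<theta> / 2"] assms by simp
  finally have c: "1 - cos \<theta> \<le> \<theta>" .
  have "rot_fst \<theta> p - fst p = (cos \<theta> - 1) *\<^sub>R fst p + sin \<theta> *\<^sub>R snd p"
    by (simp add: rot_fst_def algebra_simps)
  also have "norm \<dots> \<le> \<bar>cos \<theta> - 1\<bar> * norm (fst p) + \<bar>sin \<theta>\<bar> * norm (snd p)"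
    by (rule order_trans[OF norm_triangle_ineq]) simp
  also have "\<dots> \<le> \<theta> * norm (fst p) + \<theta> * norm (snd p)"
    using c abs_sin_x_le_abs_x[of \<theta>] assms by (intro add_mono mult_right_mono) auto
  finally show ?thesis by (simp add: algebra_simps)
qed

text \<open>Markov's inequality with second moments. For a = d / \<theta> the bound is C *
  \<theta>^2 / d^2, of smaller order than the crossing probabilities, which are of order
  \<theta>.\<close>

lemma gauss_far_bound:
  obtains C where "C > 0" "\<And>a. a > 0 \<Longrightarrow> gauss_far TYPE('a::euclidean_space) a \<le> C / a\<^sup>2"
proof -
  define u where "u p = 2 * (1 + (norm (fst p))\<^sup>2 + (norm (snd p))\<^sup>2)" for p :: "'a \<times> 'a"
  have i: "integrable gauss2 u" unfolding u_def by (rule integrable_gauss2_norms)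
  have u0: "u p \<ge> 0" for p by (simp add: u_def)
  define C where "C = (\<integral>p. u p \<partial>gauss2) + 1"
  have C: "C > 0" unfolding C_def using u0 by (intro add_nonneg_pos integral_nonneg) auto
  have "gauss_far TYPE('a) a \<le> C / a\<^sup>2" if a: "a > 0" for a
  proof -
    have "gauss_far TYPE('a) a \<le> measure gauss2 {p \<in> space gauss2. a\<^sup>2 \<le> u p}"
      unfolding gauss_far_def
    proof (rule std_gauss_pair.P.finite_measure_mono)
      show "{p :: 'a \<times> 'a. a \<le> norm (fst p) + norm (snd p)} \<subseteq> {p \<in> space gauss2. a\<^sup>2 \<le> u p}"
      proof clarsimp
        fix x y :: 'a assume "a \<le> norm x + norm y"
        then have "a\<^sup>2 \<le> (norm x + norm y)\<^sup>2" using a by (intro power_mono) auto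
        also have "\<dots> \<le> 2 * ((norm x)\<^sup>2 + (norm y)\<^sup>2)"
          using sum_squares_bound[of "norm x" "norm y"] by (simp add: power2_sum)
        finally show "a\<^sup>2 \<le> u (x, y)" by (simp add: u_def)
      qed
      have [measurable]: "u \<in> borel_measurable gauss2" using i by (rule borel_measurable_integrable)
      show "{p \<in> space gauss2. a\<^sup>2 \<le> u p} \<in> sets gauss2" by measurable
    qed
    also have "\<dots> \<le> (\<integral>p. u p \<partial>gauss2) / a\<^sup>2"
      by (rule integral_Markov_inequality_measure[OF i, of "{}"]) (use u0 a in auto)
    also have "\<dots> \<le> C / a\<^sup>2" by (intro divide_right_mono) (auto simp: C_def)
    finally show ?thesis .
  qed
  with C show ?thesis by (rule that)
qed

lemma rot_joint_nonneg [simp]: "rot_joint \<theta> A B \<ge> 0"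
  by (simp add: rot_joint_def)

lemma rot_joint_set' [measurable]:
  fixes A B :: "'a::euclidean_space set"
  assumes "A \<in> sets borel" "B \<in> sets borel"
  shows "{p. fst p \<in> A \<and> rot_fst \<theta> p \<in> B} \<in> sets (borel \<Otimes>\<^sub>M borel)"
  using rot_joint_set[OF assms, of 0 \<theta>] by simp

lemma rot_fst_not_far:
  assumes "\<not> norm (fst p) + norm (snd p) \<ge> d / r" "0 \<le> \<theta>" "\<theta> \<le> r" "r > 0"
  shows "dist (fst p) (rot_fst \<theta> p) < d"
proof -
  have "norm (rot_fst \<theta> p - fst p) \<le> r * (norm (fst p) + norm (snd p))"
    by (rule order_trans[OF norm_rot_fst_diff[OF assms(2)]]) (use assms(3) in \<open>auto intro: mult_right_mono\<close>)
  also have "\<dots> < r * (d / r)" using assms(1,4) by (intro mult_strict_left_mono) auto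
  finally show ?thesis using assms(4) by (simp add: dist_norm norm_minus_commute)
qed

text \<open>Unless the pair is far, a flip that starts in K has both ends in
  \<open>\<Omega>'\<close>. The two directions are equally likely by
  \<open>rot_joint_commute\<close>, hence the factor 2.\<close>

lemma rotation_flip_le:
  fixes E K \<Omega>' :: "'a::euclidean_space set"
  assumes [measurable]: "E \<in> sets borel" "\<Omega>' \<in> sets borel"
    and K: "\<And>x y. x \<in> K \<Longrightarrow> dist x y < d \<Longrightarrow> y \<in> \<Omega>'" and \<theta>: "0 < \<theta>" "\<theta> \<le> pi" and d: "d > 0"
  shows "measure gauss2 (rotation_flip \<theta> K E) \<le> 2 * rot_joint \<theta> (E \<inter> \<Omega>') (- E \<inter> \<Omega>') + gauss_far TYPE('a) (d / \<theta>)"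
proof -
  let ?S = "{p. fst p \<in> E \<inter> \<Omega>' \<and> rot_fst \<theta> p \<in> - E \<inter> \<Omega>'}" and ?T = "{p. fst p \<in> - E \<inter> \<Omega>' \<and> rot_fst \<theta> p \<in> E \<inter> \<Omega>'}"
  let ?F = "{p :: 'a \<times> 'a. norm (fst p) + norm (snd p) \<ge> d / \<theta>}"
  have s: "?S \<in> sets gauss2" "?T \<in> sets gauss2" "?F \<in> sets gauss2"
    by (auto simp only: sets_gauss2 intro!: rot_joint_set' gauss_far_set) auto
  have "rotation_flip \<theta> K E \<subseteq> (?S \<union> ?T) \<union> ?F"
  proof
    fix p assume p: "p \<in> rotation_flip \<theta> K E"
    show "p \<in> (?S \<union> ?T) \<union> ?F"
    proof (cases "p \<in> ?F")
      case False
      then have "dist (fst p) (rot_fst \<theta> p) < d" using rot_fst_not_far[of d \<theta> p \<theta>] \<theta>(1) by simp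
      moreover have "fst p \<in> K" using p by (simp add: rotation_flip_def)
      ultimately have "rot_fst \<theta> p \<in> \<Omega>'" "fst p \<in> \<Omega>'" using K d by auto
      then show ?thesis using p by (auto simp: rotation_flip_def rot_fst_def)
    qed simp
  qed
  then have "measure gauss2 (rotation_flip \<theta> K E) \<le> measure gauss2 ((?S \<union> ?T) \<union> ?F)"
    by (rule std_gauss_pair.P.finite_measure_mono) (intro sets.Un s)
  also have "\<dots> \<le> (measure gauss2 ?S + measure gauss2 ?T) + measure gauss2 ?F"
    by (intro order_trans[OF measure_Un_le] add_right_mono measure_Un_le sets.Un s)
  also have "measure gauss2 ?T = measure gauss2 ?S"
    using rot_joint_commute[of "- E \<inter> \<Omega>'" "E \<inter> \<Omega>'" \<theta>] \<theta> by (simp add: rot_joint_def)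
  finally show ?thesis by (simp add: rot_joint_def gauss_far_def)
qed

text \<open>A rotation path from \<open>F\<close> to its complement, cut into \<open>m\<close> equal steps, crosses in some step.\<close>

lemma rot_joint_subadditive:
  fixes F \<Omega> \<Omega>' :: "'a::euclidean_space set"
  assumes [measurable]: "F \<in> sets borel" "\<Omega> \<in> sets borel" "\<Omega>' \<in> sets borel"
    and \<Omega>': "\<And>x y. x \<in> \<Omega>' \<Longrightarrow> dist x y < d \<Longrightarrow> y \<in> \<Omega>" and \<theta>: "0 < \<theta>" "real m * \<theta> \<le> pi" and m: "m > 0" and d: "d > 0"
  shows "rot_joint (real m * \<theta>) (F \<inter> \<Omega>') (- F \<inter> \<Omega>') \<le> real m * rot_joint \<theta> (F \<inter> \<Omega>) (- F \<inter> \<Omega>) + gauss_far TYPE('a) (d / (real m * \<theta>))"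
proof -
  let ?A = "\<lambda>i. {p. rot_fst (real i * \<theta>) p \<in> F \<inter> \<Omega> \<and> rot_fst (real i * \<theta> + \<theta>) p \<in> - F \<inter> \<Omega>}"
  let ?F = "{p :: 'a \<times> 'a. norm (fst p) + norm (snd p) \<ge> d / (real m * \<theta>)}"
  have s: "?A i \<in> sets gauss2" "?F \<in> sets gauss2" for i
    by (auto simp only: sets_gauss2 intro!: rot_joint_set gauss_far_set) auto
  \<comment> \<open>By stationarity all steps have the same crossing probability; i < m keeps the
    initial angle of the step below pi.\<close>
  have mA: "measure gauss2 (?A i) = rot_joint \<theta> (F \<inter> \<Omega>) (- F \<inter> \<Omega>)" if "i < m" for i
  proof (rule measure_rotate)
    have "real i * \<theta> < real m * \<theta>" using that \<theta>(1) by simp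
    then show "real i * \<theta> < pi" using \<theta>(2) by linarith
  qed (use \<theta> in auto)
  have "{p. fst p \<in> F \<inter> \<Omega>' \<and> rot_fst (real m * \<theta>) p \<in> - F \<inter> \<Omega>'} \<subseteq> (\<Union>i\<in>{..<m}. ?A i) \<union> ?F"
  proof
    fix p assume p: "p \<in> {p. fst p \<in> F \<inter> \<Omega>' \<and> rot_fst (real m * \<theta>) p \<in> - F \<inter> \<Omega>'}"
    show "p \<in> (\<Union>i\<in>{..<m}. ?A i) \<union> ?F"
    proof (cases "p \<in> ?F")
      case False
      \<comment> \<open>A path that is not far remains within d of its start in
        \<open>\<Omega>'\<close>, so all its division points lie in \<Omega> and the crossing step
        is one that counts.\<close>
      have in\<Omega>: "rot_fst (real i * \<theta>) p \<in> \<Omega>" if "i \<le> m" for i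
      proof -
        have "real i * \<theta> \<le> real m * \<theta>" using that \<theta>(1) by simp
        then have "dist (fst p) (rot_fst (real i * \<theta>) p) < d"
          using False \<theta>(1) m by (intro rot_fst_not_far[of d "real m * \<theta>"]) auto
        then show ?thesis using \<Omega>' p by auto
      qed
      have "\<exists>i<m. rot_fst (real i * \<theta>) p \<in> F \<and> rot_fst (real (Suc i) * \<theta>) p \<notin> F"
      proof (rule ccontr)
        assume *: "\<not> ?thesis"
        have "i \<le> m \<longrightarrow> rot_fst (real i * \<theta>) p \<in> F" for i
          by (induction i) (use * p in auto)
        then show False using p by auto
      qed
      then obtain i where i: "i < m" "rot_fst (real i * \<theta>) p \<in> F" "rot_fst (real (Suc i) * \<theta>) p \<notin> F" by blast
      have e: "real (Suc i) * \<theta> = real i * \<theta> + \<theta>" by (simp add: algebra_simps)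
      have "p \<in> ?A i" using i(2,3) in\<Omega>[of i] in\<Omega>[of "Suc i"] i(1) unfolding e by auto
      then show ?thesis using i(1) by blast
    qed simp
  qed
  then have "rot_joint (real m * \<theta>) (F \<inter> \<Omega>') (- F \<inter> \<Omega>') \<le> measure gauss2 ((\<Union>i\<in>{..<m}. ?A i) \<union> ?F)"
    unfolding rot_joint_def by (rule std_gauss_pair.P.finite_measure_mono) (intro sets.Un s sets.finite_UN finite_lessThan)
  also have "\<dots> \<le> measure gauss2 (\<Union>i\<in>{..<m}. ?A i) + measure gauss2 ?F"
    by (intro measure_Un_le s sets.finite_UN finite_lessThan)
  also have "measure gauss2 (\<Union>i\<in>{..<m}. ?A i) \<le> (\<Sum>i\<in>{..<m}. measure gauss2 (?A i))"
    by (intro measure_UNION_le s finite_lessThan)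
  also have "\<dots> = real m * rot_joint \<theta> (F \<inter> \<Omega>) (- F \<inter> \<Omega>)"
    using mA by simp
  finally show ?thesis by (simp add: gauss_far_def)
qed

text \<open>The error does not shrink with \<theta>. A comparison of two sets is therefore useful
  only at angles bounded below, and the passage from F n to E is confined to one dyadic
  interval.\<close>

lemma rot_joint_sym_diff:
  fixes E F A :: "'a::euclidean_space set"
  assumes [measurable]: "E \<in> sets borel" "F \<in> sets borel" "A \<in> sets borel" and \<theta>: "0 \<le> \<theta>" "\<theta> < pi"
  shows "rot_joint \<theta> (E \<inter> A) (- E \<inter> A) \<le> rot_joint \<theta> (F \<inter> A) (- F \<inter> A) + 2 * measure std_gauss ((F - E) \<union> (E - F))"
proof -
  let ?D = "(F - E) \<union> (E - F)"
  let ?P = "{p. fst p \<in> F \<inter> A \<and> rot_fst \<theta> p \<in> - F \<inter> A}" and ?Q = "{p. fst p \<in> ?D}" and ?R = "{p. rot_fst \<theta> p \<in> ?D}"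
  have s: "?P \<in> sets gauss2" "?R \<in> sets gauss2"
    by (auto simp only: sets_gauss2 intro!: rot_joint_set' rot_fst_set) auto
  have s2: "?Q \<in> sets gauss2" using rot_fst_set[of ?D 0] by (simp add: sets_gauss2)
  have "rot_joint \<theta> (E \<inter> A) (- E \<inter> A) \<le> measure gauss2 ((?P \<union> ?Q) \<union> ?R)"
    unfolding rot_joint_def by (rule std_gauss_pair.P.finite_measure_mono) (use s s2 in auto)
  also have "\<dots> \<le> (measure gauss2 ?P + measure gauss2 ?Q) + measure gauss2 ?R"
    by (intro order_trans[OF measure_Un_le] add_right_mono measure_Un_le sets.Un s s2)
  also have "measure gauss2 ?Q = measure std_gauss ?D" by (rule measure_gauss2_fst) measurable
  also have "measure gauss2 ?R = measure std_gauss ?D" by (rule measure_rot_fst) (use \<theta> in auto)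
  finally show ?thesis by (simp add: rot_joint_def)
qed

lemma borel_measurable_rot_joint [measurable]:
  fixes A B :: "'a::euclidean_space set"
  assumes [measurable]: "A \<in> sets borel" "B \<in> sets borel"
  shows "(\<lambda>\<theta>. rot_joint \<theta> A B) \<in> borel_measurable borel"
proof -
  have e: "rot_joint \<theta> A B = enn2real (\<integral>\<^sup>+p. indicator A (fst p) * indicator B (cos \<theta> *\<^sub>R fst p + sin \<theta> *\<^sub>R snd p) \<partial>gauss2)" for \<theta>
  proof -
    have "emeasure gauss2 {p. fst p \<in> A \<and> rot_fst \<theta> p \<in> B} = (\<integral>\<^sup>+p. indicator {p. fst p \<in> A \<and> rot_fst \<theta> p \<in> B} p \<partial>gauss2)"
      by (rule nn_integral_indicator[symmetric]) measurable
    also have "\<dots> = (\<integral>\<^sup>+p. indicator A (fst p) * indicator B (cos \<theta> *\<^sub>R fst p + sin \<theta> *\<^sub>R snd p) \<partial>gauss2)"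
      by (intro nn_integral_cong) (auto simp: indicator_def rot_fst_def)
    finally show ?thesis by (simp add: rot_joint_def measure_def)
  qed
  show ?thesis unfolding e
    by (intro measurable_compose[OF _ borel_measurable_enn2real] std_gauss_pair.P.borel_measurable_nn_integral) measurable
qed

text \<open>The substitution t = - ln (cos \<theta>) with dt = tan \<theta> d\<theta>. Restricting
  to angles between a and b only discards a nonnegative part.\<close>

lemma nn_integral_angle_le:
  fixes A B :: "'a::euclidean_space set"
  assumes [measurable]: "A \<in> sets borel" "B \<in> sets borel" and ab: "0 < a" "a \<le> b" "b < pi / 2"
  shows "(\<integral>\<^sup>+\<theta>\<in>{a..b}. ennreal (tan \<theta> / (- ln (cos \<theta>)) powr (s / 2 + 1) * rot_joint \<theta> A B) \<partial>lborel)
    \<le> (\<integral>\<^sup>+t\<in>{0<..}. ennreal (1 / t powr (s / 2 + 1)) * gauss_joint (exp (- t)) A B \<partial>lborel)"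
proof -
  define g where "g \<theta> = - ln (cos \<theta>)" for \<theta> :: real
  define f where "f t = 1 / t powr (s / 2 + 1) * measure gauss2 {p. fst p \<in> A \<and> exp (- t) *\<^sub>R fst p + sqrt (1 - (exp (- t))\<^sup>2) *\<^sub>R snd p \<in> B}" for t
  have gj: "gauss_joint c A B = ennreal (measure gauss2 {p. fst p \<in> A \<and> c *\<^sub>R fst p + sqrt (1 - c\<^sup>2) *\<^sub>R snd p \<in> B})" for c
    unfolding gauss_joint_def by (simp add: std_gauss_pair.P.emeasure_eq_measure)
  have fe: "f t = 1 / t powr (s / 2 + 1) * enn2real (gauss_joint (exp (- t)) A B)" for t
    by (simp add: f_def gj)
  have [measurable]: "f \<in> borel_measurable borel" unfolding fe by measurable
  have cp: "cos \<theta> > 0" if "\<theta> \<in> {a..b}" for \<theta> using that ab by (intro cos_gt_zero) auto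
  have tp: "tan \<theta> \<ge> 0" if "\<theta> \<in> {a..b}" for \<theta> using that ab by (intro less_imp_le tan_gt_zero) auto
  have gpos: "g a > 0"
  proof -
    have "cos a < cos 0" using ab by (intro cos_monotone_0_pi) auto
    then show ?thesis using cp[of a] ab by (simp add: g_def)
  qed
  have "(\<integral>\<^sup>+\<theta>\<in>{a..b}. ennreal (tan \<theta> / (- ln (cos \<theta>)) powr (s / 2 + 1) * rot_joint \<theta> A B) \<partial>lborel)
     = (\<integral>\<^sup>+\<theta>. ennreal (f (g \<theta>) * tan \<theta> * indicator {a..b} \<theta>) \<partial>lborel)"
  proof (intro nn_integral_cong)
    fix \<theta> :: real
    show "ennreal (tan \<theta> / (- ln (cos \<theta>)) powr (s / 2 + 1) * rot_joint \<theta> A B) * indicator {a..b} \<theta> = ennreal (f (g \<theta>) * tan \<theta> * indicator {a..b} \<theta>)"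
    proof (cases "\<theta> \<in> {a..b}")
      case True
      have "exp (- g \<theta>) = cos \<theta>" using cp[OF True] by (simp add: g_def)
      moreover have "enn2real (gauss_joint (cos \<theta>) A B) = rot_joint \<theta> A B"
        using gauss_joint_cos[of \<theta> A B] True ab by simp
      ultimately have "f (g \<theta>) = 1 / g \<theta> powr (s / 2 + 1) * rot_joint \<theta> A B" by (simp add: fe)
      then show ?thesis using True by (simp add: g_def mult_ac)
    qed simp
  qed
  also have "\<dots> = (\<integral>\<^sup>+t. ennreal (f t * indicator {g a..g b} t) \<partial>lborel)"
  proof (rule nn_integral_substitution[symmetric])
    show "set_borel_measurable borel {g a..g b} f" unfolding set_borel_measurable_def by measurable
    show "(g has_real_derivative tan \<theta>) (at \<theta>)" if "\<theta> \<in> {a..b}" for \<theta>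
      unfolding g_def using cp[OF that] by (auto intro!: derivative_eq_intros simp: tan_def)
    show "continuous_on {a..b} tan" using cp by (intro continuous_intros) (metis less_irrefl)
  qed (use tp ab in auto)
  also have "\<dots> \<le> (\<integral>\<^sup>+t\<in>{0<..}. ennreal (1 / t powr (s / 2 + 1)) * gauss_joint (exp (- t)) A B \<partial>lborel)"
  proof (intro nn_integral_mono)
    fix t :: real
    show "ennreal (f t * indicator {g a..g b} t) \<le> ennreal (1 / t powr (s / 2 + 1)) * gauss_joint (exp (- t)) A B * indicator {0<..} t"
    proof (cases "t \<in> {g a..g b}")
      case True
      then have "t > 0" using gpos by simp
      then show ?thesis using True unfolding f_def gj by (simp add: ennreal_mult[symmetric])
    qed simp
  qed
  finally show ?thesis .
qed

text \<open>Since 1 + tan^2 = 1 / cos^2, twice - ln (cos \<theta>) equals ln (1 + tan^2), which is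
  at most tan^2.\<close>

lemma neg_ln_cos_le:
  assumes "0 < \<theta>" "\<theta> < pi / 2"
  shows "- ln (cos \<theta>) \<le> (tan \<theta>)\<^sup>2 / 2" "- ln (cos \<theta>) > 0"
proof -
  have c: "cos \<theta> > 0" using assms by (intro cos_gt_zero) auto
  have "cos \<theta> < cos 0" using assms by (intro cos_monotone_0_pi) auto
  then show "- ln (cos \<theta>) > 0" using c by simp
  have "1 + (tan \<theta>)\<^sup>2 = inverse ((cos \<theta>)\<^sup>2)" using c tan_sec[of \<theta>] by (simp add: power_inverse)
  then have "ln (1 + (tan \<theta>)\<^sup>2) = - (2 * ln (cos \<theta>))" using c by (simp add: ln_inverse ln_realpow)
  moreover have "ln (1 + (tan \<theta>)\<^sup>2) \<le> (tan \<theta>)\<^sup>2" by (rule ln_add_one_self_le_self) simp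
  ultimately show "- ln (cos \<theta>) \<le> (tan \<theta>)\<^sup>2 / 2" by linarith
qed

text \<open>Inserting - ln (cos \<theta>) \<le> T^2 / 2 for T = tan \<theta> leaves 2 powr (s / 2 +
  1) * T powr (- s - 1). Then T \<le> k \<theta> is used, and since the exponent - s - 1 is at least
  -2, the price is no more than 1 / k^2.\<close>

lemma angle_weight_ge:
  assumes \<theta>: "0 < \<theta>" "\<theta> < pi / 2" and k: "tan \<theta> \<le> k * \<theta>" "k \<ge> 1" and s: "0 < s" "s < 1"
  shows "2 powr (s / 2 + 1) / k\<^sup>2 * \<theta> powr (- s - 1) \<le> tan \<theta> / (- ln (cos \<theta>)) powr (s / 2 + 1)"
proof -
  define T where "T = tan \<theta>"
  have T: "T > 0" using \<theta> unfolding T_def by (intro tan_gt_zero) auto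
  have "2 powr (s / 2 + 1) / k\<^sup>2 * \<theta> powr (- s - 1) \<le> 2 powr (s / 2 + 1) * (k * \<theta>) powr (- s - 1)"
  proof -
    have "1 / k\<^sup>2 = k powr (- 2)" using k by (simp add: powr_minus_divide powr_numeral)
    also have "\<dots> \<le> k powr (- s - 1)" using k s by (intro powr_mono) auto
    finally have "1 / k\<^sup>2 * \<theta> powr (- s - 1) \<le> k powr (- s - 1) * \<theta> powr (- s - 1)"
      by (rule mult_right_mono) simp
    then have "1 / k\<^sup>2 * \<theta> powr (- s - 1) \<le> (k * \<theta>) powr (- s - 1)" using k \<theta> by (simp add: powr_mult)
    then have "2 powr (s / 2 + 1) * (1 / k\<^sup>2 * \<theta> powr (- s - 1)) \<le> 2 powr (s / 2 + 1) * (k * \<theta>) powr (- s - 1)"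
      by (rule mult_left_mono) simp
    then show ?thesis by simp
  qed
  also have "\<dots> \<le> 2 powr (s / 2 + 1) * T powr (- s - 1)"
    using T k(1) s by (intro mult_left_mono powr_mono2') (auto simp: T_def)
  also have "\<dots> = T / (T\<^sup>2 / 2) powr (s / 2 + 1)"
  proof -
    have a: "(T\<^sup>2 / 2) powr (s / 2 + 1) = T powr (s + 2) / 2 powr (s / 2 + 1)"
      using T by (simp add: powr_divide powr_powr algebra_simps flip: powr_numeral)
    have b: "T / T powr (s + 2) = T powr (- s - 1)"
    proof -
      have e: "- s - 1 = 1 - (s + 2)" by simp
      show ?thesis unfolding e powr_diff using T by simp
    qed
    show ?thesis unfolding a b[symmetric] by simp
  qed
  also have "\<dots> \<le> T / (- ln (cos \<theta>)) powr (s / 2 + 1)"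
    using neg_ln_cos_le[OF \<theta>] s T unfolding T_def
    by (intro divide_left_mono powr_mono2 mult_pos_pos) auto
  finally show ?thesis unfolding T_def .
qed

lemma nn_integral_dyadic:
  fixes f :: "real \<Rightarrow> ennreal"
  assumes [measurable]: "f \<in> borel_measurable borel" and \<delta>: "\<delta> > 0"
  shows "(\<integral>\<^sup>+\<theta>\<in>{\<delta> / 2 ^ n<..\<delta>}. f \<theta> \<partial>lborel) = (\<Sum>k<n. \<integral>\<^sup>+\<theta>\<in>{\<delta> / 2 ^ (Suc k)<..\<delta> / 2 ^ k}. f \<theta> \<partial>lborel)"
proof (induction n)
  case (Suc n)
  have le: "\<delta> / 2 ^ Suc n \<le> \<delta> / 2 ^ n" "\<delta> / 2 ^ n \<le> \<delta>" using \<delta> by (auto simp: field_simps)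
  have "(\<integral>\<^sup>+\<theta>\<in>{\<delta> / 2 ^ (Suc n)<..\<delta>}. f \<theta> \<partial>lborel) = (\<integral>\<^sup>+\<theta>. f \<theta> * indicator {\<delta> / 2 ^ n<..\<delta>} \<theta> + f \<theta> * indicator {\<delta> / 2 ^ (Suc n)<..\<delta> / 2 ^ n} \<theta> \<partial>lborel)"
    using le by (intro nn_integral_cong) (auto simp: indicator_def)
  also have "\<dots> = (\<integral>\<^sup>+\<theta>\<in>{\<delta> / 2 ^ n<..\<delta>}. f \<theta> \<partial>lborel) + (\<integral>\<^sup>+\<theta>\<in>{\<delta> / 2 ^ (Suc n)<..\<delta> / 2 ^ n}. f \<theta> \<partial>lborel)"
    by (rule nn_integral_add) measurable
  finally show ?case using Suc.IH by simp
qed simp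

lemma one_minus_powr_le: "x \<ge> 0 \<Longrightarrow> 1 - 2 powr (- x) \<le> x * ln (2::real)"
  using exp_ge_add_one_self[of "- x * ln 2"] by (simp add: powr_def)

text \<open>Every dyadic interval below \<delta> is compared with the top one by subadditivity. The
  contributions are at least those of a geometric series whose sum is of order 1 / (1 - s), which
  compensates the factor 1 - s; what remains is the linear bound m at the top scale.\<close>

lemma frac_perimeter_local_lower_bound:
  fixes F \<Omega> \<Omega>' :: "'a::euclidean_space set"
  assumes [measurable]: "F \<in> sets borel" "\<Omega> \<in> sets borel" "\<Omega>' \<in> sets borel"
    and \<Omega>': "\<And>x y. x \<in> \<Omega>' \<Longrightarrow> dist x y < d \<Longrightarrow> y \<in> \<Omega>" and d: "d > 0"
    and \<delta>: "0 < \<delta>" "\<delta> < pi / 2" and k: "k \<ge> 1" "\<And>\<theta>. 0 < \<theta> \<Longrightarrow> \<theta> \<le> \<delta> \<Longrightarrow> tan \<theta> \<le> k * \<theta>"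
    and m: "m \<ge> 0" "\<And>\<theta>. \<delta> / 2 < \<theta> \<Longrightarrow> \<theta> \<le> \<delta> \<Longrightarrow> \<theta> * m \<le> rot_joint \<theta> (F \<inter> \<Omega>') (- F \<inter> \<Omega>') - gauss_far TYPE('a) (d / \<theta>)"
    and s: "0 < s" "s < 1"
  shows "ennreal (2 powr (s / 2 + 1) / k\<^sup>2 * m * (\<delta> / 2) powr (1 - s)) \<le>
    ennreal (1 - s) * (\<integral>\<^sup>+t\<in>{0<..}. ennreal (1 / t powr (s / 2 + 1)) * gauss_joint (exp (- t)) (F \<inter> \<Omega>) (- F \<inter> \<Omega>) \<partial>lborel)"
    (is "_ \<le> ennreal (1 - s) * ?P")
proof -
  define J where "J \<theta> = rot_joint \<theta> (F \<inter> \<Omega>) (- F \<inter> \<Omega>)" for \<theta>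
  have J0: "J \<theta> \<ge> 0" for \<theta> by (simp add: J_def)
  have [measurable]: "J \<in> borel_measurable borel" unfolding J_def by measurable
  define c where "c = 2 powr (s / 2 + 1) / k\<^sup>2"
  have c: "c > 0" using k by (simp add: c_def)
  define f where "f \<theta> = ennreal (\<theta> powr (- s - 1) * J \<theta>)" for \<theta>
  have [measurable]: "f \<in> borel_measurable borel" unfolding f_def by measurable
  \<comment> \<open>Ratio of the lower bounds at consecutive scales: halving \<theta> multiplies the
    integral of \<theta> powr (- s) over a dyadic interval by 2 powr (s - 1).\<close>
  define q where "q = 2 powr (- (1 - s))"
  have q: "0 < q" "q < 1" using s powr_less_mono[of "- (1 - s)" 0 2] by (auto simp: q_def)
  \<comment> \<open>Lower bound for the top interval. The factor ln 2 is the integral of 1 /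
    \<theta> from \<delta> / 2 to \<delta>.\<close>
  define A where "A = m * (\<delta> / 2) powr (1 - s) * ln 2"
  have A: "A \<ge> 0" using m by (simp add: A_def)
  have scale: "ennreal (q ^ i * A) \<le> (\<integral>\<^sup>+\<theta>\<in>{\<delta> / 2 ^ (Suc i)<..\<delta> / 2 ^ i}. f \<theta> \<partial>lborel)" for i
  proof -
    define r where "r = 1 / (2::real) ^ i"
    have r: "r > 0" by (simp add: r_def)
    have ri: "r = 2 powr (- real i)" by (simp add: r_def powr_minus_divide powr_realpow)
    have "(\<integral>\<^sup>+\<theta>\<in>{\<delta> / 2 ^ (Suc i)<..\<delta> / 2 ^ i}. f \<theta> \<partial>lborel) = ennreal r * (\<integral>\<^sup>+\<theta>. f (r * \<theta>) * indicator {\<delta> / 2 ^ (Suc i)<..\<delta> / 2 ^ i} (r * \<theta>) \<partial>lborel)"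
      using nn_integral_real_affine[of "\<lambda>\<theta>. f \<theta> * indicator {\<delta> / 2 ^ (Suc i)<..\<delta> / 2 ^ i} \<theta>" r 0] r by simp
    also have "\<dots> = (\<integral>\<^sup>+\<theta>. ennreal r * (f (r * \<theta>) * indicator {\<delta> / 2 ^ (Suc i)<..\<delta> / 2 ^ i} (r * \<theta>)) \<partial>lborel)"
      by (rule nn_integral_cmult[symmetric]) measurable
    also have "\<dots> \<ge> (\<integral>\<^sup>+\<theta>. ennreal (q ^ i * (m * (\<delta> / 2) powr (1 - s)) * (1 / \<theta>)) * indicator {\<delta> / 2<..\<delta>} \<theta> \<partial>lborel)"
    proof (intro nn_integral_mono)
      fix \<theta> :: real
      show "ennreal (q ^ i * (m * (\<delta> / 2) powr (1 - s)) * (1 / \<theta>)) * indicator {\<delta> / 2<..\<delta>} \<theta> \<le> ennreal r * (f (r * \<theta>) * indicator {\<delta> / 2 ^ (Suc i)<..\<delta> / 2 ^ i} (r * \<theta>))"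
      proof (cases "\<theta> \<in> {\<delta> / 2<..\<delta>}")
        case True
        then have \<theta>: "\<theta> > 0" "\<delta> / 2 < \<theta>" "\<theta> \<le> \<delta>" using \<delta> by auto
        have in': "r * \<theta> \<in> {\<delta> / 2 ^ (Suc i)<..\<delta> / 2 ^ i}"
          using \<theta> by (auto simp: r_def field_simps)
        have e: "real (2 ^ i) * (r * \<theta>) = \<theta>" by (simp add: r_def)
        \<comment> \<open>The angle \<theta> in the top interval is reached by 2 ^ i steps of the
          angle r \<theta>, which lies in the interval number i.\<close>
        have "rot_joint (real (2 ^ i) * (r * \<theta>)) (F \<inter> \<Omega>') (- F \<inter> \<Omega>') \<le> real (2 ^ i) * rot_joint (r * \<theta>) (F \<inter> \<Omega>) (- F \<inter> \<Omega>)
            + gauss_far TYPE('a) (d / (real (2 ^ i) * (r * \<theta>)))"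
        proof (rule rot_joint_subadditive)
          show "real (2 ^ i) * (r * \<theta>) \<le> pi" unfolding e using \<theta> \<delta> by linarith
        qed (use \<Omega>' d \<theta> r in auto)
        then have "rot_joint \<theta> (F \<inter> \<Omega>') (- F \<inter> \<Omega>') \<le> real (2 ^ i) * rot_joint (r * \<theta>) (F \<inter> \<Omega>) (- F \<inter> \<Omega>) + gauss_far TYPE('a) (d / \<theta>)"
          unfolding e .
        then have "rot_joint \<theta> (F \<inter> \<Omega>') (- F \<inter> \<Omega>') \<le> 2 ^ i * J (r * \<theta>) + gauss_far TYPE('a) (d / \<theta>)"
          by (simp add: J_def)
        with m(2)[OF \<theta>(2,3)] have 1: "\<theta> * m \<le> 2 ^ i * J (r * \<theta>)" by linarith
        have "(\<delta> / 2) powr (1 - s) \<le> \<theta> powr (1 - s)" using \<theta> \<delta> s by (intro powr_mono2) auto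
        then have "q ^ i * (m * (\<delta> / 2) powr (1 - s)) * (1 / \<theta>) \<le> q ^ i * (m * \<theta> powr (1 - s)) * (1 / \<theta>)"
          using m q \<theta> by (intro mult_right_mono mult_left_mono) auto
        also have "\<dots> = q ^ i * \<theta> powr (- s - 1) * (\<theta> * m)"
        proof -
          have "\<theta> powr (1 - s) * (1 / \<theta>) = \<theta> powr (- s - 1) * \<theta>"
          proof -
            have "\<theta> powr (1 - s) = \<theta> powr (- s - 1) * \<theta> powr 2" by (simp flip: powr_add)
            then show ?thesis using \<theta>(1) by (simp add: powr_numeral power2_eq_square)
          qed
          then show ?thesis by (simp add: mult_ac)
        qed
        also have "\<dots> \<le> q ^ i * \<theta> powr (- s - 1) * (2 ^ i * J (r * \<theta>))"
          using q 1 by (intro mult_left_mono) auto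
        also have "\<dots> = r * ((r * \<theta>) powr (- s - 1) * J (r * \<theta>))"
        proof -
          \<comment> \<open>As q * 2 = 2 powr s, the product q ^ i * 2 ^ i is exactly the scaling
            factor of \<theta> powr (- s - 1) d\<theta> under \<theta> \<mapsto> r \<theta>.\<close>
          have p: "q * 2 = 2 powr s" using powr_add[of 2 "- (1 - s)" 1] by (simp add: q_def)
          have "q ^ i * 2 ^ i = (q * 2) ^ i" by (simp add: power_mult_distrib)
          also have "\<dots> = (2 powr s) ^ i" unfolding p ..
          also have "\<dots> = 2 powr (s * real i)" by (simp add: powr_powr flip: powr_realpow)
          also have "\<dots> = 2 powr (- real i) * (2 powr (- real i)) powr (- s - 1)"
            by (simp add: powr_powr algebra_simps flip: powr_add)
          also have "\<dots> = r * r powr (- s - 1)" unfolding ri ..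
          finally have "q ^ i * 2 ^ i = r * r powr (- s - 1)" .
          then have "q ^ i * 2 ^ i * (\<theta> powr (- s - 1) * J (r * \<theta>)) = r * r powr (- s - 1) * (\<theta> powr (- s - 1) * J (r * \<theta>))" by simp
          then show ?thesis using r \<theta>(1) by (simp add: powr_mult mult_ac)
        qed
        finally show ?thesis using True in' r by (simp add: f_def ennreal_mult'[symmetric] ennreal_leI)
      qed simp
    qed
    finally have 2: "(\<integral>\<^sup>+\<theta>. ennreal (q ^ i * (m * (\<delta> / 2) powr (1 - s)) * (1 / \<theta>)) * indicator {\<delta> / 2<..\<delta>} \<theta> \<partial>lborel) \<le> (\<integral>\<^sup>+\<theta>\<in>{\<delta> / 2 ^ (Suc i)<..\<delta> / 2 ^ i}. f \<theta> \<partial>lborel)" .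
    define B where "B = q ^ i * (m * (\<delta> / 2) powr (1 - s))"
    have B: "B \<ge> 0" using q m by (simp add: B_def)
    have "(\<integral>\<^sup>+\<theta>. ennreal (B * (1 / \<theta>)) * indicator {\<delta> / 2<..\<delta>} \<theta> \<partial>lborel) = (\<integral>\<^sup>+\<theta>. ennreal (B * (1 / \<theta>)) * indicator {\<delta> / 2..\<delta>} \<theta> \<partial>lborel)"
      using AE_lborel_singleton[of "\<delta> / 2"] by (intro nn_integral_cong_AE) (auto simp: indicator_def elim!: eventually_mono)
    also have "\<dots> = ennreal (B * ln \<delta> - B * ln (\<delta> / 2))"
      using \<delta> B by (intro nn_integral_FTC_Icc) (auto intro!: derivative_eq_intros)
    also have "B * ln \<delta> - B * ln (\<delta> / 2) = B * ln 2" using \<delta> by (simp add: ln_div algebra_simps)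
    finally show ?thesis using 2 unfolding B_def A_def by (simp add: mult_ac)
  qed
  have "ennreal (c * (A * (\<Sum>i<n. q ^ i))) \<le> ?P" for n
  proof -
    have "ennreal (A * (\<Sum>i<n. q ^ i)) = (\<Sum>i<n. ennreal (q ^ i * A))"
      using q A by (subst sum_ennreal) (auto simp: sum_distrib_left mult_ac)
    also have "\<dots> \<le> (\<integral>\<^sup>+\<theta>\<in>{\<delta> / 2 ^ n<..\<delta>}. f \<theta> \<partial>lborel)"
      unfolding nn_integral_dyadic[OF \<open>f \<in> _\<close> \<delta>(1)] by (intro sum_mono scale)
    finally have "ennreal c * ennreal (A * (\<Sum>i<n. q ^ i)) \<le> ennreal c * (\<integral>\<^sup>+\<theta>\<in>{\<delta> / 2 ^ n<..\<delta>}. f \<theta> \<partial>lborel)"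
      by (rule mult_left_mono) simp
    also have "\<dots> = (\<integral>\<^sup>+\<theta>. ennreal c * (f \<theta> * indicator {\<delta> / 2 ^ n<..\<delta>} \<theta>) \<partial>lborel)"
      by (rule nn_integral_cmult[symmetric]) measurable
    also have "\<dots> \<le> (\<integral>\<^sup>+\<theta>\<in>{\<delta> / 2 ^ n..\<delta>}. ennreal (tan \<theta> / (- ln (cos \<theta>)) powr (s / 2 + 1) * J \<theta>) \<partial>lborel)"
    proof (intro nn_integral_mono)
      fix \<theta> :: real
      show "ennreal c * (f \<theta> * indicator {\<delta> / 2 ^ n<..\<delta>} \<theta>) \<le> ennreal (tan \<theta> / (- ln (cos \<theta>)) powr (s / 2 + 1) * J \<theta>) * indicator {\<delta> / 2 ^ n..\<delta>} \<theta>"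
      proof (cases "\<theta> \<in> {\<delta> / 2 ^ n<..\<delta>}")
        case True
        have "0 < \<delta> / 2 ^ n" using \<delta> by simp
        with True have \<theta>: "0 < \<theta>" "\<theta> \<le> \<delta>" by auto
        have "c * \<theta> powr (- s - 1) \<le> tan \<theta> / (- ln (cos \<theta>)) powr (s / 2 + 1)"
          unfolding c_def using \<theta> \<delta> k s by (intro angle_weight_ge) auto
        from mult_right_mono[OF this J0[of \<theta>]]
        show ?thesis using True c by (simp add: f_def ennreal_mult'[symmetric] ennreal_leI mult.assoc)
      qed simp
    qed
    also have "\<dots> \<le> ?P"
      unfolding J_def by (rule nn_integral_angle_le) (use \<delta> in \<open>auto simp: field_simps\<close>)
    finally show ?thesis using c A by (simp add: ennreal_mult'[symmetric])
  qed
  moreover have "(\<lambda>n. ennreal (c * (A * (\<Sum>i<n. q ^ i)))) \<longlonglongrightarrow> ennreal (c * (A * (1 / (1 - q))))"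
    using q geometric_sums[of q] by (intro tendsto_ennrealI tendsto_intros) (simp add: sums_def)
  ultimately have "ennreal (c * (A * (1 / (1 - q)))) \<le> ?P"
    by (intro LIMSEQ_le_const2) auto
  then have 3: "ennreal (1 - s) * ennreal (c * (A * (1 / (1 - q)))) \<le> ennreal (1 - s) * ?P"
    by (rule mult_left_mono) simp
  \<comment> \<open>The factor 1 - s is spent here: the geometric sum 1 / (1 - q) is at least 1 /
    ((1 - s) ln 2), and ln 2 cancels against the one in A.\<close>
  have "1 - q \<le> (1 - s) * ln 2" unfolding q_def using s by (intro one_minus_powr_le) auto
  then have "1 \<le> (1 - s) * ln 2 / (1 - q)" using q by simp
  then have "c * m * (\<delta> / 2) powr (1 - s) * 1 \<le> c * m * (\<delta> / 2) powr (1 - s) * ((1 - s) * ln 2 / (1 - q))"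
    using c m by (intro mult_left_mono) auto
  also have "\<dots> = (1 - s) * (c * (A * (1 / (1 - q))))" by (simp add: A_def mult_ac)
  finally have "ennreal (c * m * (\<delta> / 2) powr (1 - s)) \<le> ennreal (1 - s) * ennreal (c * (A * (1 / (1 - q))))"
    using s c A q by (simp add: ennreal_mult'[symmetric] ennreal_leI)
  from order_trans[OF this 3] show ?thesis by (simp add: c_def)
qed

lemma tan_le_eventually:
  assumes "k > (1::real)"
  obtains \<delta> where "\<delta> > 0" "\<And>\<theta>. 0 < \<theta> \<Longrightarrow> \<theta> < \<delta> \<Longrightarrow> tan \<theta> \<le> k * \<theta>"
proof -
  have "(tan has_real_derivative inverse ((cos 0)\<^sup>2)) (at 0)" by (rule DERIV_tan) simp
  then have "((\<lambda>\<theta>. tan \<theta> / \<theta>) \<longlongrightarrow> (1::real)) (at 0)"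
    by (simp add: has_field_derivative_iff)
  then have "eventually (\<lambda>\<theta>. tan \<theta> / \<theta> < k) (at 0)" using assms by (rule order_tendstoD)
  then obtain \<delta> where \<delta>: "\<delta> > 0" "\<And>\<theta>. \<theta> \<noteq> 0 \<Longrightarrow> dist \<theta> 0 < \<delta> \<Longrightarrow> tan \<theta> / \<theta> < k"
    unfolding eventually_at by auto
  show ?thesis
  proof (rule that[OF \<delta>(1)])
    fix \<theta> :: real assume "0 < \<theta>" "\<theta> < \<delta>"
    then show "tan \<theta> \<le> k * \<theta>" using \<delta>(2)[of \<theta>] by (simp add: divide_less_eq less_imp_le)
  qed
qed

text \<open>The choices are made in this order: the tolerance \<eta>, then the scale \<delta>
  depending on the fixed set E, then n large. F n is compared with E only at angles between \<delta>
  / 2 and \<delta>.\<close>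

lemma liminf_inequality_field:
  fixes \<Omega> E :: "'a::euclidean_space set" and F :: "nat \<Rightarrow> 'a set" and \<phi> :: "'a \<Rightarrow> 'a"
  assumes \<Omega>: "open \<Omega>" and s: "\<And>n. 0 < s n" "\<And>n. s n < 1" "s \<longlonglongrightarrow> 1"
    and Fm[measurable]: "\<And>n. F n \<in> sets borel" and E[measurable]: "E \<in> sets borel"
    and lim: "(\<lambda>n. measure std_gauss ((F n - E) \<union> (E - F n))) \<longlonglongrightarrow> 0"
    and \<phi>: "\<phi> \<in> test_fields \<Omega>"
  defines "V \<equiv> (\<integral>x. indicator E x * (divergence \<phi> x - \<phi> x \<bullet> x) \<partial>std_gauss)"
  shows "ennreal (2 / sqrt pi * V) \<le> liminf (\<lambda>n. ennreal (1 - s n) *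
     (\<integral>\<^sup>+t\<in>{0<..}. ennreal (1 / t powr (s n / 2 + 1)) * gauss_joint (exp (- t)) (F n \<inter> \<Omega>) (- F n \<inter> \<Omega>) \<partial>lborel))"
    (is "_ \<le> liminf ?X")
proof (cases "V > 0")
  case False
  then have "2 / sqrt pi * V \<le> 0" by (simp add: divide_le_0_iff)
  then show ?thesis by (simp add: ennreal_neg)
next
  case True
  \<comment> \<open>Half of the flip rate sqrt (2 / pi) * V, the share of one direction.\<close>
  define M where "M = sqrt (2 / pi) * V / 2"
  have M: "M > 0" using True by (simp add: M_def)
  \<comment> \<open>The bound of \<open>frac_perimeter_local_lower_bound\<close> for s tending to 1,
    with k = 1 + \<eta> and slope M - 2 * \<eta>. At \<eta> = 0 it is the required constant.\<close>
  define h where "h \<eta> = 2 powr (3 / 2) / (1 + \<eta>)\<^sup>2 * (M - 2 * \<eta>)" for \<eta> :: real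
  have [measurable]: "\<Omega> \<in> sets borel" using \<Omega> by simp
  define K where "K = closure {x. \<phi> x \<noteq> 0}"
  have C1: "C_k (Suc 0) \<phi>" and K: "compact K" "K \<subseteq> \<Omega>" and le1: "\<And>x. norm (\<phi> x) \<le> 1"
    using \<phi> unfolding test_fields_def K_def by blast+
  have K0: "\<phi> x = 0" if "x \<notin> K" for x using that closure_subset[of "{x. \<phi> x \<noteq> 0}"] unfolding K_def by auto
  obtain e where e: "e > 0" "(\<Union>x\<in>K. ball x e) \<subseteq> \<Omega>"
    by (rule compact_subset_open_imp_ball_epsilon_subset[OF K(1) \<Omega> K(2)]) (rule that)
  \<comment> \<open>Half of the distance that is available, for two layers: \<open>\<Omega>'\<close>
    is the d-neighbourhood of the support of \<phi>, and the d-neighbourhood of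
    \<open>\<Omega>'\<close> is still inside \<Omega>. The inner layer serves
    \<open>rotation_flip_le\<close>, the outer one subadditivity.\<close>
  define d where "d = e / 2"
  have d: "d > 0" using e(1) by (simp add: d_def)
  define \<Omega>' where "\<Omega>' = (\<Union>x\<in>K. ball x d)"
  have "open \<Omega>'" unfolding \<Omega>'_def by auto
  then have [measurable]: "\<Omega>' \<in> sets borel" by simp
  have K\<Omega>': "y \<in> \<Omega>'" if "x \<in> K" "dist x y < d" for x y using that unfolding \<Omega>'_def by auto
  have \<Omega>'\<Omega>: "y \<in> \<Omega>" if xy: "x \<in> \<Omega>'" "dist x y < d" for x y
  proof -
    obtain z where z: "z \<in> K" "dist z x < d" using xy(1) unfolding \<Omega>'_def by auto
    have "dist z y < e" using dist_triangle[of z y x] z(2) xy(2) by (simp add: d_def)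
    then have "y \<in> (\<Union>x\<in>K. ball x e)" using z(1) by auto
    then show ?thesis using e(2) by blast
  qed
  obtain C where C: "C > 0" "\<And>a. a > 0 \<Longrightarrow> gauss_far TYPE('a) a \<le> C / a\<^sup>2"
    by (rule gauss_far_bound) (rule that)
  have main: "ennreal (h \<eta>) \<le> liminf ?X" if \<eta>: "0 < \<eta>" "\<eta> < M / 2" for \<eta>
  proof -
    obtain \<delta>1 where \<delta>1: "\<delta>1 > 0" "\<And>\<theta>. 0 < \<theta> \<Longrightarrow> \<theta> < \<delta>1 \<Longrightarrow> \<theta> * (sqrt (2 / pi) * V - \<eta>) \<le> measure gauss2 (rotation_flip \<theta> K E)"
      using rotation_flip_lower_bound[OF C1 K(1) K0 le1 E \<eta>(1)] unfolding V_def by blast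
    obtain \<delta>2 where \<delta>2: "\<delta>2 > 0" "\<And>\<theta>. 0 < \<theta> \<Longrightarrow> \<theta> < \<delta>2 \<Longrightarrow> tan \<theta> \<le> (1 + \<eta>) * \<theta>"
      by (rule tan_le_eventually[of "1 + \<eta>"]) (use \<eta> in auto)
    \<comment> \<open>The last entry makes the far probability at most \<theta> * \<eta> / 3. It is
      lost once when flips are restricted to \<open>\<Omega>'\<close>, with weight 1/2, and once
      more by subadditivity; together this is \<theta> * \<eta> / 2.\<close>
    define \<delta> where "\<delta> = min (min (\<delta>1 / 2) (\<delta>2 / 2)) (min (pi / 4) (\<eta> * d\<^sup>2 / (3 * C)))"
    have "\<delta> > 0" using \<delta>1(1) \<delta>2(1) \<eta>(1) d C(1) by (simp add: \<delta>_def)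
    moreover have "\<delta> \<le> \<delta>1 / 2" "\<delta> \<le> \<delta>2 / 2" "\<delta> \<le> pi / 4" "\<delta> \<le> \<eta> * d\<^sup>2 / (3 * C)"
      by (simp_all add: \<delta>_def)
    ultimately have \<delta>: "\<delta> > 0" "\<delta> < \<delta>1" "\<delta> < \<delta>2" "\<delta> < pi / 2" "\<delta> \<le> \<eta> * d\<^sup>2 / (3 * C)"
      using \<delta>1(1) \<delta>2(1) pi_gt_zero by linarith+
    have JE: "\<theta> * (M - \<eta>) \<le> rot_joint \<theta> (E \<inter> \<Omega>') (- E \<inter> \<Omega>') - gauss_far TYPE('a) (d / \<theta>)" if \<theta>: "0 < \<theta>" "\<theta> \<le> \<delta>" for \<theta>
    proof -
      have "gauss_far TYPE('a) (d / \<theta>) \<le> C / (d / \<theta>)\<^sup>2" using d \<theta> by (intro C) auto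
      also have "\<dots> = \<theta> * (C * \<theta> / d\<^sup>2)" using d \<theta> by (simp add: power2_eq_square)
      also have "\<dots> \<le> \<theta> * (\<eta> / 3)"
      proof (intro mult_left_mono)
        have "\<theta> \<le> \<eta> * d\<^sup>2 / (3 * C)" using \<theta> \<delta> by linarith
        then have "\<theta> * (3 * C) \<le> \<eta> * d\<^sup>2" using C(1) by (simp add: pos_le_divide_eq)
        then show "C * \<theta> / d\<^sup>2 \<le> \<eta> / 3" using d by (simp add: divide_le_eq mult_ac)
      qed (use \<theta> in auto)
      finally have far: "gauss_far TYPE('a) (d / \<theta>) \<le> \<theta> * (\<eta> / 3)" .
      have "\<theta> * (sqrt (2 / pi) * V - \<eta>) \<le> measure gauss2 (rotation_flip \<theta> K E)"
        using \<theta> \<delta> by (intro \<delta>1) auto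
      also have "\<dots> \<le> 2 * rot_joint \<theta> (E \<inter> \<Omega>') (- E \<inter> \<Omega>') + gauss_far TYPE('a) (d / \<theta>)"
        using \<theta> \<delta> d K\<Omega>' by (intro rotation_flip_le) auto
      finally have "\<theta> * (2 * M - \<eta>) \<le> 2 * rot_joint \<theta> (E \<inter> \<Omega>') (- E \<inter> \<Omega>') + gauss_far TYPE('a) (d / \<theta>)"
        by (simp add: M_def)
      with far show ?thesis by (simp add: algebra_simps)
    qed
    \<comment> \<open>The comparison of E with F n costs twice this measure, less than \<eta> *
      \<delta> / 2, which is below \<theta> * \<eta> because \<theta> > \<delta> / 2.\<close>
    have "eventually (\<lambda>n. measure std_gauss ((F n - E) \<union> (E - F n)) < \<eta> * \<delta> / 4) sequentially"
      using \<eta> \<delta> by (intro order_tendstoD(2)[OF lim]) auto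
    then have ev: "eventually (\<lambda>n. ennreal (2 powr (s n / 2 + 1) / (1 + \<eta>)\<^sup>2 * (M - 2 * \<eta>) * (\<delta> / 2) powr (1 - s n)) \<le> ?X n) sequentially"
    proof eventually_elim
      case (elim n)
      show ?case
      proof (rule frac_perimeter_local_lower_bound)
        show "\<theta> * (M - 2 * \<eta>) \<le> rot_joint \<theta> (F n \<inter> \<Omega>') (- F n \<inter> \<Omega>') - gauss_far TYPE('a) (d / \<theta>)"
          if \<theta>: "\<delta> / 2 < \<theta>" "\<theta> \<le> \<delta>" for \<theta>
        proof -
          have \<theta>0: "\<theta> > 0" using \<theta> \<delta> by linarith
          have "rot_joint \<theta> (E \<inter> \<Omega>') (- E \<inter> \<Omega>') \<le> rot_joint \<theta> (F n \<inter> \<Omega>') (- F n \<inter> \<Omega>') + 2 * measure std_gauss ((F n - E) \<union> (E - F n))"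
            using \<theta> \<theta>0 \<delta> by (intro rot_joint_sym_diff) auto
          moreover have "2 * measure std_gauss ((F n - E) \<union> (E - F n)) \<le> \<theta> * \<eta>"
          proof -
            have "\<eta> * (\<delta> / 2) \<le> \<eta> * \<theta>" using \<theta> \<eta> by (intro mult_left_mono) auto
            with elim show ?thesis by (simp add: mult.commute)
          qed
          ultimately show ?thesis using JE[OF \<theta>0 \<theta>(2)] by (simp add: algebra_simps)
        qed
        show "\<And>\<theta>. 0 < \<theta> \<Longrightarrow> \<theta> \<le> \<delta> \<Longrightarrow> tan \<theta> \<le> (1 + \<eta>) * \<theta>" using \<delta> by (intro \<delta>2) auto
      qed (use \<delta> d \<eta> \<Omega>'\<Omega> s in auto)
    qed
    have "(\<lambda>n. ennreal (2 powr (s n / 2 + 1) / (1 + \<eta>)\<^sup>2 * (M - 2 * \<eta>) * (\<delta> / 2) powr (1 - s n))) \<longlonglongrightarrow>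
       ennreal (2 powr (1 / 2 + 1) / (1 + \<eta>)\<^sup>2 * (M - 2 * \<eta>) * (\<delta> / 2) powr (1 - 1))"
      using \<eta> \<delta> by (intro tendsto_ennrealI tendsto_intros s(3)) auto
    then have "liminf (\<lambda>n. ennreal (2 powr (s n / 2 + 1) / (1 + \<eta>)\<^sup>2 * (M - 2 * \<eta>) * (\<delta> / 2) powr (1 - s n))) =
       ennreal (2 powr (1 / 2 + 1) / (1 + \<eta>)\<^sup>2 * (M - 2 * \<eta>) * (\<delta> / 2) powr (1 - 1))"
      by (intro lim_imp_Liminf) auto
    also have "\<dots> = ennreal (h \<eta>)" using \<delta> by (simp add: h_def)
    finally show ?thesis using Liminf_mono[OF ev] by simp
  qed
  have "((\<lambda>\<eta>. ennreal (h \<eta>)) \<longlongrightarrow> ennreal (h 0)) (at_right 0)"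
    unfolding h_def by (intro tendsto_ennrealI tendsto_intros) auto
  moreover have "eventually (\<lambda>\<eta>. ennreal (h \<eta>) \<le> liminf ?X) (at_right 0)"
    using M by (intro eventually_mono[OF eventually_at_right_real[of 0 "M / 2"]]) (auto intro: main)
  ultimately have "ennreal (h 0) \<le> liminf ?X" by (rule tendsto_upperbound) simp
  moreover have "h 0 = 2 / sqrt pi * V"
  proof -
    have "(2::real) powr (3 / 2) = 2 powr 1 * 2 powr (1 / 2)" by (subst powr_add[symmetric]) simp
    then have "(2::real) powr (3 / 2) = 2 * sqrt 2" by (simp add: powr_half_sqrt)
    then show ?thesis by (simp add: h_def M_def real_sqrt_divide)
  qed
  ultimately show ?thesis by simp
qed

lemma perimeter_constant: "sqrt 2 / pi * sqrt (2 * pi) = 2 / sqrt pi"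
proof -
  have "sqrt 2 / pi * sqrt (2 * pi) = (sqrt 2 * sqrt 2) * (sqrt pi / pi)"
    unfolding real_sqrt_mult by (simp only: times_divide_eq_left times_divide_eq_right mult.assoc)
  also have "sqrt pi / pi = inverse (sqrt pi)" by (rule sqrt_divide_self_eq) simp
  finally show ?thesis by (simp add: divide_inverse)
qed

lemma liminf_inequality:
  fixes \<Omega> E :: "'a::euclidean_space set" and F :: "nat \<Rightarrow> 'a set"
  assumes \<Omega>: "open \<Omega>" and E: "E \<in> sets lebesgue"
    and s: "\<And>n. 0 < s n \<and> s n < 1" "s \<longlonglongrightarrow> 1"
    and F: "\<And>n. F n \<in> sets lebesgue" and lim: "L1_loc_tendsto (\<lambda>n. indicator (F n)) (indicator E)"
  shows "liminf (\<lambda>n. ennreal (1 - s n) * frac_perimeter_local (s n) (F n) \<Omega>)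
              \<ge> ennreal (sqrt 2 / pi) * gauss_perimeter E \<Omega>"
proof -
  obtain E0 where E0: "E0 \<in> sets borel" "AE x in lebesgue. x \<in> E \<longleftrightarrow> x \<in> E0"
    using lebesgue_set_borel_version[OF E] by blast
  have "\<exists>F0. F0 \<in> sets borel \<and> (AE x in lebesgue. x \<in> F n \<longleftrightarrow> x \<in> F0)" for n
    using lebesgue_set_borel_version[OF F[of n]] by blast
  then obtain F0 where F0: "\<And>n. F0 n \<in> sets borel" "\<And>n. AE x in lebesgue. x \<in> F n \<longleftrightarrow> x \<in> F0 n"
    by metis
  have \<Omega>m: "\<Omega> \<in> sets borel" using \<Omega> by simp
  have lim0: "(\<lambda>n. measure std_gauss ((F0 n - E0) \<union> (E0 - F0 n))) \<longlonglongrightarrow> 0"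
    by (rule L1_loc_tendsto_imp_gauss[OF F0 E0 lim])
  have c: "ennreal (sqrt 2 / pi) * ennreal (sqrt (2 * pi)) = ennreal (2 / sqrt pi)"
    unfolding perimeter_constant[symmetric] by (rule ennreal_mult[symmetric]) auto
  have "ennreal (sqrt 2 / pi) * gauss_perimeter E \<Omega> = ennreal (2 / sqrt pi) * field_sup E0 \<Omega>"
    unfolding gauss_perimeter_eq[OF E0(1) E E0(2)] c[symmetric] by (rule mult.assoc[symmetric])
  also have "\<dots> = (SUP \<phi> \<in> test_fields \<Omega>. ennreal (2 / sqrt pi) * ennreal (\<integral>x. indicator E0 x * (divergence \<phi> x - \<phi> x \<bullet> x) \<partial>std_gauss))"
    unfolding field_sup_def by (rule SUP_mult_left_ennreal)
  also have "\<dots> \<le> liminf (\<lambda>n. ennreal (1 - s n) * frac_perimeter_local (s n) (F n) \<Omega>)"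
  proof (rule SUP_least)
    fix \<phi> :: "'a \<Rightarrow> 'a" assume "\<phi> \<in> test_fields \<Omega>"
    from liminf_inequality_field[OF \<Omega> _ _ s(2) F0(1) E0(1) lim0 this] s(1)
    show "ennreal (2 / sqrt pi) * ennreal (\<integral>x. indicator E0 x * (divergence \<phi> x - \<phi> x \<bullet> x) \<partial>std_gauss)
       \<le> liminf (\<lambda>n. ennreal (1 - s n) * frac_perimeter_local (s n) (F n) \<Omega>)"
      unfolding frac_perimeter_local_eq[OF F0(1) \<Omega>m F0(2)] by (simp add: ennreal_mult'[symmetric])
  qed
  finally show ?thesis .
qed

section \<open>Smooth functions and mollification\<close>

lemma C_k_SucI:
  fixes f :: "'a::euclidean_space \<Rightarrow> 'b::real_normed_vector"
  assumes "\<And>x. (f has_derivative D x) (at x)" "\<And>b. b \<in> Basis \<Longrightarrow> C_k k (\<lambda>x. D x b)"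
  shows "C_k (Suc k) f"
proof -
  have "frechet_derivative f (at x) = D x" for x using frechet_derivative_at[OF assms(1)] by simp
  then show ?thesis using assms by (auto simp: differentiable_def)
qed

lemma C_k_SucD:
  assumes "C_k (Suc k) f"
  shows "(f has_derivative frechet_derivative f (at x)) (at x)"
    and "b \<in> Basis \<Longrightarrow> C_k k (\<lambda>x. frechet_derivative f (at x) b)"
  using assms by (auto simp: frechet_derivative_works)

lemma C_k_Suc_imp: "C_k (Suc k) f \<Longrightarrow> C_k k f"
proof (induction k arbitrary: f)
  case 0
  then show ?case using C_k_1_continuous[of f] by simp
next
  case (Suc k)
  show ?case by (rule C_k_SucI[OF C_k_SucD(1)[OF Suc.prems]]) (intro Suc.IH C_k_SucD(2)[OF Suc.prems])
qed

lemma C_k_const: "C_k k (\<lambda>_. c)"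
proof (induction k arbitrary: c)
  case (Suc k)
  then show ?case by (intro C_k_SucI[of _ "\<lambda>_ _. 0"]) auto
qed simp

lemma C_k_add: "C_k k f \<Longrightarrow> C_k k g \<Longrightarrow> C_k k (\<lambda>x. f x + g x)"
proof (induction k arbitrary: f g)
  case 0
  then show ?case by (auto intro!: continuous_intros)
next
  case (Suc k)
  show ?case
    by (rule C_k_SucI[OF has_derivative_add[OF C_k_SucD(1)[OF Suc.prems(1)] C_k_SucD(1)[OF Suc.prems(2)]]])
       (intro Suc.IH C_k_SucD(2)[OF Suc.prems(1)] C_k_SucD(2)[OF Suc.prems(2)])
qed

lemma C_k_scaleR:
  fixes f :: "'a::euclidean_space \<Rightarrow> real"
  shows "C_k k f \<Longrightarrow> C_k k g \<Longrightarrow> C_k k (\<lambda>x. f x *\<^sub>R g x)"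
proof (induction k arbitrary: f g)
  case 0
  then show ?case by (auto intro!: continuous_intros)
next
  case (Suc k)
  show ?case
    by (rule C_k_SucI[OF has_derivative_scaleR[OF C_k_SucD(1)[OF Suc.prems(1)] C_k_SucD(1)[OF Suc.prems(2)]]])
       (intro C_k_add Suc.IH C_k_SucD(2)[OF Suc.prems(1)] C_k_SucD(2)[OF Suc.prems(2)] C_k_Suc_imp[OF Suc.prems(1)] C_k_Suc_imp[OF Suc.prems(2)])
qed

lemma C_k_mult:
  fixes f :: "'a::euclidean_space \<Rightarrow> real"
  shows "C_k k f \<Longrightarrow> C_k k g \<Longrightarrow> C_k k (\<lambda>x. f x * g x)"
  using C_k_scaleR[of k f g] by simp

lemma C_k_cmult: "C_k k f \<Longrightarrow> C_k k (\<lambda>x. c *\<^sub>R f x)"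
  using C_k_scaleR[OF C_k_const] .

lemma C_k_sum: "(\<And>i. i \<in> I \<Longrightarrow> C_k k (f i)) \<Longrightarrow> C_k k (\<lambda>x. \<Sum>i\<in>I. f i x)"
  by (induction I rule: infinite_finite_induct) (auto intro: C_k_const C_k_add)

lemma C_k_inner: "C_k k (\<lambda>x. x \<bullet> (b :: 'a::euclidean_space))"
proof (cases k)
  case (Suc j)
  then show ?thesis
    by (auto intro!: C_k_SucI[of _ "\<lambda>_ h. h \<bullet> b"] C_k_const derivative_eq_intros simp del: C_k.simps)
qed (simp add: continuous_intros)

lemma C_k_affine:
  fixes f :: "'a::euclidean_space \<Rightarrow> 'b::real_normed_vector"
  shows "C_k k f \<Longrightarrow> C_k k (\<lambda>x. f (r *\<^sub>R x + a))"
proof (induction k arbitrary: f)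
  case 0
  then have "continuous_on UNIV f" by simp
  then have "continuous_on UNIV (\<lambda>x. f (r *\<^sub>R x + a))"
    by (rule continuous_on_compose2) (auto intro!: continuous_intros)
  then show ?case by simp
next
  case (Suc k)
  let ?f' = "\<lambda>x. frechet_derivative f (at x)"
  have lin: "linear (?f' x)" for x using C_k_SucD(1)[OF Suc.prems] by (rule has_derivative_linear)
  show ?case
  proof (rule C_k_SucI)
    fix x
    have "((\<lambda>x. r *\<^sub>R x + a) has_derivative (\<lambda>h. r *\<^sub>R h)) (at x)" by (auto intro!: derivative_eq_intros)
    from has_derivative_compose[OF this C_k_SucD(1)[OF Suc.prems]]
    show "((\<lambda>x. f (r *\<^sub>R x + a)) has_derivative (\<lambda>h. r *\<^sub>R ?f' (r *\<^sub>R x + a) h)) (at x)"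
      by (simp add: linear_cmul[OF lin])
  qed (intro C_k_cmult Suc.IH[of "\<lambda>x. ?f' x _"] C_k_SucD(2)[OF Suc.prems])
qed

lemma C_k_exp_square: "C_k k (\<lambda>x::'a::euclidean_space. exp (a * (x \<bullet> x)))"
proof (induction k)
  case (Suc k)
  show ?case
  proof (rule C_k_SucI)
    show "((\<lambda>x::'a. exp (a * (x \<bullet> x))) has_derivative (\<lambda>h. 2 * a * (x \<bullet> h) * exp (a * (x \<bullet> x)))) (at x)" for x
      by (auto intro!: derivative_eq_intros simp: inner_commute algebra_simps)
    show "C_k k (\<lambda>x::'a. 2 * a * (x \<bullet> b) * exp (a * (x \<bullet> x)))" for b
      by (intro C_k_mult C_k_const C_k_inner Suc.IH)
  qed
qed (auto intro!: continuous_intros)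

text \<open>For p = 1 the classical flat function exp (- 1 / t). The polynomial parameter closes the
  family under differentiation, so smoothness follows by induction on the order for all p at
  once.\<close>

definition smooth_step :: "real poly \<Rightarrow> real \<Rightarrow> real" where
  "smooth_step p t = (if t \<le> 0 then 0 else poly p (1 / t) * exp (- (1 / t)))"

lemma poly_div_exp_tendsto_0: "((\<lambda>y. poly p y * exp (- y)) \<longlongrightarrow> (0::real)) at_top"
proof -
  have "((\<lambda>y. \<Sum>i\<le>degree p. coeff p i * (y ^ i / exp y)) \<longlongrightarrow> 0) at_top"
    by (intro tendsto_null_sum tendsto_mult_right_zero tendsto_power_div_exp_0)
  moreover have "poly p y * exp (- y) = (\<Sum>i\<le>degree p. coeff p i * (y ^ i / exp y))" for y
    by (simp only: poly_altdef sum_distrib_right exp_minus divide_inverse mult.assoc)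
  ultimately show ?thesis by simp
qed

text \<open>In terms of y = 1 / t, the derivative of p(y) exp (- y) with respect to t is y^2 (p(y) -
  p'(y)) exp (- y).\<close>

lemma smooth_step_has_derivative:
  "(smooth_step p has_real_derivative smooth_step ([:0, 0, 1:] * (p - pderiv p)) t) (at t)"
proof -
  let ?q = "[:0, 0, 1:] * (p - pderiv p)"
  consider "t < 0" | "t = 0" | "t > 0" by linarith
  then show ?thesis
  proof cases
    case 1
    have "((\<lambda>_. 0) has_real_derivative 0) (at t)" by simp
    then have "(smooth_step p has_real_derivative 0) (at t)"
      by (rule has_field_derivative_transform_within_open[of _ _ _ "{..<0}"]) (use 1 in \<open>auto simp: smooth_step_def\<close>)
    then show ?thesis using 1 by (simp add: smooth_step_def)
  next
    case 2
    \<comment> \<open>At 0 the right difference quotient is y p(y) exp (- y) with y = 1 / h tending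
      to infinity; on the left it is 0.\<close>
    have "((\<lambda>h. poly ([:0, 1:] * p) (1 / h) * exp (- (1 / h))) \<longlongrightarrow> 0) (at_right (0::real))"
      by (rule filterlim_compose[OF poly_div_exp_tendsto_0]) (use filterlim_inverse_at_top_right in \<open>simp add: inverse_eq_divide\<close>)
    then have r: "((\<lambda>h. smooth_step p h / h) \<longlongrightarrow> 0) (at_right 0)"
      by (rule Lim_transform_eventually) (auto simp: smooth_step_def eventually_at_filter)
    have l: "((\<lambda>h. smooth_step p h / h) \<longlongrightarrow> 0) (at_left 0)"
      by (rule Lim_transform_eventually[OF tendsto_const]) (auto simp: smooth_step_def eventually_at_filter)
    have "((\<lambda>h. smooth_step p h / h) \<longlongrightarrow> 0) (at 0)" using l r by (simp add: filterlim_split_at)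
    then show ?thesis using 2 by (simp add: has_field_derivative_iff smooth_step_def)
  next
    case 3
    have "((\<lambda>t. 1 / t) has_real_derivative - (1 / t\<^sup>2)) (at t)" "((\<lambda>t. - (1 / t)) has_real_derivative 1 / t\<^sup>2) (at t)"
      using 3 by (auto intro!: derivative_eq_intros simp: power2_eq_square)
    from DERIV_mult[OF DERIV_chain2[OF poly_DERIV this(1)] DERIV_chain2[OF DERIV_exp this(2)]]
    have "((\<lambda>t. poly p (1 / t) * exp (- (1 / t))) has_real_derivative
       (poly (pderiv p) (1 / t) * (- (1 / t\<^sup>2))) * exp (- (1 / t)) + (exp (- (1 / t)) * (1 / t\<^sup>2)) * poly p (1 / t)) (at t)" .
    then have "(smooth_step p has_real_derivative
       (poly (pderiv p) (1 / t) * (- (1 / t\<^sup>2))) * exp (- (1 / t)) + (exp (- (1 / t)) * (1 / t\<^sup>2)) * poly p (1 / t)) (at t)"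
      by (rule has_field_derivative_transform_within_open[of _ _ _ "{0<..}"]) (use 3 in \<open>auto simp: smooth_step_def\<close>)
    moreover have "(poly (pderiv p) (1 / t) * (- (1 / t\<^sup>2))) * exp (- (1 / t)) + (exp (- (1 / t)) * (1 / t\<^sup>2)) * poly p (1 / t) = smooth_step ?q t"
      using 3 by (simp add: smooth_step_def power2_eq_square algebra_simps)
    ultimately show ?thesis by simp
  qed
qed

lemma C_k_smooth_bump: "C_k k (\<lambda>x::'a::euclidean_space. smooth_step p (1 - x \<bullet> x))"
proof (induction k arbitrary: p)
  case 0
  have "isCont (smooth_step p) t" for t using smooth_step_has_derivative by (rule DERIV_isCont)
  then have "continuous_on UNIV (smooth_step p)" by (simp add: continuous_at_imp_continuous_on)
  then have "continuous_on UNIV (\<lambda>x::'a. smooth_step p (1 - x \<bullet> x))"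
    by (rule continuous_on_compose2) (auto intro!: continuous_intros)
  then show ?case by simp
next
  case (Suc k)
  let ?q = "[:0, 0, 1:] * (p - pderiv p)"
  show ?case
  proof (rule C_k_SucI)
    fix x :: 'a
    have "((\<lambda>x::'a. 1 - x \<bullet> x) has_derivative (\<lambda>h. - 2 * (x \<bullet> h))) (at x)"
      by (auto intro!: derivative_eq_intros simp: inner_commute)
    from has_derivative_compose[OF this smooth_step_has_derivative[unfolded has_field_derivative_def]]
    show "((\<lambda>x::'a. smooth_step p (1 - x \<bullet> x)) has_derivative (\<lambda>h. (- 2 * (x \<bullet> h)) * smooth_step ?q (1 - x \<bullet> x))) (at x)"
      by (simp add: mult.commute)
    show "C_k k (\<lambda>x::'a. (- 2 * (x \<bullet> b)) * smooth_step ?q (1 - x \<bullet> x))" for b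
      by (intro C_k_mult C_k_const C_k_inner Suc.IH)
  qed
qed

definition smooth_kernel :: "('a::euclidean_space \<Rightarrow> real) \<Rightarrow> bool" where
  "smooth_kernel \<kappa> \<longleftrightarrow> (\<forall>k. C_k k \<kappa>) \<and> (\<exists>R>0. \<forall>x. norm x > R \<longrightarrow> \<kappa> x = 0)"

definition conv :: "('a::euclidean_space \<Rightarrow> real) \<Rightarrow> ('a \<Rightarrow> 'b::euclidean_space) \<Rightarrow> 'a \<Rightarrow> 'b" where
  "conv \<kappa> f x = (\<integral>y. \<kappa> (x - y) *\<^sub>R f y \<partial>lborel)"

lemma smooth_kernelE:
  assumes "smooth_kernel \<kappa>"
  obtains R B where "R > 0" "B > 0" "\<And>x. norm x > R \<Longrightarrow> \<kappa> x = 0" "\<And>x. \<bar>\<kappa> x\<bar> \<le> B" "continuous_on UNIV \<kappa>"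
proof -
  from assms obtain R where R: "R > 0" "\<And>x. norm x > R \<Longrightarrow> \<kappa> x = 0" and C: "C_k 0 \<kappa>" unfolding smooth_kernel_def by blast
  have c: "continuous_on UNIV \<kappa>" using C by simp
  obtain B where "B > 0" "\<And>x. norm (\<kappa> x) \<le> B"
    by (rule continuous_compact_support_bounded[OF c compact_cball[of 0 R]]) (use R in auto)
  with R c show ?thesis by (intro that[of R B]) auto
qed

lemma smooth_kernel_derivative:
  fixes \<kappa> :: "'a::euclidean_space \<Rightarrow> real"
  assumes "smooth_kernel \<kappa>" "b \<in> Basis"
  shows "smooth_kernel (\<lambda>x. frechet_derivative \<kappa> (at x) b)"
proof -
  from assms obtain R where R: "R > 0" "\<And>x. norm x > R \<Longrightarrow> \<kappa> x = 0" and C: "\<And>k. C_k k \<kappa>" unfolding smooth_kernel_def by blast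
  have "frechet_derivative \<kappa> (at x) b = 0" if "norm x > R" for x
    using frechet_derivative_at[OF has_derivative_zero_outside[of "cball 0 R" \<kappa> x]] R that by (simp add: fun_eq_iff)
  moreover have "C_k k (\<lambda>x. frechet_derivative \<kappa> (at x) b)" for k using C_k_SucD(2)[OF C[of "Suc k"] assms(2)] .
  ultimately show ?thesis unfolding smooth_kernel_def using R(1) by blast
qed

text \<open>The partial derivatives are smooth kernels themselves and hence Lipschitz, so the
  remainder is quadratic uniformly in the base point. This lets a convolution with a merely bounded
  Borel function be differentiated.\<close>

lemma smooth_kernel_taylor:
  fixes \<kappa> :: "'a::euclidean_space \<Rightarrow> real"
  assumes "smooth_kernel \<kappa>"
  obtains M where "M > 0" "\<And>u h. \<bar>\<kappa> (u + h) - \<kappa> u - (\<Sum>b\<in>Basis. (h \<bullet> b) * frechet_derivative \<kappa> (at u) b)\<bar> \<le> M * (norm h)\<^sup>2"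
proof -
  let ?D = "\<lambda>b x. frechet_derivative \<kappa> (at x) b"
  have C: "C_k (Suc k) \<kappa>" for k using assms unfolding smooth_kernel_def by blast
  note d\<kappa> = C_k_SucD(1)[OF C[of 0]]
  have "\<exists>M>0. \<forall>x y. \<bar>?D b x - ?D b y\<bar> \<le> M * norm (x - y)" if b: "b \<in> Basis" for b
  proof -
    from smooth_kernel_derivative[OF assms b] obtain R where R: "\<And>x. norm x > R \<Longrightarrow> ?D b x = 0" and C': "C_k (Suc 0) (?D b)"
      unfolding smooth_kernel_def by blast
    obtain M where M: "M > 0" "\<And>x v. norm (frechet_derivative (?D b) (at x) v) \<le> M * norm v"
      by (rule C_k_1_derivative_bounded[OF C' compact_cball[of 0 R]]) (use R in auto)
    have "norm (?D b x - ?D b y) \<le> M * norm (x - y)" for x y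
      by (rule differentiable_bound[OF convex_UNIV]) (use C_k_SucD(1)[OF C'] M in \<open>auto intro!: onorm_le\<close>)
    with M(1) show ?thesis by auto
  qed
  then obtain M where M: "\<And>b. b \<in> Basis \<Longrightarrow> M b > 0" "\<And>b x y. b \<in> Basis \<Longrightarrow> \<bar>?D b x - ?D b y\<bar> \<le> M b * norm (x - y)"
    by metis
  define N where "N = (\<Sum>b\<in>(Basis::'a set). M b)"
  have N: "N > 0" unfolding N_def by (intro sum_pos) (auto intro: M)
  have rep: "frechet_derivative \<kappa> (at x) v = (\<Sum>b\<in>Basis. (v \<bullet> b) * ?D b x)" for x v
  proof -
    have lin: "linear (frechet_derivative \<kappa> (at x))" using d\<kappa> by (rule has_derivative_linear)
    have "frechet_derivative \<kappa> (at x) v = frechet_derivative \<kappa> (at x) (\<Sum>b\<in>Basis. (v \<bullet> b) *\<^sub>R b)"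
      by (simp add: euclidean_representation)
    also have "\<dots> = (\<Sum>b\<in>Basis. (v \<bullet> b) * ?D b x)"
      by (simp only: linear_sum[OF lin] linear_cmul[OF lin] real_scaleR_def)
    finally show ?thesis .
  qed
  have T: "\<bar>\<kappa> (u + h) - \<kappa> u - frechet_derivative \<kappa> (at u) h\<bar> \<le> N * (norm h)\<^sup>2" for u h
  proof -
    let ?L = "frechet_derivative \<kappa> (at u)"
    have bl: "bounded_linear ?L" using d\<kappa> by (rule has_derivative_bounded_linear)
    \<comment> \<open>The kernel minus its linear part at u: on the ball of radius |h| its
      derivative is at most N * |h|, and the mean value inequality yields the second factor
      |h|.\<close>
    let ?g = "\<lambda>v. \<kappa> v - ?L v"
    have "norm (?g (u + h) - ?g u) \<le> (N * norm h) * norm ((u + h) - u)"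
    proof (rule differentiable_bound[where S="cball u (norm h)"])
      fix v assume v: "v \<in> cball u (norm h)"
      show "(?g has_derivative (\<lambda>k. frechet_derivative \<kappa> (at v) k - ?L k)) (at v within cball u (norm h))"
        by (intro has_derivative_diff has_derivative_at_withinI[OF d\<kappa>] bounded_linear_imp_has_derivative bl)
      show "onorm (\<lambda>k. frechet_derivative \<kappa> (at v) k - ?L k) \<le> N * norm h"
      proof (rule onorm_le)
        fix k
        have "frechet_derivative \<kappa> (at v) k - ?L k = (\<Sum>b\<in>Basis. (k \<bullet> b) * (?D b v - ?D b u))"
          unfolding rep[of v k] rep[of u k] by (simp add: sum_subtractf right_diff_distrib)
        also have "norm \<dots> \<le> (\<Sum>b\<in>Basis. norm k * (M b * norm h))"
        proof (rule sum_norm_le)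
          fix b :: 'a assume b: "b \<in> Basis"
          have "\<bar>?D b v - ?D b u\<bar> \<le> M b * norm (v - u)" by (rule M(2)[OF b])
          also have "\<dots> \<le> M b * norm h" using v M(1)[OF b] by (intro mult_left_mono) (auto simp: dist_norm norm_minus_commute)
          finally show "norm ((k \<bullet> b) * (?D b v - ?D b u)) \<le> norm k * (M b * norm h)"
            unfolding real_norm_def abs_mult using Basis_le_norm[OF b, of k] by (intro mult_mono) auto
        qed
        also have "\<dots> = N * norm h * norm k" by (simp add: N_def sum_distrib_left sum_distrib_right mult_ac)
        finally show "norm (frechet_derivative \<kappa> (at v) k - ?L k) \<le> N * norm h * norm k" .
      qed
    qed (auto simp: dist_norm)
    moreover have "?L (u + h) = ?L u + ?L h" using linear_add[OF bounded_linear.linear[OF bl]] .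
    ultimately show ?thesis by (simp add: power2_eq_square algebra_simps)
  qed
  show ?thesis
    by (rule that[OF N]) (use T in \<open>simp only: rep[symmetric]\<close>)
qed

lemma bounded_support_integrable:
  fixes f :: "'a::euclidean_space \<Rightarrow> 'b::euclidean_space"
  assumes [measurable]: "f \<in> borel_measurable borel" and "\<And>y. norm (f y) \<le> C" "\<And>y. y \<notin> cball a R \<Longrightarrow> f y = 0"
  shows "integrable lborel f" "norm (integral\<^sup>L lborel f) \<le> C * measure lborel (cball a R)"
proof -
  have i: "integrable lborel (\<lambda>y. C * indicator (cball a R) y)"
    by (intro integrable_mult_right integrable_real_indicator emeasure_bounded_finite bounded_cball) simp
  have le: "norm (f y) \<le> C * indicator (cball a R) y" for y
    using assms(2,3)[of y] by (cases "y \<in> cball a R") auto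
  show int: "integrable lborel f"
    by (rule Bochner_Integration.integrable_bound[OF i]) (use order_trans[OF le abs_ge_self] in auto)
  have "norm (integral\<^sup>L lborel f) \<le> (\<integral>y. C * indicator (cball a R) y \<partial>lborel)"
    by (rule Bochner_Integration.integral_norm_bound_integral[OF int i]) (rule le)
  then show "norm (integral\<^sup>L lborel f) \<le> C * measure lborel (cball a R)" by simp
qed

lemma conv_integrable:
  fixes f :: "'a::euclidean_space \<Rightarrow> 'b::euclidean_space"
  assumes \<kappa>: "smooth_kernel \<kappa>" and [measurable]: "f \<in> borel_measurable borel" and f: "\<And>y. norm (f y) \<le> C"
  shows "integrable lborel (\<lambda>y. \<kappa> (x - y) *\<^sub>R f y)"
proof -
  obtain R B where R: "R > 0" "B > 0" "\<And>x. norm x > R \<Longrightarrow> \<kappa> x = 0" "\<And>x. \<bar>\<kappa> x\<bar> \<le> B" "continuous_on UNIV \<kappa>"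
    by (rule smooth_kernelE[OF \<kappa>]) (rule that)
  have [measurable]: "\<kappa> \<in> borel_measurable borel" using R(5) by (rule borel_measurable_continuous_onI)
  show ?thesis
    by (rule bounded_support_integrable(1)[where C="B * C" and a=x and R=R])
       (use R f in \<open>auto simp: dist_norm intro!: mult_mono order_trans[OF norm_ge_zero f]\<close>)
qed

text \<open>All derivatives fall on the kernel. The uniform Taylor remainder is integrated over a
  fixed ball and stays quadratic in h.\<close>

lemma conv_has_derivative:
  fixes f :: "'a::euclidean_space \<Rightarrow> 'b::euclidean_space"
  assumes \<kappa>: "smooth_kernel \<kappa>" and [measurable]: "f \<in> borel_measurable borel" and f: "\<And>y. norm (f y) \<le> C"
  shows "(conv \<kappa> f has_derivative (\<lambda>h. \<Sum>b\<in>Basis. (h \<bullet> b) *\<^sub>R conv (\<lambda>x. frechet_derivative \<kappa> (at x) b) f x)) (at x)"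
  unfolding has_derivative_at_alt
proof (intro conjI allI impI)
  let ?D = "\<lambda>b x. frechet_derivative \<kappa> (at x) b"
  let ?L = "\<lambda>h. \<Sum>b\<in>Basis. (h \<bullet> b) *\<^sub>R conv (?D b) f x"
  show "bounded_linear ?L"
    by (intro bounded_linear_sum bounded_linear_scaleR_const bounded_linear_inner_left)
  fix e :: real assume e: "e > 0"
  obtain M where M: "M > 0" "\<And>u h. \<bar>\<kappa> (u + h) - \<kappa> u - (\<Sum>b\<in>Basis. (h \<bullet> b) * ?D b u)\<bar> \<le> M * (norm h)\<^sup>2"
    by (rule smooth_kernel_taylor[OF \<kappa>]) (rule that)
  obtain R B where R: "R > 0" "B > 0" "\<And>x. norm x > R \<Longrightarrow> \<kappa> x = 0" "\<And>x. \<bar>\<kappa> x\<bar> \<le> B" "continuous_on UNIV \<kappa>"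
    by (rule smooth_kernelE[OF \<kappa>]) (rule that)
  have R': "?D b x = 0" if "norm x > R" for b x
    using frechet_derivative_at[OF has_derivative_zero_outside[of "cball 0 R" \<kappa> x]] R(3) that by (simp add: fun_eq_iff)
  have [measurable]: "\<kappa> \<in> borel_measurable borel" using R(5) by (rule borel_measurable_continuous_onI)
  have Dm[measurable]: "?D b \<in> borel_measurable borel" if "b \<in> Basis" for b
  proof (rule smooth_kernelE[OF smooth_kernel_derivative[OF \<kappa> that]])
    assume "continuous_on UNIV (?D b)"
    then show ?thesis by (rule borel_measurable_continuous_onI)
  qed
  have C0: "C \<ge> 0" using f[of 0] norm_ge_zero order_trans by blast
  \<comment> \<open>For |h| < 1 the remainder vanishes outside the ball of radius R + 1 about x, so
    its integral is at most (Q - 1) * |h|^2; the added 1 keeps Q positive for the division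
    below.\<close>
  define Q where "Q = M * C * measure lborel (cball x (R + 1)) + 1"
  have Q: "Q > 0" using M(1) C0 unfolding Q_def by (intro add_nonneg_pos mult_nonneg_nonneg) auto
  show "\<exists>d>0. \<forall>y. norm (y - x) < d \<longrightarrow> norm (conv \<kappa> f y - conv \<kappa> f x - ?L (y - x)) \<le> e * norm (y - x)"
  proof (intro exI[of _ "min 1 (e / Q)"] conjI allI impI)
    show "0 < min 1 (e / Q)" using e Q by simp
    fix y assume y: "norm (y - x) < min 1 (e / Q)"
    define h where "h = y - x"
    define F where "F z = (\<kappa> (x - z + h) - \<kappa> (x - z) - (\<Sum>b\<in>Basis. (h \<bullet> b) * ?D b (x - z))) *\<^sub>R f z" for z
    have Fz: "F z = \<kappa> (y - z) *\<^sub>R f z - \<kappa> (x - z) *\<^sub>R f z - (\<Sum>b\<in>Basis. (h \<bullet> b) *\<^sub>R (?D b (x - z) *\<^sub>R f z))" for z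
      by (simp add: F_def h_def algebra_simps scaleR_left_diff_distrib scaleR_sum_left)
    have i: "integrable lborel (\<lambda>z. ?D b (x - z) *\<^sub>R f z)" if "b \<in> Basis" for b
      by (rule conv_integrable[OF smooth_kernel_derivative[OF \<kappa> that] _ f]) measurable
    have iy: "integrable lborel (\<lambda>z. \<kappa> (y - z) *\<^sub>R f z)" for y by (rule conv_integrable[OF \<kappa> _ f]) measurable
    have i2: "integrable lborel (\<lambda>z. \<Sum>b\<in>Basis. (h \<bullet> b) *\<^sub>R (?D b (x - z) *\<^sub>R f z))"
      by (intro Bochner_Integration.integrable_sum integrable_scaleR_right i)
    have "F = (\<lambda>z. \<kappa> (y - z) *\<^sub>R f z - \<kappa> (x - z) *\<^sub>R f z - (\<Sum>b\<in>Basis. (h \<bullet> b) *\<^sub>R (?D b (x - z) *\<^sub>R f z)))"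
      using Fz by blast
    moreover have "(\<integral>z. (\<Sum>b\<in>Basis. (h \<bullet> b) *\<^sub>R (?D b (x - z) *\<^sub>R f z)) \<partial>lborel) = ?L h"
      unfolding conv_def by (subst Bochner_Integration.integral_sum) (auto intro!: integrable_scaleR_right i simp del: scaleR_scaleR)
    ultimately have "conv \<kappa> f y - conv \<kappa> f x - ?L h = integral\<^sup>L lborel F"
      by (simp only: Bochner_Integration.integral_diff[OF Bochner_Integration.integrable_diff[OF iy iy] i2] Bochner_Integration.integral_diff[OF iy iy] conv_def)
    also have "norm \<dots> \<le> (M * (norm h)\<^sup>2 * C) * measure lborel (cball x (R + 1))"
    proof (rule bounded_support_integrable(2))
      show "F \<in> borel_measurable borel" unfolding F_def by measurable
      show "norm (F z) \<le> M * (norm h)\<^sup>2 * C" for z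
        unfolding F_def norm_scaleR using M f[of z] by (intro mult_mono) (auto intro: M(2))
      show "F z = 0" if "z \<notin> cball x (R + 1)" for z
      proof -
        have "norm (x - z) > R + 1" using that by (simp add: dist_norm)
        moreover have "norm (x - z + h) \<ge> norm (x - z) - norm h" using norm_diff_ineq[of "x - z" h] by simp
        moreover have "norm h < 1" using y by (simp add: h_def)
        ultimately have "norm (x - z) > R" "norm (x - z + h) > R" by linarith+
        then show ?thesis by (simp add: F_def R(3) R')
      qed
    qed
    also have "\<dots> \<le> Q * norm h * norm h" unfolding Q_def by (simp add: power2_eq_square algebra_simps)
    also have "\<dots> \<le> e * norm h"
      using y Q by (intro mult_right_mono) (auto simp: h_def field_simps)
    finally show "norm (conv \<kappa> f y - conv \<kappa> f x - ?L (y - x)) \<le> e * norm (y - x)" unfolding h_def .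
  qed
qed

lemma conv_C_k:
  fixes f :: "'a::euclidean_space \<Rightarrow> 'b::euclidean_space"
  assumes "smooth_kernel \<kappa>" and f[measurable]: "f \<in> borel_measurable borel" and fC: "\<And>y. norm (f y) \<le> C"
  shows "C_k k (conv \<kappa> f)"
  using assms(1)
proof (induction k arbitrary: \<kappa>)
  case 0
  have "continuous_on UNIV (conv \<kappa> f)"
    using conv_has_derivative[OF 0 f fC] by (meson continuous_at_imp_continuous_on has_derivative_continuous)
  then show ?case by simp
next
  case (Suc k)
  show ?case
  proof (rule C_k_SucI[OF conv_has_derivative[OF Suc.prems f fC]])
    fix b :: 'a assume b: "b \<in> Basis"
    have "(\<Sum>i\<in>Basis. (b \<bullet> i) *\<^sub>R conv (\<lambda>x. frechet_derivative \<kappa> (at x) i) f x) = conv (\<lambda>x. frechet_derivative \<kappa> (at x) b) f x" for x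
      using b by (simp add: inner_Basis if_distrib[of "\<lambda>c. c *\<^sub>R _"] sum.delta cong: if_cong)
    then show "C_k k (\<lambda>x. \<Sum>i\<in>Basis. (b \<bullet> i) *\<^sub>R conv (\<lambda>x. frechet_derivative \<kappa> (at x) i) f x)"
      using Suc.IH[OF smooth_kernel_derivative[OF Suc.prems b]] by simp
  qed
qed

text \<open>A rescaled flat bump divided by its integral. The centre is arbitrary because kernels
  off the origin are the ones that push points into \<Omega>.\<close>

lemma mollifier_exists:
  fixes a :: "'a::euclidean_space"
  assumes \<epsilon>: "\<epsilon> > 0"
  obtains \<kappa> where "smooth_kernel \<kappa>" "\<And>x. \<kappa> x \<ge> 0" "\<And>x. x \<notin> cball a \<epsilon> \<Longrightarrow> \<kappa> x = 0" "has_bochner_integral lborel \<kappa> 1"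
proof -
  define g where "g x = smooth_step [:1:] (1 - x \<bullet> x)" for x :: 'a
  define f where "f x = g ((1 / \<epsilon>) *\<^sub>R x + - (1 / \<epsilon>) *\<^sub>R a)" for x
  have arg: "(1 / \<epsilon>) *\<^sub>R x + - (1 / \<epsilon>) *\<^sub>R a = (1 / \<epsilon>) *\<^sub>R (x - a)" for x by (simp add: algebra_simps)
  have g0: "g x \<ge> 0" for x by (simp add: g_def smooth_step_def)
  have gp: "g x > 0" if "norm x < 1" for x
  proof -
    have "x \<bullet> x < 1" using that by (simp add: power2_norm_eq_inner[symmetric] abs_square_less_1)
    then show ?thesis by (simp add: g_def smooth_step_def)
  qed
  have gz: "g x = 0" if "norm x > 1" for x
  proof -
    have "x \<bullet> x \<ge> 1" using that one_le_power[of "norm x" 2] by (simp add: power2_norm_eq_inner[symmetric])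
    then show ?thesis by (simp add: g_def smooth_step_def)
  qed
  have Cf: "C_k k f" for k unfolding f_def by (intro C_k_affine) (simp add: g_def C_k_smooth_bump)
  have fz: "f x = 0" if "x \<notin> cball a \<epsilon>" for x
  proof -
    have "norm ((1 / \<epsilon>) *\<^sub>R (x - a)) > 1" using that \<epsilon> by (simp add: dist_norm norm_minus_commute)
    then show ?thesis unfolding f_def arg by (rule gz)
  qed
  have fpos: "f x > 0" if "x \<in> ball a \<epsilon>" for x
  proof -
    have "norm ((1 / \<epsilon>) *\<^sub>R (x - a)) < 1" using that \<epsilon> by (simp add: dist_norm norm_minus_commute)
    then show ?thesis unfolding f_def arg by (rule gp)
  qed
  have sk: "smooth_kernel f" unfolding smooth_kernel_def
  proof (intro conjI allI exI[of _ "norm a + \<epsilon>"] impI)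
    fix x :: 'a assume "norm a + \<epsilon> < norm x"
    then show "f x = 0" using norm_triangle_sub[of x a] by (intro fz) (auto simp: dist_norm norm_minus_commute)
  qed (use Cf \<epsilon> in \<open>auto intro: add_nonneg_pos\<close>)
  have int: "integrable lborel f"
  proof (rule smooth_kernelE[OF sk])
    fix R B assume *: "\<And>x. \<bar>f x\<bar> \<le> B" "continuous_on UNIV f"
    show ?thesis by (rule bounded_support_integrable(1)[of _ B a \<epsilon>]) (use * fz in \<open>auto intro: borel_measurable_continuous_onI\<close>)
  qed
  define Z where "Z = integral\<^sup>L lborel f"
  have f0: "f x \<ge> 0" for x by (simp add: f_def g0)
  have "Z \<noteq> 0"
  proof
    assume "Z = 0"
    then have "AE x in lborel. f x = 0" using integral_nonneg_eq_0_iff_AE[OF int] f0 by (simp add: Z_def)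
    then have "AE x in lborel. x \<notin> ball a \<epsilon>" by eventually_elim (use fpos in force)
    then have "emeasure lborel (ball a \<epsilon>) = 0" by (subst (asm) AE_iff_measurable[of "ball a \<epsilon>"]) auto
    moreover have "unit_ball_vol (real DIM('a)) * \<epsilon> ^ DIM('a) > 0" using \<epsilon> by (intro mult_pos_pos unit_ball_vol_pos) auto
    ultimately show False using \<epsilon> by (simp add: emeasure_ball)
  qed
  moreover have "Z \<ge> 0" unfolding Z_def using f0 by simp
  ultimately have Z: "Z > 0" by simp
  show ?thesis
  proof (rule that[of "\<lambda>x. (1 / Z) *\<^sub>R f x"])
    show "smooth_kernel (\<lambda>x. (1 / Z) *\<^sub>R f x)"
    proof -
      obtain R where "R > 0" "\<And>x. norm x > R \<Longrightarrow> f x = 0" using sk unfolding smooth_kernel_def by blast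
      then show ?thesis unfolding smooth_kernel_def by (intro conjI allI C_k_cmult Cf exI[of _ R]) auto
    qed
    show "has_bochner_integral lborel (\<lambda>x. (1 / Z) *\<^sub>R f x) 1"
      using int Z by (auto simp: has_bochner_integral_iff Z_def)
  qed (use f0 fz Z in auto)
qed

section \<open>Approximation by smooth functions\<close>

lemma nn_integral_lborel_reflect:
  fixes f :: "'a::euclidean_space \<Rightarrow> ennreal"
  assumes [measurable]: "f \<in> borel_measurable borel"
  shows "(\<integral>\<^sup>+y. f (x - y) \<partial>lborel) = (\<integral>\<^sup>+y. f y \<partial>lborel)"
  by (subst (2) lborel_affine[of "-1" x]) (simp_all add: nn_integral_density nn_integral_distr)

lemma emeasure_lborel_translate:
  fixes A :: "'a::euclidean_space set"
  assumes [measurable]: "A \<in> sets borel"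
  shows "emeasure lborel {x. x - h \<in> A} = emeasure lborel A"
proof -
  have "{x \<in> space borel. x - h \<in> A} \<in> sets borel" by measurable
  then have [measurable]: "{x. x - h \<in> A} \<in> sets borel" by simp
  have "emeasure lborel {x. x - h \<in> A} = (\<integral>\<^sup>+x. indicator {x. x - h \<in> A} x \<partial>lborel)" by simp
  also have "\<dots> = (\<integral>\<^sup>+x. indicator A (x + - h) \<partial>lborel)"
    by (intro nn_integral_cong) (simp add: indicator_def)
  also have "\<dots> = emeasure lborel A" by (subst nn_integral_lborel_shift) auto
  finally show ?thesis .
qed

text \<open>Enclose E between a compact K and an open U with U - K small. A shift by less than the
  distance from K to the complement of U takes K into U, so whenever x and x - h disagree about E,
  one of them lies in U - K.\<close>

lemma emeasure_translate_sym_diff_small: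
  fixes E :: "'a::euclidean_space set"
  assumes E: "E \<in> sets borel" "bounded E" and e: "e > (0::real)"
  obtains \<eta> where "\<eta> > 0" "\<And>h. norm h < \<eta> \<Longrightarrow> emeasure lborel {x. (x - h \<in> E) \<noteq> (x \<in> E)} \<le> ennreal e"
proof -
  have El: "E \<in> sets lebesgue" using E(1) by simp
  obtain U where U: "open U" "E \<subseteq> U" "emeasure lebesgue (U - E) < ennreal (e / 4)"
    by (rule sets_lebesgue_outer_open[OF El, of "e / 4"]) (use e in auto)
  obtain K where K: "closed K" "K \<subseteq> E" "emeasure lebesgue (E - K) < ennreal (e / 4)"
    by (rule sets_lebesgue_inner_closed[OF El, of "e / 4"]) (use e in auto)
  have cK: "compact K" using K E(2) bounded_subset compact_eq_bounded_closed by blast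
  have [measurable]: "U \<in> sets borel" "K \<in> sets borel" "E \<in> sets borel" using U K E by auto
  define D where "D = U - K"
  have [measurable]: "D \<in> sets borel" unfolding D_def by measurable
  have "emeasure lborel D = emeasure lborel ((U - E) \<union> (E - K))"
    using U(2) K(2) by (intro arg_cong[where f="emeasure lborel"]) (auto simp: D_def)
  also have "\<dots> \<le> emeasure lborel (U - E) + emeasure lborel (E - K)" by (rule emeasure_subadditive) auto
  also have "\<dots> \<le> ennreal (e / 4) + ennreal (e / 4)" using U(3) K(3) by (intro add_mono) auto
  also have "\<dots> = ennreal (e / 2)" using e by (simp add: ennreal_plus[symmetric] del: ennreal_plus)
  finally have D: "emeasure lborel D \<le> ennreal (e / 2)" .
  obtain \<eta> where \<eta>: "\<eta> > 0" "(\<Union>x\<in>K. ball x \<eta>) \<subseteq> U"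
    by (rule compact_subset_open_imp_ball_epsilon_subset[OF cK U(1)]) (use K(2) U(2) in auto)
  show ?thesis
  proof (rule that[OF \<eta>(1)])
    fix h :: 'a assume h: "norm h < \<eta>"
    have near: "y \<in> U" if "x \<in> K" "norm (x - y) < \<eta>" for x y
    proof -
      have "y \<in> (\<Union>x\<in>K. ball x \<eta>)" using that by (auto simp: dist_norm)
      then show ?thesis using \<eta>(2) by blast
    qed
    have "{x. (x - h \<in> E) \<noteq> (x \<in> E)} \<subseteq> D \<union> {x. x - h \<in> D}"
    proof
      fix x assume "x \<in> {x. (x - h \<in> E) \<noteq> (x \<in> E)}"
      then show "x \<in> D \<union> {x. x - h \<in> D}"
        using near[of x "x - h"] near[of "x - h" x] h U(2) K(2) by (auto simp: D_def norm_minus_commute)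
    qed
    moreover have "{x \<in> space borel. x - h \<in> D} \<in> sets borel" by measurable
    ultimately have "emeasure lborel {x. (x - h \<in> E) \<noteq> (x \<in> E)} \<le> emeasure lborel (D \<union> {x. x - h \<in> D})"
      by (intro emeasure_mono) auto
    also have "\<dots> \<le> emeasure lborel D + emeasure lborel {x. x - h \<in> D}"
      using \<open>{x \<in> space borel. x - h \<in> D} \<in> sets borel\<close> by (intro emeasure_subadditive) auto
    also have "\<dots> \<le> ennreal (e / 2) + ennreal (e / 2)" using D by (simp add: emeasure_lborel_translate add_mono)
    also have "\<dots> = ennreal e" using e by (simp add: ennreal_plus[symmetric] del: ennreal_plus)
    finally show "emeasure lborel {x. (x - h \<in> E) \<noteq> (x \<in> E)} \<le> ennreal e" .
  qed
qed

lemma conv_indicator_bounds: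
  fixes E :: "'a::euclidean_space set"
  assumes \<kappa>: "smooth_kernel \<kappa>" "\<And>x. \<kappa> x \<ge> 0" "has_bochner_integral lborel \<kappa> 1" and [measurable]: "E \<in> sets borel"
  shows "0 \<le> conv \<kappa> (indicat_real E) x" "conv \<kappa> (indicat_real E) x \<le> 1"
    "ennreal \<bar>conv \<kappa> (indicat_real E) x - indicator E x\<bar> \<le> (\<integral>\<^sup>+h. ennreal (\<kappa> h) * indicator {h. (x - h \<in> E) \<noteq> (x \<in> E)} h \<partial>lborel)"
proof -
  have \<kappa>m[measurable]: "\<kappa> \<in> borel_measurable borel" using borel_measurable_has_bochner_integral[OF \<kappa>(3)] by simp
  have i1: "integrable lborel (\<lambda>y. \<kappa> (x - y) *\<^sub>R indicat_real E y)"
    by (rule conv_integrable[OF \<kappa>(1), of _ 1]) (auto simp: indicator_def)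
  have n1: "(\<integral>\<^sup>+y. ennreal (\<kappa> (x - y)) \<partial>lborel) = 1"
    using nn_integral_lborel_reflect[of "\<lambda>h. ennreal (\<kappa> h)" x] \<kappa>(2,3)
    by (simp add: nn_integral_eq_integral has_bochner_integral_iff)
  have i2: "has_bochner_integral lborel (\<lambda>y. \<kappa> (x - y)) 1"
    by (rule has_bochner_integral_nn_integral) (use n1 \<kappa>(2) in auto)
  show "0 \<le> conv \<kappa> (indicat_real E) x" unfolding conv_def using \<kappa>(2) by (intro integral_nonneg_AE AE_I2) auto
  have "conv \<kappa> (indicat_real E) x \<le> (\<integral>y. \<kappa> (x - y) \<partial>lborel)"
    unfolding conv_def using i1 i2 \<kappa>(2) by (intro integral_mono) (auto simp: has_bochner_integral_iff indicator_def)
  then show "conv \<kappa> (indicat_real E) x \<le> 1" using i2 by (simp add: has_bochner_integral_iff)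
  have i3: "integrable lborel (\<lambda>y. \<kappa> (x - y) * indicat_real E x)"
    using i2 by (intro integrable_mult_left) (simp add: has_bochner_integral_iff)
  have "conv \<kappa> (indicat_real E) x - indicator E x = (\<integral>y. \<kappa> (x - y) *\<^sub>R indicat_real E y - \<kappa> (x - y) * indicat_real E x \<partial>lborel)"
    unfolding conv_def using i1 i3 i2 by (subst Bochner_Integration.integral_diff) (auto simp: has_bochner_integral_iff)
  then have "ennreal \<bar>conv \<kappa> (indicat_real E) x - indicator E x\<bar> \<le> (\<integral>\<^sup>+y. ennreal (norm (\<kappa> (x - y) *\<^sub>R indicat_real E y - \<kappa> (x - y) * indicat_real E x)) \<partial>lborel)"
    using integral_norm_bound_ennreal[OF Bochner_Integration.integrable_diff[OF i1 i3]] by simp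
  also have "\<dots> = (\<integral>\<^sup>+y. (\<lambda>h. ennreal (\<kappa> h) * indicator {h. (x - h \<in> E) \<noteq> (x \<in> E)} h) (x - y) \<partial>lborel)"
    using \<kappa>(2) by (intro nn_integral_cong) (auto simp: indicator_def)
  also have "\<dots> = (\<integral>\<^sup>+h. ennreal (\<kappa> h) * indicator {h. (x - h \<in> E) \<noteq> (x \<in> E)} h \<partial>lborel)"
  proof (rule nn_integral_lborel_reflect)
    have "{h \<in> space borel. (x - h \<in> E) \<noteq> (x \<in> E)} \<in> sets borel" by measurable
    then have [measurable]: "{h. (x - h \<in> E) \<noteq> (x \<in> E)} \<in> sets borel" by simp
    show "(\<lambda>h. ennreal (\<kappa> h) * indicator {h. (x - h \<in> E) \<noteq> (x \<in> E)} h) \<in> borel_measurable borel" by measurable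
  qed
  finally show "ennreal \<bar>conv \<kappa> (indicat_real E) x - indicator E x\<bar> \<le> (\<integral>\<^sup>+h. ennreal (\<kappa> h) * indicator {h. (x - h \<in> E) \<noteq> (x \<in> E)} h \<partial>lborel)" .
qed

text \<open>The radius \<eta> serves every kernel supported in that ball, symmetric or not. The
  shifted kernels depend on the boundary chart and are chosen only after \<eta>.\<close>

lemma conv_indicator_L1_close:
  fixes E :: "'a::euclidean_space set"
  assumes E[measurable]: "E \<in> sets borel" and e: "e > (0::real)"
  obtains \<eta> where "\<eta> > 0" "\<And>\<kappa>. smooth_kernel \<kappa> \<Longrightarrow> (\<And>x. \<kappa> x \<ge> 0) \<Longrightarrow> has_bochner_integral lborel \<kappa> 1 \<Longrightarrow>
     (\<And>x. x \<notin> cball 0 \<eta> \<Longrightarrow> \<kappa> x = 0) \<Longrightarrow>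
     (\<integral>\<^sup>+x\<in>cball 0 R. ennreal \<bar>conv \<kappa> (indicat_real E) x - indicator E x\<bar> \<partial>lborel) \<le> ennreal e"
proof -
  \<comment> \<open>For x in the ball of radius R and shifts of length at most 1 only this bounded
    piece of E matters.\<close>
  define E1 where "E1 = E \<inter> cball 0 (R + 1)"
  have [measurable]: "E1 \<in> sets borel" unfolding E1_def by measurable
  obtain \<eta>0 where \<eta>0: "\<eta>0 > 0" "\<And>h. norm h < \<eta>0 \<Longrightarrow> emeasure lborel {x. (x - h \<in> E1) \<noteq> (x \<in> E1)} \<le> ennreal e"
    by (rule emeasure_translate_sym_diff_small[of E1 e]) (use e in \<open>auto simp: E1_def\<close>)
  show ?thesis
  proof (rule that[of "min 1 (\<eta>0 / 2)"])
    show "min 1 (\<eta>0 / 2) > 0" using \<eta>0(1) by simp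
    fix \<kappa> :: "'a \<Rightarrow> real"
    assume \<kappa>: "smooth_kernel \<kappa>" "\<And>x. \<kappa> x \<ge> 0" "has_bochner_integral lborel \<kappa> 1" "\<And>x. x \<notin> cball 0 (min 1 (\<eta>0 / 2)) \<Longrightarrow> \<kappa> x = 0"
    have [measurable]: "\<kappa> \<in> borel_measurable borel" using borel_measurable_has_bochner_integral[OF \<kappa>(3)] by simp
    have "{p \<in> space (borel \<Otimes>\<^sub>M borel). (fst p - snd p \<in> E) \<noteq> (fst p \<in> E)} \<in> sets (borel \<Otimes>\<^sub>M (borel :: 'a measure))" by measurable
    then have Sm[measurable]: "{p. (fst p - snd p \<in> E) \<noteq> (fst p \<in> E)} \<in> sets (borel \<Otimes>\<^sub>M (borel :: 'a measure))" by (simp add: space_pair_measure)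
    have [measurable]: "cball (0::'a) R \<in> sets borel" by simp
    let ?G = "\<lambda>x h. ennreal (\<kappa> h) * indicator {p. (fst p - snd p \<in> E) \<noteq> (fst p \<in> E)} (x, h) * indicator (cball 0 R) x"
    have "(\<integral>\<^sup>+x\<in>cball 0 R. ennreal \<bar>conv \<kappa> (indicat_real E) x - indicator E x\<bar> \<partial>lborel) \<le> (\<integral>\<^sup>+x. (\<integral>\<^sup>+h. ?G x h \<partial>lborel) \<partial>lborel)"
    proof (intro nn_integral_mono)
      fix x :: 'a
      show "ennreal \<bar>conv \<kappa> (indicat_real E) x - indicator E x\<bar> * indicator (cball 0 R) x \<le> (\<integral>\<^sup>+h. ?G x h \<partial>lborel)"
        using conv_indicator_bounds(3)[OF \<kappa>(1-3) E, of x] by (cases "x \<in> cball 0 R") (auto simp: indicator_def)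
    qed
    also have "\<dots> = (\<integral>\<^sup>+h. (\<integral>\<^sup>+x. ?G x h \<partial>lborel) \<partial>lborel)"
      by (rule lborel_pair.Fubini'[symmetric]) measurable
    also have "\<dots> \<le> (\<integral>\<^sup>+h. ennreal (\<kappa> h) * ennreal e \<partial>lborel)"
    proof (intro nn_integral_mono)
      fix h :: 'a
      show "(\<integral>\<^sup>+x. ?G x h \<partial>lborel) \<le> ennreal (\<kappa> h) * ennreal e"
      proof (cases "\<kappa> h = 0")
        case False
        then have "h \<in> cball 0 (min 1 (\<eta>0 / 2))" using \<kappa>(4) by blast
        then have h: "norm h \<le> 1" "norm h < \<eta>0" using \<eta>0(1) by auto
        have "{x \<in> space borel. (x - h \<in> E1) \<noteq> (x \<in> E1)} \<in> sets borel" by measurable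
        then have [measurable]: "{x. (x - h \<in> E1) \<noteq> (x \<in> E1)} \<in> sets borel" by simp
        have "(\<integral>\<^sup>+x. ?G x h \<partial>lborel) \<le> (\<integral>\<^sup>+x. ennreal (\<kappa> h) * indicator {x. (x - h \<in> E1) \<noteq> (x \<in> E1)} x \<partial>lborel)"
        proof (intro nn_integral_mono)
          fix x :: 'a
          have "x - h \<in> cball 0 (R + 1)" "x \<in> cball 0 (R + 1)" if "x \<in> cball 0 R"
            using that h norm_triangle_ineq4[of x h] by auto
          then show "?G x h \<le> ennreal (\<kappa> h) * indicator {x. (x - h \<in> E1) \<noteq> (x \<in> E1)} x"
            by (cases "x \<in> cball 0 R") (auto simp: indicator_def E1_def)
        qed
        also have "\<dots> = ennreal (\<kappa> h) * emeasure lborel {x. (x - h \<in> E1) \<noteq> (x \<in> E1)}"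
          by (rule nn_integral_cmult_indicator) measurable
        also have "\<dots> \<le> ennreal (\<kappa> h) * ennreal e" by (intro mult_left_mono \<eta>0 h) auto
        finally show ?thesis .
      qed simp
    qed
    also have "\<dots> = (\<integral>\<^sup>+h. ennreal (\<kappa> h) \<partial>lborel) * ennreal e" by (rule nn_integral_multc) measurable
    also have "\<dots> = ennreal e" using \<kappa>(2,3) by (simp add: nn_integral_eq_integral has_bochner_integral_iff)
    finally show "(\<integral>\<^sup>+x\<in>cball 0 R. ennreal \<bar>conv \<kappa> (indicat_real E) x - indicator E x\<bar> \<partial>lborel) \<le> ennreal e" .
  qed
qed

section \<open>Cutoffs, partitions of unity and shifts into the domain\<close>

text \<open>The ball of radius 3/2 averaged at radius 1/2: for |x| \<le> 1 the averaging ball lies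
  inside it, for |x| > 2 outside.\<close>

lemma cutoff_exists:
  obtains \<beta> :: "'a::euclidean_space \<Rightarrow> real" where "\<And>k. C_k k \<beta>" "\<And>x. 0 \<le> \<beta> x" "\<And>x. \<beta> x \<le> 1"
    "\<And>x. norm x \<le> 1 \<Longrightarrow> \<beta> x = 1" "\<And>x. norm x > 2 \<Longrightarrow> \<beta> x = 0"
proof -
  obtain \<kappa> :: "'a \<Rightarrow> real" where \<kappa>: "smooth_kernel \<kappa>" "\<And>x. \<kappa> x \<ge> 0" "\<And>x. x \<notin> cball 0 (1/2) \<Longrightarrow> \<kappa> x = 0" "has_bochner_integral lborel \<kappa> 1"
    by (rule mollifier_exists[of "1/2" "0::'a"]) auto
  have [measurable]: "\<kappa> \<in> borel_measurable borel" using borel_measurable_has_bochner_integral[OF \<kappa>(4)] by simp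
  let ?E = "cball 0 (3/2) :: 'a set"
  note b = conv_indicator_bounds[OF \<kappa>(1,2,4), of ?E]
  have z: "conv \<kappa> (indicat_real ?E) x = indicator ?E x" if "norm x \<le> 1 \<or> norm x > 2" for x
  proof -
    have kz: "\<kappa> h = 0 \<or> (x - h \<in> ?E) = (x \<in> ?E)" for h
    proof (cases "h \<in> cball 0 (1/2)")
      case True
      then show ?thesis using that norm_triangle_ineq4[of x h] norm_triangle_ineq2[of x h] by auto
    qed (use \<kappa>(3) in auto)
    then have "(\<integral>\<^sup>+h. ennreal (\<kappa> h) * indicator {h. (x - h \<in> ?E) \<noteq> (x \<in> ?E)} h \<partial>lborel) = (\<integral>\<^sup>+h. 0 \<partial>(lborel :: 'a measure))"
    proof (intro nn_integral_cong)
      fix h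
      show "ennreal (\<kappa> h) * indicator {h. (x - h \<in> ?E) \<noteq> (x \<in> ?E)} h = 0" using kz[of h] by (auto simp: indicator_def)
    qed
    then show ?thesis using b(3)[of x] by simp
  qed
  have im: "indicat_real ?E \<in> borel_measurable borel" by (intro borel_measurable_indicator) simp
  show ?thesis
    by (rule that[of "conv \<kappa> (indicat_real ?E)"])
       (use b z im in \<open>auto intro!: conv_C_k[OF \<kappa>(1), of _ 1] simp: indicator_def\<close>)
qed

text \<open>Each new function takes the fraction \<open>b j\<close> of what is left, so that 1 minus
  the sum is the product of all 1 - b i, which is 0 as soon as one b i equals 1.\<close>

lemma partition_of_unity_finite:
  fixes b :: "'i \<Rightarrow> 'a::euclidean_space \<Rightarrow> real"
  assumes "finite I" and b: "\<And>i k. i \<in> I \<Longrightarrow> C_k k (b i)" "\<And>i x. i \<in> I \<Longrightarrow> 0 \<le> b i x" "\<And>i x. i \<in> I \<Longrightarrow> b i x \<le> 1"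
  shows "\<exists>\<zeta>. (\<forall>i\<in>I. (\<forall>k. C_k k (\<zeta> i)) \<and> (\<forall>x. 0 \<le> \<zeta> i x \<and> \<zeta> i x \<le> b i x)) \<and>
     (\<forall>x. (\<Sum>i\<in>I. \<zeta> i x) \<le> 1 \<and> ((\<exists>i\<in>I. b i x = 1) \<longrightarrow> (\<Sum>i\<in>I. \<zeta> i x) = 1))"
  using assms
proof (induction I rule: finite_induct)
  case (insert j I)
  then obtain \<zeta> where \<zeta>: "\<And>i k. i \<in> I \<Longrightarrow> C_k k (\<zeta> i)" "\<And>i x. i \<in> I \<Longrightarrow> 0 \<le> \<zeta> i x" "\<And>i x. i \<in> I \<Longrightarrow> \<zeta> i x \<le> b i x"
    "\<And>x. (\<Sum>i\<in>I. \<zeta> i x) \<le> 1" "\<And>x i. i \<in> I \<Longrightarrow> b i x = 1 \<Longrightarrow> (\<Sum>i\<in>I. \<zeta> i x) = 1"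
    by (fastforce simp del: C_k.simps)
  define S where "S x = (\<Sum>i\<in>I. \<zeta> i x)" for x
  have S: "0 \<le> S x" "S x \<le> 1" for x using \<zeta>(2,4) by (auto simp: S_def intro: sum_nonneg)
  have CS: "C_k k S" for k unfolding S_def by (intro C_k_sum \<zeta>)
  define z where "z x = b j x * (1 + (-1) *\<^sub>R S x)" for x
  have Cz: "C_k k z" for k unfolding z_def by (intro C_k_mult C_k_add C_k_const C_k_cmult CS insert.prems) simp
  have z: "z x = b j x * (1 - S x)" for x by (simp add: z_def)
  have bj: "0 \<le> b j x" "b j x \<le> 1" for x using insert.prems by auto
  let ?\<zeta> = "\<zeta>(j := z)"
  have sum: "(\<Sum>i\<in>insert j I. ?\<zeta> i x) = 1 - (1 - b j x) * (1 - S x)" for x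
  proof -
    have "(\<Sum>i\<in>I. ?\<zeta> i x) = S x" unfolding S_def using insert.hyps(2) by (intro sum.cong) auto
    then show ?thesis using insert.hyps by (simp add: z algebra_simps)
  qed
  show ?case
  proof (intro exI[of _ ?\<zeta>] conjI ballI allI impI)
    fix i k x assume i: "i \<in> insert j I"
    show "C_k k (?\<zeta> i)" using i Cz \<zeta>(1) by auto
    show "0 \<le> ?\<zeta> i x" using i \<zeta>(2) S bj by (auto simp: z)
    show "?\<zeta> i x \<le> b i x" using i \<zeta>(3) S bj[of x] by (auto simp: z intro: mult_left_le)
  next
    fix x
    show "(\<Sum>i\<in>insert j I. ?\<zeta> i x) \<le> 1" unfolding sum using S[of x] bj[of x] by simp
    assume "\<exists>i\<in>insert j I. b i x = 1"
    then have "b j x = 1 \<or> S x = 1" using \<zeta>(5) by (auto simp: S_def)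
    then show "(\<Sum>i\<in>insert j I. ?\<zeta> i x) = 1" unfolding sum by auto
  qed
qed simp

text \<open>At a boundary point \<nu> is the direction of the chart. Points of the closure satisfy
  the graph inequality weakly, by continuity of g, and moving upwards makes it strict without
  changing the base point of the graph.\<close>

lemma lipschitz_boundary_shift:
  fixes \<Omega> :: "'a::euclidean_space set"
  assumes \<Omega>: "open \<Omega>" "lipschitz_boundary \<Omega>"
  obtains r \<nu> \<tau>0 where "r > 0" "\<tau>0 > 0" "norm \<nu> \<le> 1"
    "\<And>\<tau> x. 0 < \<tau> \<Longrightarrow> \<tau> < \<tau>0 \<Longrightarrow> x \<in> closure \<Omega> \<Longrightarrow> x \<in> cball p r \<Longrightarrow> x + \<tau> *\<^sub>R \<nu> \<in> \<Omega>"
proof -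
  consider "p \<in> \<Omega>" | "p \<notin> closure \<Omega>" | "p \<in> frontier \<Omega>" using \<Omega>(1) by (auto simp: frontier_def interior_open)
  then show ?thesis
  proof cases
    case 1
    then obtain r where r: "r > 0" "cball p r \<subseteq> \<Omega>" using \<Omega>(1) open_contains_cball by blast
    \<comment> \<open>Away from the frontier nothing has to be moved; to allow \<nu> = 0 the
      conclusion only demands norm at most 1.\<close>
    show ?thesis by (rule that[of r 1 0]) (use r in auto)
  next
    case 2
    then obtain r where r: "r > 0" "cball p r \<subseteq> - closure \<Omega>" using open_contains_cball[of "- closure \<Omega>"] by auto
    show ?thesis by (rule that[of r 1 0]) (use r in auto)
  next
    case 3
    then obtain r \<nu> L and g :: "'a \<Rightarrow> real" where r: "r > 0" and \<nu>: "norm \<nu> = 1" and g: "L-lipschitz_on {z. z \<bullet> \<nu> = 0} g"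
      and eq: "\<Omega> \<inter> ball p r = {x \<in> ball p r. g (x - (x \<bullet> \<nu>) *\<^sub>R \<nu>) < x \<bullet> \<nu>}"
      using \<Omega>(2) unfolding lipschitz_boundary_def by blast
    have \<nu>1: "\<nu> \<bullet> \<nu> = 1" using \<nu> by (simp add: norm_eq_1)
    define \<pi> where "\<pi> x = x - (x \<bullet> \<nu>) *\<^sub>R \<nu>" for x
    have \<pi>0: "\<pi> x \<in> {z. z \<bullet> \<nu> = 0}" for x by (simp add: \<pi>_def inner_simps \<nu>1)
    have "continuous_on UNIV \<pi>" unfolding \<pi>_def by (intro continuous_intros)
    then have cg: "continuous_on UNIV (\<lambda>x. g (\<pi> x))"
      by (rule continuous_on_compose2[OF lipschitz_on_continuous_on[OF g]]) (use \<pi>0 in auto)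
    show ?thesis
    \<comment> \<open>Half of the radius for the point and half for the shift: the moved point stays
      in \<open>ball p r\<close>, where the chart describes \<Omega>.\<close>
    proof (rule that[of "r / 2" "r / 2" \<nu>])
      fix \<tau> x assume \<tau>: "0 < \<tau>" "\<tau> < r / 2" and x: "x \<in> closure \<Omega>" "x \<in> cball p (r / 2)"
      have "x \<in> ball p r" using x(2) r by auto
      have "x \<in> closure (\<Omega> \<inter> ball p r)"
        using x(1) \<open>x \<in> ball p r\<close> open_Int_closure_subset[of "ball p r" \<Omega>] by (auto simp: Int_commute)
      moreover have "closure (\<Omega> \<inter> ball p r) \<subseteq> {x. g (\<pi> x) \<le> x \<bullet> \<nu>}"
      proof (rule closure_minimal)
        show "\<Omega> \<inter> ball p r \<subseteq> {x. g (\<pi> x) \<le> x \<bullet> \<nu>}" unfolding eq \<pi>_def by auto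
        show "closed {x. g (\<pi> x) \<le> x \<bullet> \<nu>}" by (intro closed_Collect_le cg continuous_intros)
      qed
      ultimately have "g (\<pi> x) \<le> x \<bullet> \<nu>" by auto
      moreover have "\<pi> (x + \<tau> *\<^sub>R \<nu>) = \<pi> x" by (simp add: \<pi>_def inner_simps \<nu>1 algebra_simps)
      moreover have "(x + \<tau> *\<^sub>R \<nu>) \<bullet> \<nu> = x \<bullet> \<nu> + \<tau>" by (simp add: inner_simps \<nu>1)
      moreover have "x + \<tau> *\<^sub>R \<nu> \<in> ball p r"
      proof -
        have "dist p (x + \<tau> *\<^sub>R \<nu>) \<le> dist p x + dist x (x + \<tau> *\<^sub>R \<nu>)" by (rule dist_triangle)
        also have "dist x (x + \<tau> *\<^sub>R \<nu>) = \<tau>" using \<tau> \<nu> by (simp add: dist_norm)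
        finally show ?thesis using \<tau> x(2) by simp
      qed
      ultimately have "x + \<tau> *\<^sub>R \<nu> \<in> {x \<in> ball p r. g (\<pi> x) < x \<bullet> \<nu>}" using \<tau> by simp
      then show "x + \<tau> *\<^sub>R \<nu> \<in> \<Omega>" using eq unfolding \<pi>_def by blast
    qed (use r \<nu> in auto)
  qed
qed

text \<open>Averaging against the kernel looks only at points that were pushed into \<open>\<Omega>\<close>.\<close>

lemma inward_kernel_exists:
  fixes \<Omega> :: "'a::euclidean_space set"
  assumes \<Omega>: "open \<Omega>" and \<tau>0: "\<tau>0 > 0" and \<nu>: "norm \<nu> \<le> 1" and \<eta>: "\<eta> > 0"
    and shift: "\<And>\<tau> x. 0 < \<tau> \<Longrightarrow> \<tau> < \<tau>0 \<Longrightarrow> x \<in> closure \<Omega> \<Longrightarrow> x \<in> cball p r \<Longrightarrow> x + \<tau> *\<^sub>R \<nu> \<in> \<Omega>"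
  obtains \<kappa> T where "smooth_kernel \<kappa>" "\<And>x. \<kappa> x \<ge> 0" "has_bochner_integral lborel \<kappa> 1" "\<And>x. x \<notin> cball 0 \<eta> \<Longrightarrow> \<kappa> x = 0"
    "compact T" "T \<subseteq> \<Omega>" "\<And>x y. x \<in> closure \<Omega> \<Longrightarrow> x \<in> cball p r \<Longrightarrow> \<kappa> (x - y) \<noteq> 0 \<Longrightarrow> y \<in> T"
proof -
  \<comment> \<open>The shift \<tau> and the radius \<epsilon> of the kernel each use at most half
    of \<eta>, so the support stays in \<open>cball 0 \<eta>\<close>.\<close>
  define \<tau> where "\<tau> = min (\<tau>0 / 2) (\<eta> / 2)"
  have \<tau>: "0 < \<tau>" "\<tau> < \<tau>0" "\<tau> \<le> \<eta> / 2" using \<tau>0 \<eta> by (auto simp: \<tau>_def)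
  define S where "S = (\<lambda>x. x + \<tau> *\<^sub>R \<nu>) ` (closure \<Omega> \<inter> cball p r)"
  have cS: "compact S" unfolding S_def
    by (intro compact_continuous_image continuous_intros closed_Int_compact) auto
  have "S \<subseteq> \<Omega>" using shift \<tau> by (auto simp: S_def)
  then obtain e where e: "e > 0" "(\<Union>x\<in>S. ball x e) \<subseteq> \<Omega>"
    by (rule compact_subset_open_imp_ball_epsilon_subset[OF cS \<Omega>]) (rule that)
  define \<epsilon> where "\<epsilon> = min (e / 2) (\<eta> / 2)"
  have \<epsilon>: "0 < \<epsilon>" "\<epsilon> < e" "\<epsilon> \<le> \<eta> / 2" using e(1) \<eta> by (auto simp: \<epsilon>_def)
  define T where "T = {x + y | x y. x \<in> S \<and> y \<in> cball 0 \<epsilon>}"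
  have cT: "compact T" unfolding T_def using compact_sums[OF cS compact_cball[of 0 \<epsilon>]] .
  have T\<Omega>: "T \<subseteq> \<Omega>"
  proof
    fix z assume "z \<in> T"
    then obtain x y where z: "z = x + y" "x \<in> S" "norm y \<le> \<epsilon>" by (auto simp: T_def)
    then have "z \<in> (\<Union>x\<in>S. ball x e)" using \<epsilon>(2) by (intro UN_I[of x]) (auto simp: dist_norm)
    then show "z \<in> \<Omega>" using e(2) by blast
  qed
  \<comment> \<open>Centred at - \<tau> \<nu>: the kernel is evaluated at x - y, and this is near -
    \<tau> \<nu> when y is near x + \<tau> \<nu>.\<close>
  obtain \<kappa> where \<kappa>: "smooth_kernel \<kappa>" "\<And>x. \<kappa> x \<ge> 0" "\<And>x. x \<notin> cball (- \<tau> *\<^sub>R \<nu>) \<epsilon> \<Longrightarrow> \<kappa> x = 0" "has_bochner_integral lborel \<kappa> 1"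
    by (rule mollifier_exists[OF \<epsilon>(1), of "- \<tau> *\<^sub>R \<nu>"]) (rule that)
  show ?thesis
  proof (rule that[of \<kappa> T])
    show "\<kappa> x = 0" if "x \<notin> cball 0 \<eta>" for x
    proof (rule \<kappa>(3))
      have "norm (\<tau> *\<^sub>R \<nu>) \<le> \<eta> / 2" using \<tau> \<nu> mult_mono[of \<tau> "\<eta> / 2" "norm \<nu>" 1] by simp
      moreover have "norm x \<le> norm (\<tau> *\<^sub>R \<nu> + x) + norm (\<tau> *\<^sub>R \<nu>)" using norm_triangle_ineq4[of "\<tau> *\<^sub>R \<nu> + x" "\<tau> *\<^sub>R \<nu>"] by simp
      ultimately have "norm (\<tau> *\<^sub>R \<nu> + x) > \<eta> / 2" using that by simp
      moreover have "dist (- \<tau> *\<^sub>R \<nu>) x = norm (\<tau> *\<^sub>R \<nu> + x)"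
        using norm_minus_cancel[of "\<tau> *\<^sub>R \<nu> + x"] by (simp add: dist_norm)
      ultimately show "x \<notin> cball (- \<tau> *\<^sub>R \<nu>) \<epsilon>" using \<epsilon>(3) by simp
    qed
    show "y \<in> T" if "x \<in> closure \<Omega>" "x \<in> cball p r" "\<kappa> (x - y) \<noteq> 0" for x y
    proof -
      have "x - y \<in> cball (- \<tau> *\<^sub>R \<nu>) \<epsilon>" using \<kappa>(3) that(3) by blast
      then have "norm (y - x - \<tau> *\<^sub>R \<nu>) \<le> \<epsilon>" by (simp add: dist_norm algebra_simps)
      moreover have "y = (x + \<tau> *\<^sub>R \<nu>) + (y - x - \<tau> *\<^sub>R \<nu>)" by simp
      ultimately show ?thesis unfolding T_def S_def using that(1,2) by force
    qed
  qed (use \<kappa> cT T\<Omega> in auto)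
qed

section \<open>Duality between mollified indicators and test fields\<close>

text \<open>Fubini's theorem: the supports of f and of the kernel confine the double integrand to a
  bounded set, and it is bounded there.\<close>

lemma conv_adjoint:
  fixes f g :: "'a::euclidean_space \<Rightarrow> real"
  assumes \<kappa>: "smooth_kernel \<kappa>" and [measurable]: "f \<in> borel_measurable borel" "g \<in> borel_measurable borel"
    and f: "\<And>x. \<bar>f x\<bar> \<le> C" "\<And>x. norm x > \<rho> \<Longrightarrow> f x = 0" and g: "\<And>y. \<bar>g y\<bar> \<le> C'"
  shows "(\<integral>y. g y * conv (\<lambda>z. \<kappa> (- z)) f y \<partial>lborel) = (\<integral>x. f x * conv \<kappa> g x \<partial>lborel)"
proof -
  obtain R B where R: "R > 0" "B > 0" "\<And>x. norm x > R \<Longrightarrow> \<kappa> x = 0" "\<And>x. \<bar>\<kappa> x\<bar> \<le> B" "continuous_on UNIV \<kappa>"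
    by (rule smooth_kernelE[OF \<kappa>]) (rule that)
  have [measurable]: "\<kappa> \<in> borel_measurable borel" using R(5) by (rule borel_measurable_continuous_onI)
  have C: "C \<ge> 0" "C' \<ge> 0" using f(1)[of 0] g[of 0] by auto
  have i: "integrable (lborel \<Otimes>\<^sub>M lborel) (\<lambda>(x, y). f x * (\<kappa> (x - y) * g y))"
    unfolding lborel_prod
  proof (rule bounded_support_integrable(1)[where C="C * (B * C')" and a=0 and R="\<bar>\<rho>\<bar> + (\<bar>\<rho>\<bar> + R)"])
    show "(\<lambda>(x, y). f x * (\<kappa> (x - y) * g y)) \<in> borel_measurable borel" unfolding borel_prod[symmetric] by measurable
    show "norm (case p of (x, y) \<Rightarrow> f x * (\<kappa> (x - y) * g y)) \<le> C * (B * C')" for p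
      using C R(2,4) f(1) g by (auto simp: abs_mult split: prod.split intro!: mult_mono)
    show "(case p of (x, y) \<Rightarrow> f x * (\<kappa> (x - y) * g y)) = 0" if "p \<notin> cball 0 (\<bar>\<rho>\<bar> + (\<bar>\<rho>\<bar> + R))" for p :: "'a \<times> 'a"
    proof (cases p)
      case (Pair x y)
      have "norm p \<le> norm x + norm y" unfolding Pair by (rule norm_Pair_le)
      moreover have "norm y \<le> norm x + norm (x - y)" using norm_triangle_ineq4[of x "x - y"] by simp
      ultimately have "norm x > \<rho> \<or> norm (x - y) > R" using that by auto
      then show ?thesis using f(2) R(3) Pair by auto
    qed
  qed
  have "(\<integral>y. g y * conv (\<lambda>z. \<kappa> (- z)) f y \<partial>lborel) = (\<integral>y. \<integral>x. f x * (\<kappa> (x - y) * g y) \<partial>lborel \<partial>lborel)"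
    unfolding conv_def by (subst integral_mult_right_zero[symmetric]) (simp add: mult_ac)
  also have "\<dots> = (\<integral>x. \<integral>y. f x * (\<kappa> (x - y) * g y) \<partial>lborel \<partial>lborel)"
    by (rule lborel_pair.Fubini_integral[OF i])
  also have "\<dots> = (\<integral>x. f x * conv \<kappa> g x \<partial>lborel)"
    unfolding conv_def by simp
  finally show ?thesis .
qed

lemma gauss_density_eq_exp:
  "gauss_density (x::'a::euclidean_space) = (2 * pi) powr (- (real DIM('a) / 2)) * exp ((- 1 / 2) * (x \<bullet> x))"
  by (simp add: gauss_density_def power2_norm_eq_inner)

lemma C_k_gauss_density: "C_k k gauss_density"
  unfolding gauss_density_eq_exp[abs_def] by (intro C_k_mult C_k_const C_k_exp_square)

lemma gauss_density_le_1: "gauss_density (x::'a::euclidean_space) \<le> 1"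
proof -
  have "(2 * pi) powr (- (real DIM('a) / 2)) \<le> (2 * pi) powr 0" using pi_gt3 by (intro powr_mono) auto
  then show ?thesis using gauss_density_le[of x] by simp
qed

lemma smooth_kernel_reflect:
  assumes "smooth_kernel \<kappa>"
  shows "smooth_kernel (\<lambda>z. \<kappa> (- z))"
    and "frechet_derivative (\<lambda>z. \<kappa> (- z)) (at x) b = - frechet_derivative \<kappa> (at (- x)) b"
proof -
  have C: "C_k k \<kappa>" for k using assms unfolding smooth_kernel_def by blast
  have "C_k k (\<lambda>z. \<kappa> (- z))" for k using C_k_affine[OF C, of k "-1" 0] by simp
  then show "smooth_kernel (\<lambda>z. \<kappa> (- z))" using assms unfolding smooth_kernel_def by (metis norm_minus_cancel)
  have lin: "linear (frechet_derivative \<kappa> (at (- x)))" using C_k_SucD(1)[OF C] by (rule has_derivative_linear)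
  have "((\<lambda>z. - z) has_derivative (\<lambda>h. - h)) (at x)" by (auto intro!: derivative_eq_intros)
  from has_derivative_compose[OF this C_k_SucD(1)[OF C[of "Suc 0"]]]
  have "((\<lambda>z. \<kappa> (- z)) has_derivative (\<lambda>h. - frechet_derivative \<kappa> (at (- x)) h)) (at x)"
    by (simp add: linear_neg[OF lin])
  from frechet_derivative_at[OF this] show "frechet_derivative (\<lambda>z. \<kappa> (- z)) (at x) b = - frechet_derivative \<kappa> (at (- x)) b"
    by (metis (no_types))
qed

lemma divergence_eqI:
  assumes "(f has_derivative D) (at x)"
  shows "divergence f x = (\<Sum>b\<in>Basis. D b \<bullet> b)"
  using frechet_derivative_at[OF assms] by (simp add: divergence_def)

text \<open>Duality: the kernels move the field \<open>\<zeta> i \<Psi>\<close>, which lives on the closure of \<open>\<Omega>\<close>, to a smooth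
  field compactly supported in \<open>\<Omega>\<close>.\<close>

lemma dual_estimate:
  fixes \<Omega> E :: "'a::euclidean_space set" and \<zeta> \<kappa> :: "'i \<Rightarrow> 'a \<Rightarrow> real" and \<Psi> :: "'a \<Rightarrow> 'a"
  assumes fin: "finite I" and E[measurable]: "E \<in> sets borel" and V: "field_sup E \<Omega> \<le> ennreal V" "V \<ge> 0" and \<epsilon>: "\<epsilon> \<ge> 0"
    and \<zeta>: "\<And>i k. i \<in> I \<Longrightarrow> C_k k (\<zeta> i)" "\<And>i x. i \<in> I \<Longrightarrow> 0 \<le> \<zeta> i x" "\<And>i x. i \<in> I \<Longrightarrow> \<zeta> i x \<le> 1"
      "\<And>i x. i \<in> I \<Longrightarrow> x \<notin> B i \<Longrightarrow> \<zeta> i x = 0" "\<And>i x. i \<in> I \<Longrightarrow> norm x > \<rho> \<Longrightarrow> \<zeta> i x = 0"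
    and \<kappa>: "\<And>i. i \<in> I \<Longrightarrow> smooth_kernel (\<kappa> i)" "\<And>i x. i \<in> I \<Longrightarrow> 0 \<le> \<kappa> i x"
    and T: "\<And>i. i \<in> I \<Longrightarrow> compact (T i)" "\<And>i. i \<in> I \<Longrightarrow> T i \<subseteq> \<Omega>"
      "\<And>i x y. i \<in> I \<Longrightarrow> x \<in> closure \<Omega> \<Longrightarrow> x \<in> B i \<Longrightarrow> \<kappa> i (x - y) \<noteq> 0 \<Longrightarrow> y \<in> T i"
    and \<Psi>[measurable]: "\<Psi> \<in> borel_measurable borel" and \<Psi>b: "\<And>x. norm (\<Psi> x) \<le> gauss_density x" "\<And>x. x \<notin> closure \<Omega> \<Longrightarrow> \<Psi> x = 0"
    and H: "\<And>y. (\<Sum>i\<in>I. \<integral>x. \<kappa> i (x - y) * (\<zeta> i x * gauss_density x) \<partial>lborel) \<le> (1 + \<epsilon>) * gauss_density y"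
  shows "(\<Sum>i\<in>I. \<Sum>b\<in>Basis. \<integral>x. (\<zeta> i x * (\<Psi> x \<bullet> b)) * conv (\<lambda>x. frechet_derivative (\<kappa> i) (at x) b) (indicat_real E) x \<partial>lborel) \<le> (1 + \<epsilon>) * V"
proof -
  define r where "r i z = \<kappa> i (- z)" for i z
  \<comment> \<open>The minus sign offsets the one produced by differentiating the reflected kernel,
    so that \<open>adj\<close> below has no sign.\<close>
  define f where "f i x = - (\<zeta> i x *\<^sub>R \<Psi> x)" for i x
  define \<Phi>0 where "\<Phi>0 y = (\<Sum>i\<in>I. conv (r i) (f i) y)" for y
  \<comment> \<open>The reciprocal of (1 + \<epsilon>) times the Gaussian density. It normalizes the
    field and at the same time turns the Gaussian divergence into the ordinary one.\<close>
  define gi where "gi y = ((2 * pi) powr (real DIM('a) / 2) / (1 + \<epsilon>)) * exp ((1 / 2) * (y \<bullet> y))" for y :: 'a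
  define \<Phi> where "\<Phi> y = gi y *\<^sub>R \<Phi>0 y" for y
  have gi: "gauss_density y * gi y = 1 / (1 + \<epsilon>)" "gi y > 0" for y
  proof -
    have "exp ((- 1 / 2) * (y \<bullet> y)) * exp ((1 / 2) * (y \<bullet> y)) = 1" by (simp flip: exp_add)
    moreover have "(2 * pi) powr (- (real DIM('a) / 2)) * (2 * pi) powr (real DIM('a) / 2) = 1" by (simp flip: powr_add)
    ultimately show "gauss_density y * gi y = 1 / (1 + \<epsilon>)"
      unfolding gauss_density_eq_exp gi_def by (simp add: mult_ac)
    show "gi y > 0" using \<epsilon> by (simp add: gi_def add_pos_nonneg)
  qed
  have Cz: "continuous_on UNIV (\<zeta> i)" if "i \<in> I" for i using \<zeta>(1)[OF that, of 0] by simp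
  have \<zeta>m[measurable]: "\<zeta> i \<in> borel_measurable borel" if "i \<in> I" for i using Cz[OF that] by (rule borel_measurable_continuous_onI)
  have \<kappa>m[measurable]: "\<kappa> i \<in> borel_measurable borel" if "i \<in> I" for i
    using \<kappa>(1)[OF that] unfolding smooth_kernel_def by (metis C_k.simps(1) borel_measurable_continuous_onI)
  have fm[measurable]: "f i \<in> borel_measurable borel" if "i \<in> I" for i unfolding f_def using that by measurable
  have fb: "norm (f i x) \<le> \<zeta> i x * gauss_density x" if "i \<in> I" for i x
    using \<zeta>(2)[OF that, of x] \<Psi>b(1)[of x] by (simp add: f_def mult_left_mono)
  have f1: "norm (f i x) \<le> 1" if "i \<in> I" for i x
    using fb[OF that, of x] \<zeta>(3)[OF that, of x] gauss_density_le_1[of x] \<zeta>(2)[OF that, of x]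
    by (intro order_trans[OF fb[OF that]] mult_le_one) auto
  have sr: "smooth_kernel (r i)" if "i \<in> I" for i unfolding r_def by (rule smooth_kernel_reflect(1)[OF \<kappa>(1)[OF that]])
  have C\<Phi>0: "C_k k \<Phi>0" for k unfolding \<Phi>0_def by (intro C_k_sum conv_C_k[where C=1] sr fm f1)
  have Cgi: "C_k k gi" for k unfolding gi_def by (intro C_k_mult C_k_const C_k_exp_square)
  have C\<Phi>: "C_k k \<Phi>" for k unfolding \<Phi>_def by (intro C_k_scaleR Cgi C\<Phi>0)
  have cT: "compact (\<Union>i\<in>I. T i)" using fin T(1) by auto
  have supp: "\<Phi>0 y = 0" if "y \<notin> (\<Union>i\<in>I. T i)" for y
    unfolding \<Phi>0_def
  proof (intro sum.neutral ballI)
    fix i assume i: "i \<in> I"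
    have z: "r i (y - x) *\<^sub>R f i x = 0" for x
      using T(3)[OF i, of x y] \<Psi>b(2)[of x] \<zeta>(4)[OF i, of x] that i by (auto simp: r_def f_def)
    show "conv (r i) (f i) y = 0" unfolding conv_def by (simp only: z Bochner_Integration.integral_zero)
  qed
  have cl: "closure {x. \<Phi> x \<noteq> 0} \<subseteq> (\<Union>i\<in>I. T i)"
    using supp by (intro closure_minimal compact_imp_closed cT) (auto simp: \<Phi>_def)
  \<comment> \<open>Pieces moved from different x may pile up at y. The hypothesis \<open>H\<close>
    limits the total to (1 + \<epsilon>) times the density, so that \<Phi> has norm at most
    1.\<close>
  have n0: "norm (\<Phi>0 y) \<le> (1 + \<epsilon>) * gauss_density y" for y
  proof -
    have "norm (\<Phi>0 y) \<le> (\<Sum>i\<in>I. norm (conv (r i) (f i) y))" unfolding \<Phi>0_def by (rule norm_sum)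
    also have "\<dots> \<le> (\<Sum>i\<in>I. \<integral>x. \<kappa> i (x - y) * (\<zeta> i x * gauss_density x) \<partial>lborel)"
    proof (rule sum_mono)
      fix i assume i: "i \<in> I"
      have m[measurable]: "(\<lambda>x. \<zeta> i x * gauss_density x) \<in> borel_measurable borel" using i by measurable
      have b: "norm (\<zeta> i x * gauss_density x) \<le> 1" for x
        using \<zeta>(2,3)[OF i, of x] gauss_density_le_1[of x] by (simp add: abs_mult mult_le_one)
      have i2: "integrable lborel (\<lambda>x. \<kappa> i (x - y) * (\<zeta> i x * gauss_density x))"
        using conv_integrable[OF sr[OF i] m b, of y] by (simp add: r_def)
      show "norm (conv (r i) (f i) y) \<le> (\<integral>x. \<kappa> i (x - y) * (\<zeta> i x * gauss_density x) \<partial>lborel)"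
        unfolding conv_def
      proof (rule Bochner_Integration.integral_norm_bound_integral[OF conv_integrable[OF sr[OF i] fm[OF i] f1[OF i]] i2])
        show "norm (r i (y - x) *\<^sub>R f i x) \<le> \<kappa> i (x - y) * (\<zeta> i x * gauss_density x)" for x
          using \<kappa>(2)[OF i, of "x - y"] fb[OF i, of x] by (simp add: r_def mult_left_mono)
      qed
    qed
    also have "\<dots> \<le> (1 + \<epsilon>) * gauss_density y" by (rule H)
    finally show ?thesis .
  qed
  have n1: "norm (\<Phi> y) \<le> 1" for y
  proof -
    have "norm (\<Phi> y) = gi y * norm (\<Phi>0 y)" using gi(2)[of y] by (simp add: \<Phi>_def)
    also have "\<dots> \<le> gi y * ((1 + \<epsilon>) * gauss_density y)" using gi(2)[of y] n0[of y] by (intro mult_left_mono) auto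
    also have "\<dots> = (1 + \<epsilon>) * (gauss_density y * gi y)" by simp
    also have "\<dots> = 1" unfolding gi(1) using \<epsilon> by simp
    finally show ?thesis .
  qed
  have tf: "\<Phi> \<in> test_fields \<Omega>"
    unfolding test_fields_def mem_Collect_eq
  proof (intro conjI allI C\<Phi> n1)
    show "compact (closure {x. \<Phi> x \<noteq> 0})" using compact_Int_closed[OF cT closed_closure, of "{x. \<Phi> x \<noteq> 0}"] cl by (simp add: Int_absorb1)
    show "closure {x. \<Phi> x \<noteq> 0} \<subseteq> \<Omega>" using cl T(2) by blast
  qed
  let ?c = "\<lambda>i b y. conv (\<lambda>x. frechet_derivative (r i) (at x) b) (f i) y"
  have d\<Phi>0: "(\<Phi>0 has_derivative (\<lambda>h. \<Sum>i\<in>I. \<Sum>b\<in>Basis. (h \<bullet> b) *\<^sub>R ?c i b y)) (at y)" for y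
    unfolding \<Phi>0_def by (intro has_derivative_sum conv_has_derivative[where C=1] sr fm f1)
  \<comment> \<open>The gradient of gi at y is gi y times y; its contribution to the divergence is
    \<Phi> y \<bullet> y, precisely what is subtracted.\<close>
  have div: "divergence \<Phi> y - \<Phi> y \<bullet> y = gi y * (\<Sum>i\<in>I. \<Sum>b\<in>Basis. ?c i b y \<bullet> b)" for y
  proof -
    have "(gi has_derivative (\<lambda>h. (y \<bullet> h) * gi y)) (at y)"
    proof -
      have "((\<lambda>y::'a. c * exp ((1 / 2) * (y \<bullet> y))) has_derivative (\<lambda>h. (y \<bullet> h) * (c * exp ((1 / 2) * (y \<bullet> y))))) (at y)" for c
        by (auto intro!: derivative_eq_intros simp: inner_commute algebra_simps)
      then show ?thesis unfolding gi_def .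
    qed
    from has_derivative_scaleR[OF this d\<Phi>0]
    have "divergence \<Phi> y = (\<Sum>b\<in>Basis. (gi y *\<^sub>R (\<Sum>i\<in>I. \<Sum>b'\<in>Basis. (b \<bullet> b') *\<^sub>R ?c i b' y) + ((y \<bullet> b) * gi y) *\<^sub>R \<Phi>0 y) \<bullet> b)"
      unfolding \<Phi>_def[abs_def] by (rule divergence_eqI)
    also have "\<dots> = (\<Sum>b\<in>Basis. gi y * (\<Sum>i\<in>I. ?c i b y \<bullet> b) + gi y * ((y \<bullet> b) * (\<Phi>0 y \<bullet> b)))"
    proof (rule sum.cong[OF refl])
      fix b :: 'a assume b: "b \<in> Basis"
      have "(\<Sum>b'\<in>Basis. (b \<bullet> b') *\<^sub>R ?c i b' y) = ?c i b y" for i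
        using b by (simp add: inner_Basis if_distrib[of "\<lambda>c. c *\<^sub>R _"] sum.delta cong: if_cong)
      then show "(gi y *\<^sub>R (\<Sum>i\<in>I. \<Sum>b'\<in>Basis. (b \<bullet> b') *\<^sub>R ?c i b' y) + ((y \<bullet> b) * gi y) *\<^sub>R \<Phi>0 y) \<bullet> b = gi y * (\<Sum>i\<in>I. ?c i b y \<bullet> b) + gi y * ((y \<bullet> b) * (\<Phi>0 y \<bullet> b))"
        by (simp add: inner_add_left inner_sum_left)
    qed
    also have "\<dots> = gi y * (\<Sum>b\<in>Basis. \<Sum>i\<in>I. ?c i b y \<bullet> b) + gi y * (y \<bullet> \<Phi>0 y)"
      by (simp add: sum.distrib sum_distrib_left[symmetric] euclidean_inner[of y "\<Phi>0 y", symmetric])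
    also have "(\<Sum>b\<in>Basis. \<Sum>i\<in>I. ?c i b y \<bullet> b) = (\<Sum>i\<in>I. \<Sum>b\<in>Basis. ?c i b y \<bullet> b)" by (rule sum.swap)
    finally show ?thesis by (simp add: \<Phi>_def[abs_def] inner_commute)
  qed
  have cm: "continuous_on UNIV (?c i b)" if "i \<in> I" "b \<in> Basis" for i b
    using conv_C_k[OF smooth_kernel_derivative[OF sr[OF that(1)] that(2)] fm[OF that(1)] f1[OF that(1)], of 0] by simp
  have cmm[measurable]: "?c i b \<in> borel_measurable borel" if "i \<in> I" "b \<in> Basis" for i b
    using cm[OF that] by (rule borel_measurable_continuous_onI)
  \<comment> \<open>The hypothesis on T is about values of the kernel. As T i is closed, these
    vanish in a whole neighbourhood of y - x, and so does the derivative.\<close>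
  have cz: "?c i b y = 0" if i: "i \<in> I" and b: "b \<in> Basis" and y: "y \<notin> T i" for i b y
  proof -
    have z: "frechet_derivative (r i) (at (y - x)) b *\<^sub>R f i x = 0" for x
    proof (cases "f i x = 0")
      case False
      then have x: "x \<in> closure \<Omega>" "x \<in> B i" using \<Psi>b(2)[of x] \<zeta>(4)[OF i, of x] by (auto simp: f_def)
      have "open (- T i)" using T(1)[OF i] by (simp add: compact_imp_closed open_Compl)
      then obtain e where e: "e > 0" "ball y e \<subseteq> - T i" using y open_contains_ball by blast
      have "r i z = 0" if "z \<in> ball (y - x) e" for z
      proof (rule ccontr)
        assume "r i z \<noteq> 0"
        then have "z + x \<in> T i" using T(3)[OF i x, of "z + x"] by (simp add: r_def)
        moreover have "z + x \<in> ball y e" using that by (simp add: dist_norm algebra_simps)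
        ultimately show False using e(2) by blast
      qed
      then have "(r i has_derivative (\<lambda>_. 0)) (at (y - x))"
        using e(1) by (intro has_derivative_zero_outside[of "- ball (y - x) e"]) auto
      from frechet_derivative_at[OF this] show ?thesis by (simp add: fun_eq_iff)
    qed simp
    show ?thesis unfolding conv_def by (simp only: z Bochner_Integration.integral_zero)
  qed
  have ic: "integrable lborel (\<lambda>y. indicat_real E y * (?c i b y \<bullet> b))" if i: "i \<in> I" and b: "b \<in> Basis" for i b
  proof -
    obtain M where M: "M > 0" "\<And>y. norm (?c i b y) \<le> M"
      by (rule continuous_compact_support_bounded[OF cm[OF i b] T(1)[OF i]]) (use cz[OF i b] in auto)
    obtain R where R: "T i \<subseteq> cball 0 R" using compact_imp_bounded[OF T(1)[OF i]] unfolding bounded_iff by (auto simp: subset_iff)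
    show ?thesis
    proof (rule bounded_support_integrable(1)[where C=M and a=0 and R=R])
      show "(\<lambda>y. indicat_real E y * (?c i b y \<bullet> b)) \<in> borel_measurable borel" using i b by measurable
      show "norm (indicat_real E y * (?c i b y \<bullet> b)) \<le> M" for y
        using order_trans[OF Basis_le_norm[OF b, of "?c i b y"] M(2)[of y]] M(1) by (auto simp: indicator_def)
      show "indicat_real E y * (?c i b y \<bullet> b) = 0" if "y \<notin> cball 0 R" for y
      proof -
        have "y \<notin> T i" using R that by blast
        then show ?thesis using cz[OF i b] by simp
      qed
    qed
  qed
  \<comment> \<open>Here the differentiated kernel passes from the field to the indicator of
    E.\<close>
  have adj: "(\<integral>y. indicat_real E y * (?c i b y \<bullet> b) \<partial>lborel) =
     (\<integral>x. (\<zeta> i x * (\<Psi> x \<bullet> b)) * conv (\<lambda>x. frechet_derivative (\<kappa> i) (at x) b) (indicat_real E) x \<partial>lborel)" if i: "i \<in> I" and b: "b \<in> Basis" for i b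
  proof -
    let ?D = "\<lambda>x. frechet_derivative (\<kappa> i) (at x) b"
    have "?c i b y \<bullet> b = conv (\<lambda>z. ?D (- z)) (\<lambda>x. \<zeta> i x * (\<Psi> x \<bullet> b)) y" for y
    proof -
      have "?c i b y \<bullet> b = (\<integral>x. (frechet_derivative (r i) (at (y - x)) b *\<^sub>R f i x) \<bullet> b \<partial>lborel)"
        unfolding conv_def
        by (rule integral_inner_left[symmetric]) (use conv_integrable[OF smooth_kernel_derivative[OF sr[OF i] b] fm[OF i] f1[OF i]] in auto)
      also have "\<dots> = conv (\<lambda>z. ?D (- z)) (\<lambda>x. \<zeta> i x * (\<Psi> x \<bullet> b)) y"
        unfolding conv_def r_def f_def smooth_kernel_reflect(2)[OF \<kappa>(1)[OF i]] by (simp add: mult_ac)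
      finally show ?thesis .
    qed
    then have "(\<integral>y. indicat_real E y * (?c i b y \<bullet> b) \<partial>lborel) = (\<integral>y. indicat_real E y * conv (\<lambda>z. ?D (- z)) (\<lambda>x. \<zeta> i x * (\<Psi> x \<bullet> b)) y \<partial>lborel)"
      by simp
    also have "\<dots> = (\<integral>x. (\<zeta> i x * (\<Psi> x \<bullet> b)) * conv ?D (indicat_real E) x \<partial>lborel)"
    proof (rule conv_adjoint[OF smooth_kernel_derivative[OF \<kappa>(1)[OF i] b]])
      show "(\<lambda>x. \<zeta> i x * (\<Psi> x \<bullet> b)) \<in> borel_measurable borel" using i by measurable
      show "\<bar>\<zeta> i x * (\<Psi> x \<bullet> b)\<bar> \<le> 1" for x
      proof -
        have "\<bar>\<Psi> x \<bullet> b\<bar> \<le> 1" using Basis_le_norm[OF b, of "\<Psi> x"] \<Psi>b(1)[of x] gauss_density_le_1[of x] by linarith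
        then show ?thesis using \<zeta>(2,3)[OF i, of x] by (simp add: abs_mult mult_le_one)
      qed
      show "\<zeta> i x * (\<Psi> x \<bullet> b) = 0" if "norm x > \<rho>" for x using \<zeta>(5)[OF i that] by simp
      show "\<bar>indicat_real E y\<bar> \<le> 1" for y by (simp add: indicator_def)
    qed measurable
    finally show ?thesis .
  qed
  let ?V = "\<integral>y. indicator E y * (divergence \<Phi> y - \<Phi> y \<bullet> y) \<partial>std_gauss"
  have "ennreal ?V \<le> field_sup E \<Omega>" unfolding field_sup_def by (rule SUP_upper[OF tf])
  then have "ennreal ?V \<le> ennreal V" using V(1) by (rule order_trans)
  then have V': "?V \<le> V" using V(2) by (cases "?V \<ge> 0") auto
  have "?V = (\<integral>y. gauss_density y *\<^sub>R (indicator E y * (divergence \<Phi> y - \<Phi> y \<bullet> y)) \<partial>lborel)"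
  proof -
    have C: "C_k (Suc 0) \<Phi>" by (rule C\<Phi>)
    have [measurable]: "divergence \<Phi> \<in> borel_measurable borel" "\<Phi> \<in> borel_measurable borel"
      using C_k_1_continuous_divergence[OF C] C_k_1_continuous[OF C] by (auto intro: borel_measurable_continuous_onI)
    show ?thesis unfolding std_gauss_def by (rule integral_density) auto
  qed
  also have "\<dots> = (\<integral>y. (1 / (1 + \<epsilon>)) * (\<Sum>i\<in>I. \<Sum>b\<in>Basis. indicator E y * (?c i b y \<bullet> b)) \<partial>lborel)"
  proof (rule Bochner_Integration.integral_cong[OF refl])
    fix y :: 'a
    have "gauss_density y *\<^sub>R (indicator E y * (divergence \<Phi> y - \<Phi> y \<bullet> y)) = (gauss_density y * gi y) * (indicator E y * (\<Sum>i\<in>I. \<Sum>b\<in>Basis. ?c i b y \<bullet> b))"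
      unfolding div by simp
    also have "\<dots> = (1 / (1 + \<epsilon>)) * (\<Sum>i\<in>I. \<Sum>b\<in>Basis. indicator E y * (?c i b y \<bullet> b))"
      unfolding gi(1) by (simp only: sum_distrib_left)
    finally show "gauss_density y *\<^sub>R (indicator E y * (divergence \<Phi> y - \<Phi> y \<bullet> y)) = (1 / (1 + \<epsilon>)) * (\<Sum>i\<in>I. \<Sum>b\<in>Basis. indicator E y * (?c i b y \<bullet> b))" .
  qed
  also have "\<dots> = (1 / (1 + \<epsilon>)) * (\<Sum>i\<in>I. \<Sum>b\<in>Basis. \<integral>y. indicator E y * (?c i b y \<bullet> b) \<partial>lborel)"
  proof -
    have "has_bochner_integral lborel (\<lambda>y. \<Sum>i\<in>I. \<Sum>b\<in>Basis. indicator E y * (?c i b y \<bullet> b))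
       (\<Sum>i\<in>I. \<Sum>b\<in>Basis. \<integral>y. indicator E y * (?c i b y \<bullet> b) \<partial>lborel)"
      by (intro has_bochner_integral_sum has_bochner_integral_integrable ic)
    from has_bochner_integral_integral_eq[OF this] show ?thesis by (simp only: integral_mult_right_zero)
  qed
  also have "(\<Sum>i\<in>I. \<Sum>b\<in>Basis. \<integral>y. indicator E y * (?c i b y \<bullet> b) \<partial>lborel) =
     (\<Sum>i\<in>I. \<Sum>b\<in>Basis. \<integral>x. (\<zeta> i x * (\<Psi> x \<bullet> b)) * conv (\<lambda>x. frechet_derivative (\<kappa> i) (at x) b) (indicat_real E) x \<partial>lborel)"
    by (intro sum.cong refl adj)
  finally have "1 / (1 + \<epsilon>) * (\<Sum>i\<in>I. \<Sum>b\<in>Basis. \<integral>x. (\<zeta> i x * (\<Psi> x \<bullet> b)) * conv (\<lambda>x. frechet_derivative (\<kappa> i) (at x) b) (indicat_real E) x \<partial>lborel) \<le> V"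
    using V' by simp
  then show ?thesis using \<epsilon> by (simp add: divide_le_eq mult.commute add_nonneg_pos)
qed

text \<open>Supplies the hypothesis \<open>H\<close> of \<open>dual_estimate\<close>. Averaging at
  radius \<eta> changes each \<zeta> i times the density by at most L * \<eta>; the sum of these
  errors is at most \<epsilon> * m, hence at most \<epsilon> times the density wherever y is within
  reach of the supports.\<close>

lemma kernel_average_le:
  fixes \<zeta> \<kappa> :: "'i \<Rightarrow> 'a::euclidean_space \<Rightarrow> real"
  assumes fin: "finite I" and \<epsilon>: "\<epsilon> \<ge> 0" and \<eta>: "0 \<le> \<eta>" "\<eta> \<le> 1" and m: "\<And>y::'a. norm y \<le> \<rho> + 1 \<Longrightarrow> m \<le> gauss_density y"
    and \<zeta>: "\<And>i x. i \<in> I \<Longrightarrow> 0 \<le> \<zeta> i x" "\<And>x. (\<Sum>i\<in>I. \<zeta> i x) \<le> 1" "\<And>i x. i \<in> I \<Longrightarrow> norm x > \<rho> \<Longrightarrow> \<zeta> i x = 0"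
      "\<And>i. i \<in> I \<Longrightarrow> continuous_on UNIV (\<zeta> i)"
    and L: "L \<ge> 0" "\<And>i x y. i \<in> I \<Longrightarrow> \<bar>\<zeta> i x * gauss_density x - \<zeta> i y * gauss_density y\<bar> \<le> L * norm (x - y)"
    and small: "real (card I) * (L * \<eta>) \<le> \<epsilon> * m"
    and \<kappa>: "\<And>i. i \<in> I \<Longrightarrow> smooth_kernel (\<kappa> i)" "\<And>i x. i \<in> I \<Longrightarrow> 0 \<le> \<kappa> i x" "\<And>i. i \<in> I \<Longrightarrow> has_bochner_integral lborel (\<kappa> i) 1"
      "\<And>i x. i \<in> I \<Longrightarrow> x \<notin> cball 0 \<eta> \<Longrightarrow> \<kappa> i x = 0"
  shows "(\<Sum>i\<in>I. \<integral>x. \<kappa> i (x - y) * (\<zeta> i x * gauss_density x) \<partial>lborel) \<le> (1 + \<epsilon>) * gauss_density y"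
proof (cases "norm y \<le> \<rho> + 1")
  case True
  have "(\<Sum>i\<in>I. \<integral>x. \<kappa> i (x - y) * (\<zeta> i x * gauss_density x) \<partial>lborel) \<le> (\<Sum>i\<in>I. \<zeta> i y * gauss_density y + L * \<eta>)"
  proof (rule sum_mono)
    fix i assume i: "i \<in> I"
    have [measurable]: "\<zeta> i \<in> borel_measurable borel" using \<zeta>(4)[OF i] by (rule borel_measurable_continuous_onI)
    have [measurable]: "\<kappa> i \<in> borel_measurable borel" using borel_measurable_has_bochner_integral[OF \<kappa>(3)[OF i]] by simp
    have "(\<integral>\<^sup>+x. ennreal (\<kappa> i (x - y)) \<partial>lborel) = 1"
      using nn_integral_lborel_shift[of "\<lambda>h. ennreal (\<kappa> i h)" "- y"] \<kappa>(2)[OF i] \<kappa>(3)[OF i]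
      by (simp add: nn_integral_eq_integral has_bochner_integral_iff)
    then have b: "has_bochner_integral lborel (\<lambda>x. \<kappa> i (x - y)) 1"
      by (intro has_bochner_integral_nn_integral) (use \<kappa>(2)[OF i] in auto)
    have b2: "has_bochner_integral lborel (\<lambda>x. \<kappa> i (x - y) * (\<zeta> i y * gauss_density y + L * \<eta>)) (1 * (\<zeta> i y * gauss_density y + L * \<eta>))"
      by (intro has_bochner_integral_mult_left b)
    have le: "\<kappa> i (x - y) * (\<zeta> i x * gauss_density x) \<le> \<kappa> i (x - y) * (\<zeta> i y * gauss_density y + L * \<eta>)" for x
    proof (cases "\<kappa> i (x - y) = 0")
      case False
      then have "norm (x - y) \<le> \<eta>" using \<kappa>(4)[OF i, of "x - y"] by auto
      then have "L * norm (x - y) \<le> L * \<eta>" using L(1) by (rule mult_left_mono)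
      then have "\<zeta> i x * gauss_density x \<le> \<zeta> i y * gauss_density y + L * \<eta>" using L(2)[OF i, of x y] by linarith
      then show ?thesis using \<kappa>(2)[OF i] by (intro mult_left_mono) auto
    qed simp
    have "(\<integral>x. \<kappa> i (x - y) * (\<zeta> i x * gauss_density x) \<partial>lborel) \<le> (\<integral>x. \<kappa> i (x - y) * (\<zeta> i y * gauss_density y + L * \<eta>) \<partial>lborel)"
    proof (rule integral_mono[OF _ _ le])
      show i2: "integrable lborel (\<lambda>x. \<kappa> i (x - y) * (\<zeta> i y * gauss_density y + L * \<eta>))" using b2 by (rule integrable.intros)
      show "integrable lborel (\<lambda>x. \<kappa> i (x - y) * (\<zeta> i x * gauss_density x))"
      proof (rule Bochner_Integration.integrable_bound[OF i2])
        show "AE x in lborel. norm (\<kappa> i (x - y) * (\<zeta> i x * gauss_density x)) \<le> norm (\<kappa> i (x - y) * (\<zeta> i y * gauss_density y + L * \<eta>))"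
        proof (rule AE_I2)
          fix x
          have "0 \<le> \<kappa> i (x - y) * (\<zeta> i x * gauss_density x)" using \<kappa>(2)[OF i] \<zeta>(1)[OF i] by simp
          then show "norm (\<kappa> i (x - y) * (\<zeta> i x * gauss_density x)) \<le> norm (\<kappa> i (x - y) * (\<zeta> i y * gauss_density y + L * \<eta>))"
            using le[of x] by simp
        qed
      qed measurable
    qed
    also have "\<dots> = 1 * (\<zeta> i y * gauss_density y + L * \<eta>)" by (rule has_bochner_integral_integral_eq[OF b2])
    finally show "(\<integral>x. \<kappa> i (x - y) * (\<zeta> i x * gauss_density x) \<partial>lborel) \<le> \<zeta> i y * gauss_density y + L * \<eta>"
      by simp
  qed
  also have "\<dots> = (\<Sum>i\<in>I. \<zeta> i y) * gauss_density y + real (card I) * (L * \<eta>)"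
    by (simp add: sum.distrib sum_distrib_right)
  also have "\<dots> \<le> 1 * gauss_density y + \<epsilon> * gauss_density y"
    using \<zeta>(2)[of y] order_trans[OF small mult_left_mono[OF m[OF True] \<epsilon>]] by (intro add_mono mult_right_mono) auto
  finally show ?thesis by (simp add: algebra_simps)
next
  \<comment> \<open>Kernels of radius at most 1 cannot connect such a y to the supports, which lie
    within \<rho>, so all integrals vanish.\<close>
  case False
  have z: "\<kappa> i (x - y) * (\<zeta> i x * gauss_density x) = 0" if i: "i \<in> I" for i x
  proof (cases "\<kappa> i (x - y) = 0")
    case k: False
    then have "norm (x - y) \<le> \<eta>" using \<kappa>(4)[OF i, of "x - y"] by auto
    moreover have "norm y \<le> norm x + norm (x - y)" using norm_triangle_ineq4[of x "x - y"] by simp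
    ultimately have "norm x > \<rho>" using False \<eta>(2) by linarith
    then show ?thesis using \<zeta>(3)[OF i] by simp
  qed simp
  have "(\<Sum>i\<in>I. \<integral>x. \<kappa> i (x - y) * (\<zeta> i x * gauss_density x) \<partial>lborel) = 0"
    by (intro sum.neutral ballI) (simp only: z Bochner_Integration.integral_zero)
  then show ?thesis using \<epsilon> by simp
qed

definition grad :: "('a::euclidean_space \<Rightarrow> real) \<Rightarrow> 'a \<Rightarrow> 'a" where
  "grad u x = (\<Sum>b\<in>Basis. frechet_derivative u (at x) b *\<^sub>R b)"

lemma inner_grad:
  assumes "C_k (Suc 0) u"
  shows "v \<bullet> grad u x = frechet_derivative u (at x) v"
proof -
  have lin: "linear (frechet_derivative u (at x))" using C_k_SucD(1)[OF assms] by (rule has_derivative_linear)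
  have "frechet_derivative u (at x) v = frechet_derivative u (at x) (\<Sum>b\<in>Basis. (v \<bullet> b) *\<^sub>R b)"
    by (simp add: euclidean_representation)
  also have "\<dots> = (\<Sum>b\<in>Basis. (v \<bullet> b) *\<^sub>R frechet_derivative u (at x) b)"
    by (simp only: linear_sum[OF lin] linear_cmul[OF lin])
  finally show ?thesis by (simp add: grad_def inner_sum_right mult.commute)
qed

lemma continuous_grad: "C_k (Suc 0) u \<Longrightarrow> continuous_on UNIV (grad u)"
  unfolding grad_def by (auto intro!: continuous_intros)

lemma C_k_1_derivative_bounded_finite:
  fixes f :: "'i \<Rightarrow> 'a::euclidean_space \<Rightarrow> real"
  assumes "finite I" "\<And>i. i \<in> I \<Longrightarrow> C_k (Suc 0) (f i)" "\<And>i x. i \<in> I \<Longrightarrow> norm x > \<rho> \<Longrightarrow> f i x = 0"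
  obtains B where "B > 0" "\<And>i x v. i \<in> I \<Longrightarrow> \<bar>frechet_derivative (f i) (at x) v\<bar> \<le> B * norm v"
    "\<And>i x y. i \<in> I \<Longrightarrow> \<bar>f i x - f i y\<bar> \<le> B * norm (x - y)"
proof -
  have "\<exists>B>0. \<forall>x v. \<bar>frechet_derivative (f i) (at x) v\<bar> \<le> B * norm v" if i: "i \<in> I" for i
  proof -
    obtain B where "B > 0" "\<And>x v. norm (frechet_derivative (f i) (at x) v) \<le> B * norm v"
      by (rule C_k_1_derivative_bounded[OF assms(2)[OF i] compact_cball[of 0 \<rho>]]) (use assms(3)[OF i] in simp, rule that)
    then show ?thesis unfolding real_norm_def by blast
  qed
  then have "\<forall>i\<in>I. \<exists>B. B > 0 \<and> (\<forall>x v. \<bar>frechet_derivative (f i) (at x) v\<bar> \<le> B * norm v)" by blast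
  from bchoice[OF this] obtain B where "\<forall>i\<in>I. B i > 0 \<and> (\<forall>x v. \<bar>frechet_derivative (f i) (at x) v\<bar> \<le> B i * norm v)" ..
  then have B: "\<And>i. i \<in> I \<Longrightarrow> B i > 0" "\<And>i x v. i \<in> I \<Longrightarrow> \<bar>frechet_derivative (f i) (at x) v\<bar> \<le> B i * norm v"
    by auto
  define C where "C = (\<Sum>i\<in>I. B i) + 1"
  have BC: "B i \<le> C" if "i \<in> I" for i
  proof -
    have "B i \<le> (\<Sum>i\<in>I. B i)" by (rule member_le_sum[OF that]) (simp_all add: assms(1) B(1) less_imp_le)
    then show ?thesis by (simp add: C_def)
  qed
  have C: "C > 0" unfolding C_def using B(1) by (intro add_nonneg_pos sum_nonneg less_imp_le) auto
  have d: "\<bar>frechet_derivative (f i) (at x) v\<bar> \<le> C * norm v" if "i \<in> I" for i x v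
    by (rule order_trans[OF B(2)[OF that]]) (intro mult_right_mono BC that norm_ge_zero)
  show ?thesis
  proof (rule that[OF C d])
    fix i x y assume i: "i \<in> I"
    have "norm (f i x - f i y) \<le> C * norm (x - y)"
      by (rule differentiable_bound[OF convex_UNIV]) (use C_k_SucD(1)[OF assms(2)[OF i]] d[OF i] in \<open>auto intro!: onorm_le\<close>)
    then show "\<bar>f i x - f i y\<bar> \<le> C * norm (x - y)" by simp
  qed
qed

lemma nn_integral_std_gauss_le:
  fixes f :: "'a::euclidean_space \<Rightarrow> ennreal"
  assumes [measurable]: "f \<in> borel_measurable borel"
  shows "nn_integral std_gauss f \<le> nn_integral lborel f"
proof -
  have "nn_integral std_gauss f = (\<integral>\<^sup>+x. ennreal (gauss_density x) * f x \<partial>lborel)"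
    unfolding std_gauss_def by (rule nn_integral_density) auto
  also have "\<dots> \<le> (\<integral>\<^sup>+x. 1 * f x \<partial>lborel)"
    using gauss_density_le_1 by (intro nn_integral_mono mult_right_mono) (auto simp: ennreal_le_1)
  finally show ?thesis by simp
qed

text \<open>Finitely many half-size balls cover \<open>cball 0 (2 * R)\<close>, outside which the
  cutoff vanishes; multiplying by the cutoff makes the sum equal to it everywhere. The kernel size
  \<eta> is left open, since it can be fixed only when bounds on the functions \<zeta> are
  known.\<close>

lemma boundary_partition:
  fixes \<Omega> :: "'a::euclidean_space set"
  assumes \<Omega>: "open \<Omega>" "lipschitz_boundary \<Omega>" and R: "R > 0"
    and \<beta>: "\<And>k. C_k k (\<beta> :: 'a \<Rightarrow> real)" "\<And>x. 0 \<le> \<beta> x" "\<And>x. \<beta> x \<le> 1" "\<And>x. norm x \<le> 1 \<Longrightarrow> \<beta> x = 1" "\<And>x. norm x > 2 \<Longrightarrow> \<beta> x = 0"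
  obtains I :: "'a set" and \<zeta> r where "finite I" "\<And>p k. p \<in> I \<Longrightarrow> C_k k (\<zeta> p)" "\<And>p x. p \<in> I \<Longrightarrow> 0 \<le> \<zeta> p x"
    "\<And>x. (\<Sum>p\<in>I. \<zeta> p x) = \<beta> ((1 / R) *\<^sub>R x)" "\<And>p x. p \<in> I \<Longrightarrow> x \<notin> cball p (r p) \<Longrightarrow> \<zeta> p x = 0"
    "\<And>p \<eta>. p \<in> I \<Longrightarrow> \<eta> > 0 \<Longrightarrow> \<exists>\<kappa> T. smooth_kernel \<kappa> \<and> (\<forall>x. \<kappa> x \<ge> 0) \<and> has_bochner_integral lborel \<kappa> 1 \<and>
       (\<forall>x. x \<notin> cball 0 \<eta> \<longrightarrow> \<kappa> x = 0) \<and> compact T \<and> T \<subseteq> \<Omega> \<and>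
       (\<forall>x y. x \<in> closure \<Omega> \<longrightarrow> x \<in> cball p (r p) \<longrightarrow> \<kappa> (x - y) \<noteq> 0 \<longrightarrow> y \<in> T)"
proof -
  have "\<exists>r>0. \<forall>\<eta>>0. \<exists>\<kappa> T. smooth_kernel \<kappa> \<and> (\<forall>x. \<kappa> x \<ge> 0) \<and> has_bochner_integral lborel \<kappa> 1 \<and>
       (\<forall>x. x \<notin> cball 0 \<eta> \<longrightarrow> \<kappa> x = 0) \<and> compact T \<and> T \<subseteq> \<Omega> \<and>
       (\<forall>x y. x \<in> closure \<Omega> \<longrightarrow> x \<in> cball p r \<longrightarrow> \<kappa> (x - y) \<noteq> 0 \<longrightarrow> y \<in> T)" (is "\<exists>r>0. ?Q p r") for p
  proof (rule lipschitz_boundary_shift[OF \<Omega>, of p])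
    fix r \<tau>0 :: real and \<nu> :: 'a
    assume *: "r > 0" "\<tau>0 > 0" "norm \<nu> \<le> 1" "\<And>\<tau> x. 0 < \<tau> \<Longrightarrow> \<tau> < \<tau>0 \<Longrightarrow> x \<in> closure \<Omega> \<Longrightarrow> x \<in> cball p r \<Longrightarrow> x + \<tau> *\<^sub>R \<nu> \<in> \<Omega>"
    have "?Q p r"
    proof (intro allI impI)
      fix \<eta> :: real assume \<eta>: "\<eta> > 0"
      show "\<exists>\<kappa> T. smooth_kernel \<kappa> \<and> (\<forall>x. \<kappa> x \<ge> 0) \<and> has_bochner_integral lborel \<kappa> 1 \<and>
       (\<forall>x. x \<notin> cball 0 \<eta> \<longrightarrow> \<kappa> x = 0) \<and> compact T \<and> T \<subseteq> \<Omega> \<and>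
       (\<forall>x y. x \<in> closure \<Omega> \<longrightarrow> x \<in> cball p r \<longrightarrow> \<kappa> (x - y) \<noteq> 0 \<longrightarrow> y \<in> T)"
        by (rule inward_kernel_exists[OF \<Omega>(1) *(2,3) \<eta> *(4)]) (assumption | blast)+
    qed
    with *(1) show "\<exists>r>0. ?Q p r" by blast
  qed
  then have "\<exists>r. \<forall>p. r p > 0 \<and> ?Q p (r p)" by (intro choice allI) blast
  then obtain r where r: "\<And>p. r p > 0" "\<And>p. ?Q p (r p)" by blast
  have "cball 0 (2 * R) \<subseteq> (\<Union>p\<in>cball 0 (2 * R). ball p (r p / 2))" using r(1) by force
  then obtain I where I: "I \<subseteq> cball (0::'a) (2 * R)" "finite I" "cball 0 (2 * R) \<subseteq> (\<Union>p\<in>I. ball p (r p / 2))"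
    by (rule compactE_image[OF compact_cball, rotated]) (auto intro: that)
  \<comment> \<open>The cutoff is 1 up to radius 1 and 0 beyond radius 2, so b p is 1 on the
    half-size ball and vanishes outside \<open>cball p (r p)\<close>.\<close>
  define b where "b p x = \<beta> ((2 / r p) *\<^sub>R x + - ((2 / r p) *\<^sub>R p))" for p x
  have barg: "norm ((2 / r p) *\<^sub>R x + - ((2 / r p) *\<^sub>R p)) = 2 / r p * dist p x" for p x
    using r(1)[of p] by (simp add: dist_norm norm_minus_commute flip: scaleR_diff_right)
  have b1: "b p x = 1" if "dist p x < r p / 2" for p x
    unfolding b_def by (rule \<beta>(4)) (use that r(1)[of p] in \<open>simp only: barg, simp add: field_simps\<close>)
  have b0: "b p x = 0" if "x \<notin> cball p (r p)" for p x
    unfolding b_def by (rule \<beta>(5)) (use that r(1)[of p] in \<open>simp only: barg, simp add: field_simps\<close>)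
  have "\<exists>\<zeta>. (\<forall>p\<in>I. (\<forall>k. C_k k (\<zeta> p)) \<and> (\<forall>x. 0 \<le> \<zeta> p x \<and> \<zeta> p x \<le> b p x)) \<and>
     (\<forall>x. (\<Sum>p\<in>I. \<zeta> p x) \<le> 1 \<and> ((\<exists>p\<in>I. b p x = 1) \<longrightarrow> (\<Sum>p\<in>I. \<zeta> p x) = 1))"
    by (rule partition_of_unity_finite[OF I(2)]) (auto simp only: b_def intro!: C_k_affine \<beta>)
  then obtain z where z: "\<And>p k. p \<in> I \<Longrightarrow> C_k k (z p)" "\<And>p x. p \<in> I \<Longrightarrow> 0 \<le> z p x" "\<And>p x. p \<in> I \<Longrightarrow> z p x \<le> b p x"
    "\<And>x. \<exists>p\<in>I. b p x = 1 \<Longrightarrow> (\<Sum>p\<in>I. z p x) = 1" by blast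
  have C\<theta>: "C_k k (\<lambda>x. \<beta> ((1 / R) *\<^sub>R x))" for k using C_k_affine[OF \<beta>(1), of k "1 / R" 0] by simp
  show ?thesis
  proof (rule that[of I "\<lambda>p x. \<beta> ((1 / R) *\<^sub>R x) * z p x" r])
    show "(\<Sum>p\<in>I. \<beta> ((1 / R) *\<^sub>R x) * z p x) = \<beta> ((1 / R) *\<^sub>R x)" for x
    proof (cases "norm x \<le> 2 * R")
      case True
      then obtain p where "p \<in> I" "dist p x < r p / 2" using I(3) by force
      then have "(\<Sum>p\<in>I. z p x) = 1" using b1 by (intro z(4)) auto
      then show ?thesis by (simp flip: sum_distrib_left)
    next
      case False
      then have "\<beta> ((1 / R) *\<^sub>R x) = 0" using R by (intro \<beta>(5)) (simp add: field_simps)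
      then show ?thesis by simp
    qed
    show "\<beta> ((1 / R) *\<^sub>R x) * z p x = 0" if "p \<in> I" "x \<notin> cball p (r p)" for p x
      using z(2,3)[OF that(1), of x] b0[OF that(2)] by simp
    show "\<exists>\<kappa> T. smooth_kernel \<kappa> \<and> (\<forall>x. \<kappa> x \<ge> 0) \<and> has_bochner_integral lborel \<kappa> 1 \<and>
       (\<forall>x. x \<notin> cball 0 \<eta> \<longrightarrow> \<kappa> x = 0) \<and> compact T \<and> T \<subseteq> \<Omega> \<and>
       (\<forall>x y. x \<in> closure \<Omega> \<longrightarrow> x \<in> cball p (r p) \<longrightarrow> \<kappa> (x - y) \<noteq> 0 \<longrightarrow> y \<in> T)" if "p \<in> I" "\<eta> > 0" for p \<eta>
      using r(2)[of p] that(2) by blast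
  qed (use I(2) z \<beta>(2) C\<theta> in \<open>auto intro!: C_k_mult\<close>)
qed

text \<open>Each piece of the partition carries its own inward mollification of the indicator. Where
  the derivative falls on a kernel, \<open>dual_estimate\<close> applies; where it falls on the
  partition, the mollified indicators nearly coincide and the derivatives of the \<zeta> p nearly
  cancel.\<close>

lemma smooth_approximation:
  fixes \<Omega> E :: "'a::euclidean_space set"
  assumes \<Omega>: "open \<Omega>" "lipschitz_boundary \<Omega>" and E[measurable]: "E \<in> sets borel"
    and V: "field_sup E \<Omega> \<le> ennreal V" "V \<ge> 0" and \<epsilon>: "\<epsilon> > 0"
  obtains u \<rho> where "C_k (Suc 0) u" "\<And>x. norm x > \<rho> \<Longrightarrow> u x = 0" "\<And>x. 0 \<le> u x" "\<And>x. u x \<le> 1"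
    "(\<integral>\<^sup>+x\<in>closure \<Omega>. ennreal (norm (grad u x)) \<partial>std_gauss) \<le> ennreal ((1 + \<epsilon>) * V + \<epsilon>)"
    "(\<integral>\<^sup>+x. ennreal \<bar>u x - indicator E x\<bar> \<partial>std_gauss) \<le> ennreal \<epsilon>"
proof -
  obtain \<beta> :: "'a \<Rightarrow> real" where \<beta>: "\<And>k. C_k k \<beta>" "\<And>x. 0 \<le> \<beta> x" "\<And>x. \<beta> x \<le> 1" "\<And>x. norm x \<le> 1 \<Longrightarrow> \<beta> x = 1" "\<And>x. norm x > 2 \<Longrightarrow> \<beta> x = 0"
    by (rule cutoff_exists) (rule that)
  obtain C0 where C0: "C0 > 0" "\<And>x v. norm (frechet_derivative \<beta> (at x) v) \<le> C0 * norm v"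
    by (rule C_k_1_derivative_bounded[OF \<beta>(1) compact_cball[of 0 2]]) (use \<beta>(5) in auto)
  obtain R0 where R0: "R0 > 0" "measure (std_gauss :: 'a measure) (- cball 0 R0) < \<epsilon> / 2"
    by (rule gauss_tail_small[of "\<epsilon> / 2"]) (use \<epsilon> in auto)
  \<comment> \<open>Large enough for the Gaussian tail and for C0 / R, which bounds the gradient of
    the cutoff at scale R; both are at most \<epsilon> / 2.\<close>
  define R where "R = max R0 (2 * C0 / \<epsilon>)"
  have R: "R > 0" "C0 / R \<le> \<epsilon> / 2" using R0 C0(1) \<epsilon> by (auto simp: R_def field_simps max_def)
  have tail: "measure (std_gauss :: 'a measure) (- cball 0 R) \<le> \<epsilon> / 2"
  proof -
    have "measure (std_gauss :: 'a measure) (- cball 0 R) \<le> measure (std_gauss :: 'a measure) (- cball 0 R0)"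
      by (intro std_gauss.finite_measure_mono) (auto simp: R_def)
    then show ?thesis using R0(2) by simp
  qed
  define \<rho> where "\<rho> = 2 * R"
  define \<theta> where "\<theta> x = \<beta> ((1 / R) *\<^sub>R x)" for x
  obtain I :: "'a set" and \<zeta> r where fin: "finite I" and \<zeta>: "\<And>p k. p \<in> I \<Longrightarrow> C_k k (\<zeta> p)" "\<And>p x. p \<in> I \<Longrightarrow> 0 \<le> \<zeta> p x"
    "\<And>x. (\<Sum>p\<in>I. \<zeta> p x) = \<beta> ((1 / R) *\<^sub>R x)" "\<And>p x. p \<in> I \<Longrightarrow> x \<notin> cball p (r p) \<Longrightarrow> \<zeta> p x = 0"
    and ker: "\<And>p \<eta>. p \<in> I \<Longrightarrow> \<eta> > 0 \<Longrightarrow> \<exists>\<kappa> T. smooth_kernel \<kappa> \<and> (\<forall>x. \<kappa> x \<ge> 0) \<and> has_bochner_integral lborel \<kappa> 1 \<and>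
       (\<forall>x. x \<notin> cball 0 \<eta> \<longrightarrow> \<kappa> x = 0) \<and> compact T \<and> T \<subseteq> \<Omega> \<and>
       (\<forall>x y. x \<in> closure \<Omega> \<longrightarrow> x \<in> cball p (r p) \<longrightarrow> \<kappa> (x - y) \<noteq> 0 \<longrightarrow> y \<in> T)"
    by (rule boundary_partition[where \<beta>=\<beta>, OF \<Omega> R(1)]) (assumption | rule \<beta> that)+
  have sum\<theta>: "(\<Sum>p\<in>I. \<zeta> p x) = \<theta> x" for x using \<zeta>(3) by (simp add: \<theta>_def)
  have \<theta>b: "0 \<le> \<theta> x" "\<theta> x \<le> 1" for x using \<beta>(2,3) by (auto simp: \<theta>_def)
  have \<theta>1: "\<theta> x = 1" if "norm x \<le> R" for x unfolding \<theta>_def using that R(1) by (intro \<beta>(4)) (simp add: field_simps)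
  have \<theta>0: "\<theta> x = 0" if "norm x > \<rho>" for x unfolding \<theta>_def using that R(1) by (intro \<beta>(5)) (simp add: field_simps \<rho>_def)
  have \<zeta>\<theta>: "\<zeta> p x \<le> \<theta> x" if "p \<in> I" for p x
    unfolding sum\<theta>[symmetric] by (rule member_le_sum[OF that]) (use \<zeta>(2) fin in auto)
  have \<zeta>0: "\<zeta> p x = 0" if "p \<in> I" "norm x > \<rho>" for p x using \<zeta>\<theta>[OF that(1), of x] \<theta>0[OF that(2)] \<zeta>(2)[OF that(1), of x] by simp
  have \<zeta>1: "\<zeta> p x \<le> 1" if "p \<in> I" for p x using \<zeta>\<theta>[OF that, of x] \<theta>b(2)[of x] by linarith
  obtain Bz where Bz: "Bz > 0" "\<And>p x v. p \<in> I \<Longrightarrow> \<bar>frechet_derivative (\<zeta> p) (at x) v\<bar> \<le> Bz * norm v"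
    by (rule C_k_1_derivative_bounded_finite[OF fin \<zeta>(1) \<zeta>0]) (assumption | rule that)+
  have C\<zeta>\<gamma>: "C_k (Suc 0) (\<lambda>x. \<zeta> p x * gauss_density x)" if "p \<in> I" for p by (intro C_k_mult \<zeta>(1)[OF that] C_k_gauss_density)
  have \<zeta>\<gamma>0: "\<zeta> p x * gauss_density x = 0" if "p \<in> I" "norm x > \<rho>" for p x using \<zeta>0[OF that] by simp
  obtain L where L: "L > 0" "\<And>p x y. p \<in> I \<Longrightarrow> \<bar>\<zeta> p x * gauss_density x - \<zeta> p y * gauss_density y\<bar> \<le> L * norm (x - y)"
    by (rule C_k_1_derivative_bounded_finite[OF fin C\<zeta>\<gamma> \<zeta>\<gamma>0]) (assumption | rule that)+
  define m where "m = (2 * pi) powr (- (real DIM('a) / 2)) * exp (- (\<rho> + 1)\<^sup>2 / 2)"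
  have m: "m > 0" "\<And>y::'a. norm y \<le> \<rho> + 1 \<Longrightarrow> m \<le> gauss_density y"
    unfolding m_def by (simp, rule gauss_density_ge)
  define N where "N = real (card I)"
  have N: "N \<ge> 0" by (simp add: N_def)
  \<comment> \<open>L1 error allowed to a single mollified indicator. The N errors enter with weight
    1 in the distance of u from E and with weight Bz in the gradient estimate.\<close>
  define e1 where "e1 = \<epsilon> / (2 * (Bz + 1) * (N + 1))"
  have e1: "e1 > 0" unfolding e1_def using \<epsilon> Bz(1) N by (intro divide_pos_pos mult_pos_pos) auto
  have e1': "N * e1 \<le> \<epsilon> / 2" "N * (Bz * e1) \<le> \<epsilon> / 2"
  proof -
    have "e1 * (2 * (Bz + 1) * (N + 1)) = \<epsilon>"
      by (rule nonzero_eq_divide_eq[THEN iffD1, OF _ e1_def]) (use Bz(1) N in auto)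
    then have e: "(Bz + 1) * (N + 1) * e1 = \<epsilon> / 2" by (simp add: algebra_simps)
    have "1 * N * e1 \<le> (Bz + 1) * (N + 1) * e1" "Bz * N * e1 \<le> (Bz + 1) * (N + 1) * e1"
      using Bz(1) N e1 by (intro mult_right_mono mult_mono; simp)+
    then show "N * e1 \<le> \<epsilon> / 2" "N * (Bz * e1) \<le> \<epsilon> / 2" unfolding e by (simp_all add: mult_ac)
  qed
  obtain \<eta>1 where \<eta>1: "\<eta>1 > 0" "\<And>\<kappa>. smooth_kernel \<kappa> \<Longrightarrow> (\<And>x. \<kappa> x \<ge> 0) \<Longrightarrow> has_bochner_integral lborel \<kappa> 1 \<Longrightarrow>
     (\<And>x. x \<notin> cball 0 \<eta>1 \<Longrightarrow> \<kappa> x = 0) \<Longrightarrow>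
     (\<integral>\<^sup>+x\<in>cball 0 \<rho>. ennreal \<bar>conv \<kappa> (indicat_real E) x - indicator E x\<bar> \<partial>lborel) \<le> ennreal e1"
  proof (rule conv_indicator_L1_close[OF E e1, of \<rho>])
    fix \<eta>
    assume a: "\<eta> > 0" "\<And>\<kappa>. smooth_kernel \<kappa> \<Longrightarrow> (\<And>x. \<kappa> x \<ge> 0) \<Longrightarrow> has_bochner_integral lborel \<kappa> 1 \<Longrightarrow>
     (\<And>x. x \<notin> cball 0 \<eta> \<Longrightarrow> \<kappa> x = 0) \<Longrightarrow>
     (\<integral>\<^sup>+x\<in>cball 0 \<rho>. ennreal \<bar>conv \<kappa> (indicat_real E) x - indicator E x\<bar> \<partial>lborel) \<le> ennreal e1"
    show thesis by (rule that; fact a)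
  qed
  \<comment> \<open>Three demands on the kernel radius: L1 closeness, no reach beyond \<rho> + 1,
    and the smallness condition of \<open>kernel_average_le\<close>.\<close>
  define \<eta> where "\<eta> = min \<eta>1 (min 1 (\<epsilon> * m / (N * L + 1)))"
  have NL: "N * L + 1 > 0" using N L(1) by (simp add: add_nonneg_pos)
  have \<eta>: "\<eta> > 0" "\<eta> \<le> 1" "\<eta> \<le> \<eta>1" using \<eta>1(1) \<epsilon> m(1) NL by (auto simp: \<eta>_def)
  have small: "N * (L * \<eta>) \<le> \<epsilon> * m"
  proof -
    have "\<eta> \<le> \<epsilon> * m / (N * L + 1)" by (simp add: \<eta>_def)
    then have "\<eta> * (N * L + 1) \<le> \<epsilon> * m" using NL by (simp add: pos_le_divide_eq)
    then show ?thesis using \<eta>(1) by (simp add: algebra_simps)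
  qed
  have "\<forall>p\<in>I. \<exists>\<kappa>T. smooth_kernel (fst \<kappa>T) \<and> (\<forall>x. fst \<kappa>T x \<ge> 0) \<and> has_bochner_integral lborel (fst \<kappa>T) 1 \<and>
       (\<forall>x. x \<notin> cball 0 \<eta> \<longrightarrow> fst \<kappa>T x = 0) \<and> compact (snd \<kappa>T) \<and> snd \<kappa>T \<subseteq> \<Omega> \<and>
       (\<forall>x y. x \<in> closure \<Omega> \<longrightarrow> x \<in> cball p (r p) \<longrightarrow> fst \<kappa>T (x - y) \<noteq> 0 \<longrightarrow> y \<in> snd \<kappa>T)"
    using ker[OF _ \<eta>(1)] by simp
  from bchoice[OF this] obtain \<kappa>T where \<kappa>T: "\<forall>p\<in>I. smooth_kernel (fst (\<kappa>T p)) \<and> (\<forall>x. fst (\<kappa>T p) x \<ge> 0) \<and> has_bochner_integral lborel (fst (\<kappa>T p)) 1 \<and>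
       (\<forall>x. x \<notin> cball 0 \<eta> \<longrightarrow> fst (\<kappa>T p) x = 0) \<and> compact (snd (\<kappa>T p)) \<and> snd (\<kappa>T p) \<subseteq> \<Omega> \<and>
       (\<forall>x y. x \<in> closure \<Omega> \<longrightarrow> x \<in> cball p (r p) \<longrightarrow> fst (\<kappa>T p) (x - y) \<noteq> 0 \<longrightarrow> y \<in> snd (\<kappa>T p))" ..
  define \<kappa> where "\<kappa> p = fst (\<kappa>T p)" for p
  define T where "T p = snd (\<kappa>T p)" for p
  have \<kappa>: "smooth_kernel (\<kappa> p)" "\<And>x. 0 \<le> \<kappa> p x" "has_bochner_integral lborel (\<kappa> p) 1" "\<And>x. x \<notin> cball 0 \<eta> \<Longrightarrow> \<kappa> p x = 0"
    and T: "compact (T p)" "T p \<subseteq> \<Omega>" "\<And>x y. x \<in> closure \<Omega> \<Longrightarrow> x \<in> cball p (r p) \<Longrightarrow> \<kappa> p (x - y) \<noteq> 0 \<Longrightarrow> y \<in> T p" if "p \<in> I" for p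
    using \<kappa>T that unfolding \<kappa>_def T_def by blast+
  define c where "c p = conv (\<kappa> p) (indicat_real E)" for p
  have im: "indicat_real E \<in> borel_measurable borel" by measurable
  have ib: "norm (indicat_real E y) \<le> 1" for y by (simp add: indicator_def)
  have Cc: "C_k k (c p)" if "p \<in> I" for p k unfolding c_def by (rule conv_C_k[OF \<kappa>(1)[OF that] im ib])
  have cb: "0 \<le> c p x" "c p x \<le> 1" if "p \<in> I" for p x
    using conv_indicator_bounds(1,2)[OF \<kappa>(1-3)[OF that] E, of x] by (auto simp: c_def)
  have cL1: "(\<integral>\<^sup>+x\<in>cball 0 \<rho>. ennreal \<bar>c p x - indicator E x\<bar> \<partial>lborel) \<le> ennreal e1" if "p \<in> I" for p
    unfolding c_def by (rule \<eta>1(2)[OF \<kappa>(1-3)[OF that]]) (use \<kappa>(4)[OF that] \<eta>(3) in auto)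
  define u where "u x = (\<Sum>p\<in>I. \<zeta> p x * c p x)" for x
  have Cu: "C_k (Suc 0) u" unfolding u_def by (intro C_k_sum C_k_mult \<zeta>(1) Cc)
  have u0: "u x = 0" if "norm x > \<rho>" for x unfolding u_def using \<zeta>0 that by (intro sum.neutral ballI) simp
  have ub: "0 \<le> u x" "u x \<le> 1" for x
  proof -
    show "0 \<le> u x" unfolding u_def using \<zeta>(2) cb by (intro sum_nonneg mult_nonneg_nonneg) auto
    have "u x \<le> (\<Sum>p\<in>I. \<zeta> p x)" unfolding u_def using \<zeta>(2) cb by (intro sum_mono mult_left_le) auto
    then show "u x \<le> 1" using sum\<theta>[of x] \<theta>b(2)[of x] by simp
  qed
  have cm[measurable]: "c p \<in> borel_measurable borel" if "p \<in> I" for p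
    using Cc[OF that, of 0] by (auto intro: borel_measurable_continuous_onI)
  have \<zeta>m[measurable]: "\<zeta> p \<in> borel_measurable borel" if "p \<in> I" for p
    using \<zeta>(1)[OF that, of 0] by (auto intro: borel_measurable_continuous_onI)
  have [measurable]: "u \<in> borel_measurable borel" unfolding u_def by measurable
  have [measurable]: "cball (0::'a) \<rho> \<in> sets borel" "cball (0::'a) R \<in> sets borel" by simp_all
  define s where "s x = (\<Sum>p\<in>I. ennreal (\<bar>c p x - indicator E x\<bar> * indicator (cball 0 \<rho>) x))" for x
  have [measurable]: "s \<in> borel_measurable borel" unfolding s_def by measurable
  have s: "(\<integral>\<^sup>+x. s x \<partial>lborel) \<le> ennreal (N * e1)"
  proof -
    have "(\<integral>\<^sup>+x. s x \<partial>lborel) = (\<Sum>p\<in>I. \<integral>\<^sup>+x. ennreal (\<bar>c p x - indicator E x\<bar> * indicator (cball 0 \<rho>) x) \<partial>lborel)"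
      unfolding s_def by (rule nn_integral_sum) measurable
    also have "\<dots> \<le> (\<Sum>p\<in>I. ennreal e1)"
    proof (rule sum_mono)
      fix p assume "p \<in> I"
      from cL1[OF this] show "(\<integral>\<^sup>+x. ennreal (\<bar>c p x - indicator E x\<bar> * indicator (cball 0 \<rho>) x) \<partial>lborel) \<le> ennreal e1"
        by (simp add: ennreal_mult' ennreal_indicator)
    qed
    also have "\<dots> = ennreal (N * e1)" using e1 by (simp add: N_def ennreal_mult ennreal_of_nat_eq_real_of_nat)
    finally show ?thesis .
  qed
  have sr: "s x = ennreal (\<Sum>p\<in>I. \<bar>c p x - indicator E x\<bar> * indicator (cball 0 \<rho>) x)" for x
    unfolding s_def by (rule sum_ennreal) simp
  have L1: "(\<integral>\<^sup>+x. ennreal \<bar>u x - indicator E x\<bar> \<partial>std_gauss) \<le> ennreal \<epsilon>"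
  proof -
    have "(\<integral>\<^sup>+x. ennreal \<bar>u x - indicator E x\<bar> \<partial>std_gauss) \<le> (\<integral>\<^sup>+x. s x + indicator (- cball 0 R) x \<partial>std_gauss)"
    proof (rule nn_integral_mono)
      fix x :: 'a
      \<comment> \<open>The \<zeta> p sum up to \<theta>, which is 1 on the ball of radius R; the
        last term is therefore a tail term.\<close>
      have "u x - indicator E x = (\<Sum>p\<in>I. \<zeta> p x * (c p x - indicator E x)) + (\<theta> x - 1) * indicator E x"
        unfolding u_def sum\<theta>[symmetric] by (simp add: right_diff_distrib sum_subtractf sum_distrib_right left_diff_distrib)
      also have "\<bar>\<dots>\<bar> \<le> (\<Sum>p\<in>I. \<bar>c p x - indicator E x\<bar> * indicator (cball 0 \<rho>) x) + indicator (- cball 0 R) x"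
      proof (rule order_trans[OF abs_triangle_ineq add_mono])
        have "\<bar>\<Sum>p\<in>I. \<zeta> p x * (c p x - indicator E x)\<bar> \<le> (\<Sum>p\<in>I. \<bar>\<zeta> p x * (c p x - indicator E x)\<bar>)" by (rule sum_abs)
        also have "\<dots> \<le> (\<Sum>p\<in>I. \<bar>c p x - indicator E x\<bar> * indicator (cball 0 \<rho>) x)"
        proof (rule sum_mono)
          fix p assume p: "p \<in> I"
          show "\<bar>\<zeta> p x * (c p x - indicator E x)\<bar> \<le> \<bar>c p x - indicator E x\<bar> * indicator (cball 0 \<rho>) x"
            using \<zeta>1[OF p, of x] \<zeta>(2)[OF p, of x] \<zeta>0[OF p, of x]
            by (cases "norm x \<le> \<rho>") (auto simp: abs_mult mult_left_le_one_le)
        qed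
        finally show "\<bar>\<Sum>p\<in>I. \<zeta> p x * (c p x - indicator E x)\<bar> \<le> (\<Sum>p\<in>I. \<bar>c p x - indicator E x\<bar> * indicator (cball 0 \<rho>) x)" .
        show "\<bar>(\<theta> x - 1) * indicator E x\<bar> \<le> indicator (- cball 0 R) x"
          using \<theta>b[of x] \<theta>1[of x] by (cases "norm x \<le> R") (auto simp: indicator_def)
      qed
      finally have "ennreal \<bar>u x - indicator E x\<bar> \<le> ennreal ((\<Sum>p\<in>I. \<bar>c p x - indicator E x\<bar> * indicator (cball 0 \<rho>) x) + indicator (- cball 0 R) x)"
        by (rule ennreal_leI)
      then show "ennreal \<bar>u x - indicator E x\<bar> \<le> s x + indicator (- cball 0 R) x"
        unfolding sr by (subst (asm) ennreal_plus) (auto simp: ennreal_indicator intro!: sum_nonneg)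
    qed
    also have "\<dots> = (\<integral>\<^sup>+x. s x \<partial>std_gauss) + emeasure std_gauss (- cball (0::'a) R)"
      by (subst nn_integral_add) auto
    also have "\<dots> \<le> ennreal (N * e1) + ennreal (\<epsilon> / 2)"
      using order_trans[OF nn_integral_std_gauss_le s] tail
      by (intro add_mono) (auto simp: std_gauss.emeasure_eq_measure ennreal_leI)
    also have "\<dots> \<le> ennreal (\<epsilon> / 2) + ennreal (\<epsilon> / 2)" using e1'(1) by (intro add_mono ennreal_leI) auto
    also have "\<dots> = ennreal \<epsilon>" using \<epsilon> by (simp add: ennreal_plus[symmetric] del: ennreal_plus)
    finally show ?thesis .
  qed
  let ?G = "\<lambda>p b. conv (\<lambda>x. frechet_derivative (\<kappa> p) (at x) b) (indicat_real E)"
  let ?D = "\<lambda>p x v. frechet_derivative (\<zeta> p) (at x) v"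
  have Du: "frechet_derivative u (at x) v = (\<Sum>p\<in>I. \<zeta> p x * (\<Sum>b\<in>Basis. (v \<bullet> b) * ?G p b x) + ?D p x v * c p x)" for x v
  proof -
    have "(u has_derivative (\<lambda>h. \<Sum>p\<in>I. \<zeta> p x * (\<Sum>b\<in>Basis. (h \<bullet> b) *\<^sub>R ?G p b x) + ?D p x h * c p x)) (at x)"
      unfolding u_def c_def
      by (intro has_derivative_sum has_derivative_mult C_k_SucD(1)[OF \<zeta>(1)] conv_has_derivative[OF \<kappa>(1) im ib])
    from frechet_derivative_at[OF this] show ?thesis by (simp add: fun_eq_iff)
  qed
  \<comment> \<open>Dual field: pairing it with the gradient gives the density times |grad u| on the
    closure of \<Omega>. It is only measurable, which is all that \<open>dual_estimate\<close>
    requires.\<close>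
  define \<Psi> where "\<Psi> x = (gauss_density x * indicator (closure \<Omega>) x) *\<^sub>R sgn (grad u x)" for x
  have cg: "continuous_on UNIV (grad u)" by (rule continuous_grad[OF Cu])
  have [measurable]: "grad u \<in> borel_measurable borel" using cg by (rule borel_measurable_continuous_onI)
  have \<Psi>m[measurable]: "\<Psi> \<in> borel_measurable borel" unfolding \<Psi>_def sgn_div_norm by measurable
  have \<Psi>b: "norm (\<Psi> x) \<le> gauss_density x" for x by (auto simp: \<Psi>_def norm_sgn indicator_def)
  have \<Psi>0: "\<Psi> x = 0" if "x \<notin> closure \<Omega>" for x using that by (simp add: \<Psi>_def)
  have \<Psi>g: "\<Psi> x \<bullet> grad u x = gauss_density x * indicator (closure \<Omega>) x * norm (grad u x)" for x
  proof -
    have "sgn v \<bullet> v = norm v" for v :: 'a by (cases "v = 0") (simp_all add: sgn_div_norm dot_square_norm power2_eq_square)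
    then show ?thesis by (simp add: \<Psi>_def)
  qed
  \<comment> \<open>A collects the derivatives of the partition functions, B those that fall on the
    kernels.\<close>
  define A where "A x = (\<Sum>p\<in>I. ?D p x (\<Psi> x) * c p x)" for x
  define B where "B x = (\<Sum>p\<in>I. \<Sum>b\<in>Basis. (\<zeta> p x * (\<Psi> x \<bullet> b)) * ?G p b x)" for x
  have AB: "gauss_density x * indicator (closure \<Omega>) x * norm (grad u x) = A x + B x" for x
    unfolding \<Psi>g[symmetric] inner_grad[OF Cu] Du A_def B_def by (simp add: sum.distrib sum_distrib_left mult_ac)
  have iB: "integrable lborel (\<lambda>x. (\<zeta> p x * (\<Psi> x \<bullet> b)) * ?G p b x)" if p: "p \<in> I" and b: "b \<in> Basis" for p b
  proof -
    have cG: "continuous_on UNIV (?G p b)" using conv_C_k[OF smooth_kernel_derivative[OF \<kappa>(1)[OF p] b] im ib, of 0] by simp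
    then have [measurable]: "?G p b \<in> borel_measurable borel" by (rule borel_measurable_continuous_onI)
    have "continuous_on UNIV (\<lambda>x. \<zeta> p x * ?G p b x)" using cG \<zeta>(1)[OF p, of 0] by (auto intro!: continuous_intros)
    then obtain M where M: "M > 0" "\<And>x. norm (\<zeta> p x * ?G p b x) \<le> M"
      by (rule continuous_compact_support_bounded[OF _ compact_cball[of 0 \<rho>]]) (use \<zeta>0[OF p] in auto)
    show ?thesis
    proof (rule bounded_support_integrable(1)[where C=M and a=0 and R=\<rho>])
      show "(\<lambda>x. (\<zeta> p x * (\<Psi> x \<bullet> b)) * ?G p b x) \<in> borel_measurable borel" using p by measurable
      show "norm ((\<zeta> p x * (\<Psi> x \<bullet> b)) * ?G p b x) \<le> M" for x
      proof -
        have "\<bar>\<Psi> x \<bullet> b\<bar> \<le> 1" using Basis_le_norm[OF b, of "\<Psi> x"] \<Psi>b[of x] gauss_density_le_1[of x] by linarith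
        then have "norm (\<zeta> p x * ?G p b x) * \<bar>\<Psi> x \<bullet> b\<bar> \<le> M * 1" using M by (intro mult_mono) auto
        then show ?thesis by (simp add: abs_mult mult_ac)
      qed
    qed (use \<zeta>0[OF p] in auto)
  qed
  have hB: "has_bochner_integral lborel B (\<Sum>p\<in>I. \<Sum>b\<in>Basis. \<integral>x. (\<zeta> p x * (\<Psi> x \<bullet> b)) * ?G p b x \<partial>lborel)"
    unfolding B_def by (intro has_bochner_integral_sum has_bochner_integral_integrable iB)
  have intB: "integral\<^sup>L lborel B \<le> (1 + \<epsilon>) * V"
    unfolding has_bochner_integral_integral_eq[OF hB]
  proof (rule dual_estimate[where T=T and \<rho>=\<rho> and B="\<lambda>p. cball p (r p)", OF fin E V])
    show "(\<Sum>i\<in>I. \<integral>x. \<kappa> i (x - y) * (\<zeta> i x * gauss_density x) \<partial>lborel) \<le> (1 + \<epsilon>) * gauss_density y" for y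
    proof (rule kernel_average_le[where \<rho>=\<rho> and L=L and \<eta>=\<eta> and m=m, OF fin])
      show "(\<Sum>i\<in>I. \<zeta> i x) \<le> 1" for x unfolding sum\<theta> by (rule \<theta>b)
      show "continuous_on UNIV (\<zeta> p)" if "p \<in> I" for p using \<zeta>(1)[OF that, of 0] by simp
    qed (use \<epsilon> \<eta> m \<zeta>(2) \<zeta>0 L small[unfolded N_def] \<kappa> in auto)
  qed (use \<epsilon> \<zeta>(1,2,4) \<zeta>1 \<zeta>0 \<kappa>(1,2) T \<Psi>m \<Psi>b \<Psi>0 in auto)
  have ig: "integrable lborel (\<lambda>x. gauss_density x * indicator (closure \<Omega>) x * norm (grad u x))"
  proof -
    have g0: "grad u x = 0" if "x \<notin> cball 0 \<rho>" for x
      using frechet_derivative_at[OF has_derivative_zero_outside[of "cball 0 \<rho>" u x]] u0 that by (simp add: grad_def fun_eq_iff)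
    obtain M where M: "M > 0" "\<And>x. norm (grad u x) \<le> M"
      by (rule continuous_compact_support_bounded[OF cg compact_cball[of 0 \<rho>] g0]) (assumption, rule that)
    show ?thesis
    proof (rule bounded_support_integrable(1)[where C=M and a=0 and R=\<rho>])
      have [measurable]: "closure \<Omega> \<in> sets borel" by simp
      show "(\<lambda>x. gauss_density x * indicator (closure \<Omega>) x * norm (grad u x)) \<in> borel_measurable borel" by measurable
      show "norm (gauss_density x * indicator (closure \<Omega>) x * norm (grad u x)) \<le> M" for x
        using mult_mono[OF gauss_density_le_1[of x] M(2)[of x]] M(1) by (auto simp: indicator_def abs_mult)
    qed (use g0 in auto)
  qed
  have iA: "integrable lborel A"
  proof -
    have "A = (\<lambda>x. gauss_density x * indicator (closure \<Omega>) x * norm (grad u x) - B x)" using AB by (simp add: fun_eq_iff)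
    then show ?thesis using ig hB by (simp add: integrable.intros)
  qed
  have D\<theta>: "(\<Sum>p\<in>I. ?D p x v) = frechet_derivative \<beta> (at ((1 / R) *\<^sub>R x)) ((1 / R) *\<^sub>R v)" for x v
  proof -
    have 1: "((\<lambda>x. \<Sum>p\<in>I. \<zeta> p x) has_derivative (\<lambda>v. \<Sum>p\<in>I. ?D p x v)) (at x)"
      by (intro has_derivative_sum C_k_SucD(1)[OF \<zeta>(1)])
    have "((\<lambda>x. (1 / R) *\<^sub>R x) has_derivative (\<lambda>v. (1 / R) *\<^sub>R v)) (at x)" by (auto intro!: derivative_eq_intros)
    from has_derivative_compose[OF this C_k_SucD(1)[OF \<beta>(1)]]
    have 2: "((\<lambda>x. \<Sum>p\<in>I. \<zeta> p x) has_derivative (\<lambda>v. frechet_derivative \<beta> (at ((1 / R) *\<^sub>R x)) ((1 / R) *\<^sub>R v))) (at x)"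
      unfolding \<zeta>(3) .
    from has_derivative_unique[OF 1 2] show ?thesis by (rule fun_cong)
  qed
  have Ab: "ennreal \<bar>A x\<bar> \<le> ennreal Bz * s x + ennreal (C0 / R) * ennreal (gauss_density x)" for x
  proof -
    \<comment> \<open>The same indicator can be subtracted from all c p, because the derivatives of
      the \<zeta> p sum up to the derivative of the cutoff, which is of size C0 / R.\<close>
    have "A x = (\<Sum>p\<in>I. ?D p x (\<Psi> x) * (c p x - indicator E x)) + indicator E x * (\<Sum>p\<in>I. ?D p x (\<Psi> x))"
      unfolding A_def sum_distrib_left sum.distrib[symmetric] by (intro sum.cong refl) (simp add: algebra_simps)
    also have "\<bar>\<dots>\<bar> \<le> (\<Sum>p\<in>I. Bz * (\<bar>c p x - indicator E x\<bar> * indicator (cball 0 \<rho>) x)) + C0 / R * gauss_density x"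
    proof (rule order_trans[OF abs_triangle_ineq add_mono])
      have "\<bar>\<Sum>p\<in>I. ?D p x (\<Psi> x) * (c p x - indicator E x)\<bar> \<le> (\<Sum>p\<in>I. \<bar>?D p x (\<Psi> x) * (c p x - indicator E x)\<bar>)" by (rule sum_abs)
      also have "\<dots> \<le> (\<Sum>p\<in>I. Bz * (\<bar>c p x - indicator E x\<bar> * indicator (cball 0 \<rho>) x))"
      proof (rule sum_mono)
        fix p assume p: "p \<in> I"
        show "\<bar>?D p x (\<Psi> x) * (c p x - indicator E x)\<bar> \<le> Bz * (\<bar>c p x - indicator E x\<bar> * indicator (cball 0 \<rho>) x)"
        proof (cases "x \<in> cball 0 \<rho>")
          case True
          have "\<bar>?D p x (\<Psi> x)\<bar> \<le> Bz * norm (\<Psi> x)" by (rule Bz(2)[OF p])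
          also have "\<dots> \<le> Bz * 1" using \<Psi>b[of x] gauss_density_le_1[of x] Bz(1) by (intro mult_left_mono) auto
          finally show ?thesis using True by (simp add: abs_mult mult_right_mono)
        next
          case False
          then show ?thesis
            using frechet_derivative_at[OF has_derivative_zero_outside[of "cball 0 \<rho>" "\<zeta> p" x]] \<zeta>0[OF p] by (simp add: fun_eq_iff)
        qed
      qed
      finally show "\<bar>\<Sum>p\<in>I. ?D p x (\<Psi> x) * (c p x - indicator E x)\<bar> \<le> (\<Sum>p\<in>I. Bz * (\<bar>c p x - indicator E x\<bar> * indicator (cball 0 \<rho>) x))" .
      have "\<bar>\<Sum>p\<in>I. ?D p x (\<Psi> x)\<bar> \<le> C0 * norm ((1 / R) *\<^sub>R \<Psi> x)" unfolding D\<theta> by (rule C0(2)[unfolded real_norm_def])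
      also have "\<dots> = C0 / R * norm (\<Psi> x)" using R(1) by simp
      also have "\<dots> \<le> C0 / R * gauss_density x" using C0(1) R(1) by (intro mult_left_mono \<Psi>b) auto
      finally show "\<bar>indicator E x * (\<Sum>p\<in>I. ?D p x (\<Psi> x))\<bar> \<le> C0 / R * gauss_density x"
        using C0(1) R(1) by (auto simp: indicator_def)
    qed
    finally have "ennreal \<bar>A x\<bar> \<le> ennreal ((\<Sum>p\<in>I. Bz * (\<bar>c p x - indicator E x\<bar> * indicator (cball 0 \<rho>) x)) + C0 / R * gauss_density x)"
      by (rule ennreal_leI)
    also have "\<dots> = ennreal Bz * s x + ennreal (C0 / R) * ennreal (gauss_density x)"
      unfolding sr using Bz(1) C0(1) R(1)
      by (subst ennreal_plus) (auto simp: sum_distrib_left[symmetric] ennreal_mult[symmetric] sum_nonneg intro!: mult_nonneg_nonneg)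
    finally show ?thesis .
  qed
  have intA: "integral\<^sup>L lborel A \<le> \<epsilon>"
  proof -
    have "ennreal (norm (integral\<^sup>L lborel A)) \<le> (\<integral>\<^sup>+x. ennreal (norm (A x)) \<partial>lborel)"
      by (rule integral_norm_bound_ennreal[OF iA])
    also have "\<dots> \<le> (\<integral>\<^sup>+x. ennreal Bz * s x + ennreal (C0 / R) * ennreal (gauss_density x) \<partial>lborel)"
      using Ab by (intro nn_integral_mono) simp
    also have "\<dots> = ennreal Bz * (\<integral>\<^sup>+x. s x \<partial>lborel) + ennreal (C0 / R) * (\<integral>\<^sup>+x. ennreal (gauss_density x) \<partial>(lborel :: 'a measure))"
      by (subst nn_integral_add) (auto simp: nn_integral_cmult)
    also have "(\<integral>\<^sup>+x. ennreal (gauss_density x) \<partial>(lborel :: 'a measure)) = 1"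
      using std_gauss.emeasure_space_1 by (simp add: std_gauss_def emeasure_density)
    also have "ennreal Bz * (\<integral>\<^sup>+x. s x \<partial>lborel) + ennreal (C0 / R) * 1 \<le> ennreal Bz * ennreal (N * e1) + ennreal (\<epsilon> / 2)"
      using s R(2) by (intro add_mono mult_left_mono) (auto simp: ennreal_leI)
    also have "\<dots> = ennreal (N * (Bz * e1) + \<epsilon> / 2)"
      using Bz(1) N e1 \<epsilon> by (subst ennreal_plus) (auto simp: ennreal_mult[symmetric] mult_ac)
    also have "\<dots> \<le> ennreal \<epsilon>" using e1'(2) by (intro ennreal_leI) simp
    finally have "norm (integral\<^sup>L lborel A) \<le> \<epsilon>" using \<epsilon> by simp
    then show ?thesis by simp
  qed
  have "(\<integral>\<^sup>+x\<in>closure \<Omega>. ennreal (norm (grad u x)) \<partial>std_gauss) = (\<integral>\<^sup>+x. ennreal (gauss_density x * indicator (closure \<Omega>) x * norm (grad u x)) \<partial>lborel)"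
  proof -
    have [measurable]: "closure \<Omega> \<in> sets borel" by simp
    have "(\<integral>\<^sup>+x\<in>closure \<Omega>. ennreal (norm (grad u x)) \<partial>std_gauss) = (\<integral>\<^sup>+x. ennreal (gauss_density x) * (ennreal (norm (grad u x)) * indicator (closure \<Omega>) x) \<partial>lborel)"
      unfolding std_gauss_def by (rule nn_integral_density) auto
    also have "\<dots> = (\<integral>\<^sup>+x. ennreal (gauss_density x * indicator (closure \<Omega>) x * norm (grad u x)) \<partial>lborel)"
      by (intro nn_integral_cong) (auto simp: indicator_def ennreal_mult)
    finally show ?thesis .
  qed
  also have "\<dots> = ennreal (\<integral>x. A x + B x \<partial>lborel)"
    unfolding AB[symmetric] by (rule nn_integral_eq_integral[OF ig]) simp
  also have "\<dots> \<le> ennreal ((1 + \<epsilon>) * V + \<epsilon>)"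
    using intA intB iA hB by (intro ennreal_leI) (simp add: integrable.intros)
  finally show ?thesis by (intro that[of u \<rho>] Cu u0 ub L1)
qed

section \<open>The limsup inequality\<close>

text \<open>The positive part is half the sum of the absolute value and the function itself, and the
  latter has mean 0.\<close>

lemma has_bochner_integral_std_gauss_pos_inner:
  fixes v :: "'a::euclidean_space"
  shows "has_bochner_integral std_gauss (\<lambda>z. max 0 (v \<bullet> z)) (norm v / sqrt (2 * pi))"
proof -
  have m: "has_bochner_integral std_gauss (\<lambda>z. v \<bullet> z) 0"
  proof (cases "v = 0")
    case False
    have D: "distributed std_gauss lborel (\<lambda>x. v \<bullet> x) (normal_density 0 (norm v))" by (rule distributed_std_gauss_inner[OF False])
    have "integrable std_gauss (\<lambda>z. \<bar>v \<bullet> z\<bar>)" using has_bochner_integral_std_gauss_abs_inner by (rule integrable.intros)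
    then have "integrable std_gauss (\<lambda>z. v \<bullet> z)" by (simp add: integrable_abs_iff)
    moreover have "(\<integral>z. v \<bullet> z \<partial>std_gauss) = 0" using std_gauss.normal_distributed_expectation[OF _ D] False by simp
    ultimately show ?thesis by (simp add: has_bochner_integral_iff)
  qed (simp add: has_bochner_integral_zero)
  have "has_bochner_integral std_gauss (\<lambda>z. (\<bar>v \<bullet> z\<bar> + v \<bullet> z) / 2) ((sqrt (2 / pi) * norm v + 0) / 2)"
    by (intro has_bochner_integral_divide has_bochner_integral_add m has_bochner_integral_std_gauss_abs_inner)
  moreover have "(\<bar>v \<bullet> z\<bar> + v \<bullet> z) / 2 = max 0 (v \<bullet> z)" for z by (simp add: max_def abs_if)
  moreover have "(sqrt (2 / pi) * norm v + 0) / 2 = norm v / sqrt (2 * pi)"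
  proof -
    have "sqrt (2 * pi) * sqrt (2 / pi) = 2" by (simp flip: real_sqrt_mult)
    then have "sqrt (2 * pi) * sqrt (2 / pi) * norm v = 2 * norm v" by (simp only:)
    then show ?thesis by (simp add: field_simps)
  qed
  ultimately show ?thesis by (simp only:)
qed

text \<open>Half of the nonlocal total variation of \<open>u\<close> seen from \<open>\<Omega>\<close>, at correlation \<open>c\<close>.\<close>

definition gauss_energy :: "real \<Rightarrow> ('a::euclidean_space \<Rightarrow> real) \<Rightarrow> 'a set \<Rightarrow> ennreal" where
  "gauss_energy c u \<Omega> = (\<integral>\<^sup>+p. ennreal (u (fst p) - u (c *\<^sub>R fst p + sqrt (1 - c\<^sup>2) *\<^sub>R snd p)) *
     indicator {p. fst p \<in> \<Omega> \<or> c *\<^sub>R fst p + sqrt (1 - c\<^sup>2) *\<^sub>R snd p \<in> \<Omega>} p \<partial>gauss2)"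

text \<open>Dominated convergence of difference quotients in \<sigma> = sqrt (1 - c^2). The point Y
  leaves X in the direction Z, so the positive part of - grad u (X) \<bullet> Z appears, with mean
  |grad u| / sqrt (2 * pi) over Z. Starting points off the closure of \<Omega> drop out, as Y
  finally stays off it too.\<close>

lemma gauss_energy_asymptotics:
  fixes \<Omega> :: "'a::euclidean_space set" and \<sigma> :: "nat \<Rightarrow> real"
  assumes \<Omega>: "open \<Omega>" and u: "C_k (Suc 0) u" "\<And>x. norm x > \<rho> \<Longrightarrow> u x = 0"
    and g: "(\<integral>\<^sup>+x\<in>closure \<Omega>. ennreal (norm (grad u x)) \<partial>std_gauss) \<le> ennreal g" "g \<ge> 0"
    and \<sigma>: "\<sigma> \<longlonglongrightarrow> 0" "\<And>n. 0 < \<sigma> n" "\<And>n. \<sigma> n < 1" and e: "e > 0"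
  shows "eventually (\<lambda>n. gauss_energy (sqrt (1 - (\<sigma> n)\<^sup>2)) u \<Omega> \<le> ennreal (\<sigma> n * (g / sqrt (2 * pi) + e))) sequentially"
proof -
  define c where "c n = sqrt (1 - (\<sigma> n)\<^sup>2)" for n
  have s2: "(\<sigma> n)\<^sup>2 < 1" for n using \<sigma>(2,3)[of n] by (simp add: abs_square_less_1)
  have c: "0 \<le> c n" "c n \<le> 1" "sqrt (1 - (c n)\<^sup>2) = \<sigma> n" for n
    using s2[of n] \<sigma>(2)[of n] by (auto simp: c_def)
  define Y where "Y n p = c n *\<^sub>R fst p + \<sigma> n *\<^sub>R snd p" for n and p :: "'a \<times> 'a"
  have Ym[measurable]: "Y n \<in> borel \<Otimes>\<^sub>M borel \<rightarrow>\<^sub>M borel" for n unfolding Y_def by measurable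
  have [measurable]: "\<Omega> \<in> sets borel" "closure \<Omega> \<in> sets borel" using \<Omega> by auto
  have [measurable]: "u \<in> borel_measurable borel" using C_k_1_continuous[OF u(1)] by (rule borel_measurable_continuous_onI)
  have [measurable]: "grad u \<in> borel_measurable borel" using continuous_grad[OF u(1)] by (rule borel_measurable_continuous_onI)
  obtain B where B: "B > 0" "\<And>x y. \<bar>u x - u y\<bar> \<le> B * norm (x - y)"
    by (rule C_k_1_derivative_bounded_finite[of "{()}" "\<lambda>_. u" \<rho>]) (use u in \<open>auto intro: that\<close>)
  have Yx: "norm (fst p - Y n p) \<le> \<sigma> n * (norm (fst p) + norm (snd p))" for n p
  proof -
    \<comment> \<open>As 1 - c \<le> 1 + c, the square of 1 - c is at most 1 - c^2 = \<sigma>^2; so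
      the change of c costs no more than \<sigma>.\<close>
    have "(1 - c n)\<^sup>2 \<le> (1 - c n) * (1 + c n)" unfolding power2_eq_square using c[of n] by (intro mult_left_mono) auto
    also have "\<dots> = (\<sigma> n)\<^sup>2" using s2[of n] by (simp add: c_def algebra_simps power2_eq_square[symmetric])
    finally have 1: "1 - c n \<le> \<sigma> n" by (rule power2_le_imp_le) (use \<sigma>(2)[of n] in simp)
    have "fst p - Y n p = (1 - c n) *\<^sub>R fst p - \<sigma> n *\<^sub>R snd p" by (simp add: Y_def algebra_simps)
    also have "norm \<dots> \<le> (1 - c n) * norm (fst p) + \<sigma> n * norm (snd p)"
      by (rule order_trans[OF norm_triangle_ineq4]) (use c[of n] \<sigma>(2)[of n] in simp)
    also have "\<dots> \<le> \<sigma> n * norm (fst p) + \<sigma> n * norm (snd p)" using 1 by (intro add_mono mult_right_mono) auto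
    finally show ?thesis by (simp add: algebra_simps)
  qed
  \<comment> \<open>Starting points in the closure get weight 1 wherever Y is. For a start on the
    frontier the true indicator need not converge; this larger weight does, and it is what brings
    the closure into the estimate.\<close>
  define h where "h n p = max 0 ((u (fst p) - u (Y n p)) / \<sigma> n) * (if fst p \<in> closure \<Omega> then 1 else indicator \<Omega> (Y n p))" for n p
  define H where "H p = max 0 ((- grad u (fst p)) \<bullet> snd p) * indicator (closure \<Omega>) (fst p)" for p :: "'a \<times> 'a"
  have [measurable]: "h n \<in> borel_measurable (borel \<Otimes>\<^sub>M borel)" for n unfolding h_def by measurable
  have [measurable]: "H \<in> borel_measurable (borel \<Otimes>\<^sub>M borel)" unfolding H_def by measurable
  have Ylim: "(\<lambda>n. Y n p) \<longlonglongrightarrow> fst p" for p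
  proof -
    have "(\<lambda>n. sqrt (1 - (\<sigma> n)\<^sup>2) *\<^sub>R fst p + \<sigma> n *\<^sub>R snd p) \<longlonglongrightarrow> sqrt (1 - 0\<^sup>2) *\<^sub>R fst p + 0 *\<^sub>R snd p"
      by (intro tendsto_intros \<sigma>(1))
    then show ?thesis by (simp add: Y_def c_def)
  qed
  have lim: "(\<lambda>n. h n p) \<longlonglongrightarrow> H p" for p
  proof (cases "fst p \<in> closure \<Omega>")
    case True
    let ?\<gamma> = "\<lambda>s. sqrt (1 - s\<^sup>2) *\<^sub>R fst p + s *\<^sub>R snd p"
    have "(?\<gamma> has_derivative (\<lambda>k. k *\<^sub>R snd p)) (at 0)"
      by (auto intro!: derivative_eq_intros simp: algebra_simps)
    moreover have "(u has_derivative frechet_derivative u (at (fst p))) (at (?\<gamma> 0))" using C_k_SucD(1)[OF u(1)] by simp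
    ultimately have "((\<lambda>s. u (?\<gamma> s)) has_derivative (\<lambda>k. frechet_derivative u (at (fst p)) (k *\<^sub>R snd p))) (at 0)"
      by (rule has_derivative_compose)
    then have "((\<lambda>s. u (?\<gamma> s)) has_real_derivative (snd p \<bullet> grad u (fst p))) (at 0)"
      unfolding has_field_derivative_def by (rule has_derivative_eq_rhs) (simp add: inner_grad[OF u(1), symmetric] fun_eq_iff)
    then have "((\<lambda>s. (u (?\<gamma> s) - u (fst p)) / s) \<longlongrightarrow> snd p \<bullet> grad u (fst p)) (at 0)"
      unfolding has_field_derivative_iff by simp
    moreover have "filterlim \<sigma> (at 0) sequentially" unfolding filterlim_at using \<sigma>(1,2) by (auto intro!: always_eventually simp: less_imp_neq[symmetric])
    ultimately have "(\<lambda>n. (u (?\<gamma> (\<sigma> n)) - u (fst p)) / \<sigma> n) \<longlonglongrightarrow> snd p \<bullet> grad u (fst p)" by (rule filterlim_compose)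
    then have "(\<lambda>n. max 0 (- ((u (Y n p) - u (fst p)) / \<sigma> n))) \<longlonglongrightarrow> max 0 (- (snd p \<bullet> grad u (fst p)))"
      unfolding Y_def c_def by (intro tendsto_intros)
    then show ?thesis using True by (simp add: h_def H_def inner_commute minus_divide_left)
  next
    case False
    have "eventually (\<lambda>n. Y n p \<in> - closure \<Omega>) sequentially"
      by (rule topological_tendstoD[OF Ylim]) (use False in auto)
    then have "eventually (\<lambda>n. 0 = h n p) sequentially"
      by eventually_elim (use False closure_subset[of \<Omega>] in \<open>auto simp: h_def indicator_def\<close>)
    from Lim_transform_eventually[OF tendsto_const this] show ?thesis using False by (simp add: H_def)
  qed
  have bound: "\<bar>h n p\<bar> \<le> B * (1 + (norm (fst p))\<^sup>2 + (norm (snd p))\<^sup>2) * 2" for n p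
  proof -
    have "\<bar>u (fst p) - u (Y n p)\<bar> \<le> B * (\<sigma> n * (norm (fst p) + norm (snd p)))"
      using B(1) by (intro order_trans[OF B(2)] mult_left_mono Yx) auto
    then have 1: "\<bar>(u (fst p) - u (Y n p)) / \<sigma> n\<bar> \<le> B * (norm (fst p) + norm (snd p))"
      using \<sigma>(2)[of n] by (simp add: divide_le_eq mult_ac)
    have "\<bar>h n p\<bar> \<le> \<bar>(u (fst p) - u (Y n p)) / \<sigma> n\<bar>" by (auto simp: h_def indicator_def max_def simp del: abs_divide)
    also have "\<dots> \<le> B * (norm (fst p) + norm (snd p))" by (rule 1)
    also have "\<dots> \<le> B * ((1 + (norm (fst p))\<^sup>2) + (1 + (norm (snd p))\<^sup>2))" using B(1) by (intro mult_left_mono add_mono norm_le_1_plus_square) auto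
    also have "\<dots> \<le> B * ((1 + (norm (fst p))\<^sup>2 + (norm (snd p))\<^sup>2) * 2)" using B(1) by (intro mult_left_mono) auto
    finally show ?thesis by (simp add: mult_ac)
  qed
  have ib: "integrable gauss2 (\<lambda>p :: 'a \<times> 'a. B * (1 + (norm (fst p))\<^sup>2 + (norm (snd p))\<^sup>2) * 2)"
    by (intro integrable_mult_left integrable_gauss2_norms)
  have hm: "h n \<in> borel_measurable gauss2" and Hm: "H \<in> borel_measurable gauss2" for n by measurable
  have ae1: "AE p in gauss2. (\<lambda>n. h n p) \<longlonglongrightarrow> H p" and ae2: "AE p in gauss2. norm (h n p) \<le> B * (1 + (norm (fst p))\<^sup>2 + (norm (snd p))\<^sup>2) * 2" for n
    using lim bound by auto
  have conv: "(\<lambda>n. integral\<^sup>L gauss2 (h n)) \<longlonglongrightarrow> integral\<^sup>L gauss2 H"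
    by (rule integral_dominated_convergence[OF Hm hm ib ae1 ae2])
  have iH: "integrable gauss2 H" by (rule integrable_dominated_convergence[OF Hm hm ib ae1 ae2])
  have ih: "integrable gauss2 (h n)" for n by (rule Bochner_Integration.integrable_bound[OF ib hm]) (use bound in \<open>auto intro: order_trans[OF bound abs_ge_self]\<close>)
  have "integral\<^sup>L gauss2 H \<le> g / sqrt (2 * pi)"
  proof -
    have "ennreal (integral\<^sup>L gauss2 H) = (\<integral>\<^sup>+p. ennreal (H p) \<partial>gauss2)"
      by (rule nn_integral_eq_integral[OF iH, symmetric]) (simp add: H_def)
    also have "\<dots> = (\<integral>\<^sup>+x. \<integral>\<^sup>+z. ennreal (H (x, z)) \<partial>std_gauss \<partial>std_gauss)"
      by (rule std_gauss.nn_integral_fst[symmetric]) measurable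
    also have "\<dots> = (\<integral>\<^sup>+x. ennreal (1 / sqrt (2 * pi)) * (ennreal (norm (grad u x)) * indicator (closure \<Omega>) x) \<partial>std_gauss)"
    proof (intro nn_integral_cong)
      fix x :: 'a
      show "(\<integral>\<^sup>+z. ennreal (H (x, z)) \<partial>std_gauss) = ennreal (1 / sqrt (2 * pi)) * (ennreal (norm (grad u x)) * indicator (closure \<Omega>) x)"
      proof (cases "x \<in> closure \<Omega>")
        case True
        have b: "has_bochner_integral std_gauss (\<lambda>z. max 0 ((- grad u x) \<bullet> z)) (norm (- grad u x) / sqrt (2 * pi))"
          by (rule has_bochner_integral_std_gauss_pos_inner)
        have "(\<integral>\<^sup>+z. ennreal (max 0 ((- grad u x) \<bullet> z)) \<partial>std_gauss) = ennreal (norm (- grad u x) / sqrt (2 * pi))"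
          unfolding nn_integral_eq_integral[OF integrable.intros[OF b] AE_I2[OF max.cobounded1]] has_bochner_integral_integral_eq[OF b] ..
        then show ?thesis using True by (simp add: H_def ennreal_mult[symmetric])
      qed (simp add: H_def)
    qed
    also have "\<dots> = ennreal (1 / sqrt (2 * pi)) * (\<integral>\<^sup>+x\<in>closure \<Omega>. ennreal (norm (grad u x)) \<partial>std_gauss)"
      by (rule nn_integral_cmult) measurable
    also have "\<dots> \<le> ennreal (1 / sqrt (2 * pi)) * ennreal g" by (intro mult_left_mono g) simp
    also have "\<dots> = ennreal (g / sqrt (2 * pi))" using g(2) by (simp add: ennreal_mult[symmetric])
    finally show ?thesis using g(2) by (simp add: ennreal_le_iff)
  qed
  then have "integral\<^sup>L gauss2 H < g / sqrt (2 * pi) + e" using e by simp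
  with conv have "eventually (\<lambda>n. integral\<^sup>L gauss2 (h n) < g / sqrt (2 * pi) + e) sequentially" by (rule order_tendstoD(2))
  then show ?thesis
  proof eventually_elim
    case (elim n)
    have "gauss_energy (sqrt (1 - (\<sigma> n)\<^sup>2)) u \<Omega> \<le> (\<integral>\<^sup>+p. ennreal (\<sigma> n * h n p) \<partial>gauss2)"
      unfolding gauss_energy_def c_def[symmetric] c(3) Y_def[symmetric]
    proof (intro nn_integral_mono)
      fix p :: "'a \<times> 'a"
      show "ennreal (u (fst p) - u (Y n p)) * indicator {p. fst p \<in> \<Omega> \<or> Y n p \<in> \<Omega>} p \<le> ennreal (\<sigma> n * h n p)"
      proof (cases "fst p \<in> \<Omega> \<or> Y n p \<in> \<Omega>")
        case True
        then have "\<sigma> n * h n p = \<sigma> n * max 0 ((u (fst p) - u (Y n p)) / \<sigma> n)"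
          using closure_subset[of \<Omega>] by (auto simp: h_def)
        also have "\<dots> \<ge> \<sigma> n * ((u (fst p) - u (Y n p)) / \<sigma> n)" using \<sigma>(2)[of n] by (intro mult_left_mono) auto
        also have "\<sigma> n * ((u (fst p) - u (Y n p)) / \<sigma> n) = u (fst p) - u (Y n p)" using \<sigma>(2)[of n] by simp
        finally show ?thesis using True by (simp add: ennreal_leI)
      qed simp
    qed
    also have "\<dots> = ennreal (\<integral>p. \<sigma> n * h n p \<partial>gauss2)"
      using ih[of n] \<sigma>(2)[of n] by (intro nn_integral_eq_integral integrable_mult_right AE_I2 mult_nonneg_nonneg) (assumption | simp | simp add: h_def)+
    also have "\<dots> \<le> ennreal (\<sigma> n * (g / sqrt (2 * pi) + e))"
      using elim \<sigma>(2)[of n] by (intro ennreal_leI) simp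
    finally show ?case .
  qed
qed

text \<open>The sequential statement becomes one for all small t, by contradiction, and \<sigma> is
  expressed by t.\<close>

lemma gauss_energy_le:
  fixes \<Omega> :: "'a::euclidean_space set"
  assumes \<Omega>: "open \<Omega>" and u: "C_k (Suc 0) u" "\<And>x. norm x > \<rho> \<Longrightarrow> u x = 0"
    and g: "(\<integral>\<^sup>+x\<in>closure \<Omega>. ennreal (norm (grad u x)) \<partial>std_gauss) \<le> ennreal g" "g \<ge> 0" and e: "e > 0"
  obtains \<delta> where "\<delta> > 0" "\<And>t. 0 < t \<Longrightarrow> t \<le> \<delta> \<Longrightarrow> gauss_energy (exp (- t)) u \<Omega> \<le> ennreal (sqrt (2 * t) * (g / sqrt (2 * pi) + e))"
proof -
  have "\<exists>\<delta>>0. \<forall>t. 0 < t \<longrightarrow> t \<le> \<delta> \<longrightarrow> gauss_energy (exp (- t)) u \<Omega> \<le> ennreal (sqrt (2 * t) * (g / sqrt (2 * pi) + e))"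
  proof (rule ccontr)
    assume "\<not> ?thesis"
    then have "\<forall>n. \<exists>t. 0 < t \<and> t \<le> inverse (real (Suc n)) \<and> \<not> gauss_energy (exp (- t)) u \<Omega> \<le> ennreal (sqrt (2 * t) * (g / sqrt (2 * pi) + e))"
      by (metis inverse_positive_iff_positive of_nat_0_less_iff zero_less_Suc)
    from choice[OF this] obtain t where t: "\<And>n. 0 < t n" "\<And>n. t n \<le> inverse (real (Suc n))"
      "\<And>n. \<not> gauss_energy (exp (- t n)) u \<Omega> \<le> ennreal (sqrt (2 * t n) * (g / sqrt (2 * pi) + e))" by blast
    have t0: "t \<longlonglongrightarrow> 0"
      by (rule tendsto_sandwich[OF _ _ tendsto_const LIMSEQ_inverse_real_of_nat]) (intro always_eventually allI less_imp_le t t(2))+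
    define \<sigma> where "\<sigma> n = sqrt (1 - (exp (- t n))\<^sup>2)" for n
    have ex: "0 < exp (- t n)" "exp (- t n) < 1" for n using t(1)[of n] by auto
    have ex2: "(exp (- t n))\<^sup>2 < 1" "0 < (exp (- t n))\<^sup>2" for n using ex[of n] by (auto simp: abs_square_less_1)
    have \<sigma>: "0 < \<sigma> n" "\<sigma> n < 1" "sqrt (1 - (\<sigma> n)\<^sup>2) = exp (- t n)" for n using ex2[of n] by (auto simp: \<sigma>_def)
    \<comment> \<open>From exp (- 2 t) \<ge> 1 - 2 t; this is the source of the factor sqrt (2 *
      t).\<close>
    have le: "\<sigma> n \<le> sqrt (2 * t n)" for n
    proof -
      have "(exp (- t n))\<^sup>2 = exp (- (2 * t n))" by (simp add: exp_double[symmetric])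
      also have "\<dots> \<ge> 1 - 2 * t n" using exp_ge_add_one_self[of "- (2 * t n)"] by simp
      finally show ?thesis unfolding \<sigma>_def by (intro real_sqrt_le_mono) simp
    qed
    have "(\<lambda>n. sqrt (1 - (exp (- t n))\<^sup>2)) \<longlonglongrightarrow> sqrt (1 - (exp (- 0))\<^sup>2)" by (intro tendsto_intros t0)
    then have "\<sigma> \<longlonglongrightarrow> 0" unfolding \<sigma>_def by simp
    from gauss_energy_asymptotics[OF \<Omega> u g this \<sigma>(1,2) e]
    obtain n where "gauss_energy (exp (- t n)) u \<Omega> \<le> ennreal (\<sigma> n * (g / sqrt (2 * pi) + e))"
      unfolding \<sigma>(3) by (auto simp: eventually_sequentially)
    also have "\<dots> \<le> ennreal (sqrt (2 * t n) * (g / sqrt (2 * pi) + e))"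
      using le[of n] g(2) e by (intro ennreal_leI mult_right_mono) auto
    finally show False using t(3) by blast
  qed
  then show ?thesis using that by blast
qed

section \<open>Level sets and the recovery sequence\<close>

text \<open>A pair crosses out of the level set exactly when u Y \<le> \<tau> < u X. These levels
  form an interval inside [0, 1] whose length is the positive part of u X - u Y; Tonelli's theorem
  does the rest.\<close>

lemma coarea_frac_perimeter:
  fixes \<Omega> :: "'a::euclidean_space set"
  assumes [measurable]: "\<Omega> \<in> sets borel" "u \<in> borel_measurable borel" and u: "\<And>x. 0 \<le> u x" "\<And>x. u x \<le> 1"
  shows "(\<lambda>\<tau>. frac_perimeter s {x. u x > \<tau>} \<Omega>) \<in> borel_measurable borel"
    and "(\<integral>\<^sup>+\<tau>\<in>{0..1}. frac_perimeter s {x. u x > \<tau>} \<Omega> \<partial>lborel) =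
      (\<integral>\<^sup>+t\<in>{0<..}. ennreal (1 / t powr (s / 2 + 1)) * gauss_energy (exp (- t)) u \<Omega> \<partial>lborel)"
proof -
  define w where "w t = ennreal (1 / t powr (s / 2 + 1)) * indicator {0<..} t" for t :: real
  have [measurable]: "w \<in> borel_measurable borel" unfolding w_def by measurable
  define Y where "Y t p = exp (- t) *\<^sub>R fst p + sqrt (1 - (exp (- t))\<^sup>2) *\<^sub>R snd p" for t and p :: "'a \<times> 'a"
  have [measurable]: "(\<lambda>q. Y (fst q) (snd q)) \<in> borel \<Otimes>\<^sub>M (borel \<Otimes>\<^sub>M borel) \<rightarrow>\<^sub>M borel" unfolding Y_def by measurable
  have [measurable]: "Y t \<in> borel \<Otimes>\<^sub>M borel \<rightarrow>\<^sub>M borel" for t unfolding Y_def by measurable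
  define q where "q t p = max (indicator \<Omega> (fst p)) (indicator \<Omega> (Y t p) :: ennreal)" for t p
  have qm[measurable]: "(\<lambda>r. q (fst r) (snd r)) \<in> borel_measurable (borel \<Otimes>\<^sub>M (borel \<Otimes>\<^sub>M borel))" unfolding q_def by measurable
  have qm'[measurable]: "q t \<in> borel_measurable (borel \<Otimes>\<^sub>M borel)" for t unfolding q_def by measurable
  define k where "k \<tau> t p = (if u (Y t p) \<le> \<tau> \<and> \<tau> < u (fst p) then q t p else 0)" for \<tau> t p
  have km[measurable]: "(\<lambda>r. k (fst r) (fst (snd r)) (snd (snd r))) \<in> borel_measurable (borel \<Otimes>\<^sub>M (borel \<Otimes>\<^sub>M (borel \<Otimes>\<^sub>M borel)))"
    unfolding k_def by measurable
  have [measurable]: "(\<lambda>p. k \<tau> t p) \<in> borel_measurable (borel \<Otimes>\<^sub>M borel)" for \<tau> t unfolding k_def by measurable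
  have lev[measurable]: "{x. u x > \<tau>} \<in> sets borel" for \<tau>
  proof -
    have "{x \<in> space borel. u x > \<tau>} \<in> sets borel" by measurable
    then show ?thesis by simp
  qed
  have cr: "gauss_crossing (exp (- t)) {x. u x > \<tau>} \<Omega> = (\<integral>\<^sup>+p. k \<tau> t p \<partial>gauss2)" for \<tau> t
  proof -
    have m: "{p. u (fst p) > \<tau> \<and> \<not> u (Y t p) > \<tau> \<and> (fst p \<in> \<Omega> \<or> Y t p \<in> \<Omega>)} \<in> sets gauss2"
    proof -
      have "{p \<in> space (borel \<Otimes>\<^sub>M borel). u (fst p) > \<tau> \<and> \<not> u (Y t p) > \<tau> \<and> (fst p \<in> \<Omega> \<or> Y t p \<in> \<Omega>)} \<in> sets (borel \<Otimes>\<^sub>M borel)" by measurable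
      then show ?thesis by (simp add: space_pair_measure)
    qed
    have "gauss_crossing (exp (- t)) {x. u x > \<tau>} \<Omega> = (\<integral>\<^sup>+p. indicator {p. u (fst p) > \<tau> \<and> \<not> u (Y t p) > \<tau> \<and> (fst p \<in> \<Omega> \<or> Y t p \<in> \<Omega>)} p \<partial>gauss2)"
      unfolding gauss_crossing_def Y_def[symmetric] mem_Collect_eq using nn_integral_indicator[OF m] by simp
    also have "\<dots> = (\<integral>\<^sup>+p. k \<tau> t p \<partial>gauss2)" by (intro nn_integral_cong) (auto simp: k_def q_def indicator_def)
    finally show ?thesis .
  qed
  have fp: "frac_perimeter s {x. u x > \<tau>} \<Omega> = (\<integral>\<^sup>+t. w t * (\<integral>\<^sup>+p. k \<tau> t p \<partial>gauss2) \<partial>lborel)" for \<tau>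
    unfolding frac_perimeter_eq[OF lev \<open>\<Omega> \<in> _\<close> AE_I2[OF refl]] cr
    by (intro nn_integral_cong) (simp add: w_def indicator_def)
  have in1[measurable]: "(\<lambda>r. \<integral>\<^sup>+p. k (fst r) (snd r) p \<partial>gauss2) \<in> borel_measurable (borel \<Otimes>\<^sub>M borel)"
    by (rule std_gauss_pair.P.borel_measurable_nn_integral) (unfold k_def q_def Y_def split_beta, measurable)
  have in3[measurable]: "(\<lambda>t. \<integral>\<^sup>+p. k \<tau> t p \<partial>gauss2) \<in> borel_measurable borel" for \<tau>
    by (rule std_gauss_pair.P.borel_measurable_nn_integral) (unfold k_def q_def Y_def split_beta, measurable)
  show "(\<lambda>\<tau>. frac_perimeter s {x. u x > \<tau>} \<Omega>) \<in> borel_measurable borel"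
    unfolding fp by measurable
  have "(\<integral>\<^sup>+\<tau>\<in>{0..1}. frac_perimeter s {x. u x > \<tau>} \<Omega> \<partial>lborel) = (\<integral>\<^sup>+\<tau>. (\<integral>\<^sup>+t. w t * (\<integral>\<^sup>+p. k \<tau> t p \<partial>gauss2) * indicator {0..1} \<tau> \<partial>lborel) \<partial>lborel)"
    unfolding fp by (intro nn_integral_cong nn_integral_multc[symmetric]) measurable
  also have "\<dots> = (\<integral>\<^sup>+t. (\<integral>\<^sup>+\<tau>. w t * (\<integral>\<^sup>+p. k \<tau> t p \<partial>gauss2) * indicator {0..1} \<tau> \<partial>lborel) \<partial>lborel)"
    by (rule lborel_pair.Fubini'[symmetric]) measurable
  also have "\<dots> = (\<integral>\<^sup>+t. w t * gauss_energy (exp (- t)) u \<Omega> \<partial>lborel)"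
  proof (rule nn_integral_cong)
    fix t :: real
    have in2[measurable]: "(\<lambda>\<tau>. \<integral>\<^sup>+p. k \<tau> t p \<partial>gauss2) \<in> borel_measurable borel"
      using measurable_compose[of "\<lambda>\<tau>. (\<tau>, t)" borel "borel \<Otimes>\<^sub>M borel", OF _ in1] by simp
    have "(\<integral>\<^sup>+\<tau>. w t * (\<integral>\<^sup>+p. k \<tau> t p \<partial>gauss2) * indicator {0..1} \<tau> \<partial>lborel) = w t * (\<integral>\<^sup>+\<tau>. (\<integral>\<^sup>+p. k \<tau> t p \<partial>gauss2) * indicator {0..1} \<tau> \<partial>lborel)"
      unfolding mult.assoc by (rule nn_integral_cmult) measurable
    also have "(\<integral>\<^sup>+\<tau>. (\<integral>\<^sup>+p. k \<tau> t p \<partial>gauss2) * indicator {0..1} \<tau> \<partial>lborel) = (\<integral>\<^sup>+\<tau>. (\<integral>\<^sup>+p. k \<tau> t p * indicator {0..1} \<tau> \<partial>gauss2) \<partial>lborel)"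
      by (intro nn_integral_cong nn_integral_multc[symmetric]) measurable
    also have "\<dots> = (\<integral>\<^sup>+p. (\<integral>\<^sup>+\<tau>. k \<tau> t p * indicator {0..1} \<tau> \<partial>lborel) \<partial>gauss2)"
    proof -
      interpret pair_sigma_finite lborel "gauss2 :: ('a \<times> 'a) measure" ..
      show ?thesis by (rule Fubini'[symmetric]) (unfold k_def, measurable)
    qed
    also have "\<dots> = gauss_energy (exp (- t)) u \<Omega>"
      unfolding gauss_energy_def Y_def[symmetric]
    proof (rule nn_integral_cong)
      fix p :: "'a \<times> 'a"
      have "(\<integral>\<^sup>+\<tau>. k \<tau> t p * indicator {0..1} \<tau> \<partial>lborel) = (\<integral>\<^sup>+\<tau>. q t p * indicator {u (Y t p)..<u (fst p)} \<tau> \<partial>lborel)"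
        using u[of "Y t p"] u[of "fst p"] by (intro nn_integral_cong) (auto simp: k_def indicator_def)
      also have "\<dots> = q t p * ennreal (u (fst p) - u (Y t p))"
        by (cases "u (Y t p) \<le> u (fst p)"; subst nn_integral_cmult_indicator) (auto simp: ennreal_neg)
      finally show "(\<integral>\<^sup>+\<tau>. k \<tau> t p * indicator {0..1} \<tau> \<partial>lborel) = ennreal (u (fst p) - u (Y t p)) * indicator {p. fst p \<in> \<Omega> \<or> Y t p \<in> \<Omega>} p"
        by (auto simp: q_def indicator_def)
    qed
    finally show "(\<integral>\<^sup>+\<tau>. w t * (\<integral>\<^sup>+p. k \<tau> t p \<partial>gauss2) * indicator {0..1} \<tau> \<partial>lborel) = w t * gauss_energy (exp (- t)) u \<Omega>" .
  qed
  also have "\<dots> = (\<integral>\<^sup>+t\<in>{0<..}. ennreal (1 / t powr (s / 2 + 1)) * gauss_energy (exp (- t)) u \<Omega> \<partial>lborel)"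
    by (intro nn_integral_cong) (simp add: w_def indicator_def)
  finally show "(\<integral>\<^sup>+\<tau>\<in>{0..1}. frac_perimeter s {x. u x > \<tau>} \<Omega> \<partial>lborel) =
      (\<integral>\<^sup>+t\<in>{0<..}. ennreal (1 / t powr (s / 2 + 1)) * gauss_energy (exp (- t)) u \<Omega> \<partial>lborel)" .
qed

lemma gauss_energy_le_1:
  fixes u :: "'a::euclidean_space \<Rightarrow> real"
  assumes "\<And>x. 0 \<le> u x" "\<And>x. u x \<le> 1"
  shows "gauss_energy c u \<Omega> \<le> 1"
proof -
  have "gauss_energy c u \<Omega> \<le> (\<integral>\<^sup>+p. 1 \<partial>(gauss2 :: ('a \<times> 'a) measure))"
    unfolding gauss_energy_def
  proof (rule nn_integral_mono)
    fix p :: "'a \<times> 'a"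
    have "u (fst p) - u (c *\<^sub>R fst p + sqrt (1 - c\<^sup>2) *\<^sub>R snd p) \<le> 1" using assms(2)[of "fst p"] assms(1)[of "c *\<^sub>R fst p + sqrt (1 - c\<^sup>2) *\<^sub>R snd p"] by linarith
    then show "ennreal (u (fst p) - u (c *\<^sub>R fst p + sqrt (1 - c\<^sup>2) *\<^sub>R snd p)) *
       indicator {p. fst p \<in> \<Omega> \<or> c *\<^sub>R fst p + sqrt (1 - c\<^sup>2) *\<^sub>R snd p \<in> \<Omega>} p \<le> 1"
      by (auto simp: indicator_def ennreal_le_1)
  qed
  also have "\<dots> = 1" unfolding nn_integral_const std_gauss_pair.P.emeasure_space_1 by simp
  finally show ?thesis .
qed

text \<open>Up to \<delta> the weight times sqrt (2 * t) has an integral of order 1 / (1 - s), and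
  the factor 1 - s leaves 2 * sqrt 2 * K. Beyond \<delta> the bound 1 gives a finite integral, which
  the factor 1 - s makes negligible as s tends to 1.\<close>

lemma weighted_energy_le:
  fixes f :: "real \<Rightarrow> ennreal"
  assumes s: "0 < s" "s < 1" and \<delta>: "\<delta> > 0" and K: "K \<ge> 0"
    and f: "\<And>t. 0 < t \<Longrightarrow> t \<le> \<delta> \<Longrightarrow> f t \<le> ennreal (sqrt (2 * t) * K)" "\<And>t. f t \<le> 1"
  shows "ennreal (1 - s) * (\<integral>\<^sup>+t\<in>{0<..}. ennreal (1 / t powr (s / 2 + 1)) * f t \<partial>lborel)
    \<le> ennreal (2 * sqrt 2 * K * \<delta> powr ((1 - s) / 2) + (1 - s) * (2 / s) * \<delta> powr (- (s / 2)))"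
proof -
  have 1: "(\<integral>\<^sup>+t. ennreal (indicator {0..\<delta>} t * t powr (- (s / 2) - 1 / 2)) \<partial>lborel) = ennreal (\<delta> powr ((1 - s) / 2) / ((1 - s) / 2))"
    using nn_integral_has_integral_lebesgue[OF _ has_integral_powr_from_0[of "- (s / 2) - 1 / 2" \<delta>]] s \<delta>
    by (simp add: diff_divide_distrib)
  have 2: "(\<integral>\<^sup>+t. ennreal (indicator {\<delta>..} t * t powr (- (s / 2) - 1)) \<partial>lborel) = ennreal (\<delta> powr (- (s / 2)) / (s / 2))"
    using nn_integral_has_integral_lebesgue[OF _ has_integral_powr_to_inf[of "- (s / 2) - 1" \<delta>]] s \<delta> by simp
  have "(\<integral>\<^sup>+t\<in>{0<..}. ennreal (1 / t powr (s / 2 + 1)) * f t \<partial>lborel)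
     \<le> (\<integral>\<^sup>+t. ennreal (sqrt 2 * K) * ennreal (indicator {0..\<delta>} t * t powr (- (s / 2) - 1 / 2)) + ennreal (indicator {\<delta>..} t * t powr (- (s / 2) - 1)) \<partial>lborel)"
  proof (rule nn_integral_mono)
    fix t :: real
    have w: "1 / t powr (s / 2 + 1) = t powr (- (s / 2) - 1)" by (simp add: powr_minus_divide[symmetric])
    consider "t \<le> 0" | "0 < t" "t \<le> \<delta>" | "\<delta> < t" using \<delta> by linarith
    then show "ennreal (1 / t powr (s / 2 + 1)) * f t * indicator {0<..} t \<le>
      ennreal (sqrt 2 * K) * ennreal (indicator {0..\<delta>} t * t powr (- (s / 2) - 1 / 2)) + ennreal (indicator {\<delta>..} t * t powr (- (s / 2) - 1))"
    proof cases
      case 2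
      have "t powr (- (s / 2) - 1) * sqrt t = t powr (- (s / 2) - 1) * t powr (1 / 2)" using 2 by (simp add: powr_half_sqrt)
      also have "\<dots> = t powr ((- (s / 2) - 1) + 1 / 2)" by (rule powr_add[symmetric])
      also have "(- (s / 2) - 1) + 1 / 2 = - (s / 2) - 1 / 2" by simp
      finally have eq: "t powr (- (s / 2) - 1) * (sqrt (2 * t) * K) = sqrt 2 * K * t powr (- (s / 2) - 1 / 2)"
        by (simp add: real_sqrt_mult)
      have "ennreal (1 / t powr (s / 2 + 1)) * f t \<le> ennreal (t powr (- (s / 2) - 1)) * ennreal (sqrt (2 * t) * K)"
        unfolding w by (intro mult_left_mono f 2) simp
      also have "\<dots> = ennreal (sqrt 2 * K * t powr (- (s / 2) - 1 / 2))"
        unfolding eq[symmetric] using K 2 by (intro ennreal_mult[symmetric]) auto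
      finally have "ennreal (1 / t powr (s / 2 + 1)) * f t \<le> ennreal (sqrt 2 * K) * ennreal (t powr (- (s / 2) - 1 / 2))"
        using K 2 by (simp add: ennreal_mult[symmetric])
      then show ?thesis using 2 by (simp add: add_increasing2)
    next
      case 3
      have "ennreal (1 / t powr (s / 2 + 1)) * f t \<le> ennreal (t powr (- (s / 2) - 1)) * 1"
        unfolding w by (intro mult_left_mono f) simp
      then show ?thesis using 3 \<delta> by simp
    qed simp
  qed
  also have "\<dots> = ennreal (sqrt 2 * K) * ennreal (\<delta> powr ((1 - s) / 2) / ((1 - s) / 2)) + ennreal (\<delta> powr (- (s / 2)) / (s / 2))"
    unfolding 1[symmetric] 2[symmetric] by (subst nn_integral_add) (auto simp: nn_integral_cmult)
  also have "\<dots> = ennreal (sqrt 2 * K * (\<delta> powr ((1 - s) / 2) / ((1 - s) / 2)) + \<delta> powr (- (s / 2)) / (s / 2))"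
    using K s by (simp add: ennreal_mult[symmetric])
  finally have "ennreal (1 - s) * (\<integral>\<^sup>+t\<in>{0<..}. ennreal (1 / t powr (s / 2 + 1)) * f t \<partial>lborel) \<le>
     ennreal (1 - s) * ennreal (sqrt 2 * K * (\<delta> powr ((1 - s) / 2) / ((1 - s) / 2)) + \<delta> powr (- (s / 2)) / (s / 2))"
    by (rule mult_left_mono) simp
  also have "\<dots> = ennreal ((1 - s) * (sqrt 2 * K * (\<delta> powr ((1 - s) / 2) / ((1 - s) / 2)) + \<delta> powr (- (s / 2)) / (s / 2)))"
    using s K by (intro ennreal_mult[symmetric]) auto
  also have "(1 - s) * (sqrt 2 * K * (\<delta> powr ((1 - s) / 2) / ((1 - s) / 2)) + \<delta> powr (- (s / 2)) / (s / 2)) =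
     2 * sqrt 2 * K * \<delta> powr ((1 - s) / 2) + (1 - s) * (2 / s) * \<delta> powr (- (s / 2))"
    using s by (simp add: field_simps)
  finally show ?thesis .
qed

text \<open>If all levels between \<kappa> and 1 - \<kappa> had larger values than M, the integral
  would be at least (1 - 2 \<kappa>) M. Levels close to 0 or 1 are avoided for the sake of
  \<open>level_set_close\<close>.\<close>

lemma nn_integral_level_exists:
  fixes P :: "real \<Rightarrow> ennreal"
  assumes P: "(\<integral>\<^sup>+\<tau>\<in>{0..1}. P \<tau> \<partial>lborel) \<le> ennreal K" and \<kappa>: "0 < \<kappa>" "\<kappa> < 1 / 2" and K: "0 \<le> K" "K < (1 - 2 * \<kappa>) * M"
  obtains (level) \<tau> where "\<kappa> \<le> \<tau>" "\<tau> \<le> 1 - \<kappa>" "P \<tau> \<le> ennreal M"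
proof (rule ccontr)
  assume "\<not> thesis"
  then have n: "ennreal M \<le> P \<tau>" if "\<kappa> \<le> \<tau> \<and> \<tau> \<le> 1 - \<kappa>" for \<tau> using level that by (meson linear)
  have "0 < (1 - 2 * \<kappa>) * M" using K by linarith
  then have M: "M > 0" using \<kappa> by (simp add: zero_less_mult_iff)
  have "ennreal ((1 - 2 * \<kappa>) * M) = ennreal M * emeasure lborel {\<kappa>..1 - \<kappa>}"
    using M \<kappa> by (simp add: ennreal_mult[symmetric] mult.commute)
  also have "\<dots> = (\<integral>\<^sup>+\<tau>. ennreal M * indicator {\<kappa>..1 - \<kappa>} \<tau> \<partial>lborel)" by (simp add: nn_integral_cmult_indicator)
  also have "\<dots> \<le> (\<integral>\<^sup>+\<tau>\<in>{0..1}. P \<tau> \<partial>lborel)" using n \<kappa> by (intro nn_integral_mono) (auto simp: indicator_def)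
  also have "\<dots> \<le> ennreal K" by (rule P)
  finally show False using K M \<kappa> by (simp add: ennreal_le_iff)
qed

text \<open>Chebyshev's inequality: on the symmetric difference u is at distance at least \<kappa>
  from the indicator, because \<tau> is that far from both 0 and 1.\<close>

lemma level_set_close:
  fixes u :: "'a::euclidean_space \<Rightarrow> real"
  assumes [measurable]: "u \<in> borel_measurable borel" "E \<in> sets borel"
    and u: "\<And>x. 0 \<le> u x" "\<And>x. u x \<le> 1" and \<tau>: "0 < \<kappa>" "\<kappa> \<le> \<tau>" "\<tau> \<le> 1 - \<kappa>"
    and \<epsilon>: "(\<integral>\<^sup>+x. ennreal \<bar>u x - indicator E x\<bar> \<partial>std_gauss) \<le> ennreal (\<kappa> * e)" "0 \<le> e"
  shows "measure std_gauss (({x. u x > \<tau>} - E) \<union> (E - {x. u x > \<tau>})) \<le> e"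
proof -
  have [measurable]: "{x. u x > \<tau>} \<in> sets borel"
  proof -
    have "{x \<in> space borel. u x > \<tau>} \<in> sets borel" by measurable
    then show ?thesis by simp
  qed
  let ?D = "({x. u x > \<tau>} - E) \<union> (E - {x. u x > \<tau>})"
  have "ennreal \<kappa> * emeasure std_gauss ?D = (\<integral>\<^sup>+x. ennreal \<kappa> * indicator ?D x \<partial>std_gauss)"
    by (rule nn_integral_cmult_indicator[symmetric]) simp
  also have "\<dots> \<le> (\<integral>\<^sup>+x. ennreal \<bar>u x - indicator E x\<bar> \<partial>std_gauss)"
  proof (rule nn_integral_mono)
    fix x
    show "ennreal \<kappa> * indicator ?D x \<le> ennreal \<bar>u x - indicator E x\<bar>"
      using u[of x] \<tau> by (auto simp: indicator_def intro!: ennreal_leI)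
  qed
  also have "\<dots> \<le> ennreal (\<kappa> * e)" by (rule \<epsilon>)
  finally have "ennreal (\<kappa> * measure std_gauss ?D) \<le> ennreal (\<kappa> * e)"
    using \<tau>(1) by (simp add: std_gauss.emeasure_eq_measure ennreal_mult)
  then show ?thesis using \<tau>(1) \<epsilon>(2) by simp
qed

text \<open>One smooth approximation u serves all n; only the level is chosen anew for each n, since
  the level with a small fractional perimeter may vary with s n.\<close>

lemma recovery_eventually:
  fixes \<Omega> E :: "'a::euclidean_space set" and s :: "nat \<Rightarrow> real"
  assumes \<Omega>: "open \<Omega>" "lipschitz_boundary \<Omega>" and E[measurable]: "E \<in> sets borel"
    and V: "field_sup E \<Omega> \<le> ennreal V" "V \<ge> 0" and e: "e > 0"
    and s: "\<And>n. 0 < s n \<and> s n < 1" "s \<longlonglongrightarrow> 1"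
  shows "eventually (\<lambda>n. \<exists>F \<in> sets borel. measure std_gauss ((F - E) \<union> (E - F)) \<le> e \<and>
     ennreal (1 - s n) * frac_perimeter (s n) F \<Omega> \<le> ennreal (2 / sqrt pi * V + e)) sequentially"
proof -
  have [measurable]: "\<Omega> \<in> sets borel" using \<Omega> by simp
  let ?M = "2 / sqrt pi * V + e"
  have a: "2 * sqrt 2 / sqrt (2 * pi) = 2 / sqrt pi" by (simp add: real_sqrt_mult)
  let ?K = "\<lambda>\<epsilon>. ((1 + \<epsilon>) * V + \<epsilon>) / sqrt (2 * pi) + \<epsilon>"
  \<comment> \<open>For \<epsilon> tending to 0 the gap between the admissible bound and the
    averaged energy tends to e. This reserve pays for the approximation, the tail of the weight and
    the omitted levels.\<close>
  have "((\<lambda>\<epsilon>. (1 - 2 * \<epsilon>) * ?M - (2 * sqrt 2 * ?K \<epsilon> + \<epsilon>)) \<longlongrightarrow> (1 - 2 * 0) * ?M - (2 * sqrt 2 * (((1 + 0) * V + 0) / sqrt (2 * pi) + 0) + 0)) (at_right 0)"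
    by (intro tendsto_intros) auto
  moreover have "(1 - 2 * 0) * ?M - (2 * sqrt 2 * (((1 + 0) * V + 0) / sqrt (2 * pi) + 0) + 0) = e"
    using arg_cong[OF a, of "\<lambda>x. x * V"] by simp
  ultimately have "eventually (\<lambda>\<epsilon>. 0 < (1 - 2 * \<epsilon>) * ?M - (2 * sqrt 2 * ?K \<epsilon> + \<epsilon>)) (at_right 0)"
    using e by (intro order_tendstoD(1)) auto
  moreover have "eventually (\<lambda>\<epsilon>::real. 0 < \<epsilon> \<and> \<epsilon> < 1 / 2) (at_right 0)"
    by (rule eventually_at_rightI[of 0 "1 / 2"]) auto
  ultimately have "eventually (\<lambda>\<epsilon>. 0 < (1 - 2 * \<epsilon>) * ?M - (2 * sqrt 2 * ?K \<epsilon> + \<epsilon>) \<and> 0 < \<epsilon> \<and> \<epsilon> < 1 / 2) (at_right 0)"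
    by (rule eventually_conj)
  then obtain \<epsilon> where \<epsilon>: "2 * sqrt 2 * ?K \<epsilon> + \<epsilon> < (1 - 2 * \<epsilon>) * ?M" "0 < \<epsilon>" "\<epsilon> < 1 / 2"
    using eventually_happens'[OF trivial_limit_at_right_real] by (metis (no_types, lifting) diff_gt_0_iff_gt)
  \<comment> \<open>Finer than \<epsilon>: the L1 error must be at most \<epsilon> * e, since
    \<open>level_set_close\<close> divides it by the distance \<epsilon> of the level from 0 and
    1.\<close>
  define \<epsilon>' where "\<epsilon>' = \<epsilon> * min 1 e"
  have \<epsilon>': "0 < \<epsilon>'" "\<epsilon>' \<le> \<epsilon>" "\<epsilon>' \<le> \<epsilon> * e" using \<epsilon>(2) e by (auto simp: \<epsilon>'_def min_def)
  obtain u \<rho> where u: "C_k (Suc 0) u" "\<And>x. norm x > \<rho> \<Longrightarrow> u x = 0" "\<And>x. 0 \<le> u x" "\<And>x. u x \<le> 1"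
    "(\<integral>\<^sup>+x\<in>closure \<Omega>. ennreal (norm (grad u x)) \<partial>std_gauss) \<le> ennreal ((1 + \<epsilon>') * V + \<epsilon>')"
    "(\<integral>\<^sup>+x. ennreal \<bar>u x - indicator E x\<bar> \<partial>std_gauss) \<le> ennreal \<epsilon>'"
    by (rule smooth_approximation[OF \<Omega> E V \<epsilon>'(1)]) (rule that)
  have um[measurable]: "u \<in> borel_measurable borel" using C_k_1_continuous[OF u(1)] by (rule borel_measurable_continuous_onI)
  have g: "(\<integral>\<^sup>+x\<in>closure \<Omega>. ennreal (norm (grad u x)) \<partial>std_gauss) \<le> ennreal ((1 + \<epsilon>) * V + \<epsilon>)"
    using \<epsilon>'(2) V(2) by (intro order_trans[OF u(5)] ennreal_leI add_mono mult_right_mono) auto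
  have g0: "0 \<le> (1 + \<epsilon>) * V + \<epsilon>" using V(2) \<epsilon>(2) by simp
  have K0: "0 \<le> ?K \<epsilon>" using g0 \<epsilon>(2) by simp
  have L1: "(\<integral>\<^sup>+x. ennreal \<bar>u x - indicator E x\<bar> \<partial>std_gauss) \<le> ennreal (\<epsilon> * e)"
    by (rule order_trans[OF u(6) ennreal_leI[OF \<epsilon>'(3)]])
  obtain \<delta> where \<delta>: "\<delta> > 0" "\<And>t. 0 < t \<Longrightarrow> t \<le> \<delta> \<Longrightarrow> gauss_energy (exp (- t)) u \<Omega> \<le> ennreal (sqrt (2 * t) * ?K \<epsilon>)"
    by (rule gauss_energy_le[OF \<Omega>(1) u(1,2) g g0 \<epsilon>(2)]) (assumption | rule that)+
  let ?b = "\<lambda>s. 2 * sqrt 2 * ?K \<epsilon> * \<delta> powr ((1 - s) / 2) + (1 - s) * (2 / s) * \<delta> powr (- (s / 2))"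
  have "(\<lambda>n. ?b (s n)) \<longlonglongrightarrow> 2 * sqrt 2 * ?K \<epsilon> * \<delta> powr ((1 - 1) / 2) + (1 - 1) * (2 / 1) * \<delta> powr (- (1 / 2))"
    using \<delta>(1) by (intro tendsto_intros s) auto
  then have "eventually (\<lambda>n. ?b (s n) < 2 * sqrt 2 * ?K \<epsilon> + \<epsilon>) sequentially"
    by (rule order_tendstoD(2)) (use \<delta>(1) \<epsilon>(2) in simp)
  then show ?thesis
  proof eventually_elim
    case (elim n)
    have "(\<integral>\<^sup>+\<tau>\<in>{0..1}. ennreal (1 - s n) * frac_perimeter (s n) {x. u x > \<tau>} \<Omega> \<partial>lborel)
       = ennreal (1 - s n) * (\<integral>\<^sup>+\<tau>\<in>{0..1}. frac_perimeter (s n) {x. u x > \<tau>} \<Omega> \<partial>lborel)"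
      unfolding mult.assoc using coarea_frac_perimeter(1)[OF \<open>\<Omega> \<in> _\<close> um u(3,4), of "s n"] by (intro nn_integral_cmult) simp
    also have "\<dots> = ennreal (1 - s n) * (\<integral>\<^sup>+t\<in>{0<..}. ennreal (1 / t powr (s n / 2 + 1)) * gauss_energy (exp (- t)) u \<Omega> \<partial>lborel)"
      unfolding coarea_frac_perimeter(2)[OF \<open>\<Omega> \<in> _\<close> um u(3,4)] ..
    also have "\<dots> \<le> ennreal (?b (s n))"
      using s(1)[of n] by (intro weighted_energy_le \<delta> K0 gauss_energy_le_1 u) auto
    also have "\<dots> \<le> ennreal (2 * sqrt 2 * ?K \<epsilon> + \<epsilon>)" using elim by (intro ennreal_leI) simp
    finally obtain \<tau> where \<tau>: "\<epsilon> \<le> \<tau>" "\<tau> \<le> 1 - \<epsilon>" "ennreal (1 - s n) * frac_perimeter (s n) {x. u x > \<tau>} \<Omega> \<le> ennreal ?M"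
      by (rule nn_integral_level_exists[OF _ \<epsilon>(2,3) _ \<epsilon>(1)]) (use K0 \<epsilon>(2) in simp, rule that)
    have "{x \<in> space borel. u x > \<tau>} \<in> sets borel" by measurable
    then have "{x. u x > \<tau>} \<in> sets borel" by simp
    moreover have "measure std_gauss (({x. u x > \<tau>} - E) \<union> (E - {x. u x > \<tau>})) \<le> e"
      by (rule level_set_close[OF um E u(3,4) \<epsilon>(2) \<tau>(1,2) L1]) (use e in simp)
    ultimately show ?case using \<tau>(3) by blast
  qed
qed

text \<open>At stage n the object is taken for the largest attainable k up to n; by monotonicity it
  also serves all smaller indices.\<close>

lemma diagonal_sequence:
  fixes P :: "nat \<Rightarrow> nat \<Rightarrow> 'b \<Rightarrow> bool"
  assumes ex: "\<And>k. eventually (\<lambda>n. \<exists>x. P k n x) sequentially"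
    and anti: "\<And>j k n x. j \<le> k \<Longrightarrow> P k n x \<Longrightarrow> P j n x"
  obtains x where "\<And>k. eventually (\<lambda>n. P k n (x n)) sequentially"
proof
  \<comment> \<open>The restriction k \<le> n makes the set finite, so that it has a maximum as soon
    as it is non-empty; before that the choice is arbitrary.\<close>
  define S where "S n = {k. k \<le> n \<and> (\<exists>x. P k n x)}" for n
  fix k
  show "eventually (\<lambda>n. P k n (SOME x. P (Max (S n)) n x)) sequentially"
    using ex[of k] eventually_ge_at_top[of k]
  proof eventually_elim
    case (elim n)
    have f: "finite (S n)" by (rule finite_subset[of _ "{..n}"]) (auto simp: S_def)
    have k: "k \<in> S n" using elim by (simp add: S_def)
    have "Max (S n) \<in> S n" using f k by (intro Max_in) auto
    then have "P (Max (S n)) n (SOME x. P (Max (S n)) n x)" unfolding S_def[of n] by (auto intro: someI_ex)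
    with Max_ge[OF f k] show ?case by (rule anti)
  qed
qed

lemma limsup_inequality:
  fixes \<Omega> E :: "'a::euclidean_space set"
  assumes \<Omega>: "open \<Omega>" "lipschitz_boundary \<Omega>" and E: "E \<in> sets lebesgue"
    and s: "\<And>n. 0 < s n \<and> s n < 1" "s \<longlonglongrightarrow> 1"
  shows "\<exists>F. (\<forall>n. F n \<in> sets lebesgue) \<and> L1_loc_tendsto (\<lambda>n. indicator (F n)) (indicator E) \<and>
     limsup (\<lambda>n. ennreal (1 - s n) * frac_perimeter (s n) (F n) \<Omega>) \<le> ennreal (sqrt 2 / pi) * gauss_perimeter E \<Omega>"
proof -
  obtain E0 where E0: "E0 \<in> sets borel" "AE x in lebesgue. x \<in> E \<longleftrightarrow> x \<in> E0"
    by (rule lebesgue_set_borel_version[OF E]) (rule that)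
  have c: "ennreal (sqrt 2 / pi) * ennreal (sqrt (2 * pi)) = ennreal (2 / sqrt pi)"
    unfolding perimeter_constant[symmetric] by (rule ennreal_mult[symmetric]) auto
  have P: "ennreal (sqrt 2 / pi) * gauss_perimeter E \<Omega> = ennreal (2 / sqrt pi) * field_sup E0 \<Omega>"
    unfolding gauss_perimeter_eq[OF E0(1) E E0(2)] c[symmetric] by (rule mult.assoc[symmetric])
  show ?thesis
  proof (cases "field_sup E0 \<Omega>")
    \<comment> \<open>With an infinite right-hand side a constant sequence is enough.\<close>
    case top
    have "L1_loc_tendsto (\<lambda>n. indicator E0) (indicator E)"
      by (rule gauss_imp_L1_loc_tendsto[OF E0(1) E0]) simp
    moreover have "E0 \<in> sets lebesgue" using E0(1) by simp
    moreover have "ennreal (2 / sqrt pi) * field_sup E0 \<Omega> = top" unfolding top by (simp add: ennreal_mult_top)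
    ultimately show ?thesis unfolding P by (intro exI[of _ "\<lambda>_. E0"]) auto
  next
    case (real V)
    define h where "h k = inverse (real (Suc k))" for k
    have h: "h k > 0" "h \<longlonglongrightarrow> 0" for k unfolding h_def using LIMSEQ_inverse_real_of_nat by auto
    have hm: "h k \<le> h j" if "j \<le> k" for j k unfolding h_def using that by (intro le_imp_inverse_le) auto
    define Q where "Q k n F \<longleftrightarrow> F \<in> sets borel \<and> measure std_gauss ((F - E0) \<union> (E0 - F)) \<le> h k \<and>
       ennreal (1 - s n) * frac_perimeter (s n) F \<Omega> \<le> ennreal (2 / sqrt pi * V + h k)" for k n F
    obtain F0 where F0: "\<And>k. eventually (\<lambda>n. Q k n (F0 n)) sequentially"
    proof (rule diagonal_sequence[of Q])
      show "eventually (\<lambda>n. \<exists>F. Q k n F) sequentially" for k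
        unfolding Q_def by (rule eventually_mono[OF recovery_eventually[OF \<Omega> E0(1) _ _ h(1) s]]) (use real in auto)
      show "Q j n F" if "j \<le> k" "Q k n F" for j k n F
        using hm[OF that(1)] that(2) unfolding Q_def by (auto elim!: order_trans intro!: ennreal_leI)
    qed (rule that)
    \<comment> \<open>The diagonal choice is arbitrary as long as no stage is attainable, and then
      possibly not measurable; the empty set replaces it for finitely many n.\<close>
    define F where "F n = (if F0 n \<in> sets borel then F0 n else {})" for n
    have Fm: "F n \<in> sets borel" for n by (simp add: F_def)
    have F: "eventually (\<lambda>n. Q k n (F n)) sequentially" for k
      using F0[of k] by eventually_elim (simp add: F_def Q_def)
    have "(\<lambda>n. measure std_gauss ((F n - E0) \<union> (E0 - F n))) \<longlonglongrightarrow> 0"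
    proof (rule order_tendstoI)
      fix a :: real assume "a > 0"
      then obtain k where "h k < a" using reals_Archimedean unfolding h_def by blast
      then show "eventually (\<lambda>n. measure std_gauss ((F n - E0) \<union> (E0 - F n)) < a) sequentially"
        using F[of k] by (auto simp: Q_def elim!: eventually_mono)
    qed (auto intro!: always_eventually elim: less_le_trans)
    then have "L1_loc_tendsto (\<lambda>n. indicator (F n)) (indicator E)" by (rule gauss_imp_L1_loc_tendsto[OF Fm E0])
    moreover have "limsup (\<lambda>n. ennreal (1 - s n) * frac_perimeter (s n) (F n) \<Omega>) \<le> ennreal (2 / sqrt pi * V + 0)"
    proof (rule LIMSEQ_le_const)
      show "(\<lambda>k. ennreal (2 / sqrt pi * V + h k)) \<longlonglongrightarrow> ennreal (2 / sqrt pi * V + 0)" by (intro tendsto_intros h)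
      show "\<exists>N. \<forall>k\<ge>N. limsup (\<lambda>n. ennreal (1 - s n) * frac_perimeter (s n) (F n) \<Omega>) \<le> ennreal (2 / sqrt pi * V + h k)"
      proof (intro exI allI impI)
        fix k
        show "limsup (\<lambda>n. ennreal (1 - s n) * frac_perimeter (s n) (F n) \<Omega>) \<le> ennreal (2 / sqrt pi * V + h k)"
          by (rule Limsup_bounded[OF eventually_mono[OF F[of k]]]) (simp add: Q_def)
      qed
    qed
    moreover have "ennreal (2 / sqrt pi * V + 0) = ennreal (2 / sqrt pi) * field_sup E0 \<Omega>"
      using real by (simp add: ennreal_mult[symmetric])
    ultimately show ?thesis unfolding P using Fm by (intro exI[of _ F]) auto
  qed
qed

theorem mainTheorem1:
  fixes \<Omega> E :: "(real ^ 'n) set"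
  assumes "open \<Omega>" and "connected \<Omega>" and "lipschitz_boundary \<Omega>"
    and "E \<in> sets lebesgue"
  shows "(\<forall>(s :: nat \<Rightarrow> real) (F :: nat \<Rightarrow> (real ^ 'n) set).
            (\<forall>n. 0 < s n \<and> s n < 1) \<and> s \<longlonglongrightarrow> 1 \<and>
            (\<forall>n. F n \<in> sets lebesgue) \<and> L1_loc_tendsto (\<lambda>n. indicator (F n)) (indicator E) \<longrightarrow>
            liminf (\<lambda>n. ennreal (1 - s n) * frac_perimeter_local (s n) (F n) \<Omega>)
              \<ge> ennreal (sqrt 2 / pi) * gauss_perimeter E \<Omega>)
       \<and> (\<forall>s :: nat \<Rightarrow> real.
            (\<forall>n. 0 < s n \<and> s n < 1) \<and> s \<longlonglongrightarrow> 1 \<longrightarrow>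
            (\<exists>F :: nat \<Rightarrow> (real ^ 'n) set.
               (\<forall>n. F n \<in> sets lebesgue) \<and> L1_loc_tendsto (\<lambda>n. indicator (F n)) (indicator E) \<and>
               limsup (\<lambda>n. ennreal (1 - s n) * frac_perimeter (s n) (F n) \<Omega>)
                 \<le> ennreal (sqrt 2 / pi) * gauss_perimeter E \<Omega>))"
proof (intro conjI allI impI; elim conjE)
  fix s :: "nat \<Rightarrow> real" and F :: "nat \<Rightarrow> (real ^ 'n) set"
  assume "\<forall>n. 0 < s n \<and> s n < 1" "s \<longlonglongrightarrow> 1" "\<forall>n. F n \<in> sets lebesgue"
    "L1_loc_tendsto (\<lambda>n. indicator (F n)) (indicator E)"
  then show "liminf (\<lambda>n. ennreal (1 - s n) * frac_perimeter_local (s n) (F n) \<Omega>) \<ge> ennreal (sqrt 2 / pi) * gauss_perimeter E \<Omega>"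
    using assms(1,4) by (intro liminf_inequality) auto
next
  fix s :: "nat \<Rightarrow> real"
  assume "\<forall>n. 0 < s n \<and> s n < 1" "s \<longlonglongrightarrow> 1"
  then show "\<exists>F :: nat \<Rightarrow> (real ^ 'n) set. (\<forall>n. F n \<in> sets lebesgue) \<and> L1_loc_tendsto (\<lambda>n. indicator (F n)) (indicator E) \<and>
      limsup (\<lambda>n. ennreal (1 - s n) * frac_perimeter (s n) (F n) \<Omega>) \<le> ennreal (sqrt 2 / pi) * gauss_perimeter E \<Omega>"
    using assms(1,3,4) by (intro limsup_inequality) auto
qed

end
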